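(* Let $\alpha>1$, $p\ge0$, and let $Q$ be a purely real and normalised solution of the BAE with finite set of hole-numbers $\mathbb{H}$; let $z$ be its associated function and $S=\sec_{\mathbb{H}}$ its sector. (1) For every $\delta>0$, $z(x)=x^{\frac{\alpha+1}{2\alpha}}-p(1+\alpha)-\frac{S}{2}(\alpha-1)+O\left(x^{-\frac{\alpha+1}{2\alpha}+\delta}\right)$ as $x\to+\infty$. (2) Assume $S=0$, let $H=|\mathbb{H}_\kappa|$, let $\omega>0$ be such that $\lceil z(\omega)-\frac12\rceil=-H$, and let $\lambda(\xi)=z(\xi\omega)-l(\xi\omega;\omega,p)$ for $\xi\ge1$. Then for every integer $n\ge0$ and every $s\in(-\frac{1+\alpha}{2\alpha},0]$, $\sup_{\xi\ge1}|\xi^{-s}D^n\lambda(\xi)|<\infty$.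
   Context: Fix $\alpha>1$, $p\ge0$. A solution of the BAE is an entire function $Q$ of order $\frac{1+\alpha}{2\alpha}$ with simple zeros such that $e^{-4\pi ip}Q(xe^{-\frac{2\pi i}{1+\alpha}})/Q(xe^{\frac{2\pi i}{1+\alpha}})=-1$ whenever $Q(x)=0$; purely real if all zeros are real positive; normalised if $Q(0)=1$ and $\lim_{x\to\infty}x^{-\frac{1+\alpha}{2\alpha}}n_Q(x)=1$ ($n_Q(x)$ = number of zeros in $[0,x]$). Associated function $z(x)=-2p+\frac1{2\pi i}\log\frac{Q(xe^{-2\pi i/(1+\alpha)})}{Q(xe^{2\pi i/(1+\alpha)})}$, branch with $z(0)=-2p$; it is strictly increasing and tends to $+\infty$. $\mathbb{Z}_p=\{k\in\mathbb{Z}:k\ge-2p-\frac12\}$, $x_k$ = unique point with $z(x_k)=k+\frac12$; $\mathbb{H}=\{k\in\mathbb{Z}_p:Q(x_k)\ne0\}$ (hole-numbers), $\overline{\mathbb{H}}=\mathbb{Z}_p\setminus\mathbb{H}$, $\kappa=\min\overline{\mathbb{H}}$, $\mathbb{H}_\kappa=\{k\in\mathbb{H}:k>\kappa\}$, sector $\sec_{\mathbb{H}}=\kappa+|\mathbb{H}_\kappa|$. $D=x\frac d{dx}$. Let $\rho=\frac{\alpha+1}\alpha\alpha^{\frac1{\alpha+1}}$, $V(u;x)=xu^2-u^{2\alpha+2}-1$, $S(x)=\frac1\pi\int_{u_1(x)}^{u_2(x)}\sqrt{V(u;x)}\frac{du}u$ for $x>\rho$ with $0<u_1<u_2$ the positive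 zeros of $V(\cdot;x)$, $S=0$ on $[0,\rho]$; $\tau(\xi)=2(1+\alpha)S(\rho\xi)$; $A=(1+\alpha)\left(\frac1{\sqrt{\pi\alpha}}\frac{\Gamma(\frac1{2\alpha})}{\Gamma(\frac{1+\alpha}{2\alpha})}\right)^{\frac{2\alpha}{\alpha+1}}$; $l(x;\omega,p)=p\tau(\frac x\omega)-\frac{2\alpha}{1+\alpha}\left[p-(\frac\omega A)^{\frac{1+\alpha}{2\alpha}}\right](D\tau)(\frac x\omega)$ for $x\ge\omega$, the unique solution of $l(x)=-2p+\int_\omega^\infty K_\alpha(\frac xy)l(y)\frac{dy}y$ with $x^{-\frac{1+\alpha}{2\alpha}}l(x)\to1$, where $K_\alpha(x)=\frac{\sin(\frac{2\pi}{1+\alpha})}\pi\frac{x}{1+x^2-2x\cos(\frac{2\pi}{1+\alpha})}$. *)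

theory Defs
  imports "HOL-Complex_Analysis.Complex_Analysis" "HOL-Library.Landau_Symbols"
begin

definition entire_of_order :: "(complex \<Rightarrow> complex) \<Rightarrow> real \<Rightarrow> bool" where
  "entire_of_order Q r0 \<longleftrightarrow> Q holomorphic_on UNIV \<and>
     (\<forall>\<mu>>r0. \<forall>\<^sub>F r in at_top. \<forall>w. norm w = r \<longrightarrow> norm (Q w) \<le> exp (r powr \<mu>)) \<and>
     (\<forall>\<mu><r0. \<not> (\<forall>\<^sub>F r in at_top. \<forall>w. norm w = r \<longrightarrow> norm (Q w) \<le> exp (r powr \<mu>)))"

definition bae_exp :: "real \<Rightarrow> real" where
  "bae_exp \<alpha> = (1 + \<alpha>) / (2 * \<alpha>)"

definition bae_theta :: "real \<Rightarrow> real" where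
  "bae_theta \<alpha> = 2 * pi / (1 + \<alpha>)"

definition bae_solution :: "real \<Rightarrow> real \<Rightarrow> (complex \<Rightarrow> complex) \<Rightarrow> bool" where
  "bae_solution \<alpha> p Q \<longleftrightarrow> entire_of_order Q (bae_exp \<alpha>) \<and>
     (\<forall>w. Q w = 0 \<longrightarrow> deriv Q w \<noteq> 0) \<and>
     (\<forall>w. Q w = 0 \<longrightarrow>
        exp (- 4 * pi * \<i> * of_real p) * Q (w * cis (- bae_theta \<alpha>)) / Q (w * cis (bae_theta \<alpha>)) = -1)"

definition purely_real :: "(complex \<Rightarrow> complex) \<Rightarrow> bool" where
  "purely_real Q \<longleftrightarrow> (\<forall>w. Q w = 0 \<longrightarrow> w \<in> \<real> \<and> Re w > 0)"

definition zero_count :: "(complex \<Rightarrow> complex) \<Rightarrow> real \<Rightarrow> nat" where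
  "zero_count Q x = card {w. Q w = 0 \<and> w \<in> closed_segment 0 (complex_of_real x)}"

definition normalised :: "real \<Rightarrow> (complex \<Rightarrow> complex) \<Rightarrow> bool" where
  "normalised \<alpha> Q \<longleftrightarrow> Q 0 = 1 \<and>
     ((\<lambda>x. x powr (- bae_exp \<alpha>) * real (zero_count Q x)) \<longlongrightarrow> 1) at_top"

(* Associated function z: the continuous branch on [0,oo) of
   -2p + 1/(2 pi i) log (Q(x e^{-i theta}) / Q(x e^{i theta})) with z(0) = -2p
   (set to 0 for x < 0 only to make it unique). *)
definition assoc_fun :: "real \<Rightarrow> real \<Rightarrow> (complex \<Rightarrow> complex) \<Rightarrow> real \<Rightarrow> real" where
  "assoc_fun \<alpha> p Q = (THE z. continuous_on {0..} z \<and> z 0 = - 2 * p \<and>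
      (\<forall>x\<ge>0. exp (2 * pi * \<i> * complex_of_real (z x + 2 * p)) =
               Q (of_real x * cis (- bae_theta \<alpha>)) / Q (of_real x * cis (bae_theta \<alpha>))) \<and>
      (\<forall>x<0. z x = 0))"

definition Zp :: "real \<Rightarrow> int set" where
  "Zp p = {k. real_of_int k \<ge> - 2 * p - 1 / 2}"

definition xk :: "real \<Rightarrow> real \<Rightarrow> (complex \<Rightarrow> complex) \<Rightarrow> int \<Rightarrow> real" where
  "xk \<alpha> p Q k = (THE x. x \<ge> 0 \<and> assoc_fun \<alpha> p Q x = real_of_int k + 1 / 2)"

definition holes :: "real \<Rightarrow> real \<Rightarrow> (complex \<Rightarrow> complex) \<Rightarrow> int set" where
  "holes \<alpha> p Q = {k \<in> Zp p. Q (complex_of_real (xk \<alpha> p Q k)) \<noteq> 0}"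

definition kappa :: "real \<Rightarrow> real \<Rightarrow> (complex \<Rightarrow> complex) \<Rightarrow> int" where
  "kappa \<alpha> p Q = (LEAST k. k \<in> Zp p - holes \<alpha> p Q)"

definition holes_kappa :: "real \<Rightarrow> real \<Rightarrow> (complex \<Rightarrow> complex) \<Rightarrow> int set" where
  "holes_kappa \<alpha> p Q = {k \<in> holes \<alpha> p Q. k > kappa \<alpha> p Q}"

definition sector :: "real \<Rightarrow> real \<Rightarrow> (complex \<Rightarrow> complex) \<Rightarrow> int" where
  "sector \<alpha> p Q = kappa \<alpha> p Q + int (card (holes_kappa \<alpha> p Q))"

definition Dop :: "(real \<Rightarrow> real) \<Rightarrow> real \<Rightarrow> real" where
  "Dop f = (\<lambda>x. x * deriv f x)"

definition rho_c :: "real \<Rightarrow> real" where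
  "rho_c \<alpha> = (\<alpha> + 1) / \<alpha> * \<alpha> powr (1 / (\<alpha> + 1))"

definition Vpot :: "real \<Rightarrow> real \<Rightarrow> real \<Rightarrow> real" where
  "Vpot \<alpha> u x = x * u\<^sup>2 - u powr (2 * \<alpha> + 2) - 1"

definition u1 :: "real \<Rightarrow> real \<Rightarrow> real" where
  "u1 \<alpha> x = Inf {u. u > 0 \<and> Vpot \<alpha> u x = 0}"

definition u2 :: "real \<Rightarrow> real \<Rightarrow> real" where
  "u2 \<alpha> x = Sup {u. u > 0 \<and> Vpot \<alpha> u x = 0}"

definition Sfun :: "real \<Rightarrow> real \<Rightarrow> real" where
  "Sfun \<alpha> x = (if x > rho_c \<alpha>
      then 1 / pi * integral {u1 \<alpha> x .. u2 \<alpha> x} (\<lambda>u. sqrt (Vpot \<alpha> u x) / u)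
      else 0)"

definition tau :: "real \<Rightarrow> real \<Rightarrow> real" where
  "tau \<alpha> \<xi> = 2 * (1 + \<alpha>) * Sfun \<alpha> (rho_c \<alpha> * \<xi>)"

definition Aconst :: "real \<Rightarrow> real" where
  "Aconst \<alpha> = (1 + \<alpha>) * ((1 / sqrt (pi * \<alpha>)) * Gamma (1 / (2 * \<alpha>)) / Gamma ((1 + \<alpha>) / (2 * \<alpha>)))
                 powr (2 * \<alpha> / (\<alpha> + 1))"

definition lfun :: "real \<Rightarrow> real \<Rightarrow> real \<Rightarrow> real \<Rightarrow> real" where
  "lfun \<alpha> om p x = p * tau \<alpha> (x / om)
     - 2 * \<alpha> / (1 + \<alpha>) * (p - (om / Aconst \<alpha>) powr bae_exp \<alpha>) * Dop (tau \<alpha>) (x / om)"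

end

theory Submission
  imports Defs "HOL-Real_Asymp.Real_Asymp"
begin

text \<open>
  Since Q has genus zero, z + 2p is the transform of the zero counting function N against a
  dilation-invariant kernel, which extends holomorphically to a sector around the positive axis.
  Counting zeros through z gives N = z + saw(z) - sector for large arguments, where the sawtooth has
  mean zero. Hence the deviation r of z from its claimed asymptotic form solves a convolution
  equation on the half-line whose inhomogeneity is small, because integrating by parts against the
  sawtooth gains a factor of order -e with e = (1 + \<alpha>) / (2 \<alpha>). The multiplier of the
  convolution is less than 1 at every exponent in (-e, 0), so a maximum principle bounds r, and the
  integral representation carries the bound over to the sector.

  With the substitution u = exp (t/2 + const) the action integral becomes G(eps), the integral of
  sqrt (q - eps) for the fixed potential q t = exp t - exp ((1 + \<alpha>) t). Layer-cake slicing
  writes G through the distance between the two turning points. This shows that \<tau> is analytic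
  up to the bottom of the well, and that \<tau> equals A^e \<xi>^e - (1 + \<alpha>) plus a remainder
  which is holomorphic and of order -e in a sector. If the sector number vanishes, the leading terms
  of z and l cancel, and Cauchy's estimate in the sector handles all powers of D at infinity;
  on compact intervals analyticity suffices.
\<close>

section \<open>Euler operators and special integrals\<close>

text \<open>The exponents come from the multiplier sin ((pi - th) s) / sin (pi s) of the
  convolution. It is even in s and equals 1 at s = e and s = -e. So the transform reproduces x^e,
  which can therefore lead the asymptotics, while -e is the barrier at which the comparison argument
  stops; this is why a loss \<delta> stays in the exponent. The constant term obeys a balance of its
  own: a constant c is sent to c (1 - th / pi), and comparing z with the zero count shifted by the
  sector leaves one linear equation for it. In the second statement the leading terms cancel because
  the prefactor 2 \<alpha> / (1 + \<alpha>) in l is 1 / e and because A^e is the leading coefficient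
  of \<tau>. The constant -(1 + \<alpha>) of \<tau> has its origin in the left turning point, which
  runs to minus infinity like ln eps: integrated over the slices, this logarithm leaves the term -pi
  sqrt eps, and the prefactor of order \<xi>^e turns it into a constant.\<close>

lemma holomorphic_on_lebesgue_integral:
  fixes f :: "complex \<Rightarrow> 'b \<Rightarrow> complex"
  assumes S: "open S" and meas: "\<And>w. w \<in> S \<Longrightarrow> f w \<in> borel_measurable M"
    and hol: "\<And>y. (\<lambda>w. f w y) holomorphic_on S"
    and dom: "\<And>w. w \<in> S \<Longrightarrow> \<exists>r>0. \<exists>g. integrable M g \<and> (\<forall>w'\<in>ball w r \<inter> S. \<forall>y. norm (f w' y) \<le> g y)"
  shows "(\<lambda>w. \<integral>y. f w y \<partial>M) holomorphic_on S"
proof -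
  have "(\<lambda>w. \<integral>y. f w y \<partial>M) field_differentiable (at w0)" if w0: "w0 \<in> S" for w0
  proof -
    obtain r1 g where r1: "r1 > 0" and g: "integrable M g"
      and bd1: "\<And>w' y. w' \<in> ball w0 r1 \<inter> S \<Longrightarrow> norm (f w' y) \<le> g y"
      using dom[OF w0] by blast
    obtain r2 where r2: "r2 > 0" "ball w0 r2 \<subseteq> S" using S w0 openE by blast
    \<comment> \<open>A third of the admissible radius leaves room for a Cauchy disc of radius
      \<open>r\<close> around every point of \<open>ball w0 r\<close>.\<close>
    define r where "r = min r1 r2 / 3"
    have r: "r > 0" "3 * r \<le> r1" "3 * r \<le> r2" using r1 r2 by (auto simp: r_def)
    have sub: "ball w0 (3*r) \<subseteq> S" using r r2 by (meson order_trans subset_ball)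
    have bd: "norm (f w y) \<le> g y" if "w \<in> ball w0 (3*r)" for w y
      using bd1[of w y] that sub r by auto
    have holb: "(\<lambda>w. f w y) holomorphic_on ball w0 (3*r)" for y
      using hol holomorphic_on_subset sub by blast
    have db: "norm (deriv (\<lambda>w. f w y) w) \<le> g y / r" if w: "w \<in> ball w0 r" for w y
    proof -
      have sb: "cball w r \<subseteq> ball w0 (3*r)"
      proof
        fix x assume "x \<in> cball w r"
        then show "x \<in> ball w0 (3*r)" using w r dist_triangle[of w0 x w] by auto
      qed
      have "norm ((deriv ^^ 1) (\<lambda>w. f w y) w) \<le> fact 1 * g y / r ^ 1"
      proof (rule Cauchy_inequality)
        show "(\<lambda>w. f w y) holomorphic_on ball w r" using holb sb ball_subset_cball holomorphic_on_subset by blast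
        show "continuous_on (cball w r) (\<lambda>w. f w y)"
          using holb sb holomorphic_on_imp_continuous_on holomorphic_on_subset by blast
        show "r > 0" by fact
        show "norm (f x y) \<le> g y" if "norm (w - x) = r" for x
          using bd sb that by (auto simp: dist_norm)
      qed
      then show ?thesis by simp
    qed
    \<comment> \<open>The Cauchy bound on the derivative dominates all difference quotients by the
      integrable \<open>g y / r\<close>, so dominated convergence along sequences applies.\<close>
    have dq: "norm ((f w y - f w0 y) / (w - w0)) \<le> g y / r" if w: "w \<in> ball w0 r" "w \<noteq> w0" for w y
    proof -
      have "norm (f w y - f w0 y) \<le> g y / r * norm (w - w0)"
      proof (rule field_differentiable_bound)
        show "convex (ball w0 r)" by simp
        show "((\<lambda>w. f w y) has_field_derivative deriv (\<lambda>w. f w y) z) (at z within ball w0 r)" if "z \<in> ball w0 r" for z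
        proof -
          have "z \<in> ball w0 (3*r)" using that r by auto
          then show ?thesis using holomorphic_derivI[OF holb] has_field_derivative_at_within by blast
        qed
        show "norm (deriv (\<lambda>w. f w y) z) \<le> g y / r" if "z \<in> ball w0 r" for z using db that by blast
      qed (use w r in auto)
      then show ?thesis using w by (simp add: norm_divide divide_le_eq)
    qed
    define D where "D = (\<lambda>y. deriv (\<lambda>w. f w y) w0)"
    have lim: "((\<lambda>w. (f w y - f w0 y) / (w - w0)) \<longlongrightarrow> D y) (at w0)" for y
      using holomorphic_derivI[OF holb[of y], of w0] r by (simp add: has_field_derivative_iff D_def)
    have lim2: "((\<lambda>w. ((\<integral>y. f w y \<partial>M) - (\<integral>y. f w0 y \<partial>M)) / (w - w0)) \<longlongrightarrow> (\<integral>y. D y \<partial>M)) (at w0 within ball w0 r)"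
      unfolding tendsto_at_iff_sequentially
    proof (intro allI impI)
      fix X :: "nat \<Rightarrow> complex" assume X: "\<forall>i. X i \<in> ball w0 r - {w0}" "X \<longlonglongrightarrow> w0"
      have Xb: "X i \<in> ball w0 (3*r)" for i
      proof -
        have "dist w0 (X i) < r" using X(1) by auto
        then show ?thesis using r by simp
      qed
      have XS: "X i \<in> S" for i using Xb sub by blast
      have int: "integrable M (f w)" if "w \<in> ball w0 (3*r)" for w
      proof (rule Bochner_Integration.integrable_bound[OF g])
        show "f w \<in> borel_measurable M" using meas that sub by blast
        show "AE x in M. norm (f w x) \<le> norm (g x)" using bd[OF that] by (intro AE_I2) (simp add: order_trans[OF _ abs_ge_self])
      qed
      have limX: "(\<lambda>i. (f (X i) y - f w0 y) / (X i - w0)) \<longlonglongrightarrow> D y" for y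
        using lim[of y] X unfolding tendsto_at_iff_sequentially comp_def by auto
      have measq: "(\<lambda>y. (f (X i) y - f w0 y) / (X i - w0)) \<in> borel_measurable M" for i
        using meas[OF XS] meas[OF w0] by measurable
      have measD: "D \<in> borel_measurable M"
        by (rule borel_measurable_LIMSEQ_metric[OF measq limX])
      have "(\<lambda>i. \<integral>y. (f (X i) y - f w0 y) / (X i - w0) \<partial>M) \<longlonglongrightarrow> (\<integral>y. D y \<partial>M)"
      proof (rule integral_dominated_convergence[where w = "\<lambda>y. g y / r"])
        show "integrable M (\<lambda>y. g y / r)" using g by simp
        show "AE x in M. norm ((f (X i) x - f w0 x) / (X i - w0)) \<le> g x / r" for i
          using dq[of "X i"] X(1) by auto
      qed (use measq measD limX in auto)
      moreover have deq: "(\<integral>y. (f (X i) y - f w0 y) / (X i - w0) \<partial>M) = ((\<integral>y. f (X i) y \<partial>M) - (\<integral>y. f w0 y \<partial>M)) / (X i - w0)" for i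
        using Bochner_Integration.integral_diff[OF int[OF Xb] int[of w0]] r by simp
      ultimately show "((\<lambda>w. ((\<integral>y. f w y \<partial>M) - (\<integral>y. f w0 y \<partial>M)) / (w - w0)) \<circ> X) \<longlonglongrightarrow> (\<integral>y. D y \<partial>M)"
        by (simp only: comp_def deq)
    qed
    have "at w0 within ball w0 r = at w0" using r by (intro at_within_open) auto
    with lim2 have "((\<lambda>w. \<integral>y. f w y \<partial>M) has_field_derivative (\<integral>y. D y \<partial>M)) (at w0)"
      by (simp add: has_field_derivative_iff)
    then show ?thesis using field_differentiable_def by blast
  qed
  then show ?thesis using S by (simp add: holomorphic_on_def field_differentiable_at_within)
qed

text \<open>A sector around the positive axis, truncated at real part \<open>M\<close> so that
  estimates valid only near infinity can be stated. Inside it \<open>Re w\<close> and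
  \<open>norm w\<close> are comparable, which is why powers of \<open>Re w\<close> serve as
  weights.\<close>

definition wedge :: "real \<Rightarrow> real \<Rightarrow> complex set" where
  "wedge m M = {w. \<bar>Im w\<bar> < m * Re w \<and> Re w > M}"

definition cDop :: "(complex \<Rightarrow> complex) \<Rightarrow> complex \<Rightarrow> complex" where
  "cDop f = (\<lambda>w. w * deriv f w)"

lemma open_wedge: "open (wedge m M)"
proof -
  have "wedge m M = {w. \<bar>Im w\<bar> < m * Re w} \<inter> {w. M < Re w}" by (auto simp: wedge_def)
  then show ?thesis by (auto intro!: open_Int open_Collect_less continuous_intros)
qed

lemma wedge_mono: "m \<le> m' \<Longrightarrow> M' \<le> M \<Longrightarrow> 0 \<le> M \<Longrightarrow> wedge m M \<subseteq> wedge m' M'"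
proof
  fix w assume h: "m \<le> m'" "M' \<le> M" "0 \<le> M" "w \<in> wedge m M"
  then have "m * Re w \<le> m' * Re w" by (intro mult_right_mono) (auto simp: wedge_def)
  then show "w \<in> wedge m' M'" using h by (auto simp: wedge_def intro: less_le_trans)
qed

lemma of_real_wedge: "m > 0 \<Longrightarrow> M \<ge> 0 \<Longrightarrow> complex_of_real x \<in> wedge m M \<longleftrightarrow> x > M"
  by (auto simp: wedge_def)

lemma cDop_holomorphic: "open V \<Longrightarrow> F holomorphic_on V \<Longrightarrow> (cDop ^^ n) F holomorphic_on V"
  by (induction n) (auto simp: cDop_def intro!: holomorphic_intros)

text \<open>The bound d <= 1/2 keeps the real part within a factor 2, and d (1 + m) <= m / 2 pays
  for the growth of the imaginary part together with the loss of real part.\<close>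

lemma ball_subset_wedge:
  assumes m: "m > 0" and M: "M \<ge> 0" and w: "w \<in> wedge (m/2) (2*M)"
    and d: "d = min (1/2) (m / (2 * (1 + m)))" and v: "v \<in> cball w (d * Re w)"
  shows "v \<in> wedge m M" "Re w / 2 \<le> Re v" "Re v \<le> 2 * Re w"
proof -
  have d0: "d > 0" "d \<le> 1/2" "d \<le> m / (2 * (1 + m))" using m by (auto simp: d)
  have d1: "d * (1 + m) \<le> m / 2" using d0(3) m by (simp add: field_simps)
  have rw: "Re w > 0" "Re w > 2 * M" "\<bar>Im w\<bar> < m/2 * Re w" using w M by (auto simp: wedge_def)
  have "norm (v - w) \<le> d * Re w" using v by (simp add: dist_norm norm_minus_commute)
  then have 1: "\<bar>Re v - Re w\<bar> \<le> d * Re w" "\<bar>Im v - Im w\<bar> \<le> d * Re w"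
    using abs_Re_le_cmod[of "v-w"] abs_Im_le_cmod[of "v-w"] by auto
  have 2: "d * Re w \<le> Re w / 2" using d0 rw by (simp add: mult.commute)
  show r1: "Re w / 2 \<le> Re v" and "Re v \<le> 2 * Re w" using 1 2 rw by linarith+
  have "\<bar>Im v\<bar> < (m/2 + d) * Re w" using 1 rw by (simp add: algebra_simps)
  also have "\<dots> \<le> (m - m * d) * Re w" using d1 rw by (intro mult_right_mono) (auto simp: algebra_simps)
  also have "\<dots> = m * (Re w - d * Re w)" by (simp add: algebra_simps)
  also have "\<dots> \<le> m * Re v" using 1 m by (intro mult_left_mono) auto
  finally have "\<bar>Im v\<bar> < m * Re v" .
  moreover have "Re v > M" using r1 rw by linarith
  ultimately show "v \<in> wedge m M" by (simp add: wedge_def)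
qed

lemma powr_comparable:
  fixes a b s :: real
  assumes "b > 0" "b / 2 \<le> a" "a \<le> 2 * b"
  shows "a powr s \<le> 2 powr \<bar>s\<bar> * b powr s"
proof -
  have a: "a > 0" using assms by linarith
  have "(a/b) powr s \<le> 2 powr \<bar>s\<bar>"
  proof (cases "s \<ge> 0")
    case True
    have "(a/b) powr s \<le> 2 powr s" using True a assms by (intro powr_mono2) (auto simp: field_simps)
    then show ?thesis using True by simp
  next
    case False
    have "(a/b) powr s \<le> (1/2) powr s" using False a assms by (intro powr_mono2') (auto simp: field_simps)
    also have "(1/2::real) powr s = 2 powr (-s)" by (simp add: powr_minus powr_divide inverse_eq_divide)
    finally show ?thesis using False by simp
  qed
  then show ?thesis using a assms by (simp add: powr_divide field_simps)
qed

text \<open>Cauchy's estimate on discs of radius proportional to the distance from the origin.\<close>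

lemma cDop_wedge_bound_step:
  assumes m: "m > 0" and M: "M \<ge> 0" and hol: "F holomorphic_on wedge m M"
    and bd: "\<And>w. w \<in> wedge m M \<Longrightarrow> norm (F w) \<le> C * Re w powr s"
  shows "\<exists>C'. \<forall>w\<in>wedge (m/2) (2*M). norm (cDop F w) \<le> C' * Re w powr s"
proof -
  define d where "d = min (1/2) (m / (2 * (1 + m)))"
  have d0: "d > 0" using m by (auto simp: d_def)
  show ?thesis
  proof (intro exI ballI)
    fix w assume w: "w \<in> wedge (m/2) (2*M)"
    have rw: "Re w > 0" "\<bar>Im w\<bar> < m/2 * Re w" using w M by (auto simp: wedge_def)
    note bs = ball_subset_wedge[OF m M w d_def]
    define B where "B = \<bar>C\<bar> * (2 powr \<bar>s\<bar> * Re w powr s)"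
    have "norm ((deriv ^^ 1) F w) \<le> fact 1 * B / (d * Re w) ^ 1"
    proof (rule Cauchy_inequality)
      have sub: "cball w (d * Re w) \<subseteq> wedge m M" using bs(1) by blast
      show "F holomorphic_on ball w (d * Re w)"
        using hol sub ball_subset_cball holomorphic_on_subset by blast
      show "continuous_on (cball w (d * Re w)) F"
        using hol sub holomorphic_on_imp_continuous_on holomorphic_on_subset by blast
      show "0 < d * Re w" using d0 rw by simp
      fix x assume "norm (w - x) = d * Re w"
      then have x: "x \<in> cball w (d * Re w)" by (simp add: dist_norm)
      have "norm (F x) \<le> C * Re x powr s" using bd[OF bs(1)[OF x]] .
      also have "\<dots> \<le> \<bar>C\<bar> * Re x powr s" by (intro mult_right_mono) auto
      also have "\<dots> \<le> B" unfolding B_def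
        using powr_comparable[OF rw(1) bs(2,3)[OF x]] by (intro mult_left_mono) auto
      finally show "norm (F x) \<le> B" .
    qed
    then have 1: "norm (deriv F w) \<le> B / (d * Re w)" by simp
    have 2: "norm w \<le> (1 + m) * Re w" 
    proof -
      have "m / 2 * Re w \<le> m * Re w" using rw m by (intro mult_right_mono) auto
      then show ?thesis using cmod_le[of w] rw by (simp add: algebra_simps)
    qed
    have "norm (cDop F w) = norm w * norm (deriv F w)" by (simp add: cDop_def norm_mult)
    also have "\<dots> \<le> ((1 + m) * Re w) * (B / (d * Re w))"
      using 1 2 m rw by (intro mult_mono) auto
    also have "\<dots> = ((1 + m) * \<bar>C\<bar> * 2 powr \<bar>s\<bar> / d) * Re w powr s"
      using rw by (simp add: B_def)
    finally show "norm (cDop F w) \<le> ((1 + m) * \<bar>C\<bar> * 2 powr \<bar>s\<bar> / d) * Re w powr s" .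
  qed
qed

text \<open>Each application of \<open>cDop\<close> halves the opening and doubles the cut-off, so
  after \<open>n\<close> steps only some smaller sector can be promised.\<close>

lemma cDop_wedge_bound:
  assumes m: "m > 0" and M: "M \<ge> 0" and hol: "F holomorphic_on wedge m M"
    and bd: "\<And>w. w \<in> wedge m M \<Longrightarrow> norm (F w) \<le> C * Re w powr s"
  shows "\<exists>C' m' M'. m' > 0 \<and> M' \<ge> M \<and> m' \<le> m \<and> (\<forall>w\<in>wedge m' M'. norm ((cDop ^^ n) F w) \<le> C' * Re w powr s)"
proof (induction n)
  case 0
  then show ?case using assms by auto
next
  case (Suc n)
  then obtain C' m' M' where *: "m' > 0" "M' \<ge> M" "m' \<le> m"
     "\<And>w. w\<in>wedge m' M' \<Longrightarrow> norm ((cDop ^^ n) F w) \<le> C' * Re w powr s" by blast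
  have "(cDop ^^ n) F holomorphic_on wedge m' M'"
    using holomorphic_on_subset[OF cDop_holomorphic[OF open_wedge hol] wedge_mono[of m' m M M']] * M by auto
  from cDop_wedge_bound_step[OF _ _ this *(4)] obtain C'' where
    C'': "\<forall>w\<in>wedge (m'/2) (2*M'). norm (cDop ((cDop ^^ n) F) w) \<le> C'' * Re w powr s" using * M by auto
  show ?case using * M C'' by (intro exI[of _ C''] exI[of _ "m'/2"] exI[of _ "2*M'"]) auto
qed

text \<open>Turns iterated real derivatives into values of a holomorphic function. The identity is
  required on an open set \<open>U\<close>, since each \<open>Dop\<close> differentiates the
  previous iterate and \<open>deriv\<close> sees a whole neighbourhood.\<close>

lemma Dop_iter_eq_Re_cDop:
  assumes V: "open V" and hol: "F holomorphic_on V" and U: "open U"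
    and sub: "\<And>x. x \<in> U \<Longrightarrow> complex_of_real x \<in> V"
    and eq: "\<And>x. x \<in> U \<Longrightarrow> f x = Re (F (of_real x))"
  shows "x \<in> U \<Longrightarrow> (Dop ^^ n) f x = Re ((cDop ^^ n) F (of_real x))"
proof (induction n arbitrary: x)
  case 0
  then show ?case using eq by simp
next
  case (Suc n)
  let ?G = "(cDop ^^ n) F"
  have holG: "?G holomorphic_on V" using cDop_holomorphic[OF V hol] .
  have "(?G has_field_derivative deriv ?G x) (at (of_real x))"
    using holomorphic_derivI[OF holG V] sub Suc.prems by blast
  then have "((\<lambda>x. ?G (of_real x)) has_vector_derivative deriv ?G x) (at x)"
    by (rule has_vector_derivative_real_field)
  then have d: "((\<lambda>x. Re (?G (of_real x))) has_real_derivative Re (deriv ?G x)) (at x)"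
    by (simp add: has_real_derivative_iff_has_vector_derivative
        bounded_linear.has_vector_derivative[OF bounded_linear_Re])
  have "((Dop ^^ n) f has_real_derivative Re (deriv ?G x)) (at x)"
    by (rule DERIV_cong_ev[THEN iffD1, OF refl _ refl d])
       (use Suc U in \<open>auto simp: eventually_nhds intro!: exI[of _ U]\<close>)
  then have "deriv ((Dop ^^ n) f) x = Re (deriv ?G x)" by (rule DERIV_imp_deriv)
  then have "Dop ((Dop ^^ n) f) x = Re (cDop ?G x)" by (simp add: Dop_def cDop_def)
  then show ?case by simp
qed


text \<open>The inverse is returned together with a disc on which \<open>f\<close> is injective,
  because the real version below needs uniqueness of preimages and not just their existence.\<close>

lemma holomorphic_local_inverse:
  assumes S: "open S" and hol: "f holomorphic_on S" and z0: "z0 \<in> S" and d: "deriv f z0 \<noteq> 0" and \<delta>: "\<delta> > 0"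
  obtains r g \<delta>1 where "r > 0" "0 < \<delta>1" "\<delta>1 \<le> \<delta>" "ball z0 \<delta>1 \<subseteq> S" "inj_on f (ball z0 \<delta>1)"
    "g holomorphic_on ball (f z0) r" "\<And>w. w \<in> ball (f z0) r \<Longrightarrow> g w \<in> ball z0 \<delta>1"
    "\<And>w. w \<in> ball (f z0) r \<Longrightarrow> f (g w) = w"
proof -
  obtain r0 where r0: "r0 > 0" "ball z0 r0 \<subseteq> S" "inj_on f (ball z0 r0)"
    using has_complex_derivative_locally_injective[OF hol z0 S d] by blast
  define \<delta>1 where "\<delta>1 = min r0 \<delta>"
  have sub: "ball z0 \<delta>1 \<subseteq> ball z0 r0" by (auto simp: \<delta>1_def)
  have inj: "inj_on f (ball z0 \<delta>1)" using inj_on_subset[OF r0(3) sub] .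
  have holb: "f holomorphic_on ball z0 \<delta>1" using hol sub r0(2) holomorphic_on_subset by blast
  obtain g where g: "g holomorphic_on (f ` ball z0 \<delta>1)" "\<And>z. z \<in> ball z0 \<delta>1 \<Longrightarrow> g (f z) = z"
    by (rule holomorphic_has_inverse[OF holb open_ball inj], rule that) simp_all
  have op: "open (f ` ball z0 \<delta>1)" using open_mapping_thm3[OF holb _ inj] by simp
  have "f z0 \<in> f ` ball z0 \<delta>1" using r0 \<delta> by (auto simp: \<delta>1_def)
  then obtain r where r: "r > 0" "ball (f z0) r \<subseteq> f ` ball z0 \<delta>1" using op openE by blast
  show ?thesis
  proof (rule that[of r \<delta>1 g])
    show "g w \<in> ball z0 \<delta>1" "f (g w) = w" if "w \<in> ball (f z0) r" for w
      using that r(2) g(2) by force+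
  qed (use r r0 \<delta> g sub inj holomorphic_on_subset in \<open>auto simp: \<delta>1_def\<close>)
qed

text \<open>For real \<open>w\<close> the conjugate of \<open>g w\<close> is a second preimage of
  \<open>w\<close> in the same disc, as the disc is centred on the real axis; injectivity forces it
  to be \<open>g w\<close> itself.\<close>

lemma real_local_inverse:
  fixes x0 :: real
  assumes S: "open S" and hol: "f holomorphic_on S" and z0: "of_real x0 \<in> S"
    and d: "deriv f (of_real x0) \<noteq> 0" and \<delta>: "\<delta> > 0"
    and sym: "\<And>z. z \<in> S \<Longrightarrow> f (cnj z) = cnj (f z)"
  obtains r g where "r > 0" "g holomorphic_on ball (f (of_real x0)) r"
    "\<And>w. w \<in> ball (f (of_real x0)) r \<Longrightarrow> f (g w) = w"
    "\<And>w. w \<in> ball (f (of_real x0)) r \<Longrightarrow> g w \<in> ball (of_real x0) \<delta>"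
    "\<And>w. w \<in> ball (f (of_real x0)) r \<Longrightarrow> w \<in> \<real> \<Longrightarrow> g w \<in> \<real>"
proof -
  obtain r g \<delta>1 where *: "r > 0" "0 < \<delta>1" "\<delta>1 \<le> \<delta>" "ball (of_real x0) \<delta>1 \<subseteq> S" "inj_on f (ball (of_real x0) \<delta>1)"
    "g holomorphic_on ball (f (of_real x0)) r" "\<And>w. w \<in> ball (f (of_real x0)) r \<Longrightarrow> g w \<in> ball (of_real x0) \<delta>1"
    "\<And>w. w \<in> ball (f (of_real x0)) r \<Longrightarrow> f (g w) = w"
    using holomorphic_local_inverse[OF S hol z0 d \<delta>] by metis
  show ?thesis
  proof (rule that[of r g])
    fix w assume w: "w \<in> ball (f (of_real x0)) r"
    show "g w \<in> ball (of_real x0) \<delta>" using *(3,7) w by fastforce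
    assume wr: "w \<in> \<real>"
    have "g w \<in> S" using *(4) *(7)[OF w] by blast
    then have "f (cnj (g w)) = f (g w)" using sym[of "g w"] *(8)[OF w] wr by (simp add: Reals_cnj_iff)
    moreover have "cnj (g w) \<in> ball (of_real x0) \<delta>1"
    proof -
      have "norm (of_real x0 - cnj (g w)) = norm (cnj (of_real x0 - g w))" by simp
      also have "\<dots> = norm (of_real x0 - g w)" by (simp only: complex_mod_cnj)
      finally show ?thesis using *(7)[OF w] by (simp add: dist_norm)
    qed
    ultimately have "cnj (g w) = g w" using *(5,7) w by (auto dest: inj_onD)
    then show "g w \<in> \<real>" by (simp add: Reals_cnj_iff)
  qed (use * in auto)
qed

text \<open>The candidate is \<open>E (csqrt u)\<close>. On the cut of \<open>csqrt\<close> evenness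
  allows the other root \<open>\<i> * csqrt (- u)\<close>, which is holomorphic there, and the
  origin is a removable singularity by continuity.\<close>

lemma even_holomorphic_sqrt:
  assumes r: "r > 0" and hol: "E holomorphic_on ball 0 r" and ev: "\<And>t. t \<in> ball 0 r \<Longrightarrow> E (-t) = E t"
  obtains w where "w holomorphic_on ball 0 (r\<^sup>2)" "\<And>t. t \<in> ball 0 r \<Longrightarrow> w (t\<^sup>2) = E t"
proof
  define w where "w = (\<lambda>u. E (csqrt u))"
  have E2: "E a = E b" if "a\<^sup>2 = b\<^sup>2" "a \<in> ball 0 r" for a b
  proof -
    have "a = b \<or> a = - b" using that by (simp add: power2_eq_iff)
    then show ?thesis using ev[of a] that(2) by auto
  qed
  have sq: "norm (csqrt u) < r" if "u \<in> ball 0 (r\<^sup>2)" for u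
  proof -
    have "(norm (csqrt u))\<^sup>2 = norm u" by (metis norm_power power2_csqrt)
    then show ?thesis using that r by (simp add: power2_less_imp_less)
  qed
  have cont: "isCont E 0" using hol r holomorphic_on_imp_continuous_on
    by (metis centre_in_ball continuous_on_eq_continuous_at open_ball)
  have cs0: "(csqrt \<longlongrightarrow> 0) (at 0)"
  proof (rule Lim_null_comparison)
    show "((\<lambda>x. sqrt (norm x)) \<longlongrightarrow> 0) (at (0::complex))" by (rule tendsto_eq_intros refl | simp)+
    show "\<forall>\<^sub>F x in at 0. norm (csqrt x) \<le> sqrt (norm x)"
      by (intro always_eventually allI real_le_rsqrt) (metis norm_power order_refl power2_csqrt)
  qed
  show "w holomorphic_on ball 0 (r\<^sup>2)"
  proof (rule no_isolated_singularity'[where K="{0}"])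
    show "(w \<longlongrightarrow> w z) (at z within ball 0 (r\<^sup>2))" if "z \<in> {0}" for z
    proof -
      have "(w \<longlongrightarrow> w 0) (at 0)" unfolding w_def
        using isCont_tendsto_compose[OF cont cs0] by simp
      then show ?thesis using that by (auto intro: tendsto_within_subset)
    qed
    have "w field_differentiable (at u)" if u: "u \<in> ball 0 (r\<^sup>2)" "u \<noteq> 0" for u
    proof (cases "u \<in> \<real>\<^sub>\<le>\<^sub>0")
      case False
      have "E field_differentiable at (csqrt u)"
        using hol sq[OF u(1)] by (auto simp: holomorphic_on_open field_differentiable_def)
      then have "(E \<circ> csqrt) field_differentiable at u"
        using False by (intro field_differentiable_compose field_differentiable_at_csqrt)
      then show ?thesis by (simp add: w_def comp_def)
    next
      case True
      then have nm: "-u \<notin> \<real>\<^sub>\<le>\<^sub>0" using u(2) by (auto simp: complex_nonpos_Reals_iff complex_eq_iff)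
      have "(\<i> * csqrt (-u))\<^sup>2 = u" for u by (simp add: power_mult_distrib)
      then have eq: "w v = E (\<i> * csqrt (-v))" if "v \<in> ball 0 (r\<^sup>2)" for v
        unfolding w_def using that sq by (intro E2) auto
      have "norm (csqrt (-u)) < r" using sq[of "-u"] u(1) by simp
      then have "E field_differentiable at (\<i> * csqrt (-u))"
        using hol by (auto simp: holomorphic_on_open field_differentiable_def norm_mult)
      moreover have "(\<lambda>u. \<i> * csqrt (-u)) field_differentiable at u"
      proof -
        have "(csqrt \<circ> uminus) field_differentiable at u"
          by (rule field_differentiable_compose) (use nm in \<open>auto intro!: field_differentiable_at_csqrt derivative_intros\<close>)
        then show ?thesis by (auto intro!: derivative_intros simp: comp_def)
      qed
      ultimately have "(E \<circ> (\<lambda>u. \<i> * csqrt (-u))) field_differentiable at u"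
        by (intro field_differentiable_compose)
      then have "(\<lambda>u. E (\<i> * csqrt (-u))) field_differentiable at u" by (simp add: comp_def)
      then obtain D where "((\<lambda>u. E (\<i> * csqrt (-u))) has_field_derivative D) (at u)"
        by (auto simp: field_differentiable_def)
      then have "(w has_field_derivative D) (at u)"
        by (rule DERIV_cong_ev[THEN iffD2, OF refl _ refl, rotated])
           (use eq u in \<open>auto simp: eventually_nhds intro!: exI[of _ "ball 0 (r\<^sup>2)"]\<close>)
      then show ?thesis by (auto simp: field_differentiable_def)
    qed
    then show "w holomorphic_on ball 0 (r\<^sup>2) - {0}"
      by (auto simp: holomorphic_on_def intro: field_differentiable_at_within)
  qed auto
  show "w (t\<^sup>2) = E t" if "t \<in> ball 0 r" for t
    unfolding w_def by (rule sym, rule E2) (use that in auto)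
qed

section \<open>Power integrals over the half-line\<close>

lemma set_integrable_halfline_scale:
  fixes f :: "real \<Rightarrow> 'a::{banach, second_countable_topology}"
  assumes c: "c > 0" and f: "set_integrable lborel {0<..} f"
  shows "set_integrable lborel {0<..} (\<lambda>y. f (c * y))"
proof -
  have eq: "indicator {0<..} (0 + c * y) *\<^sub>R f (0 + c * y) = indicator {0<..} y *\<^sub>R f (c * y)" for y
    using c by (auto simp: indicator_def zero_less_mult_iff)
  show ?thesis using lborel_integrable_real_affine[OF f[unfolded set_integrable_def], of c 0] c
    unfolding set_integrable_def eq by simp
qed

lemma set_integral_halfline_scale:
  fixes f :: "real \<Rightarrow> 'a::{banach, second_countable_topology}"
  assumes c: "c > 0"
  shows "(LINT y:{0<..}|lborel. f y) = c *\<^sub>R (LINT y:{0<..}|lborel. f (c * y))"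
proof -
  have eq: "indicator {0<..} (0 + c * y) *\<^sub>R f (0 + c * y) = indicator {0<..} y *\<^sub>R f (c * y)" for y
    using c by (auto simp: indicator_def zero_less_mult_iff)
  show ?thesis using lborel_integral_real_affine[of c "\<lambda>y. indicator {0<..} y *\<^sub>R f y" 0] c
    unfolding set_lebesgue_integral_def eq by simp
qed

text \<open>The substitution t = y / (1 + y) maps the half-line onto the unit interval and turns the
  integrand into that of the Beta integral.\<close>

lemma Beta_halfline:
  fixes a b :: real
  assumes a: "a > 0" and b: "b > 0"
  shows "set_integrable lborel {0<..} (\<lambda>y. y powr (a-1) * (1 + y) powr (-(a+b)))"
    and "(LINT y:{0<..}|lborel. y powr (a-1) * (1 + y) powr (-(a+b))) = Beta a b"
proof -
  let ?f = "\<lambda>t::real. t powr (a-1) * (1-t) powr (b-1)"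
  let ?g = "\<lambda>y::real. y / (1 + y)"
  have im: "?g ` {0<..} = {0<..<1}"
  proof
    show "?g ` {0<..} \<subseteq> {0<..<1}" by auto
    show "{0<..<1} \<subseteq> ?g ` {0<..}"
    proof
      fix t :: real assume "t \<in> {0<..<1}"
      then show "t \<in> ?g ` {0<..}" by (intro image_eqI[of _ _ "t / (1 - t)"]) (auto simp: field_simps)
    qed
  qed
  have inj: "inj_on ?g {0<..}" by (auto simp: inj_on_def field_simps)
  have hi: "(?f has_integral Beta a b) {0<..<1}"
    using has_integral_Beta_real[OF a b] by (simp add: has_integral_Icc_iff_Ioo)
  have "?f absolutely_integrable_on {0<..<1}"
    using hi by (intro nonnegative_absolutely_integrable_1) auto
  then have "?f absolutely_integrable_on (?g ` {0<..}) \<and> integral (?g ` {0<..}) ?f = Beta a b"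
    unfolding im using hi by (simp add: integral_unique)
  moreover have "(?g has_field_derivative 1 / (1+y)\<^sup>2) (at y within {0<..})" if "y \<in> {0<..}" for y
    using that by (auto intro!: derivative_eq_intros simp: power2_eq_square field_simps)
  ultimately have *: "(\<lambda>y. \<bar>1 / (1+y)\<^sup>2\<bar> * ?f (?g y)) absolutely_integrable_on {0<..} \<and>
     integral {0<..} (\<lambda>y. \<bar>1 / (1+y)\<^sup>2\<bar> * ?f (?g y)) = Beta a b"
    using has_absolute_integral_change_of_variables_1'[of "{0<..}" ?g "\<lambda>y. 1 / (1+y)\<^sup>2" ?f] inj by simp
  let ?h = "\<lambda>y::real. y powr (a-1) * (1 + y) powr (-(a+b))"
  have eq: "\<bar>1 / (1+y)\<^sup>2\<bar> * ?f (?g y) = ?h y" if "y \<in> {0<..}" for y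
  proof -
    have y: "y > 0" using that by simp
    have 1: "1 - y / (1 + y) = 1 / (1 + y)" using y by (simp add: field_simps)
    have "\<bar>1 / (1+y)\<^sup>2\<bar> * ?f (?g y) = y powr (a-1) * ((1 + y) powr (-2) * (1 + y) powr (-(a-1)) * (1 + y) powr (-(b-1)))"
    proof -
      have 2: "\<bar>1 / (1+y)\<^sup>2\<bar> = (1 + y) powr (-2)" using y by (simp add: powr_minus powr_numeral inverse_eq_divide)
      have 3: "(y / (1 + y)) powr (a-1) = y powr (a-1) * (1 + y) powr (-(a-1))"
        using y unfolding powr_minus by (simp add: powr_divide inverse_eq_divide)
      have 4: "(1 / (1 + y)) powr (b-1) = (1 + y) powr (-(b-1))"
        using y unfolding powr_minus by (simp add: powr_divide inverse_eq_divide)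
      show ?thesis unfolding 1 2 3 4 by (simp only: mult_ac)
    qed
    also have "\<dots> = ?h y" using y by (simp add: powr_add[symmetric])
    finally show ?thesis .
  qed
  have "?h absolutely_integrable_on {0<..} \<longleftrightarrow> (\<lambda>y. \<bar>1 / (1+y)\<^sup>2\<bar> * ?f (?g y)) absolutely_integrable_on {0<..}"
    using eq by (intro set_integrable_cong) auto
  moreover have "integral {0<..} ?h = integral {0<..} (\<lambda>y. \<bar>1 / (1+y)\<^sup>2\<bar> * ?f (?g y))"
    using eq by (intro integral_cong) auto
  ultimately have **: "?h absolutely_integrable_on {0<..}" "integral {0<..} ?h = Beta a b" using * by auto
  show si: "set_integrable lborel {0<..} ?h"
    using **(1) unfolding set_integrable_def
    by (subst (asm) integrable_completion) measurable
  show "(LINT y:{0<..}|lborel. ?h y) = Beta a b"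
    using set_borel_integral_eq_integral(2)[OF si] **(2) by simp
qed

text \<open>x / (x + y)^2 is a dilation-invariant majorant of the kernel introduced below; the
  condition on \<open>\<sigma>\<close> is integrability at 0 and at infinity.\<close>

lemma power_kernel_halfline:
  fixes x \<sigma> :: real
  assumes x: "x > 0" and \<sigma>: "\<bar>\<sigma>\<bar> < 1"
  shows "set_integrable lborel {0<..} (\<lambda>y. y powr \<sigma> * (x / (x + y)\<^sup>2))"
    and "(LINT y:{0<..}|lborel. y powr \<sigma> * (x / (x + y)\<^sup>2)) = Beta (1+\<sigma>) (1-\<sigma>) * x powr \<sigma>"
proof -
  have B: "set_integrable lborel {0<..} (\<lambda>y. y powr \<sigma> * (1 + y) powr (-2))"
     "(LINT y:{0<..}|lborel. y powr \<sigma> * (1 + y) powr (-2)) = Beta (1+\<sigma>) (1-\<sigma>)"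
    using Beta_halfline[of "1+\<sigma>" "1-\<sigma>"] \<sigma> by auto
  have eq: "y powr \<sigma> * (x / (x + y)\<^sup>2) = x powr \<sigma> / x * ((1/x * y) powr \<sigma> * (1 + 1/x * y) powr (-2))"
    if "y \<in> {0<..}" for y
  proof -
    have "x powr \<sigma> * (1/x * y) powr \<sigma> = y powr \<sigma>" using x that by (simp add: powr_mult[symmetric])
    moreover have "(1 + 1/x * y) powr (-2) = x\<^sup>2 / (x + y)\<^sup>2"
      using x that by (simp add: powr_minus powr_numeral power2_eq_square field_simps)
    ultimately show ?thesis using x by (simp add: power2_eq_square field_simps)
  qed
  have si: "set_integrable lborel {0<..} (\<lambda>y. x powr \<sigma> / x * ((1/x * y) powr \<sigma> * (1 + 1/x * y) powr (-2)))"
    using set_integrable_halfline_scale[OF _ B(1), of "1/x"] x by (intro set_integrable_mult_right) auto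
  show "set_integrable lborel {0<..} (\<lambda>y. y powr \<sigma> * (x / (x + y)\<^sup>2))"
    by (rule iffD2[OF set_integrable_cong[OF refl refl eq] si])
  have "(LINT y:{0<..}|lborel. y powr \<sigma> * (x / (x + y)\<^sup>2)) =
     (LINT y:{0<..}|lborel. x powr \<sigma> / x * ((1/x * y) powr \<sigma> * (1 + 1/x * y) powr (-2)))"
    using eq by (intro set_lebesgue_integral_cong) auto
  also have "\<dots> = x powr \<sigma> / x * (LINT y:{0<..}|lborel. (1/x * y) powr \<sigma> * (1 + 1/x * y) powr (-2))"
    by (rule set_integral_mult_right)
  also have "(LINT y:{0<..}|lborel. (1/x * y) powr \<sigma> * (1 + 1/x * y) powr (-2)) = x * Beta (1+\<sigma>) (1-\<sigma>)"
    using set_integral_halfline_scale[of "1/x" "\<lambda>y. y powr \<sigma> * (1 + y) powr (-2)"] x B(2) by (simp add: field_simps)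
  finally show "(LINT y:{0<..}|lborel. y powr \<sigma> * (x / (x + y)\<^sup>2)) = Beta (1+\<sigma>) (1-\<sigma>) * x powr \<sigma>" using x by simp
qed

text \<open>After scaling \<open>c\<close> to 1 this is Beta s (1 - s), which the reflection formula
  for Gamma evaluates.\<close>

lemma Stieltjes_power_real:
  fixes c s :: real
  assumes c: "c > 0" and s: "0 < s" "s < 1"
  shows "set_integrable lborel {0<..} (\<lambda>y. y powr (s-1) / (y + c))"
    and "(LINT y:{0<..}|lborel. y powr (s-1) / (y + c)) = c powr (s-1) * (pi / sin (pi * s))"
proof -
  have Beta: "Beta s (1-s) = pi / sin (pi * s)"
  proof -
    have "complex_of_real (Beta s (1-s)) = Gamma (of_real s) * Gamma (1 - of_real s)"
      by (simp add: Beta_def Gamma_complex_of_real[symmetric] flip: Beta_complex_of_real)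
    also have "\<dots> = of_real (pi / sin (pi * s))"
      by (simp add: Gamma_reflection_complex flip: sin_of_real)
    finally show ?thesis using of_real_eq_iff by blast
  qed
  have B: "set_integrable lborel {0<..} (\<lambda>y. y powr (s-1) * (1 + y) powr (-1))"
     "(LINT y:{0<..}|lborel. y powr (s-1) * (1 + y) powr (-1)) = pi / sin (pi * s)"
    using Beta_halfline[of s "1-s"] s Beta by auto
  have eq: "y powr (s-1) / (y + c) = c powr (s-1) / c * ((1/c * y) powr (s-1) * (1 + 1/c * y) powr (-1))"
    if "y \<in> {0<..}" for y
  proof -
    have "c powr (s-1) * (1/c * y) powr (s-1) = y powr (s-1)" using c that by (simp add: powr_mult[symmetric])
    moreover have "(1 + 1/c * y) powr (-1) = c / (y + c)"
      using c that by (simp add: powr_minus field_simps)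
    ultimately show ?thesis using c by (simp add: field_simps)
  qed
  have si: "set_integrable lborel {0<..} (\<lambda>y. c powr (s-1) / c * ((1/c * y) powr (s-1) * (1 + 1/c * y) powr (-1)))"
    using set_integrable_halfline_scale[OF _ B(1), of "1/c"] c by (intro set_integrable_mult_right) auto
  show "set_integrable lborel {0<..} (\<lambda>y. y powr (s-1) / (y + c))"
    by (rule iffD2[OF set_integrable_cong[OF refl refl eq] si])
  have "(LINT y:{0<..}|lborel. y powr (s-1) / (y + c)) =
     (LINT y:{0<..}|lborel. c powr (s-1) / c * ((1/c * y) powr (s-1) * (1 + 1/c * y) powr (-1)))"
    using eq by (intro set_lebesgue_integral_cong) auto
  also have "\<dots> = c powr (s-1) / c * (LINT y:{0<..}|lborel. (1/c * y) powr (s-1) * (1 + 1/c * y) powr (-1))"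
    by (rule set_integral_mult_right)
  also have "(LINT y:{0<..}|lborel. (1/c * y) powr (s-1) * (1 + 1/c * y) powr (-1)) = c * (pi / sin (pi * s))"
    using set_integral_halfline_scale[of "1/c" "\<lambda>y. y powr (s-1) * (1 + y) powr (-1)"] c B(2) by (simp add: field_simps)
  finally show "(LINT y:{0<..}|lborel. y powr (s-1) / (y + c)) = c powr (s-1) * (pi / sin (pi * s))" using c by simp
qed

section \<open>The kernel\<close>

lemma set_integrable_dominated:
  fixes f :: "'b \<Rightarrow> 'a::{banach, second_countable_topology}"
  assumes g: "set_integrable M A g" and m: "set_borel_measurable M A f" and le: "\<And>y. y \<in> A \<Longrightarrow> norm (f y) \<le> g y"
  shows "set_integrable M A f"
proof (rule set_integrable_bound[OF g m], intro AE_I2 impI)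
  fix y assume "y \<in> A"
  then show "norm (f y) \<le> norm (g y)" using le[of y] by (simp add: order_trans[OF _ abs_ge_self])
qed

text \<open>Both sides are holomorphic in \<open>c\<close> off the closed negative axis and agree
  for positive \<open>c\<close>; the slit plane is connected, so they agree throughout.\<close>

lemma Stieltjes_power_complex:
  fixes c :: complex and s :: real
  assumes c: "c \<notin> of_real ` {..0}" and s: "0 < s" "s < 1"
  shows "set_integrable lborel {0<..} (\<lambda>y. of_real (y powr (s-1)) / (of_real y + c))" (is "?P c")
    and "(LINT y:{0<..}|lborel. of_real (y powr (s-1)) / (of_real y + c)) = c powr (of_real s - 1) * of_real (pi / sin (pi * s))"
proof -
  let ?V = "- (complex_of_real ` {..0})"
  let ?f = "\<lambda>c y. of_real (y powr (s-1)) / (of_real y + c) :: complex"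
  have cl: "closed (complex_of_real ` {..0})"
    by (intro closed_injective_linear_image) (auto simp: linear_of_real inj_on_def)
  have oV: "open ?V" using cl by (simp add: open_Compl)
  \<comment> \<open>Near \<open>c0\<close> the distance of \<open>c\<close> from the slit stays
    above \<open>d\<close>, so the denominator is at least a fixed multiple of \<open>y + 1\<close>.
    This is the local domination that holomorphy of the integral needs.\<close>
  have loc: "\<exists>r>0. \<exists>k. \<forall>c\<in>ball c0 r \<inter> ?V. \<forall>y>0. norm (?f c y) \<le> k * (y powr (s-1) / (y + 1))" if c0: "c0 \<in> ?V" for c0
  proof -
    obtain d0 where d0: "d0 > 0" "ball c0 d0 \<subseteq> ?V" using oV c0 openE by blast
    define d where "d = d0 / 2"
    define R where "R = norm c0 + d"
    have d: "d > 0" "R > 0" using d0 by (auto simp: d_def R_def add_nonneg_pos)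
    have "norm (?f c y) \<le> (1 + (1+R)/d) * (y powr (s-1) / (y + 1))" if c: "c \<in> ball c0 d" and y: "y > 0" for c y
    proof -
      have "d0 \<le> dist c0 (of_real (-y))"
        using d0(2) y by (force simp: not_less[symmetric])
      then have "d0 \<le> dist c0 c + dist c (of_real (-y))" using dist_triangle order_trans by blast
      then have 1: "d \<le> norm (of_real y + c)" using c by (simp add: d_def dist_norm add.commute)
      have "norm c \<le> R" using c norm_triangle_sub[of c c0] by (simp add: R_def dist_norm norm_minus_commute)
      then have 2: "y \<le> norm (of_real y + c) + R"
        using norm_triangle_ineq4[of "of_real y + c" c] y by simp
      let ?N = "norm (of_real y + c)"
      have "1 \<le> ?N / d" using 1 d by simp
      then have "(1 + R) * 1 \<le> (1 + R) * (?N / d)" using d by (intro mult_left_mono) auto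
      then have "y + 1 \<le> (1 + (1+R)/d) * ?N" using 2 by (simp add: algebra_simps)
      then have "1 / ?N \<le> (1 + (1+R)/d) / (y + 1)" using y order.strict_trans2[OF d(1) 1]
        by (simp add: pos_divide_le_eq pos_le_divide_eq mult.commute)
      then have "y powr (s-1) * (1 / ?N) \<le> y powr (s-1) * ((1 + (1+R)/d) / (y + 1))"
        by (intro mult_left_mono) auto
      then show ?thesis by (simp add: norm_divide mult.commute)
    qed
    then show ?thesis using d by blast
  qed
  have R1: "set_integrable lborel {0<..} (\<lambda>y. y powr (s-1) / (y + 1))"
    using Stieltjes_power_real(1)[of 1 s] s by simp
  have meas: "(\<lambda>y. indicator {0<..} y *\<^sub>R ?f c y) \<in> borel_measurable lborel" for c by measurable
  have int: "?P c" if cV: "c \<in> ?V" for c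
  proof -
    obtain k where k: "\<And>y. y > 0 \<Longrightarrow> norm (?f c y) \<le> k * (y powr (s-1) / (y + 1))"
    proof -
      obtain r k where rk: "r > 0" "\<forall>c'\<in>ball c r \<inter> ?V. \<forall>y>0. norm (?f c' y) \<le> k * (y powr (s-1) / (y + 1))"
        using loc[OF cV] by blast
      have "c \<in> ball c r \<inter> ?V" using rk(1) cV by auto
      then show ?thesis using that[of k] rk by blast
    qed
    show ?thesis
    proof (rule set_integrable_dominated)
      show "set_integrable lborel {0<..} (\<lambda>y. k * (y powr (s-1) / (y + 1)))"
        using R1 by (rule set_integrable_mult_right)
      show "set_borel_measurable lborel {0<..} (?f c)" using meas by (simp add: set_borel_measurable_def)
      show "norm (?f c y) \<le> k * (y powr (s-1) / (y + 1))" if "y \<in> {0<..}" for y using k[of y] that by simp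
    qed
  qed
  show "?P c" using int c by simp
  let ?J = "\<lambda>c. (LINT y:{0<..}|lborel. ?f c y)"
  let ?G = "\<lambda>c. c powr (of_real s - 1) * of_real (pi / sin (pi * s)) :: complex"
  have hol: "?J holomorphic_on ?V" unfolding set_lebesgue_integral_def
  proof (rule holomorphic_on_lebesgue_integral[OF oV])
    show "(\<lambda>y. indicator {0<..} y *\<^sub>R ?f w y) \<in> borel_measurable lborel" for w by (rule meas)
    show "(\<lambda>w. indicator {0<..} y *\<^sub>R ?f w y) holomorphic_on ?V" for y
    proof (cases "y > 0")
      case True
      have "of_real y + w \<noteq> 0" if "w \<in> ?V" for w
      proof
        assume "of_real y + w = 0"
        then have "w = of_real (-y)" by (simp add: add_eq_0_iff)
        then show False using that True by auto
      qed
      then show ?thesis by (intro holomorphic_intros) auto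
    next
      case False then show ?thesis by simp
    qed
    fix w assume "w \<in> ?V"
    from loc[OF this] obtain r k where k: "r > 0" "\<forall>c\<in>ball w r \<inter> ?V. \<forall>y>0. norm (?f c y) \<le> k * (y powr (s-1) / (y + 1))" by blast
    show "\<exists>r>0. \<exists>g. integrable lborel g \<and> (\<forall>w'\<in>ball w r \<inter> ?V. \<forall>y. norm (indicator {0<..} y *\<^sub>R ?f w' y) \<le> g y)"
    proof (intro exI conjI)
      show "r > 0" by fact
      show "integrable lborel (\<lambda>y. indicator {0<..} y *\<^sub>R (k * (y powr (s-1) / (y + 1))))"
        using set_integrable_mult_right[OF R1, of k] unfolding set_integrable_def .
      show "\<forall>w'\<in>ball w r \<inter> ?V. \<forall>y. norm (indicator {0<..} y *\<^sub>R ?f w' y) \<le> indicator {0<..} y *\<^sub>R (k * (y powr (s-1) / (y + 1)))"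
        using k by (auto simp: indicator_def)
    qed
  qed
  have holG: "?G holomorphic_on ?V"
  proof (intro holomorphic_intros)
    fix z assume "z \<in> ?V"
    then show "z \<notin> \<real>\<^sub>\<le>\<^sub>0" by (auto simp: nonpos_Reals_def)
  qed
  have con: "connected ?V" using starlike_slotted_complex_plane_left[of 0] starlike_imp_connected by blast
  have "?J c - ?G c = 0"
  proof (rule analytic_continuation[where f="\<lambda>c. ?J c - ?G c" and w=c and S="?V" and U="complex_of_real ` {0<..}" and \<xi>=1])
    show "(\<lambda>c. ?J c - ?G c) holomorphic_on ?V" by (rule holomorphic_on_diff[OF hol holG])
    show "complex_of_real ` {0<..} \<subseteq> ?V" by auto
    show "1 \<in> ?V" by (auto simp: image_iff)
    show "1 islimpt complex_of_real ` {0<..}"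
    proof (rule islimptI)
      fix T :: "complex set" assume T: "1 \<in> T" "open T"
      then obtain e where e: "e > 0" "ball 1 e \<subseteq> T" using openE by blast
      show "\<exists>y\<in>complex_of_real ` {0<..}. y \<in> T \<and> y \<noteq> 1"
      proof (intro bexI[of _ "complex_of_real (1 + e/2)"] conjI)
        have "dist 1 (complex_of_real (1 + e/2)) = e/2" using e(1) by (simp add: dist_norm norm_divide)
        then show "complex_of_real (1 + e/2) \<in> T" using e by (intro subsetD[OF e(2)]) simp
        show "complex_of_real (1 + e/2) \<noteq> 1" using e(1) by (simp add: complex_eq_iff)
        show "complex_of_real (1 + e/2) \<in> complex_of_real ` {0<..}" using e(1) by (intro imageI) simp
      qed
    qed
    show "?J z - ?G z = 0" if "z \<in> complex_of_real ` {0<..}" for z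
    proof -
      obtain x where x: "z = of_real x" "x > 0" using \<open>z \<in> _\<close> by auto
      have "?J z = of_real (LINT y:{0<..}|lborel. y powr (s-1) / (y + x))"
        unfolding x by (simp flip: set_integral_complex_of_real)
      also have "\<dots> = of_real (x powr (s-1) * (pi / sin (pi * s)))"
        using Stieltjes_power_real(2)[OF x(2) s] by simp
      also have "\<dots> = ?G z" using x by (simp add: powr_of_real[symmetric])
      finally show ?thesis by simp
    qed
  qed (use oV con c in auto)
  then show "?J c = ?G c" by simp
qed

locale angle =
  fixes th :: real
  assumes th: "0 < th" "th < pi"
begin

text \<open>Minus the derivative in \<open>y\<close> of the function \<open>Phi\<close> below, the
  logarithm attached to a zero at \<open>y\<close>. A sum of such logarithms over zeros thus becomes
  an integral of the counting function against \<open>kern\<close>.\<close>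

definition kern :: "complex \<Rightarrow> real \<Rightarrow> complex" where
  "kern w y = 1 / (2 * pi * \<i>) * (1 / (of_real y - w * cis th) - 1 / (of_real y - w * cis (- th)))"

text \<open>For y > 0 and th = 2 pi / (1 + \<alpha>) this is K_alpha (x / y) / y, the convolution
  kernel written with respect to dy instead of dy / y.\<close>

definition kr :: "real \<Rightarrow> real \<Rightarrow> real" where
  "kr x y = sin th / pi * (x / (x\<^sup>2 + y\<^sup>2 - 2 * x * y * cos th))"

text \<open>With this slope, rotating the sector by th or by -th keeps it strictly on one side of
  the real axis, so the poles \<open>w * cis th\<close> and \<open>w * cis (- th)\<close> never meet
  the half-line of integration.\<close>

definition m0 :: real where "m0 = sin th / 2"
text \<open>If N is the distance of \<open>y\<close> from a pole, then \<open>norm w\<close> is at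
  most N / (sin th / 4) and \<open>y\<close> is at most N + \<open>norm w\<close>; hence
  \<open>norm w + y\<close> is at most N / \<open>c1\<close>.\<close>

definition c1 :: real where "c1 = 1 / (1 + 2 / (sin th / 4))"

abbreviation "sec \<equiv> wedge m0 0"

lemma sin_th: "sin th > 0" using th by (intro sin_gt_zero)

lemma m0: "m0 > 0" using sin_th by (simp add: m0_def)
lemma c1: "c1 > 0" using sin_th by (simp add: c1_def add_pos_pos)

lemma sec_Re: assumes "w \<in> sec" shows "Re w > 0" "norm w \<le> 2 * Re w" "w \<noteq> 0" "Re w \<le> norm w"
proof -
  show r: "Re w > 0" using assms by (simp add: wedge_def)
  have "\<bar>Im w\<bar> \<le> sin th / 2 * Re w" using assms by (simp add: wedge_def m0_def)
  also have "\<dots> \<le> 1 * Re w" using r sin_le_one[of th] by (intro mult_right_mono) linarith+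
  finally show "norm w \<le> 2 * Re w" using cmod_le[of w] r by simp
  show "w \<noteq> 0" using r by auto
  show "Re w \<le> norm w" by (rule complex_Re_le_cmod)
qed

lemma sec_Im:
  assumes w: "w \<in> sec"
  shows "Im (w * cis th) \<ge> sin th / 4 * norm w" "Im (w * cis (-th)) \<le> - (sin th / 4 * norm w)"
proof -
  note r = sec_Re[OF w]
  have im: "\<bar>Im w\<bar> \<le> sin th / 2 * Re w" using w by (simp add: wedge_def m0_def)
  have "\<bar>Im w * cos th\<bar> \<le> \<bar>Im w\<bar> * 1" unfolding abs_mult by (intro mult_left_mono) auto
  then have 1: "\<bar>Im w * cos th\<bar> \<le> sin th / 2 * Re w" using im by linarith
  have 2: "sin th / 4 * norm w \<le> sin th / 4 * (2 * Re w)" using r sin_th by (intro mult_left_mono) auto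
  show "Im (w * cis th) \<ge> sin th / 4 * norm w" "Im (w * cis (-th)) \<le> - (sin th / 4 * norm w)"
    using 1 2 by (simp_all add: algebra_simps)
qed

lemma sec_Im_strict:
  assumes w: "w \<in> sec"
  shows "Im (w * cis th) > 0" "Im (w * cis (-th)) < 0"
proof -
  have "sin th / 4 * norm w > 0" using sin_th sec_Re(3)[OF w] by simp
  then show "Im (w * cis th) > 0" "Im (w * cis (-th)) < 0" using sec_Im[OF w] by linarith+
qed

lemma kern_nz:
  assumes w: "w \<in> sec"
  shows "of_real y - w * cis th \<noteq> 0" "of_real y - w * cis (-th) \<noteq> 0"
proof -
  have "Im (of_real y - w * cis th) \<noteq> 0" "Im (of_real y - w * cis (-th)) \<noteq> 0"
    using sec_Im_strict[OF w] by (auto simp del: times_complex.sel)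
  then show "of_real y - w * cis th \<noteq> 0" "of_real y - w * cis (-th) \<noteq> 0" by force+
qed

lemma kern_den_lower:
  assumes w: "w \<in> sec" and y: "y \<ge> 0"
  shows "norm (of_real y - w * cis th) \<ge> c1 * (norm w + y)" "norm (of_real y - w * cis (-th)) \<ge> c1 * (norm w + y)"
proof -
  have gen: "norm (of_real y - a) \<ge> c1 * (norm w + y)" if a: "norm a = norm w" "\<bar>Im a\<bar> \<ge> sin th / 4 * norm w" for a
  proof -
    let ?c = "sin th / 4" let ?N = "norm (of_real y - a)"
    have c: "?c > 0" using sin_th by simp
    have "\<bar>Im a\<bar> \<le> ?N" using abs_Im_le_cmod[of "of_real y - a"] by simp
    then have "?c * norm w \<le> ?N" using a by linarith
    then have 1: "norm w \<le> ?N / ?c" using c by (simp add: pos_le_divide_eq mult.commute)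
    have "y \<le> ?N + norm w" using norm_triangle_ineq[of "of_real y - a" a] a y by simp
    then have "norm w + y \<le> (1 + 2 / ?c) * ?N" using 1 by (simp add: algebra_simps)
    moreover have "1 + 2 / ?c > 0" using c by (simp add: add_pos_pos)
    ultimately show ?thesis unfolding c1_def by (simp add: divide_le_eq mult.commute)
  qed
  have "\<bar>Im (w * cis th)\<bar> \<ge> sin th / 4 * norm w" "\<bar>Im (w * cis (-th))\<bar> \<ge> sin th / 4 * norm w"
    using sec_Im[OF w] by linarith+
  then show "norm (of_real y - w * cis th) \<ge> c1 * (norm w + y)" "norm (of_real y - w * cis (-th)) \<ge> c1 * (norm w + y)"
    by (auto intro!: gen simp: norm_mult simp del: times_complex.sel)
qed

lemma kern_eq:
  assumes w: "w \<in> sec"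
  shows "kern w y = of_real (sin th / pi) * w / ((of_real y - w * cis th) * (of_real y - w * cis (-th)))"
proof -
  note nz = kern_nz[OF w, of y]
  have d: "cis th - cis (-th) = 2 * \<i> * of_real (sin th)" by (simp add: complex_eq_iff)
  have "1 / (of_real y - w * cis th) - 1 / (of_real y - w * cis (- th)) =
     (w * (cis th - cis (-th))) / ((of_real y - w * cis th) * (of_real y - w * cis (-th)))"
    using nz by (simp add: divide_simps) (simp add: algebra_simps)
  then show ?thesis unfolding kern_def d by (simp add: field_simps)
qed

lemma norm_kern_le:
  assumes w: "w \<in> sec" and y: "y \<ge> 0"
  shows "norm (kern w y) \<le> 1 / c1\<^sup>2 * (norm w / (norm w + y)\<^sup>2)"
proof -
  note lo = kern_den_lower[OF w y]
  have p: "norm w + y > 0" using sec_Re(3)[OF w] y by (simp add: add_pos_nonneg)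
  have c: "c1 * (norm w + y) > 0" using c1 p by simp
  have "sin th \<le> pi" using sin_le_one[of th] pi_gt3 by linarith
  then have s: "\<bar>sin th\<bar> / pi \<le> 1" using sin_th by (simp add: divide_le_eq_1)
  have "norm (kern w y) = \<bar>sin th\<bar> / pi * norm w / (norm (of_real y - w * cis th) * norm (of_real y - w * cis (-th)))"
    unfolding kern_eq[OF w] by (simp add: norm_mult norm_divide)
  also have "\<dots> \<le> 1 * norm w / ((c1 * (norm w + y)) * (c1 * (norm w + y)))"
    using s c lo by (intro frac_le mult_mono mult_pos_pos[OF c c]) auto
  also have "\<dots> = 1 / c1\<^sup>2 * (norm w / (norm w + y)\<^sup>2)" by (simp add: power2_eq_square field_simps)
  finally show ?thesis .
qed

lemma kr_den_pos: assumes "x > 0" shows "x\<^sup>2 + y\<^sup>2 - 2 * x * y * cos th > 0"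
proof -
  have "x\<^sup>2 + y\<^sup>2 - 2 * x * y * cos th = (y - x * cos th)\<^sup>2 + (x * sin th)\<^sup>2"
    by (simp add: power_mult_distrib sin_squared_eq) (simp add: power2_eq_square algebra_simps)
  also have "\<dots> > 0" using sin_th assms by (simp add: add_nonneg_pos)
  finally show ?thesis .
qed

lemma of_real_sec [simp]: "of_real x \<in> sec \<longleftrightarrow> x > 0"
  by (simp add: of_real_wedge m0)

lemma kern_of_real:
  assumes x: "x > 0" shows "kern (of_real x) y = of_real (kr x y)"
proof -
  have w: "of_real x \<in> sec" using x by simp
  have "(of_real y - of_real x * cis th) * (of_real y - of_real x * cis (-th)) = complex_of_real (x\<^sup>2 + y\<^sup>2 - 2 * x * y * cos th)"
  proof -
    have "cis th * cis (-th) = 1" by (simp add: cis_mult)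
    moreover have "cis th + cis (-th) = of_real (2 * cos th)" by (simp add: complex_eq_iff)
    moreover have "(of_real y - of_real x * cis th) * (of_real y - of_real x * cis (-th))
      = of_real (y\<^sup>2) - of_real (x * y) * (cis th + cis (-th)) + of_real (x\<^sup>2) * (cis th * cis (-th))"
      by (simp add: power2_eq_square algebra_simps)
    ultimately have "(of_real y - of_real x * cis th) * (of_real y - of_real x * cis (-th))
      = of_real (y\<^sup>2 - x * y * (2 * cos th) + x\<^sup>2)" by simp
    also have "y\<^sup>2 - x * y * (2 * cos th) + x\<^sup>2 = x\<^sup>2 + y\<^sup>2 - 2 * x * y * cos th" by simp
    finally show ?thesis .
  qed
  then show ?thesis unfolding kern_eq[OF w] kr_def by simp
qed

lemma kr_pos: "x > 0 \<Longrightarrow> kr x y > 0"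
  using kr_den_pos sin_th by (simp add: kr_def)

lemma kr_scale: "c > 0 \<Longrightarrow> x > 0 \<Longrightarrow> kr (c * x) (c * y) = kr x y / c"
proof -
  assume "c > 0" "x > 0"
  have "(c*x)\<^sup>2 + (c*y)\<^sup>2 - 2 * (c*x) * (c*y) * cos th = c\<^sup>2 * (x\<^sup>2 + y\<^sup>2 - 2 * x * y * cos th)"
    by (simp add: power2_eq_square algebra_simps)
  then show ?thesis using \<open>c > 0\<close> by (simp add: kr_def power2_eq_square)
qed

lemma kern_holomorphic: "(\<lambda>w. kern w y) holomorphic_on sec"
  unfolding kern_def using kern_nz by (intro holomorphic_intros) auto

lemma kern_measurable [measurable]: "kern w \<in> borel_measurable borel"
  unfolding kern_def by measurable

text \<open>The rotated points lie in the upper and in the lower half-plane, which forces arg w + th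
  > 0 and arg w - th < 0. Therefore adding th - pi or pi - th stays inside the principal strip of
  the logarithm.\<close>

lemma sec_Ln:
  assumes w: "w \<in> sec"
  shows "Ln (- (w * cis th)) = Ln w + \<i> * of_real (th - pi)" "Ln (- (w * cis (-th))) = Ln w + \<i> * of_real (pi - th)"
proof -
  note r = sec_Re[OF w]
  define \<beta> where "\<beta> = Im (Ln w)"
  have \<beta>: "- pi/2 < \<beta>" "\<beta> < pi/2" using Re_Ln_pos_lt_imp[OF r(1)] by (auto simp: \<beta>_def)
  have w_eq: "w = of_real (norm w) * cis \<beta>"
    using Arg_eq[of w] r(3) by (simp add: Arg_eq_Im_Ln \<beta>_def cis_conv_exp)
  have i1: "Im (w * cis th) = norm w * sin (\<beta> + th)" "Im (w * cis (-th)) = norm w * sin (\<beta> - th)"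
    by (subst w_eq, simp add: sin_add sin_diff algebra_simps)+
  have s1: "sin (\<beta> + th) > 0" "sin (\<beta> - th) < 0"
    using sec_Im_strict[OF w] r(3) unfolding i1 by (simp_all add: zero_less_mult_iff mult_less_0_iff)
  have b1: "\<beta> + th > 0"
  proof (rule ccontr)
    assume "\<not> \<beta> + th > 0"
    then have "sin (-(\<beta> + th)) \<ge> 0" using \<beta> th by (intro sin_ge_zero) auto
    then show False using s1 by (simp only: sin_minus neg_0_le_iff_le)
  qed
  have b2: "\<beta> - th < 0"
  proof (rule ccontr)
    assume "\<not> \<beta> - th < 0"
    then have "sin (\<beta> - th) \<ge> 0" using \<beta> th by (intro sin_ge_zero) auto
    then show False using s1 by linarith
  qed
  have e: "exp (Ln w) = w" using r by simp
  have c: "exp (\<i> * of_real (th - pi)) = - cis th" "exp (\<i> * of_real (pi - th)) = - cis (-th)"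
  proof -
    have c': "exp (\<i> * of_real t) = cis t" for t :: real by (simp add: cis_conv_exp)
    show "exp (\<i> * of_real (th - pi)) = - cis th" "exp (\<i> * of_real (pi - th)) = - cis (-th)"
      unfolding c' by (simp_all add: complex_eq_iff)
  qed
  show "Ln (- (w * cis th)) = Ln w + \<i> * of_real (th - pi)"
  proof (rule Ln_unique)
    show "exp (Ln w + \<i> * of_real (th - pi)) = - (w * cis th)" unfolding exp_add e c by simp
  qed (use b1 \<beta> th in \<open>auto simp: \<beta>_def[symmetric]\<close>)
  show "Ln (- (w * cis (-th))) = Ln w + \<i> * of_real (pi - th)"
  proof (rule Ln_unique)
    show "exp (Ln w + \<i> * of_real (pi - th)) = - (w * cis (-th))" unfolding exp_add e c by simp
  qed (use b2 \<beta> th in \<open>auto simp: \<beta>_def[symmetric]\<close>)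
qed

text \<open>The basic mapping property: through the majorant x / (x + y)^2, data of size y^\<sigma>
  are transformed into size |w|^\<sigma>, uniformly in the sector.\<close>

lemma kern_bound_integrable:
  assumes w: "w \<in> sec" and \<sigma>: "\<bar>\<sigma>\<bar> < 1"
    and f: "f \<in> borel_measurable borel" and bd: "\<And>y. y > 0 \<Longrightarrow> norm (f y) \<le> C * y powr \<sigma>"
  shows "set_integrable lborel {0<..} (\<lambda>y. f y * kern w y)"
    and "norm (LINT y:{0<..}|lborel. f y * kern w y) \<le> C / c1\<^sup>2 * Beta (1+\<sigma>) (1-\<sigma>) * norm w powr \<sigma>"
proof -
  have nw: "norm w > 0" using sec_Re[OF w] by auto
  note K = power_kernel_halfline[OF nw \<sigma>]
  have le: "norm (f y * kern w y) \<le> C / c1\<^sup>2 * (y powr \<sigma> * (norm w / (norm w + y)\<^sup>2))" if "y > 0" for y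
  proof -
    have "norm (f y * kern w y) \<le> (C * y powr \<sigma>) * (1 / c1\<^sup>2 * (norm w / (norm w + y)\<^sup>2))"
      unfolding norm_mult using bd[OF that] norm_kern_le[OF w, of y] that
      by (intro mult_mono) (auto intro: order_trans[OF norm_ge_zero])
    then show ?thesis by (simp add: field_simps)
  qed
  have i: "set_integrable lborel {0<..} (\<lambda>y. C / c1\<^sup>2 * (y powr \<sigma> * (norm w / (norm w + y)\<^sup>2)))"
    using K(1) by (rule set_integrable_mult_right)
  show si: "set_integrable lborel {0<..} (\<lambda>y. f y * kern w y)"
  proof (rule set_integrable_dominated[OF i])
    show "set_borel_measurable lborel {0<..} (\<lambda>y. f y * kern w y)"
      unfolding set_borel_measurable_def using f by measurable
    show "norm (f y * kern w y) \<le> C / c1\<^sup>2 * (y powr \<sigma> * (norm w / (norm w + y)\<^sup>2))" if "y \<in> {0<..}" for y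
      by (rule le) (use that in simp)
  qed
  have "norm (LINT y:{0<..}|lborel. f y * kern w y) \<le> (LINT y:{0<..}|lborel. norm (f y * kern w y))"
    by (rule set_integral_norm_bound[OF si])
  also have "\<dots> \<le> (LINT y:{0<..}|lborel. C / c1\<^sup>2 * (y powr \<sigma> * (norm w / (norm w + y)\<^sup>2)))"
    using set_integrable_norm[OF si] i le by (intro set_integral_mono) auto
  also have "\<dots> = C / c1\<^sup>2 * (Beta (1+\<sigma>) (1-\<sigma>) * norm w powr \<sigma>)"
    unfolding set_integral_mult_right K(2) ..
  finally show "norm (LINT y:{0<..}|lborel. f y * kern w y) \<le> C / c1\<^sup>2 * Beta (1+\<sigma>) (1-\<sigma>) * norm w powr \<sigma>" by simp
qed

lemma minus_sec_not_nonpos: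
  assumes w: "w \<in> sec"
  shows "- (w * cis th) \<notin> of_real ` {..0}" "- (w * cis (-th)) \<notin> of_real ` {..0}"
proof -
  have "Im (- (w * cis th)) \<noteq> 0" "Im (- (w * cis (-th))) \<noteq> 0" using sec_Im_strict[OF w] by auto
  then show "- (w * cis th) \<notin> of_real ` {..0}" "- (w * cis (-th)) \<notin> of_real ` {..0}"
    by (metis Im_complex_of_real imageE)+
qed

lemma sec_powr_diff:
  assumes w: "w \<in> sec"
  shows "(- (w * cis (-th))) powr of_real s - (- (w * cis th)) powr of_real s = w powr of_real s * (2 * \<i> * of_real (sin ((pi - th) * s)))"
proof -
  note r = sec_Re[OF w]
  have nz: "- (w * cis th) \<noteq> 0" "- (w * cis (-th)) \<noteq> 0" using r by auto
  have "(- (w * cis th)) powr of_real s = w powr of_real s * cis ((th - pi) * s)"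
    "(- (w * cis (-th))) powr of_real s = w powr of_real s * cis ((pi - th) * s)"
    unfolding powr_def sec_Ln[OF w] cis_conv_exp[of "(_ - _) * _"] using nz r(3) by (simp_all add: exp_add[symmetric] algebra_simps)
  moreover have "cis ((pi - th) * s) - cis ((th - pi) * s) = 2 * \<i> * of_real (sin ((pi - th) * s))"
  proof -
    have "(th - pi) * s = - ((pi - th) * s)" by (simp add: algebra_simps)
    then show ?thesis by (simp add: complex_eq_iff)
  qed
  ultimately show ?thesis by (simp add: right_diff_distrib[symmetric])
qed

text \<open>Powers are eigenfunctions, and the sine quotient is the multiplier. For positive
  \<open>s\<close> the two halves of the kernel do not converge separately, so y / (y - a) = 1 + a /
  (y - a) is used first; the ones cancel in the difference.\<close>

lemma kern_power_pos:
  assumes w: "w \<in> sec" and s: "0 < s" "s < 1"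
  shows "(LINT y:{0<..}|lborel. of_real (y powr s) * kern w y) = w powr of_real s * of_real (sin ((pi - th) * s) / sin (pi * s))"
proof -
  let ?a = "w * cis th" and ?b = "w * cis (-th)"
  let ?f = "\<lambda>c y. of_real (y powr (s-1)) / (of_real y + c) :: complex"
  note A = Stieltjes_power_complex[OF minus_sec_not_nonpos(1)[OF w] s]
  note B = Stieltjes_power_complex[OF minus_sec_not_nonpos(2)[OF w] s]
  have eq: "of_real (y powr s) * kern w y = 1 / (2 * pi * \<i>) * (?a * ?f (-?a) y - ?b * ?f (-?b) y)" if "y \<in> {0<..}" for y
  proof -
    have y: "y > 0" using that by simp
    note nz = kern_nz[OF w, of y]
    have p: "complex_of_real (y powr s) = of_real y * of_real (y powr (s-1))"
    proof -
      have "y powr s = y * y powr (s-1)" using y by (simp add: powr_diff)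
      then show ?thesis by (metis of_real_mult)
    qed
    have "of_real y / (of_real y - ?a) = 1 + ?a / (of_real y - ?a)" "of_real y / (of_real y - ?b) = 1 + ?b / (of_real y - ?b)"
      using nz by (simp_all add: field_simps)
    then have "of_real y * (1 / (of_real y - ?a) - 1 / (of_real y - ?b)) = ?a / (of_real y - ?a) - ?b / (of_real y - ?b)"
      by (simp add: right_diff_distrib)
    then have "of_real (y powr (s-1)) * (1 / (2 * pi * \<i>)) * (of_real y * (1 / (of_real y - ?a) - 1 / (of_real y - ?b)))
       = of_real (y powr (s-1)) * (1 / (2 * pi * \<i>)) * (?a / (of_real y - ?a) - ?b / (of_real y - ?b))" by simp
    then show ?thesis unfolding kern_def p by (simp add: algebra_simps)
  qed
  have nz: "?a \<noteq> 0" "?b \<noteq> 0" using sec_Re(3)[OF w] by auto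
  have p1: "c * (- c) powr (of_real s - 1) = - ((- c) powr of_real s)" if "c \<noteq> 0" for c :: complex
    using that by (simp add: powr_diff)
  have "(LINT y:{0<..}|lborel. of_real (y powr s) * kern w y) =
     (LINT y:{0<..}|lborel. 1 / (2 * pi * \<i>) * (?a * ?f (-?a) y - ?b * ?f (-?b) y))"
    using eq by (intro set_lebesgue_integral_cong) auto
  also have "\<dots> = 1 / (2 * pi * \<i>) * (?a * (LINT y:{0<..}|lborel. ?f (-?a) y) - ?b * (LINT y:{0<..}|lborel. ?f (-?b) y))"
    using A(1) B(1) by (simp only: set_integral_mult_right set_integral_diff set_integrable_mult_right)
  also have "\<dots> = 1 / (2 * pi * \<i>) * ((- ?b) powr of_real s - (- ?a) powr of_real s) * of_real (pi / sin (pi * s))"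
    unfolding A(2) B(2) mult.assoc[symmetric] p1[OF nz(1)] p1[OF nz(2)] by (simp add: algebra_simps)
  also have "\<dots> = w powr of_real s * of_real (sin ((pi - th) * s) / sin (pi * s))"
    unfolding sec_powr_diff[OF w] by simp
  finally show ?thesis .
qed

text \<open>For negative \<open>s\<close> each half converges by itself and is a Stieltjes integral
  with exponent s + 1, whose sine is minus sin (pi s).\<close>

lemma kern_power_neg:
  assumes w: "w \<in> sec" and s: "-1 < s" "s < 0"
  shows "(LINT y:{0<..}|lborel. of_real (y powr s) * kern w y) = w powr of_real s * of_real (sin ((pi - th) * s) / sin (pi * s))"
proof -
  let ?a = "w * cis th" and ?b = "w * cis (-th)"
  let ?f = "\<lambda>c y. of_real (y powr (s+1-1)) / (of_real y + c) :: complex"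
  have s1: "0 < s + 1" "s + 1 < 1" using s by auto
  note A = Stieltjes_power_complex[OF minus_sec_not_nonpos(1)[OF w] s1]
  note B = Stieltjes_power_complex[OF minus_sec_not_nonpos(2)[OF w] s1]
  have sn: "sin (pi * (s + 1)) = - sin (pi * s)" by (simp add: distrib_left)
  have eq: "of_real (y powr s) * kern w y = 1 / (2 * pi * \<i>) * (?f (-?a) y - ?f (-?b) y)" for y
    unfolding kern_def by (simp add: algebra_simps)
  have "(LINT y:{0<..}|lborel. of_real (y powr s) * kern w y) =
     1 / (2 * pi * \<i>) * ((LINT y:{0<..}|lborel. ?f (-?a) y) - (LINT y:{0<..}|lborel. ?f (-?b) y))"
    unfolding eq using A(1) B(1) by (simp only: set_integral_mult_right set_integral_diff)
  also have "\<dots> = 1 / (2 * pi * \<i>) * ((- ?b) powr of_real s - (- ?a) powr of_real s) * of_real (pi / sin (pi * s))"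
    unfolding A(2) B(2) sn by (simp add: algebra_simps)
  also have "\<dots> = w powr of_real s * of_real (sin ((pi - th) * s) / sin (pi * s))"
    unfolding sec_powr_diff[OF w] by simp
  finally show ?thesis .
qed

text \<open>The contribution of a single zero at \<open>x\<close> to z + 2p, in the branch that
  tends to 0 as \<open>x\<close> grows.\<close>

definition Phi :: "real \<Rightarrow> complex \<Rightarrow> complex" where
  "Phi x w = 1 / (2 * pi * \<i>) * (Ln (of_real x - w * cis (-th)) - Ln (of_real x - w * cis th))"

lemma Ln_arg_ok:
  assumes w: "w \<in> sec"
  shows "of_real y - w * cis th \<notin> \<real>\<^sub>\<le>\<^sub>0" "of_real y - w * cis (-th) \<notin> \<real>\<^sub>\<le>\<^sub>0"
proof -
  have "Im (of_real y - w * cis th) \<noteq> 0" "Im (of_real y - w * cis (-th)) \<noteq> 0"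
    using sec_Im_strict[OF w] by (auto simp del: times_complex.sel)
  then show "of_real y - w * cis th \<notin> \<real>\<^sub>\<le>\<^sub>0" "of_real y - w * cis (-th) \<notin> \<real>\<^sub>\<le>\<^sub>0"
    by (auto simp: complex_nonpos_Reals_iff)
qed

text \<open>\<open>- Phi y w\<close> is an antiderivative of the kernel in \<open>y\<close>. Its
  limit at infinity is 0: when the factor b is pulled out of both logarithms, the two terms ln b
  cancel.\<close>

lemma kern_tail:
  assumes w: "w \<in> sec" and x: "x \<ge> 0"
  shows "set_integrable lborel {x..} (kern w)" "(LINT y:{x..}|lborel. kern w y) = Phi x w"
proof -
  have "set_integrable lborel {0<..} (\<lambda>y. 1 * kern w y)"
    by (rule kern_bound_integrable[OF w, of 0 _ 1]) auto
  then have i0: "set_integrable lborel {0<..} (kern w)" by simp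
  have "set_integrable lborel {0..} (kern w)"
    using i0 by (rule set_integrable_discrete_difference[where X="{0}", THEN iffD1, rotated -1]) auto
  then show i: "set_integrable lborel {x..} (kern w)" by (rule set_integrable_subset) (use x in auto)
  let ?F = "\<lambda>y. - Phi y w"
  have d: "(?F has_vector_derivative kern w y) (at y)" for y :: real
  proof -
    have "((\<lambda>z. Ln (z - w * cis (-th)) - Ln (z - w * cis th)) has_field_derivative
        (1 / (of_real y - w * cis (-th)) - 1 / (of_real y - w * cis th))) (at (of_real y))"
      using Ln_arg_ok[OF w, of y] kern_nz[OF w, of y] by (auto intro!: derivative_eq_intros simp: inverse_eq_divide)
    from DERIV_minus[OF DERIV_cmult[OF this, of "1 / (2 * pi * \<i>)"]]
    have "((\<lambda>z. - (1 / (2 * pi * \<i>) * (Ln (z - w * cis (-th)) - Ln (z - w * cis th)))) has_field_derivative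
        - (1 / (2 * pi * \<i>) * (1 / (of_real y - w * cis (-th)) - 1 / (of_real y - w * cis th)))) (at (of_real y))" .
    then have "((\<lambda>y. - (1 / (2 * pi * \<i>) * (Ln (of_real y - w * cis (-th)) - Ln (of_real y - w * cis th)))) has_vector_derivative
        - (1 / (2 * pi * \<i>) * (1 / (of_real y - w * cis (-th)) - 1 / (of_real y - w * cis th)))) (at y)"
      by (rule has_vector_derivative_real_field)
    moreover have "- (1 / (2 * pi * \<i>) * (1 / (of_real y - w * cis (-th)) - 1 / (of_real y - w * cis th))) = kern w y"
      unfolding kern_def by (simp add: algebra_simps)
    ultimately show ?thesis unfolding Phi_def by simp
  qed
  have cont: "continuous_on A (kern w)" for A
    unfolding kern_def using kern_nz[OF w] by (intro continuous_intros) auto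
  have "((\<lambda>b. (LINT y:{x..b}|lborel. kern w y)) \<longlongrightarrow> (LINT y:{x..}|lborel. kern w y)) at_top"
    by (rule tendsto_set_lebesgue_integral_at_top[OF _ i]) auto
  moreover have "\<forall>\<^sub>F b in at_top. (LINT y:{x..b}|lborel. kern w y) = Phi x w - Phi b w"
    using eventually_ge_at_top[of x]
  proof eventually_elim
    case (elim b)
    have "(LINT y:{x..b}|lborel. kern w y) = ?F b - ?F x" unfolding set_lebesgue_integral_def
      by (rule integral_FTC_atLeastAtMost) (use elim d cont in \<open>auto intro: has_vector_derivative_at_within\<close>)
    then show ?case by simp
  qed
  ultimately have l1: "((\<lambda>b. Phi x w - Phi b w) \<longlongrightarrow> (LINT y:{x..}|lborel. kern w y)) at_top"
    by (rule Lim_transform_eventually)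
  have "((\<lambda>b::real. 1 / (2 * pi * \<i>) * (Ln (1 - w * cis (-th) * of_real (inverse b)) - Ln (1 - w * cis th * of_real (inverse b)))) \<longlongrightarrow>
      1 / (2 * pi * \<i>) * (Ln (1 - w * cis (-th) * of_real 0) - Ln (1 - w * cis th * of_real 0))) at_top"
    by (intro tendsto_intros tendsto_inverse_0_at_top filterlim_ident) auto
  moreover have "\<forall>\<^sub>F b in at_top. 1 / (2 * pi * \<i>) * (Ln (1 - w * cis (-th) * of_real (inverse b)) - Ln (1 - w * cis th * of_real (inverse b))) = Phi b w"
    using eventually_gt_at_top[of 0]
  proof eventually_elim
    case (elim b)
    have e: "of_real b - c = of_real b * (1 - c * of_real (inverse b))" for c :: complex
      using elim by (simp add: field_simps)
    have "1 - w * cis (-th) * of_real (inverse b) \<noteq> 0" "1 - w * cis th * of_real (inverse b) \<noteq> 0"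
      using kern_nz[OF w, of b] unfolding e by auto
    moreover have L: "Ln (of_real b * z) = of_real (ln b) + Ln z" if "z \<noteq> 0" for z
      using Ln_times_of_real[OF elim that] elim by (simp add: Ln_of_real)
    ultimately have "Ln (of_real b - w * cis (-th)) = of_real (ln b) + Ln (1 - w * cis (-th) * of_real (inverse b))"
       "Ln (of_real b - w * cis th) = of_real (ln b) + Ln (1 - w * cis th * of_real (inverse b))"
      unfolding e[of "w * cis th"] e[of "w * cis (-th)"] by (auto intro!: L)
    then show ?case unfolding Phi_def by simp
  qed
  ultimately have l2: "((\<lambda>b. Phi b w) \<longlongrightarrow> 0) at_top"
    using Lim_transform_eventually by fastforce
  have "((\<lambda>b. Phi x w - Phi b w) \<longlongrightarrow> Phi x w - 0) at_top" by (intro tendsto_intros l2)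
  then show "(LINT y:{x..}|lborel. kern w y) = Phi x w" using l1 tendsto_unique[OF _ l1] by simp
qed

text \<open>The exponent 0, which the two power lemmas exclude: 1 - th / pi is the limit of the
  multiplier as s tends to 0. It governs the constant term of the asymptotics.\<close>

lemma kern_integral:
  assumes w: "w \<in> sec"
  shows "(LINT y:{0<..}|lborel. kern w y) = of_real (1 - th / pi)"
proof -
  have "(LINT y:{0<..}|lborel. kern w y) = (LINT y:{0..}|lborel. kern w y)"
    by (rule set_integral_discrete_difference[where X="{0}"]) auto
  also have "\<dots> = Phi 0 w" using kern_tail(2)[OF w] by simp
  also have "\<dots> = of_real (1 - th / pi)"
  proof -
    have "Phi 0 w = 1 / (2 * pi * \<i>) * (2 * \<i> * of_real (pi - th))"
      unfolding Phi_def of_real_0 diff_0 sec_Ln[OF w] by (simp add: algebra_simps)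
    also have "\<dots> = of_real ((pi - th) / pi)" by simp
    finally show ?thesis by (simp add: diff_divide_distrib)
  qed
  finally show ?thesis .
qed

lemma exp_Phi:
  assumes w: "w \<in> sec" and x: "x > 0"
  shows "exp (2 * pi * \<i> * Phi x w) = (1 - w * cis (-th) / of_real x) / (1 - w * cis th / of_real x)"
proof -
  note nz = kern_nz[OF w, of x]
  have "exp (2 * pi * \<i> * Phi x w) = (of_real x - w * cis (-th)) / (of_real x - w * cis th)"
    unfolding Phi_def using nz by (simp add: exp_diff)
  also have "\<dots> = (1 - w * cis (-th) / of_real x) / (1 - w * cis th / of_real x)"
    using x nz by (simp add: divide_simps)
  finally show ?thesis .
qed

end

section \<open>Entire functions of genus zero\<close>

text \<open>The map g / (2 A - g) sends the half-plane Re g < A into the unit disc and 0 to 0, so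
  the Schwarz lemma bounds it by |z| / R; solving for g gives the claim.\<close>

lemma Borel_Caratheodory:
  assumes R: "R > 0" and hol: "g holomorphic_on ball 0 R" and g0: "g 0 = 0"
    and A: "\<And>z. z \<in> ball 0 R \<Longrightarrow> Re (g z) < A" and z: "norm z < R"
  shows "norm (g z) \<le> 2 * A * norm z / (R - norm z)"
proof -
  have A0: "A > 0" using A[of 0] R g0 by simp
  define \<phi> where "\<phi> = (\<lambda>u. g (of_real R * u) / (2 * of_real A - g (of_real R * u)))"
  have inb: "of_real R * u \<in> ball 0 R" if "norm u < 1" for u :: complex
    using that R by (simp add: norm_mult)
  have lt: "norm w < norm (2 * of_real A - w)" if "Re w < A" for w :: complex
  proof -
    have "(norm (2 * of_real A - w))\<^sup>2 - (norm w)\<^sup>2 = 4 * A * (A - Re w)"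
      unfolding cmod_power2 by (simp add: power2_eq_square algebra_simps)
    also have "\<dots> > 0" using that A0 by simp
    finally show ?thesis by (simp add: power2_less_imp_less)
  qed
  have nz: "2 * of_real A - g (of_real R * u) \<noteq> 0" if "norm u < 1" for u
    using lt[OF A[OF inb[OF that]]] by (metis norm_ge_zero norm_zero not_less)
  have h1: "\<phi> holomorphic_on ball 0 1" unfolding \<phi>_def
  proof (intro holomorphic_intros)
    show "(\<lambda>u. g (of_real R * u)) holomorphic_on ball 0 1"
      using inb by (intro holomorphic_on_compose_gen[OF _ hol, unfolded o_def]) (auto intro!: holomorphic_intros)
    then show "(\<lambda>u. g (of_real R * u)) holomorphic_on ball 0 1" .
    show "2 * of_real A - g (of_real R * u) \<noteq> 0" if "u \<in> ball 0 1" for u using nz that by simp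
  qed
  have h2: "norm (\<phi> u) < 1" if "norm u < 1" for u
    unfolding \<phi>_def using lt[OF A[OF inb[OF that]]] nz[OF that] by (simp add: norm_divide divide_less_eq)
  define u where "u = z / of_real R"
  have u: "norm u < 1" "norm u = norm z / R" "of_real R * u = z" using z R by (auto simp: u_def norm_divide)
  have "norm (\<phi> u) \<le> norm u"
    by (rule Schwarz_Lemma(1)[OF h1 _ h2 u(1)]) (simp add: \<phi>_def g0)
  then have le: "norm (\<phi> u) \<le> norm z / R" using u by simp
  have "g z = \<phi> u * (2 * of_real A - g z)" using nz[OF u(1)] by (simp add: \<phi>_def u)
  then have "norm (g z) = norm (\<phi> u) * norm (2 * of_real A - g z)" by (metis norm_mult)
  also have "\<dots> \<le> norm z / R * (2 * A + norm (g z))"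
  proof (intro mult_mono le)
    show "norm (2 * of_real A - g z) \<le> 2 * A + norm (g z)"
      using norm_triangle_ineq4[of "2 * of_real A" "g z"] A0 by (simp add: norm_mult)
  qed (use R in auto)
  finally have "norm (g z) * R \<le> norm z * (2 * A + norm (g z))" using R by (simp add: field_simps)
  then have "norm (g z) * (R - norm z) \<le> 2 * A * norm z" by (simp add: algebra_simps)
  then show ?thesis using z by (simp add: pos_le_divide_eq)
qed

text \<open>Zeros are divided out one at a time. Simplicity enters at the end: if the cofactor still
  vanished at a point of \<open>A\<close>, the derivative of \<open>Q\<close> would vanish
  there.\<close>

lemma simple_zeros_factor:
  assumes hol: "Q holomorphic_on UNIV" and A: "finite A" "\<And>a. a \<in> A \<Longrightarrow> Q a = 0" "\<And>a. a \<in> A \<Longrightarrow> deriv Q a \<noteq> 0" "0 \<notin> A"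
  shows "\<exists>h. h holomorphic_on UNIV \<and> (\<forall>w. Q w = (\<Prod>a\<in>A. 1 - w / a) * h w) \<and> (\<forall>b. h b = 0 \<longrightarrow> Q b = 0 \<and> b \<notin> A)"
proof -
  have "\<exists>h. h holomorphic_on UNIV \<and> (\<forall>w. Q w = (\<Prod>a\<in>A. 1 - w / a) * h w)"
    using A(1,2,4)
  proof (induction A rule: finite_induct)
    case empty
    then show ?case using hol by auto
  next
    case (insert b A)
    then obtain h where h: "h holomorphic_on UNIV" "\<And>w. Q w = (\<Prod>a\<in>A. 1 - w / a) * h w" by auto
    have b0: "b \<noteq> 0" using insert by auto
    have "(\<Prod>a\<in>A. 1 - b / a) \<noteq> 0"
    proof (subst prod_zero_iff[OF insert(1)], safe)
      fix a assume "a \<in> A" "1 - b / a = 0"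
      then show False using insert by (cases "a = 0") auto
    qed
    then have hb: "h b = 0" using h(2)[of b] insert by auto
    \<comment> \<open>The quotient h / (w - b) with its removable value at b, multiplied by -b
      because 1 - w / b = -(w - b) / b.\<close>
    define k where "k = (\<lambda>w. - b * (if w = b then deriv h b else (h w - h b) / (w - b)))"
    have "k holomorphic_on UNIV" unfolding k_def
      by (intro holomorphic_on_mult holomorphic_on_const pole_lemma_open h(1) open_UNIV)
    moreover have "h w = (1 - w / b) * k w" for w
      using b0 hb by (cases "w = b") (auto simp: k_def divide_simps, simp add: algebra_simps)
    ultimately show ?case using h(2) insert by (intro exI[of _ k]) (simp add: mult_ac)
  qed
  then obtain h where h: "h holomorphic_on UNIV" "\<And>w. Q w = (\<Prod>a\<in>A. 1 - w / a) * h w" by auto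
  have "b \<notin> A" if "h b = 0" for b
  proof
    assume b: "b \<in> A"
    have 0: "(\<Prod>a\<in>A. 1 - b / a) = 0" using b A(1,4) by (intro prod_zero) (auto intro!: bexI[of _ b])
    have dh: "(h has_field_derivative deriv h b) (at b)" using h(1) holomorphic_derivI by blast
    have "(\<lambda>w. \<Prod>a\<in>A. 1 - w / a) holomorphic_on UNIV" using A(4) by (intro holomorphic_intros) auto
    then have dP: "((\<lambda>w. \<Prod>a\<in>A. 1 - w / a) has_field_derivative deriv (\<lambda>w. \<Prod>a\<in>A. 1 - w / a) b) (at b)"
      using holomorphic_derivI by blast
    have "(Q has_field_derivative 0) (at b)"
    proof -
      have "Q = (\<lambda>w. (\<Prod>a\<in>A. 1 - w / a) * h w)" using h(2) by auto
      then show ?thesis using DERIV_mult[OF dP dh] 0 that by simp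
    qed
    then show False using DERIV_imp_deriv A(3)[OF b] by blast
  qed
  moreover have "Q b = 0" if "h b = 0" for b using h(2)[of b] that by simp
  ultimately show ?thesis using h by blast
qed

text \<open>After division by the zeros up to radius R the cofactor is zero-free on
  \<open>ball 0 R\<close>, so it has a logarithm there. Its growth is that of \<open>Q\<close>, and
  at a fixed point Borel-Caratheodory gains 1 / R against R^\<mu>, which vanishes in the limit
  because \<mu> < 1.\<close>

lemma genus_zero_product:
  assumes hol: "Q holomorphic_on UNIV" and Q0: "Q 0 = 1"
    and simple: "\<And>w. Q w = 0 \<Longrightarrow> deriv Q w \<noteq> 0" and \<mu>: "0 < \<mu>" "\<mu> < 1"
    and growth: "\<forall>\<^sub>F r in at_top. \<forall>w. norm w = r \<longrightarrow> norm (Q w) \<le> exp (r powr \<mu>)"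
    and fin: "\<And>R. finite {a. Q a = 0 \<and> norm a \<le> R}"
  shows "((\<lambda>R. \<Prod>a\<in>{a. Q a = 0 \<and> norm a \<le> R}. 1 - w / a) \<longlongrightarrow> Q w) at_top"
proof -
  obtain R0 where R0: "\<And>r w. r \<ge> R0 \<Longrightarrow> norm w = r \<Longrightarrow> norm (Q w) \<le> exp (r powr \<mu>)"
    using growth unfolding eventually_at_top_linorder by blast
  define P where "P = (\<lambda>R w. \<Prod>a\<in>{a. Q a = 0 \<and> norm a \<le> R}. 1 - w / a)"
  define f where "f = (\<lambda>R. 2 * ((2 * R) powr \<mu> + 1) * norm w / (R - norm w))"
  have ex: "\<exists>g. norm g \<le> f R \<and> Q w = P R w * exp g" if R: "R \<ge> \<bar>R0\<bar> + norm w + 1" for R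
  proof -
    have Rp: "R > 0" "R > norm w" using R norm_ge_zero[of w] by linarith+
    obtain h where h: "h holomorphic_on UNIV" "\<And>u. Q u = P R u * h u" "\<And>b. h b = 0 \<Longrightarrow> Q b = 0 \<and> \<not> norm b \<le> R"
    proof -
      have "\<exists>h. h holomorphic_on UNIV \<and> (\<forall>w. Q w = P R w * h w) \<and> (\<forall>b. h b = 0 \<longrightarrow> Q b = 0 \<and> b \<notin> {a. Q a = 0 \<and> norm a \<le> R})"
        unfolding P_def by (rule simple_zeros_factor[OF hol fin[of R]]) (use simple Q0 in auto)
      then obtain h where h: "h holomorphic_on UNIV" "\<And>u. Q u = P R u * h u" "\<And>b. h b = 0 \<Longrightarrow> Q b = 0 \<and> b \<notin> {a. Q a = 0 \<and> norm a \<le> R}"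
        by blast
      show ?thesis by (rule that[OF h(1) h(2)]) (use h(3) in auto)
    qed
    have hB: "norm (h u) \<le> exp ((2*R) powr \<mu>)" if "u \<in> ball 0 (2*R)" for u
    proof (rule maximum_modulus_frontier[where f=h and \<xi>=u and S="ball 0 (2*R)"])
      show "h holomorphic_on interior (ball 0 (2*R))" using h(1) holomorphic_on_subset by blast
      show "continuous_on (closure (ball 0 (2*R))) h" using h(1) holomorphic_on_imp_continuous_on continuous_on_subset by blast
      fix z :: complex assume "z \<in> frontier (ball 0 (2*R))"
      then have z: "norm z = 2 * R" using Rp by (simp add: frontier_ball)
      \<comment> \<open>On the circle of radius 2 R every factor 1 - z / a with |a| <= R has modulus
        at least 1, so dividing by the product does not increase the modulus; the maximum modulus
        principle carries the bound inside.\<close>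
      have "1 \<le> norm (P R z)" unfolding P_def prod_norm[symmetric]
      proof (rule prod_ge_1)
        fix a assume "a \<in> {a. Q a = 0 \<and> norm a \<le> R}"
        then have a: "norm a \<le> R" "a \<noteq> 0" using Q0 by auto
        have "norm (z / a) \<ge> 2" using a z by (simp add: norm_divide pos_le_divide_eq)
        then show "1 \<le> norm (1 - z / a)" using norm_triangle_ineq2[of "z/a" 1] by (simp add: norm_minus_commute)
      qed
      then have "norm (h z) \<le> norm (P R z) * norm (h z)" by (simp add: mult_right_mono mult_le_cancel_right1)
      also have "\<dots> = norm (Q z)" using h(2) by (simp add: norm_mult)
      also have "\<dots> \<le> exp ((2*R) powr \<mu>)" 
        by (rule R0) (use R z Rp norm_ge_zero[of w] in linarith)+
      finally show "norm (h z) \<le> exp ((2*R) powr \<mu>)" .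
    qed (use that in auto)
    have hnz: "h u \<noteq> 0" if "u \<in> ball 0 R" for u using h(3)[of u] that by auto
    obtain g where g: "g holomorphic_on ball 0 R" "\<And>x. x \<in> ball 0 R \<Longrightarrow> exp (g x) = h x"
    proof (rule holomorphic_logarithm_exists[of "ball 0 R" h 0])
      show "h holomorphic_on ball 0 R" using h(1) holomorphic_on_subset by blast
    qed (use hnz Rp in auto)
    have h0: "h 0 = 1" using h(2)[of 0] Q0 by (simp add: P_def)
    let ?g = "\<lambda>u. g u - g 0"
    have eg: "exp (?g u) = h u" if "u \<in> ball 0 R" for u
      using g(2)[OF that] g(2)[of 0] h0 Rp by (simp add: exp_diff)
    have "norm (?g w) \<le> 2 * ((2 * R) powr \<mu> + 1) * norm w / (R - norm w)"
    proof (rule Borel_Caratheodory)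
      show "?g holomorphic_on ball 0 R" using g(1) by (intro holomorphic_intros)
      fix z :: complex assume z: "z \<in> ball 0 R"
      have "exp (Re (?g z)) = norm (h z)" using eg[OF z] by (metis norm_exp_eq_Re)
      also have "\<dots> \<le> exp ((2*R) powr \<mu>)" using hB z Rp by simp
      finally show "Re (?g z) < (2*R) powr \<mu> + 1" by simp
    qed (use Rp in auto)
    moreover have "Q w = P R w * exp (?g w)" using h(2) eg[of w] Rp by simp
    ultimately show ?thesis unfolding f_def by blast
  qed
  then obtain G where G: "\<And>R. R \<ge> \<bar>R0\<bar> + norm w + 1 \<Longrightarrow> norm (G R) \<le> f R \<and> Q w = P R w * exp (G R)"
    by metis
  have f0: "(f \<longlongrightarrow> 0) at_top"
  proof -
    have "((\<lambda>R. 2 * ((2 * R) powr \<mu> + 1) / (R - c)) \<longlongrightarrow> 0) at_top" for c :: real using \<mu> by real_asymp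
    from tendsto_mult_left_zero[OF this[of "norm w"], of "norm w"] show ?thesis unfolding f_def by (simp add: mult_ac)
  qed
  have ev: "\<forall>\<^sub>F R in at_top. norm (G R) \<le> f R" "\<forall>\<^sub>F R in at_top. Q w * exp (- G R) = P R w"
    using eventually_ge_at_top[of "\<bar>R0\<bar> + norm w + 1"]
    by (eventually_elim, use G in \<open>auto simp: exp_minus\<close>)+
  have G0: "(G \<longlongrightarrow> 0) at_top" using Lim_null_comparison[OF ev(1) f0] .
  have "((\<lambda>R. Q w * exp (- G R)) \<longlongrightarrow> Q w * exp (- 0)) at_top" by (intro tendsto_intros G0)
  then have "((\<lambda>R. P R w) \<longlongrightarrow> Q w) at_top" using Lim_transform_eventually[OF _ ev(2)] by simp
  then show ?thesis unfolding P_def .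
qed

section \<open>The associated function\<close>

context angle
begin

lemma kern_transform_holomorphic:
  fixes f :: "real \<Rightarrow> complex"
  assumes \<sigma>: "\<bar>\<sigma>\<bar> < 1" and f: "f \<in> borel_measurable borel" and bd: "\<And>y. y > 0 \<Longrightarrow> norm (f y) \<le> C * y powr \<sigma>"
  shows "(\<lambda>w. LINT y:{0<..}|lborel. f y * kern w y) holomorphic_on sec"
  unfolding set_lebesgue_integral_def
proof (rule holomorphic_on_lebesgue_integral[OF open_wedge])
  show "(\<lambda>y. indicator {0<..} y *\<^sub>R (f y * kern w y)) \<in> borel_measurable lborel" for w
    using f by measurable
  show "(\<lambda>w. indicator {0<..} y *\<^sub>R (f y * kern w y)) holomorphic_on sec" for y
    using kern_holomorphic by (intro holomorphic_intros) auto
  fix w assume w: "w \<in> sec"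
  define x where "x = norm w / 2"
  have x: "x > 0" using sec_Re(3)[OF w] by (simp add: x_def)
  have C: "C \<ge> 0" using order_trans[OF norm_ge_zero bd[of 1]] by simp
  show "\<exists>r>0. \<exists>g. integrable lborel g \<and> (\<forall>w'\<in>ball w r \<inter> sec. \<forall>y. norm (indicator {0<..} y *\<^sub>R (f y * kern w' y)) \<le> g y)"
  proof (intro exI conjI ballI allI)
    show "x > 0" by fact
    show "integrable lborel (\<lambda>y. indicator {0<..} y *\<^sub>R (C * 4 / c1\<^sup>2 * (y powr \<sigma> * (x / (x + y)\<^sup>2))))"
      using set_integrable_mult_right[OF power_kernel_halfline(1)[OF x \<sigma>], of "C * 4 / c1\<^sup>2"] unfolding set_integrable_def .
    fix w' y assume w': "w' \<in> ball w x \<inter> sec"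
    have n1: "norm w' \<le> 4 * x" "x \<le> norm w'"
      using w' norm_triangle_sub[of w' w] norm_triangle_sub[of w w'] by (auto simp: dist_norm x_def norm_minus_commute)
    show "norm (indicator {0<..} y *\<^sub>R (f y * kern w' y)) \<le> indicator {0<..} y *\<^sub>R (C * 4 / c1\<^sup>2 * (y powr \<sigma> * (x / (x + y)\<^sup>2)))"
    proof (cases "y > 0")
      case True
      have "norm (kern w' y) \<le> 1 / c1\<^sup>2 * (norm w' / (norm w' + y)\<^sup>2)" using w' True by (intro norm_kern_le) auto
      also have "\<dots> \<le> 1 / c1\<^sup>2 * (4 * x / (x + y)\<^sup>2)"
        using n1 x True by (intro mult_left_mono frac_le power_mono) auto
      finally have "norm (f y) * norm (kern w' y) \<le> (C * y powr \<sigma>) * (1 / c1\<^sup>2 * (4 * x / (x + y)\<^sup>2))"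
        using bd[OF True] C by (intro mult_mono) auto
      then show ?thesis using True by (simp add: norm_mult field_simps)
    qed auto
  qed
qed

text \<open>\<open>Phi\<close> is invariant under scaling \<open>a\<close> and \<open>w\<close>
  together, so Euler's relation turns the derivative in \<open>a\<close>, which is minus the kernel,
  into a / w times the kernel.\<close>

lemma Phi_deriv:
  assumes w: "w \<in> sec"
  shows "(Phi a has_field_derivative of_real a / w * kern w a) (at w)"
proof -
  note nz = kern_nz[OF w, of a] and ok = Ln_arg_ok[OF w, of a]
  have w0: "w \<noteq> 0" using sec_Re[OF w] by simp
  have 1: "((\<lambda>w. Ln (of_real a - w * cis (-th)) - Ln (of_real a - w * cis th)) has_field_derivative
      (- cis (-th) / (of_real a - w * cis (-th)) + cis th / (of_real a - w * cis th))) (at w)"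
    using nz ok by (auto intro!: derivative_eq_intros simp: inverse_eq_divide)
  have 2: "c / (of_real a - w * c) = (of_real a / (of_real a - w * c) - 1) / w" if "of_real a - w * c \<noteq> 0" for c
    using that w0 by (simp add: field_simps)
  have 3: "1 / (2 * pi * \<i>) * (- cis (-th) / (of_real a - w * cis (-th)) + cis th / (of_real a - w * cis th)) = of_real a / w * kern w a"
  proof -
    have gen: "c * (- ((B - 1) / w) + (A - 1) / w) = v / w * (c * (A' - B'))" if "A = v * A'" "B = v * B'" for c A B A' B' v :: complex
      using that by (simp add: diff_divide_distrib algebra_simps)
    show ?thesis unfolding kern_def minus_divide_left[symmetric] 2[OF nz(1)] 2[OF nz(2)] by (rule gen) auto
  qed
  show ?thesis unfolding Phi_def using DERIV_cmult[OF 1, of "1 / (2 * pi * \<i>)"] 3 by simp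
qed

definition step :: "real set \<Rightarrow> real \<Rightarrow> real" where
  "step J y = real (card {a\<in>J. a \<le> y})"

lemma step_eq_sum: "finite J \<Longrightarrow> step J y = (\<Sum>a\<in>J. indicator {a..} y)"
  unfolding step_def by (simp add: indicator_def sum.If_cases Int_def)

lemma step_mono: "(\<And>y. finite {a\<in>J. a \<le> y}) \<Longrightarrow> y \<le> y' \<Longrightarrow> step J y \<le> step J y'"
  unfolding step_def by (simp, intro card_mono) auto

text \<open>Each jump of the counting function contributes one tail of the kernel.\<close>

lemma step_kern_integral:
  assumes J: "finite J" "\<And>a. a \<in> J \<Longrightarrow> a > 0" and w: "w \<in> sec"
  shows "set_integrable lborel {0<..} (\<lambda>y. of_real (step J y) * kern w y)"
    "(LINT y:{0<..}|lborel. of_real (step J y) * kern w y) = (\<Sum>a\<in>J. Phi a w)"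
proof -
  have eq: "indicator {0<..} y *\<^sub>R (of_real (step J y) * kern w y) = (\<Sum>a\<in>J. indicator {a..} y *\<^sub>R kern w y)" for y
  proof (cases "y > 0")
    case True
    then show ?thesis by (simp add: step_eq_sum[OF J(1)] sum_distrib_right scaleR_conv_of_real indicator_def)
  next
    case False
    have "indicator {a..} y *\<^sub>R kern w y = 0" if "a \<in> J" for a using J(2)[OF that] False by (auto simp: indicator_def)
    then have "(\<Sum>a\<in>J. indicator {a..} y *\<^sub>R kern w y) = 0" by (intro sum.neutral) auto
    then show ?thesis using False by simp
  qed
  have i: "integrable lborel (\<lambda>y. indicator {a..} y *\<^sub>R kern w y)" if "a \<in> J" for a
    using kern_tail(1)[OF w, of a] J(2)[OF that] unfolding set_integrable_def by simp
  show "set_integrable lborel {0<..} (\<lambda>y. of_real (step J y) * kern w y)"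
    unfolding set_integrable_def eq using i by (intro Bochner_Integration.integrable_sum)
  show "(LINT y:{0<..}|lborel. of_real (step J y) * kern w y) = (\<Sum>a\<in>J. Phi a w)"
    unfolding set_lebesgue_integral_def eq
    using i J(2) kern_tail(2)[OF w] unfolding set_lebesgue_integral_def
    by (subst Bochner_Integration.integral_sum) (auto intro!: sum.cong simp: less_imp_le)
qed

lemma kern_real_scale:
  fixes f :: "real \<Rightarrow> complex"
  assumes x: "x > 0"
  shows "(LINT y:{0<..}|lborel. f y * kern (of_real x) y) = (LINT y:{0<..}|lborel. f (x * y) * kern 1 y)"
proof -
  have k: "of_real x * kern (of_real x) (x * y) = kern 1 y" for y
    using kr_scale[of x 1 y] x kern_of_real[of 1 y] by (simp add: kern_of_real)
  have "(LINT y:{0<..}|lborel. f y * kern (of_real x) y) = x *\<^sub>R (LINT y:{0<..}|lborel. f (x * y) * kern (of_real x) (x * y))"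
    by (rule set_integral_halfline_scale[OF x])
  also have "\<dots> = (LINT y:{0<..}|lborel. of_real x * (f (x * y) * kern (of_real x) (x * y)))"
    by (simp add: scaleR_conv_of_real)
  also have "(\<lambda>y. of_real x * (f (x * y) * kern (of_real x) (x * y))) = (\<lambda>y. f (x * y) * kern 1 y)"
    using k by (simp add: fun_eq_iff mult.left_commute)
  finally show ?thesis .
qed

end

section \<open>Zeros of a solution, integral representation and the branch z\<close>

locale bae =
  fixes \<alpha> p :: real and Q :: "complex \<Rightarrow> complex"
  assumes \<alpha>: "\<alpha> > 1" and p: "p \<ge> 0"
    and sol: "bae_solution \<alpha> p Q" and pr: "purely_real Q" and nm: "normalised \<alpha> Q"
    and fin_holes: "finite (holes \<alpha> p Q)"
begin

abbreviation "th \<equiv> bae_theta \<alpha>"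
abbreviation "e \<equiv> bae_exp \<alpha>"

lemma e_bounds: "1/2 < e" "e < 1" "0 < e"
  using \<alpha> by (auto simp: bae_exp_def field_simps)

sublocale angle th
  by unfold_locales (use \<alpha> in \<open>auto simp: bae_theta_def field_simps\<close>)

definition zeros :: "real set" where "zeros = {x. x > 0 \<and> Q (of_real x) = 0}"
definition X :: "real \<Rightarrow> real set" where "X y = {a\<in>zeros. a \<le> y}"
abbreviation N :: "real \<Rightarrow> real" where "N \<equiv> step zeros"

lemma hol: "Q holomorphic_on UNIV" using sol by (simp add: bae_solution_def entire_of_order_def)
lemma Q0: "Q 0 = 1" using nm by (simp add: normalised_def)
lemma zero_real: "Q w = 0 \<Longrightarrow> \<exists>x\<in>zeros. w = of_real x"
  using pr unfolding purely_real_def zeros_def by (metis (mono_tags, lifting) Reals_cases Re_complex_of_real mem_Collect_eq)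

lemma zero_set_eq: "{a. Q a = 0 \<and> norm a \<le> R} = of_real ` X R"
proof safe
  fix a assume a: "Q a = 0" "norm a \<le> R"
  obtain x where x: "x \<in> zeros" "a = of_real x" using zero_real[OF a(1)] by blast
  then show "a \<in> of_real ` X R" using a by (auto simp: X_def zeros_def)
qed (auto simp: X_def zeros_def)

lemma finite_zero_set: "finite {a. Q a = 0 \<and> norm a \<le> R}"
proof -
  have "finite {z \<in> cball 0 R. Q z = 0}"
  proof (rule holomorphic_compact_finite_zeros[OF hol])
    show "\<not> Q constant_on UNIV"
    proof
      assume "Q constant_on UNIV"
      then have Q1: "Q w = 1" for w using Q0 unfolding constant_on_def by (metis UNIV_I)
      then have "((\<lambda>x::real. 0) \<longlongrightarrow> (1::real)) at_top" using nm by (simp add: normalised_def zero_count_def)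
      then show False by (simp add: tendsto_const_iff)
    qed
  qed auto
  then show ?thesis by (rule rev_finite_subset) auto
qed

lemma finite_X: "finite (X R)"
  using finite_zero_set[of R] unfolding zero_set_eq by (rule finite_imageD) (auto simp: inj_on_def)

lemma N_eq: "N y = real (card (X y))" by (simp add: step_def X_def)

lemma zero_count_eq: "y \<ge> 0 \<Longrightarrow> real (zero_count Q y) = N y"
proof -
  assume y: "y \<ge> 0"
  have "{w. Q w = 0 \<and> w \<in> closed_segment 0 (complex_of_real y)} = of_real ` X y"
  proof safe
    fix w assume w: "Q w = 0" "w \<in> closed_segment 0 (complex_of_real y)"
    obtain x where x: "x \<in> zeros" "w = of_real x" using zero_real[OF w(1)] by blast
    obtain u where u: "0 \<le> u" "u \<le> 1" "w = u *\<^sub>R of_real y" using w(2) by (auto simp: closed_segment_def)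
    have "x = u * y" using x u by (simp add: scaleR_conv_of_real flip: of_real_mult)
    then have "x \<le> y" using u y by (simp add: mult_left_le_one_le)
    then show "w \<in> of_real ` X y" using x by (auto simp: X_def)
  next
    fix x assume x: "x \<in> X y"
    then show "Q (of_real x) = 0" by (auto simp: X_def zeros_def)
    have "0 < x" "x \<le> y" using x by (auto simp: X_def zeros_def)
    then show "complex_of_real x \<in> closed_segment 0 (complex_of_real y)"
      by (auto simp: closed_segment_def scaleR_conv_of_real intro!: exI[of _ "x/y"])
  qed
  then show ?thesis unfolding zero_count_def N_eq by (simp add: card_image inj_on_def)
qed

lemma N_mono: "y \<le> y' \<Longrightarrow> N y \<le> N y'"
  using finite_X by (intro step_mono) (auto simp: X_def)

lemma N_measurable [measurable]: "N \<in> borel_measurable borel"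
  by (rule borel_measurable_mono) (auto simp: mono_def N_mono)

lemma N_lim: "((\<lambda>x. x powr (- e) * N x) \<longlongrightarrow> 1) at_top"
proof -
  have "((\<lambda>x. x powr (- e) * real (zero_count Q x)) \<longlongrightarrow> 1) at_top" using nm by (simp add: normalised_def)
  moreover have "\<forall>\<^sub>F x in at_top. x powr (- e) * real (zero_count Q x) = x powr (- e) * N x"
    using eventually_ge_at_top[of 0] by eventually_elim (simp add: zero_count_eq)
  ultimately show ?thesis by (rule Lim_transform_eventually)
qed

text \<open>For large \<open>y\<close> this is the normalisation. Below the smallest zero
  \<open>N\<close> vanishes, so the power bound holds down to 0, and the range in between is
  absorbed into the constant.\<close>

lemma N_bound_ex: "\<exists>C>0. \<forall>y>0. N y \<le> C * y powr e"
proof -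
  have "\<forall>\<^sub>F x in at_top. x powr (- e) * N x < 2" using N_lim by (rule order_tendstoD) simp
  then obtain Y0 where Y0: "\<And>x. x \<ge> Y0 \<Longrightarrow> x powr (- e) * N x < 2" unfolding eventually_at_top_linorder by blast
  define Y where "Y = max Y0 1"
  have Y: "N x \<le> 2 * x powr e" if "x \<ge> Y" for x
    using Y0[of x] that by (auto simp: Y_def powr_minus field_simps)
  have Y1: "Y \<ge> 1" by (simp add: Y_def)
  show ?thesis
  proof (cases "X Y = {}")
    case True
    have "N y \<le> 2 * y powr e" if "y > 0" for y
    proof (cases "y \<ge> Y")
      case False
      then have "X y = {}" using True by (auto simp: X_def)
      then show ?thesis by (simp add: N_eq)
    qed (use Y in auto)
    then show ?thesis by (intro exI[of _ 2]) auto
  next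
    case False
    define \<delta> where "\<delta> = Min (X Y)"
    have \<delta>in: "\<delta> \<in> X Y" unfolding \<delta>_def using finite_X False by (rule Min_in)
    then have \<delta>: "\<delta> > 0" by (simp add: X_def zeros_def)
    have min: "\<delta> \<le> a" if "a \<in> X Y" for a unfolding \<delta>_def using finite_X that by (rule Min_le)
    define C where "C = 2 + N Y / \<delta> powr e"
    have C2: "C \<ge> 2" unfolding C_def step_def by simp
    have "N y \<le> C * y powr e" if y: "y > 0" for y
    proof (cases "y \<ge> Y")
      case True
      have "N y \<le> 2 * y powr e" by (rule Y[OF True])
      also have "\<dots> \<le> C * y powr e" using C2 by (intro mult_right_mono) auto
      finally show ?thesis .
    next
      case False
      show ?thesis
      proof (cases "y < \<delta>")
        case True
        have "X y = {}"
        proof (rule ccontr)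
          assume "X y \<noteq> {}"
          then obtain a where "a \<in> X y" by blast
          then have "a \<le> y" "a \<in> X Y" using False by (auto simp: X_def)
          then show False using min True by fastforce
        qed
        then have "N y = 0" by (simp add: N_eq)
        then show ?thesis using C2 by simp
      next
        case F2: False
        have "N y \<le> N Y" using False by (intro N_mono) auto
        also have "\<dots> = N Y / \<delta> powr e * \<delta> powr e" using \<delta> by simp
        also have "\<dots> \<le> N Y / \<delta> powr e * y powr e" using F2 \<delta> e_bounds
          by (intro mult_left_mono powr_mono2) (auto simp: step_def)
        also have "\<dots> \<le> C * y powr e" unfolding C_def by (intro mult_right_mono) auto
        finally show ?thesis .
      qed
    qed
    then show ?thesis using C2 by (intro exI[of _ C]) auto
  qed
qed

definition CN where "CN = (SOME C. C > 0 \<and> (\<forall>y>0. N y \<le> C * y powr e))"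

lemma CN: "CN > 0" "\<And>y. y > 0 \<Longrightarrow> N y \<le> CN * y powr e"
  using someI_ex[OF N_bound_ex] unfolding CN_def by auto

lemma N_nonneg: "N y \<ge> 0" by (simp add: step_def)

lemma e_abs: "\<bar>e\<bar> < 1" using e_bounds by auto

lemma norm_N: "y > 0 \<Longrightarrow> norm (complex_of_real (N y)) \<le> CN * y powr e"
  using CN(2) N_nonneg by simp

text \<open>The extension of z + 2p from the positive axis to the sector; its holomorphy is the
  source of the derivative estimates for z.\<close>

definition ZI :: "complex \<Rightarrow> complex" where
  "ZI w = (LINT y:{0<..}|lborel. of_real (N y) * kern w y)"

definition zi :: "real \<Rightarrow> real" where "zi x = Re (ZI (of_real x))"

lemma ZI_holomorphic: "ZI holomorphic_on sec"
  unfolding ZI_def by (rule kern_transform_holomorphic[OF e_abs _ norm_N]) auto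

lemma N_kern_integrable: "w \<in> sec \<Longrightarrow> set_integrable lborel {0<..} (\<lambda>y. of_real (N y) * kern w y)"
  by (rule kern_bound_integrable(1)[OF _ e_abs _ norm_N]) auto

lemma ZI_bound_ex: "\<exists>C. \<forall>w\<in>sec. norm (ZI w) \<le> C * norm w powr e"
  unfolding ZI_def by (intro exI[of _ "CN / c1\<^sup>2 * Beta (1+e) (1-e)"] ballI kern_bound_integrable(2)[OF _ e_abs _ norm_N]) auto

lemma ZI_of_real: "x > 0 \<Longrightarrow> ZI (of_real x) = of_real (LINT y:{0<..}|lborel. N y * kr x y)"
  unfolding ZI_def by (simp add: kern_of_real flip: set_integral_complex_of_real)

lemma ZI_real: "x > 0 \<Longrightarrow> ZI (of_real x) = of_real (zi x)"
  by (simp add: zi_def ZI_of_real)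

lemma zi_0: "zi 0 = 0" by (simp add: zi_def ZI_def kern_def set_lebesgue_integral_def)

lemma product_limit: "((\<lambda>R. \<Prod>a\<in>X R. 1 - w / of_real a) \<longlongrightarrow> Q w) at_top"
proof -
  obtain \<mu> where \<mu>: "e < \<mu>" "\<mu> < 1" using e_bounds dense by blast
  have "((\<lambda>R. \<Prod>a\<in>{a. Q a = 0 \<and> norm a \<le> R}. 1 - w / a) \<longlongrightarrow> Q w) at_top"
  proof (rule genus_zero_product[OF hol Q0 _ _ \<mu>(2)])
    show "\<And>w. Q w = 0 \<Longrightarrow> deriv Q w \<noteq> 0" using sol by (simp add: bae_solution_def)
    show "\<forall>\<^sub>F r in at_top. \<forall>w. norm w = r \<longrightarrow> norm (Q w) \<le> exp (r powr \<mu>)"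
      using sol \<mu> by (auto simp: bae_solution_def entire_of_order_def)
    show "0 < \<mu>" using \<mu> e_bounds by linarith
  qed (rule finite_zero_set)
  then show ?thesis unfolding zero_set_eq by (simp add: prod.reindex inj_on_def)
qed

text \<open>The zeros up to R have counting function N (min y R), which \<open>N\<close> dominates,
  so dominated convergence passes to the limit.\<close>

lemma Phi_sum_limit:
  assumes w: "w \<in> sec"
  shows "((\<lambda>R. \<Sum>a\<in>X R. Phi a w) \<longlongrightarrow> ZI w) at_top"
proof -
  have fin: "finite (X R)" "\<And>a. a \<in> X R \<Longrightarrow> a > 0" for R using finite_X by (auto simp: X_def zeros_def)
  have sX: "step (X R) y = N (min y R)" for R y
    unfolding step_def X_def by (rule arg_cong[where f="\<lambda>A. real (card A)"]) auto
  have "((\<lambda>R. LINT y:{0<..}|lborel. of_real (step (X R) y) * kern w y) \<longlongrightarrow> ZI w) at_top"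
    unfolding ZI_def set_lebesgue_integral_def
  proof (rule integral_dominated_convergence_at_top[where w="\<lambda>y. norm (indicator {0<..} y *\<^sub>R (of_real (N y) * kern w y))"])
    show "(\<lambda>y. indicator {0<..} y *\<^sub>R (of_real (N y) * kern w y)) \<in> borel_measurable lborel" by measurable
    show "(\<lambda>y. indicator {0<..} y *\<^sub>R (of_real (step (X R) y) * kern w y)) \<in> borel_measurable lborel" for R
      unfolding sX by measurable
    show "integrable lborel (\<lambda>y. norm (indicator {0<..} y *\<^sub>R (of_real (N y) * kern w y)))"
      using N_kern_integrable[OF w] unfolding set_integrable_def by (rule integrable_norm)
    show "\<forall>\<^sub>F R in at_top. AE y in lborel. norm (indicator {0<..} y *\<^sub>R (of_real (step (X R) y) * kern w y))
       \<le> norm (indicator {0<..} y *\<^sub>R (of_real (N y) * kern w y))"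
      unfolding sX by (intro always_eventually allI AE_I2) (auto simp: norm_mult indicator_def N_nonneg intro!: mult_right_mono N_mono)
    show "AE y in lborel. ((\<lambda>R. indicator {0<..} y *\<^sub>R (of_real (step (X R) y) * kern w y)) \<longlongrightarrow> indicator {0<..} y *\<^sub>R (of_real (N y) * kern w y)) at_top"
    proof (rule AE_I2)
      fix y
      have "\<forall>\<^sub>F R in at_top. indicator {0<..} y *\<^sub>R (of_real (N y) * kern w y) = indicator {0<..} y *\<^sub>R (of_real (step (X R) y) * kern w y)"
        using eventually_ge_at_top[of y] by eventually_elim (simp add: sX min_def)
      then show "((\<lambda>R. indicator {0<..} y *\<^sub>R (of_real (step (X R) y) * kern w y)) \<longlongrightarrow> indicator {0<..} y *\<^sub>R (of_real (N y) * kern w y)) at_top"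
        by (rule Lim_transform_eventually[OF tendsto_const])
    qed
  qed
  then show ?thesis using step_kern_integral(2)[OF fin w] by simp
qed

lemma Q_nz: "x > 0 \<Longrightarrow> Q (of_real x * cis th) \<noteq> 0" "x > 0 \<Longrightarrow> Q (of_real x * cis (-th)) \<noteq> 0"
proof -
  assume x: "x > 0"
  have "Im (of_real x * cis th) \<noteq> 0" "Im (of_real x * cis (-th)) \<noteq> 0" using x sin_th by auto
  then show "Q (of_real x * cis th) \<noteq> 0" "Q (of_real x * cis (-th)) \<noteq> 0" using zero_real by (metis Im_complex_of_real)+
qed

text \<open>For finitely many zeros this is a product of the identities for single zeros. Both sides
  converge by the product expansion of \<open>Q\<close>, and the denominator does not vanish because
  all zeros are real.\<close>

lemma exp_ZI:
  assumes x: "x > 0"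
  shows "exp (2 * pi * \<i> * ZI (of_real x)) = Q (of_real x * cis (-th)) / Q (of_real x * cis th)"
proof -
  have w: "complex_of_real x \<in> sec" using x by simp
  have "((\<lambda>R. exp (2 * pi * \<i> * (\<Sum>a\<in>X R. Phi a (of_real x)))) \<longlongrightarrow> exp (2 * pi * \<i> * ZI (of_real x))) at_top"
    by (intro tendsto_intros Phi_sum_limit w)
  moreover have "exp (2 * pi * \<i> * (\<Sum>a\<in>X R. Phi a (of_real x))) =
     (\<Prod>a\<in>X R. 1 - of_real x * cis (-th) / of_real a) / (\<Prod>a\<in>X R. 1 - of_real x * cis th / of_real a)" for R
  proof -
    have "exp (2 * pi * \<i> * (\<Sum>a\<in>X R. Phi a (of_real x))) = (\<Prod>a\<in>X R. exp (2 * pi * \<i> * Phi a (of_real x)))"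
      by (simp add: sum_distrib_left exp_sum finite_X)
    also have "\<dots> = (\<Prod>a\<in>X R. (1 - of_real x * cis (-th) / of_real a) / (1 - of_real x * cis th / of_real a))"
      by (intro prod.cong refl exp_Phi w) (auto simp: X_def zeros_def)
    finally show ?thesis by (simp add: prod_dividef)
  qed
  ultimately have "((\<lambda>R. (\<Prod>a\<in>X R. 1 - of_real x * cis (-th) / of_real a) / (\<Prod>a\<in>X R. 1 - of_real x * cis th / of_real a))
     \<longlongrightarrow> exp (2 * pi * \<i> * ZI (of_real x))) at_top" by simp
  moreover have "((\<lambda>R. (\<Prod>a\<in>X R. 1 - of_real x * cis (-th) / of_real a) / (\<Prod>a\<in>X R. 1 - of_real x * cis th / of_real a))
     \<longlongrightarrow> Q (of_real x * cis (-th)) / Q (of_real x * cis th)) at_top"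
    by (intro tendsto_divide product_limit Q_nz x)
  ultimately show ?thesis using tendsto_unique trivial_limit_at_top_linorder by blast
qed

lemma zi_deriv: "x > 0 \<Longrightarrow> (zi has_real_derivative Re (deriv ZI (of_real x))) (at x)"
proof -
  assume x: "x > 0"
  have "(ZI has_field_derivative deriv ZI (of_real x)) (at (of_real x))"
    using holomorphic_derivI[OF ZI_holomorphic open_wedge] x by simp
  then have "((\<lambda>x. ZI (of_real x)) has_vector_derivative deriv ZI (of_real x)) (at x)"
    by (rule has_vector_derivative_real_field)
  then show ?thesis unfolding zi_def
    by (simp add: has_real_derivative_iff_has_vector_derivative bounded_linear.has_vector_derivative[OF bounded_linear_Re])
qed

lemma zi_continuous: "continuous_on {0..} zi"
proof -
  have "continuous (at x within {0..}) zi" if x: "x \<ge> 0" for x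
  proof (cases "x = 0")
    case False
    then have "isCont zi x" using zi_deriv x DERIV_isCont by (metis less_eq_real_def)
    then show ?thesis by (rule continuous_at_imp_continuous_at_within)
  next
    case True
    obtain C where C: "\<And>w. w \<in> sec \<Longrightarrow> norm (ZI w) \<le> C * norm w powr e" using ZI_bound_ex by blast
    have "(zi \<longlongrightarrow> 0) (at 0 within {0..})"
    proof (rule Lim_null_comparison)
      show "\<forall>\<^sub>F x in at 0 within {0..}. norm (zi x) \<le> C * x powr e"
        unfolding eventually_at_filter
      proof (intro always_eventually allI impI)
        fix x :: real assume "x \<noteq> 0" "x \<in> {0..}"
        then have "x > 0" by auto
        then show "norm (zi x) \<le> C * x powr e" using C[of "of_real x"] by (simp add: ZI_real)
      qed
      have "((\<lambda>x. C * x powr e) \<longlongrightarrow> C * 0 powr e) (at 0 within {0..})"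
        using e_bounds by (intro tendsto_intros) (auto simp: eventually_at_filter)
      then show "((\<lambda>x. C * x powr e) \<longlongrightarrow> 0) (at 0 within {0..})" using e_bounds by simp
    qed
    then show ?thesis using True by (simp add: continuous_within zi_0)
  qed
  then show ?thesis by (simp add: continuous_on_eq_continuous_within)
qed

definition z :: "real \<Rightarrow> real" where "z x = (if x < 0 then 0 else - 2 * p + zi x)"

text \<open>Two continuous branches differ on the closed half-line by a continuous integer-valued
  function, which is constant and vanishes at 0. The value 0 on the negative axis matches the
  convention in \<open>assoc_fun\<close>.\<close>

lemma assoc_fun_eq: "assoc_fun \<alpha> p Q = z"
  unfolding assoc_fun_def
proof (rule the_equality, intro conjI allI impI)
  show cz: "continuous_on {0..} z"
  proof -
    have "continuous_on {0..} (\<lambda>x. - 2 * p + zi x)" by (intro continuous_intros zi_continuous)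
    then show ?thesis by (rule continuous_on_eq) (auto simp: z_def)
  qed
  show "z 0 = - 2 * p" by (simp add: z_def zi_0)
  have ez: "exp (2 * pi * \<i> * complex_of_real (z x + 2 * p)) = Q (of_real x * cis (- th)) / Q (of_real x * cis th)" if "x \<ge> 0" for x
  proof (cases "x = 0")
    case True
    then show ?thesis by (simp add: z_def zi_0 Q0)
  next
    case False
    then have "x > 0" using that by simp
    then show ?thesis using exp_ZI[of x] by (simp add: z_def ZI_real)
  qed
  show "exp (2 * pi * \<i> * complex_of_real (z x + 2 * p)) = Q (of_real x * cis (- th)) / Q (of_real x * cis th)" if "x \<ge> 0" for x
    using ez that by blast
  show "z x = 0" if "x < 0" for x using that by (simp add: z_def)
  fix f assume f: "continuous_on {0..} f \<and> f 0 = - 2 * p \<and>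
      (\<forall>x\<ge>0. exp (2 * pi * \<i> * complex_of_real (f x + 2 * p)) = Q (of_real x * cis (- th)) / Q (of_real x * cis th)) \<and>
      (\<forall>x<0. f x = 0)"
  have int: "f x - z x \<in> \<int>" if "x \<ge> 0" for x
  proof -
    have "exp (2 * pi * \<i> * complex_of_real (f x + 2 * p)) = exp (2 * pi * \<i> * complex_of_real (z x + 2 * p))"
      using f ez that by simp
    then obtain n :: int where "2 * pi * \<i> * complex_of_real (f x + 2 * p) = 2 * pi * \<i> * complex_of_real (z x + 2 * p) + of_int (2 * n) * pi * \<i>"
      unfolding exp_eq by blast
    then have "2 * pi * \<i> * (complex_of_real (f x + 2 * p) - complex_of_real (z x + 2 * p) - of_int n) = 0"
      by (simp add: algebra_simps)
    then have "complex_of_real (f x + 2 * p) - complex_of_real (z x + 2 * p) - of_int n = 0"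
      by simp
    then have "f x - z x = of_int n" by (simp add: complex_eq_iff)
    then show ?thesis by simp
  qed
  have "continuous_on {0..} (\<lambda>x. f x - z x)" using f cz by (intro continuous_intros) auto
  then have "(\<lambda>x. f x - z x) constant_on {0..}"
  proof (rule continuous_discrete_range_constant[OF connected_Ici])
    fix x :: real assume x: "x \<in> {0..}"
    show "\<exists>e>0. \<forall>y. y \<in> {0..} \<and> f y - z y \<noteq> f x - z x \<longrightarrow> e \<le> norm (f y - z y - (f x - z x))"
    proof (intro exI[of _ 1] conjI allI impI)
      fix y assume y: "y \<in> {0..} \<and> f y - z y \<noteq> f x - z x"
      have "f y - z y - (f x - z x) \<in> \<int>" using Ints_diff[OF int int] x y by auto
      then show "1 \<le> norm (f y - z y - (f x - z x))" using y by (simp add: Ints_nonzero_abs_ge1)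
    qed simp
  qed
  then have c: "f x - z x = f 0 - z 0" if "x \<ge> 0" for x using that unfolding constant_on_def by force
  show "f = z"
  proof
    fix x show "f x = z x"
    proof (cases "x \<ge> 0")
      case True then show ?thesis using c[OF True] f by (simp add: z_def zi_0)
    qed (use f in \<open>auto simp: z_def\<close>)
  qed
qed

end

section \<open>Monotonicity and growth of z, and the count of zeros through z\<close>

context angle
begin

lemma kr_bound_integrable:
  fixes f :: "real \<Rightarrow> real"
  assumes x: "x > 0" and \<sigma>: "\<bar>\<sigma>\<bar> < 1"
    and f: "f \<in> borel_measurable borel" and bd: "\<And>y. y > 0 \<Longrightarrow> \<bar>f y\<bar> \<le> C * y powr \<sigma>"
  shows "set_integrable lborel {0<..} (\<lambda>y. f y * kr x y)"
proof -
  have "set_integrable lborel {0<..} (\<lambda>y. complex_of_real (f y) * kern (of_real x) y)"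
    by (rule kern_bound_integrable(1)[OF _ \<sigma>]) (use x f bd in auto)
  then have "integrable lborel (\<lambda>y. complex_of_real (indicator {0<..} y *\<^sub>R (f y * kr x y)))"
    unfolding set_integrable_def kern_of_real[OF x] by (simp add: scaleR_conv_of_real)
  then show ?thesis unfolding set_integrable_def complex_of_real_integrable_eq .
qed

lemma kern_kr_integral:
  assumes x: "x > 0"
  shows "(LINT y:{0<..}|lborel. of_real (f y) * kern (of_real x) y) = of_real (LINT y:{0<..}|lborel. f y * kr x y)"
  by (simp add: kern_of_real[OF x] flip: set_integral_complex_of_real)

lemma kr_lower: "x > 0 \<Longrightarrow> 0 < a \<Longrightarrow> a \<le> x \<Longrightarrow> kr x a \<ge> sin th / pi * (1 / (4 * x))"
proof -
  assume x: "x > 0" and a: "0 < a" "a \<le> x"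
  have "- (x * a * cos th) \<le> x * a" using x a cos_ge_minus_one[of th]
    by (metis minus_le_iff mult_minus1_right mult_left_mono mult_nonneg_nonneg less_imp_le)
  moreover have "2 * x * a * cos th = 2 * (x * a * cos th)" "2 * x * a = 2 * (x * a)" by simp_all
  ultimately have "x\<^sup>2 + a\<^sup>2 - 2 * x * a * cos th \<le> x\<^sup>2 + a\<^sup>2 + 2 * x * a" by linarith
  also have "\<dots> = (x + a)\<^sup>2" by (simp add: power2_eq_square algebra_simps)
  also have "\<dots> \<le> (2 * x)\<^sup>2" using a x by (intro power_mono) auto
  finally have "x / (2 * x)\<^sup>2 \<le> x / (x\<^sup>2 + a\<^sup>2 - 2 * x * a * cos th)"
    using kr_den_pos[OF x, of a] x by (intro divide_left_mono) auto
  then have "1 / (4 * x) \<le> x / (x\<^sup>2 + a\<^sup>2 - 2 * x * a * cos th)" using x by (simp add: power2_eq_square field_simps)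
  then show ?thesis unfolding kr_def using sin_th by (intro mult_left_mono) auto
qed

end

context bae
begin

definition zd :: "real \<Rightarrow> real" where "zd x = Re (deriv ZI (of_real x))"

lemma z_pos: "x \<ge> 0 \<Longrightarrow> z x = - 2 * p + zi x" by (simp add: z_def)

lemma z_deriv: "x > 0 \<Longrightarrow> (z has_real_derivative zd x) (at x)"
proof -
  assume x: "x > 0"
  have "((\<lambda>x. - 2 * p + zi x) has_real_derivative zd x) (at x)"
    using zi_deriv[OF x] unfolding zd_def by (auto intro!: derivative_eq_intros)
  then show ?thesis
    by (rule DERIV_cong_ev[THEN iffD1, OF refl _ refl, rotated])
       (use x in \<open>auto simp: eventually_nhds z_def intro!: exI[of _ "{0<..}"]\<close>)
qed

lemma step_diff_mono: "y \<le> y' \<Longrightarrow> step (zeros - J) y \<le> step (zeros - J) y'"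
proof (rule step_mono)
  show "finite {a \<in> zeros - J. a \<le> y}" for y
    by (rule finite_subset[OF _ finite_X[of y]]) (auto simp: X_def)
qed

lemma step_split: "finite J \<Longrightarrow> J \<subseteq> zeros \<Longrightarrow> N y = step J y + step (zeros - J) y"
proof -
  assume J: "finite J" "J \<subseteq> zeros"
  have "{a\<in>zeros. a \<le> y} = {a\<in>J. a \<le> y} \<union> {a\<in>zeros - J. a \<le> y}" using J by auto
  moreover have "finite {a\<in>zeros - J. a \<le> y}" by (rule finite_subset[OF _ finite_X[of y]]) (auto simp: X_def)
  ultimately show ?thesis unfolding step_def using J by (simp add: card_Un_disjoint disjoint_iff)
qed

text \<open>The kernel is invariant under dilations, so replacing the counting function by any
  non-decreasing one gives a non-decreasing transform.\<close>

lemma zi_minus_Phi_mono: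
  assumes J: "finite J" "J \<subseteq> zeros" and x: "0 < x" "x \<le> x'"
  shows "zi x - (\<Sum>a\<in>J. Re (Phi a (of_real x))) \<le> zi x' - (\<Sum>a\<in>J. Re (Phi a (of_real x')))"
proof -
  define M where "M = step (zeros - J)"
  have M0: "0 \<le> M y" "M y \<le> N y" for y using step_split[OF J, of y] by (auto simp: M_def step_def)
  have Mmono: "y \<le> y' \<Longrightarrow> M y \<le> M y'" for y y' unfolding M_def by (rule step_diff_mono)
  have Mm: "M \<in> borel_measurable borel" by (rule borel_measurable_mono) (auto simp: mono_def Mmono)
  have Jpos: "\<And>a. a \<in> J \<Longrightarrow> a > 0" using J by (auto simp: zeros_def)
  have bd: "\<bar>M (t * y)\<bar> \<le> (CN * t powr e) * y powr e" if "t > 0" "y > 0" for t y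
    using M0[of "t*y"] CN(2)[of "t*y"] that by (simp add: powr_mult mult_ac)
  have int: "set_integrable lborel {0<..} (\<lambda>y. M (t * y) * kr 1 y)" if t: "t > 0" for t
    by (rule kr_bound_integrable[OF _ e_abs _ bd[OF t]]) (use Mm in measurable)
  have eq: "zi t - (\<Sum>a\<in>J. Re (Phi a (of_real t))) = (LINT y:{0<..}|lborel. M (t * y) * kr 1 y)" if t: "t > 0" for t
  proof -
    have w: "complex_of_real t \<in> sec" using t by simp
    have sJ: "(\<Sum>a\<in>J. Phi a (of_real t)) = (LINT y:{0<..}|lborel. of_real (step J y) * kern (of_real t) y)"
      by (rule step_kern_integral(2)[symmetric]) (use J Jpos w in auto)
    have "ZI (of_real t) - (\<Sum>a\<in>J. Phi a (of_real t)) =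
       (LINT y:{0<..}|lborel. of_real (N y) * kern (of_real t) y - of_real (step J y) * kern (of_real t) y)"
      unfolding ZI_def sJ using N_kern_integrable[OF w] step_kern_integral(1)[OF J(1) _ w] Jpos
      by (intro set_integral_diff(2)[symmetric]) auto
    also have "\<dots> = (LINT y:{0<..}|lborel. of_real (M y) * kern (of_real t) y)"
      unfolding step_split[OF J] M_def by (simp add: algebra_simps)
    also have "\<dots> = (LINT y:{0<..}|lborel. of_real (M (t * y)) * kern (of_real 1) y)"
      using kern_real_scale[OF t, of "\<lambda>y. of_real (M y)"] by simp
    also have "\<dots> = of_real (LINT y:{0<..}|lborel. M (t * y) * kr 1 y)"
      by (rule kern_kr_integral) simp
    finally have "Re (ZI (of_real t) - (\<Sum>a\<in>J. Phi a (of_real t))) = (LINT y:{0<..}|lborel. M (t * y) * kr 1 y)" by simp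
    then show ?thesis by (simp add: zi_def)
  qed
  have "(LINT y:{0<..}|lborel. M (x * y) * kr 1 y) \<le> (LINT y:{0<..}|lborel. M (x' * y) * kr 1 y)"
    using x kr_pos[of 1] by (intro set_integral_mono int mult_right_mono Mmono) (auto simp: less_imp_le)
  then show ?thesis using eq[of x] eq[of x'] x by simp
qed

text \<open>Removing finitely many zeros leaves a non-decreasing function, so the derivative of z is
  at least what the removed zeros contribute to it.\<close>

lemma zd_lower:
  assumes J: "finite J" "J \<subseteq> zeros" and x: "0 < x"
  shows "zd x \<ge> (\<Sum>a\<in>J. a / x * kr x a)"
proof -
  have dPhi: "((\<lambda>x. Re (Phi a (of_real x))) has_real_derivative a / x * kr x a) (at x)" for a
  proof -
    have "((\<lambda>x. Phi a (of_real x)) has_vector_derivative of_real a / of_real x * kern (of_real x) a) (at x)"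
      by (rule has_vector_derivative_real_field[OF Phi_deriv]) (use x in simp)
    from bounded_linear.has_vector_derivative[OF bounded_linear_Re this] show ?thesis
      by (simp add: has_real_derivative_iff_has_vector_derivative kern_of_real[OF x] flip: of_real_divide of_real_mult)
  qed
  let ?g = "\<lambda>x. zi x - (\<Sum>a\<in>J. Re (Phi a (of_real x)))"
  have d: "(?g has_real_derivative zd x - (\<Sum>a\<in>J. a / x * kr x a)) (at x)"
    using zi_deriv[OF x] unfolding zd_def by (intro DERIV_diff DERIV_sum dPhi)
  show ?thesis
  proof (rule ccontr)
    assume "\<not> ?thesis"
    then have "zd x - (\<Sum>a\<in>J. a / x * kr x a) < 0" by simp
    from DERIV_neg_dec_right[OF d this] obtain d where d: "d > 0" "\<And>h. h > 0 \<Longrightarrow> h < d \<Longrightarrow> ?g x > ?g (x + h)" by blast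
    show False using d(2)[of "d/2"] d(1) zi_minus_Phi_mono[OF J x, of "x + d/2"] by simp
  qed
qed

text \<open>Since N(x) divided by x^e tends to 1, the difference behaves like (1 - 2^(-e)) x^e; the
  constant is half of that coefficient.\<close>

lemma N_gap: "\<exists>c>0. \<exists>x0>0. \<forall>x\<ge>x0. N x - N (x/2) \<ge> c * x powr e"
proof -
  have "((\<lambda>x. (x/2) powr (- e) * N (x/2)) \<longlongrightarrow> 1) at_top"
    by (rule filterlim_compose[OF N_lim]) real_asymp
  from tendsto_mult[OF tendsto_const[of "2 powr (- e)"] this]
  have "((\<lambda>x. 2 powr (-e) * ((x/2) powr (- e) * N (x/2))) \<longlongrightarrow> 2 powr (-e)) at_top" by simp
  from tendsto_diff[OF N_lim this]
  have l: "((\<lambda>x. x powr (- e) * N x - 2 powr (-e) * ((x/2) powr (- e) * N (x/2))) \<longlongrightarrow> 1 - 2 powr (-e)) at_top" .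
  define c where "c = (1 - 2 powr (-e)) / 2"
  have "2 powr (-e) < (2::real) powr 0" using e_bounds by (intro powr_less_mono) auto
  then have c: "c > 0" "c < 1 - 2 powr (-e)" by (auto simp: c_def)
  have "\<forall>\<^sub>F x in at_top. c < x powr (- e) * N x - 2 powr (-e) * ((x/2) powr (- e) * N (x/2))"
    using order_tendstoD(1)[OF l c(2)] .
  then obtain Y where Y: "\<And>x. x \<ge> Y \<Longrightarrow> c < x powr (- e) * N x - 2 powr (-e) * ((x/2) powr (- e) * N (x/2))"
    unfolding eventually_at_top_linorder by blast
  have "N x - N (x/2) \<ge> c * x powr e" if x: "x \<ge> max Y 1" for x
  proof -
    have x0: "x > 0" using x by simp
    have "2 powr (-e) * ((x/2) powr (- e) * N (x/2)) = x powr (-e) * N (x/2)"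
      using x0 by (simp add: powr_mult[symmetric] mult.assoc[symmetric])
    moreover have "c < x powr (- e) * N x - 2 powr (-e) * ((x/2) powr (- e) * N (x/2))" using Y[of x] x by simp
    ultimately have "c < x powr (- e) * N x - x powr (-e) * N (x/2)" by linarith
    then have "c \<le> x powr (-e) * (N x - N (x/2))" by (simp add: right_diff_distrib)
    then have "c * x powr e \<le> x powr (-e) * (N x - N (x/2)) * x powr e" by (intro mult_right_mono) auto
    also have "\<dots> = N x - N (x/2)" using x0 by (simp add: powr_minus field_simps)
    finally show ?thesis .
  qed
  then show ?thesis using c by (intro exI[of _ c] conjI exI[of _ "max Y 1"]) auto
qed

text \<open>At least c x^e zeros lie between x/2 and x, and each contributes at least a multiple of
  1 / x to the derivative. This lower bound permits division by \<open>zd\<close> when integrating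
  by parts.\<close>

lemma zd_growth: "\<exists>c>0. \<exists>x0>0. \<forall>x\<ge>x0. zd x \<ge> c * x powr (e - 1)"
proof -
  obtain c x0 where c: "c > 0" "x0 > 0" "\<And>x. x \<ge> x0 \<Longrightarrow> N x - N (x/2) \<ge> c * x powr e" using N_gap by blast
  define c' where "c' = sin th / pi / 8 * c"
  have "zd x \<ge> c' * x powr (e - 1)" if x: "x \<ge> x0" for x
  proof -
    have x0: "x > 0" using x c by simp
    define J where "J = X x - X (x/2)"
    have J: "finite J" "J \<subseteq> zeros" using finite_X by (auto simp: J_def X_def)
    have "X (x/2) \<subseteq> X x" using x0 by (auto simp: X_def)
    then have cJ: "real (card J) = N x - N (x/2)" unfolding J_def N_eq using finite_X
      by (subst card_Diff_subset) (auto simp: of_nat_diff card_mono)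
    have "a / x * kr x a \<ge> 1/2 * (sin th / pi * (1 / (4 * x)))" if a: "a \<in> J" for a
    proof -
      have a2: "x/2 < a" "a \<le> x" "0 < a" using a by (auto simp: J_def X_def zeros_def)
      show ?thesis using a2 x0 kr_lower[OF x0 a2(3) a2(2)] sin_th kr_pos[OF x0, of a]
        by (intro mult_mono) (auto simp: field_simps)
    qed
    then have "(\<Sum>a\<in>J. a / x * kr x a) \<ge> (\<Sum>a\<in>J. 1/2 * (sin th / pi * (1 / (4 * x))))" by (intro sum_mono)
    then have "zd x \<ge> real (card J) * (1/2 * (sin th / pi * (1 / (4 * x))))" using zd_lower[OF J x0] by simp
    moreover have "real (card J) * (1/2 * (sin th / pi * (1 / (4 * x)))) \<ge> (c * x powr e) * (1/2 * (sin th / pi * (1 / (4 * x))))"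
      using c(3)[OF x] cJ sin_th x0 by (intro mult_right_mono) auto
    moreover have "(c * x powr e) * (1/2 * (sin th / pi * (1 / (4 * x)))) = c' * x powr (e - 1)"
      using x0 by (simp add: c'_def powr_diff field_simps)
    ultimately show ?thesis by linarith
  qed
  then show ?thesis using c sin_th by (intro exI[of _ c'] conjI exI[of _ x0]) (auto simp: c'_def)
qed

lemma zero_exists: "\<exists>a. a \<in> zeros"
proof -
  obtain c x0 where c: "c > 0" "x0 > 0" "\<And>x. x \<ge> x0 \<Longrightarrow> N x - N (x/2) \<ge> c * x powr e" using N_gap by blast
  have "N x0 > 0" using c(3)[of x0] c N_nonneg[of "x0/2"] by (smt (verit) mult_pos_pos powr_gt_zero)
  then have "X x0 \<noteq> {}" by (auto simp: N_eq)
  then show ?thesis by (auto simp: X_def)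
qed

lemma zd_pos: "x > 0 \<Longrightarrow> zd x > 0"
proof -
  assume x: "x > 0"
  obtain a where a: "a \<in> zeros" using zero_exists by blast
  have "zd x \<ge> (\<Sum>a\<in>{a}. a / x * kr x a)" using a x by (intro zd_lower) auto
  moreover have "a / x * kr x a > 0" using a x kr_pos[OF x] by (auto simp: zeros_def)
  ultimately show ?thesis by simp
qed

lemma z_continuous: "continuous_on {0..} z"
proof -
  have "continuous_on {0..} (\<lambda>x. - 2 * p + zi x)" by (intro continuous_intros zi_continuous)
  then show ?thesis by (rule continuous_on_eq) (auto simp: z_def)
qed

lemma z_strict: "0 \<le> x \<Longrightarrow> x < y \<Longrightarrow> z x < z y"
proof -
  assume xy: "0 \<le> x" "x < y"
  show ?thesis
  proof (rule DERIV_pos_imp_increasing_open[OF xy(2)])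
    fix t assume "x < t" "t < y"
    then show "\<exists>D. (z has_real_derivative D) (at t) \<and> 0 < D" using z_deriv[of t] zd_pos[of t] xy by auto
  next
    show "continuous_on {x..y} z" using z_continuous by (rule continuous_on_subset) (use xy in auto)
  qed
qed

lemma z_inj: "0 \<le> x \<Longrightarrow> 0 \<le> y \<Longrightarrow> z x = z y \<Longrightarrow> x = y"
  using z_strict[of x y] z_strict[of y x] by linarith

lemma z_le_iff: "0 \<le> x \<Longrightarrow> 0 \<le> y \<Longrightarrow> z x \<le> z y \<longleftrightarrow> x \<le> y"
  using z_strict[of x y] z_strict[of y x] by force

lemma z_0: "z 0 = - 2 * p" by (simp add: z_def zi_0)

text \<open>The mean value theorem between x/2 and x turns the lower bound on the derivative into
  growth of order x^e.\<close>

lemma z_at_top: "filterlim z at_top at_top"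
proof -
  obtain c x0 where c: "c > 0" "x0 > 0" "\<And>x. x \<ge> x0 \<Longrightarrow> zd x \<ge> c * x powr (e - 1)" using zd_growth by blast
  have lo: "z x \<ge> - 2 * p + c / 2 * x powr e" if x: "x \<ge> 2 * x0" for x
  proof -
    have x0: "x > 0" using x c by simp
    have "\<exists>t>x/2. t < x \<and> z x - z (x/2) = (x - x/2) * zd t"
      using x0 by (intro MVT2) (auto intro: z_deriv)
    then obtain t where t: "x/2 < t" "t < x" "z x - z (x/2) = x/2 * zd t" by auto
    have "zd t \<ge> c * t powr (e - 1)" using c t x by auto
    moreover have "t powr (e - 1) \<ge> x powr (e - 1)" using t x0 e_bounds by (intro powr_mono2') auto
    ultimately have "zd t \<ge> c * x powr (e - 1)" using c(1) by (meson mult_left_mono less_imp_le order_trans)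
    then have "x/2 * zd t \<ge> x/2 * (c * x powr (e - 1))" using x0 by (intro mult_left_mono) auto
    also have "x/2 * (c * x powr (e - 1)) = c / 2 * x powr e" using x0 by (simp add: powr_diff)
    finally show ?thesis using t(3) z_strict[of 0 "x/2"] x0 z_0 by simp
  qed
  have "filterlim (\<lambda>x. - 2 * p + c / 2 * x powr e) at_top at_top"
    using c(1) e_bounds by real_asymp
  then show ?thesis
    by (rule filterlim_at_top_mono) (use lo in \<open>auto simp: eventually_at_top_linorder intro!: exI[of _ "2*x0"]\<close>)
qed

lemma z_attains: assumes "t \<ge> - 2 * p" shows "\<exists>x\<ge>0. z x = t"
proof -
  have "\<forall>\<^sub>F x in at_top. z x \<ge> t" using z_at_top by (simp add: filterlim_at_top)
  then obtain b0 where b0: "\<And>x. x \<ge> b0 \<Longrightarrow> z x \<ge> t" unfolding eventually_at_top_linorder by blast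
  define b where "b = max b0 0"
  have "continuous_on {0..b} z" using z_continuous by (rule continuous_on_subset) auto
  then obtain x where "0 \<le> x" "x \<le> b" "z x = t"
    using IVT'[of z 0 t b] assms b0[of b] z_0 by (auto simp: b_def)
  then show ?thesis by blast
qed

lemma xk_eq: "x \<ge> 0 \<Longrightarrow> z x = real_of_int k + 1/2 \<Longrightarrow> xk \<alpha> p Q k = x"
  unfolding xk_def assoc_fun_eq by (rule the_equality) (auto intro: z_inj)

lemma xk: assumes "k \<in> Zp p" shows "xk \<alpha> p Q k \<ge> 0" "z (xk \<alpha> p Q k) = real_of_int k + 1/2"
proof -
  have "real_of_int k + 1/2 \<ge> - 2 * p" using assms by (simp add: Zp_def)
  from z_attains[OF this] obtain x where "x \<ge> 0" "z x = real_of_int k + 1/2" by blast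
  with xk_eq[OF this] show "xk \<alpha> p Q k \<ge> 0" "z (xk \<alpha> p Q k) = real_of_int k + 1/2" by auto
qed

text \<open>The Bethe equation at a zero says exp (2 pi i z) = -1, so z is a half-integer there; z x
  > z 0 = -2p puts the integer into \<open>Zp p\<close>.\<close>

lemma zero_quantised: assumes x: "x \<in> zeros" shows "\<exists>k\<in>Zp p. z x = real_of_int k + 1/2"
proof -
  have x0: "x > 0" "Q (of_real x) = 0" using x by (auto simp: zeros_def)
  have "exp (- 4 * pi * \<i> * of_real p) * Q (of_real x * cis (- th)) / Q (of_real x * cis th) = -1"
    using sol x0(2) unfolding bae_solution_def by blast
  then have "exp (- 4 * pi * \<i> * of_real p) * exp (2 * pi * \<i> * of_real (zi x)) = -1"
    using exp_ZI[OF x0(1)] by (simp add: ZI_real[OF x0(1)])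
  moreover have "- 4 * pi * \<i> * of_real p + 2 * pi * \<i> * of_real (zi x) = 2 * pi * \<i> * of_real (z x)"
    using x0 by (simp add: z_pos algebra_simps)
  ultimately have "exp (2 * pi * \<i> * of_real (z x)) = -1" by (metis exp_add)
  also have "-1 = exp (pi * \<i>)" by simp
  finally obtain n :: int where "2 * pi * \<i> * complex_of_real (z x) = pi * \<i> + of_int (2 * n) * pi * \<i>"
    unfolding exp_eq by blast
  then have "2 * pi * \<i> * (complex_of_real (z x) - of_int n - 1/2) = 0" by (simp add: algebra_simps)
  then have "complex_of_real (z x) - of_int n - 1/2 = 0" by simp
  then have "complex_of_real (z x - real_of_int n - 1/2) = 0" by simp
  then have zn: "z x = real_of_int n + 1/2" unfolding of_real_eq_0_iff by simp
  have "z 0 < z x" using x0 by (intro z_strict) auto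
  then have "n \<in> Zp p" using zn z_0 by (simp add: Zp_def)
  then show ?thesis using zn by blast
qed

lemma X_eq_image: assumes y: "y \<ge> 0"
  shows "X y = xk \<alpha> p Q ` {k \<in> Zp p - holes \<alpha> p Q. real_of_int k + 1/2 \<le> z y}"
proof safe
  fix x assume "x \<in> X y"
  then have x: "x \<in> zeros" "x \<le> y" "x > 0" by (auto simp: X_def zeros_def)
  obtain k where k: "k \<in> Zp p" "z x = real_of_int k + 1/2" using zero_quantised[OF x(1)] by blast
  have xk: "xk \<alpha> p Q k = x" using xk_eq k x by simp
  have "k \<notin> holes \<alpha> p Q" using x xk by (simp add: holes_def zeros_def)
  moreover have "z x \<le> z y" using x y by (simp add: z_le_iff)
  ultimately show "x \<in> xk \<alpha> p Q ` {k \<in> Zp p - holes \<alpha> p Q. real_of_int k + 1/2 \<le> z y}" using k xk by force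
next
  fix k assume k: "k \<in> Zp p" "k \<notin> holes \<alpha> p Q" "real_of_int k + 1/2 \<le> z y"
  note x = xk[OF k(1)]
  have q: "Q (of_real (xk \<alpha> p Q k)) = 0" using k by (simp add: holes_def)
  \<comment> \<open>The index with k + 1/2 = -2p has \<open>xk\<close> equal to 0; it cannot belong
    to a zero as Q 0 = 1.\<close>
  then have "xk \<alpha> p Q k \<noteq> 0" using Q0 by (metis of_real_0 zero_neq_one)
  then show "xk \<alpha> p Q k \<in> X y" using x q k z_le_iff[OF x(1) y] by (auto simp: X_def zeros_def)
qed

lemma kappa_least: "kappa \<alpha> p Q \<in> Zp p - holes \<alpha> p Q" "\<And>k. k \<in> Zp p - holes \<alpha> p Q \<Longrightarrow> kappa \<alpha> p Q \<le> k"
proof -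
  let ?B = "Zp p - holes \<alpha> p Q"
  define L where "L = \<lceil>- 2 * p - 1/2\<rceil>"
  have L: "k \<in> Zp p \<longleftrightarrow> L \<le> k" for k unfolding Zp_def L_def by (simp add: ceiling_le_iff)
  have "infinite (Zp p)"
  proof -
    have "Zp p = {L..}" using L by auto
    then show ?thesis by (simp add: infinite_Ici)
  qed
  then have "?B \<noteq> {}" using fin_holes by (metis Diff_eq_empty_iff finite_subset)
  then obtain k0 where k0: "k0 \<in> ?B" by blast
  \<comment> \<open>\<open>LEAST\<close> on integers requires that a minimum exists; shifting by the
    lower bound \<open>L\<close> of \<open>Zp p\<close> reduces this to natural numbers.\<close>
  from ex_has_least_nat[of "\<lambda>k. k \<in> ?B" k0 "\<lambda>k. nat (k - L)", OF k0]
  obtain k where k: "k \<in> ?B" "\<And>j. j \<in> ?B \<Longrightarrow> nat (k - L) \<le> nat (j - L)" by blast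
  have le: "k \<le> j" if "j \<in> ?B" for j using k(2)[OF that] k(1) that L by auto
  have "kappa \<alpha> p Q = k" unfolding kappa_def by (rule Least_equality) (use k le in auto)
  then show "kappa \<alpha> p Q \<in> ?B" "\<And>k. k \<in> ?B \<Longrightarrow> kappa \<alpha> p Q \<le> k" using k le by auto
qed

abbreviation "S \<equiv> real_of_int (sector \<alpha> p Q)"

text \<open>Once z has passed every hole above kappa, the zeros up to y correspond to the integers
  from kappa to m = floor (z - 1/2) without those holes. Their number is m + 1 - kappa minus the
  number of holes, and m + 1 = floor (z + 1/2), so exactly the sector is subtracted.\<close>

lemma N_count: "\<exists>y0>0. \<forall>y\<ge>y0. N y = real_of_int \<lfloor>z y + 1/2\<rfloor> - S"
proof -
  let ?\<kappa> = "kappa \<alpha> p Q" and ?Hk = "holes_kappa \<alpha> p Q"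
  have fk: "finite ?Hk" using fin_holes by (simp add: holes_kappa_def)
  obtain b where b: "\<And>k. k \<in> ?Hk \<Longrightarrow> k \<le> b" using fk by (meson Max_ge)
  define T where "T = real_of_int (max b ?\<kappa>) + 1"
  have "\<forall>\<^sub>F x in at_top. z x \<ge> T" using z_at_top by (simp add: filterlim_at_top)
  then obtain y1 where y1: "\<And>x. x \<ge> y1 \<Longrightarrow> z x \<ge> T" unfolding eventually_at_top_linorder by blast
  have "N y = real_of_int \<lfloor>z y + 1/2\<rfloor> - S" if y: "y \<ge> max y1 1" for y
  proof -
    define m where "m = \<lfloor>z y - 1/2\<rfloor>"
    have zy: "z y \<ge> T" using y1 y by simp
    have m: "b \<le> m" "?\<kappa> \<le> m" using zy unfolding m_def T_def by (simp_all add: le_floor_iff)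
    have set: "{k \<in> Zp p - holes \<alpha> p Q. real_of_int k + 1/2 \<le> z y} = {?\<kappa>..m} - ?Hk"
    proof safe
      fix k assume k: "k \<in> Zp p" "k \<notin> holes \<alpha> p Q" "real_of_int k + 1/2 \<le> z y"
      then show "k \<in> {?\<kappa>..m}" using kappa_least(2)[of k] by (auto simp: m_def le_floor_iff)
      assume "k \<in> ?Hk" then show False using k by (simp add: holes_kappa_def)
    next
      fix k assume k: "k \<in> {?\<kappa>..m}" "k \<notin> ?Hk"
      show "k \<in> Zp p" using k kappa_least(1) by (auto simp: Zp_def)
      show False if "k \<in> holes \<alpha> p Q" using that k kappa_least(1) by (cases "k = ?\<kappa>") (auto simp: holes_kappa_def)
      show "real_of_int k + 1/2 \<le> z y" using k by (auto simp: m_def le_floor_iff)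
    qed
    have inj: "inj_on (xk \<alpha> p Q) (Zp p)"
    proof (rule inj_onI)
      fix j k assume jk: "j \<in> Zp p" "k \<in> Zp p" "xk \<alpha> p Q j = xk \<alpha> p Q k"
      have "real_of_int j + 1/2 = z (xk \<alpha> p Q j)" by (rule xk(2)[OF jk(1), symmetric])
      also have "\<dots> = real_of_int k + 1/2" unfolding jk(3) by (rule xk(2)[OF jk(2)])
      finally show "j = k" by simp
    qed
    have y0: "y \<ge> 0" using y by simp
    have cX: "card (X y) = card ({?\<kappa>..m} - ?Hk)"
      unfolding X_eq_image[OF y0] set[symmetric]
      by (rule card_image[OF inj_on_subset[OF inj]]) auto
    have sub: "?Hk \<subseteq> {?\<kappa>..m}"
    proof
      fix k assume k: "k \<in> ?Hk"
      then have "k \<le> m" using b[OF k] m by linarith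
      then show "k \<in> {?\<kappa>..m}" using k by (auto simp: holes_kappa_def)
    qed
    have "card (X y) = card ({?\<kappa>..m} - ?Hk)" using cX .
    also have "card ({?\<kappa>..m} - ?Hk) = card {?\<kappa>..m} - card ?Hk"
      using fk sub by (rule card_Diff_subset)
    also have "card {?\<kappa>..m} = nat (m - ?\<kappa> + 1)" by simp
    finally have c: "card (X y) = nat (m - ?\<kappa> + 1) - card ?Hk" .
    have "card ?Hk \<le> card {?\<kappa>..m}" using sub by (intro card_mono) auto
    then have "int (card (X y)) = m - ?\<kappa> + 1 - int (card ?Hk)" using c m by simp
    then have "int (card (X y)) = m + 1 - sector \<alpha> p Q" by (simp add: sector_def)
    moreover have "\<lfloor>z y + 1/2\<rfloor> = m + 1"
    proof -
      show ?thesis unfolding m_def by linarith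
    qed
    ultimately have "int (card (X y)) = \<lfloor>z y + 1/2\<rfloor> - sector \<alpha> p Q" by simp
    then show ?thesis unfolding N_eq by (metis of_int_diff of_int_of_nat_eq)
  qed
  then show ?thesis by (intro exI[of _ "max y1 1"]) auto
qed

end

section \<open>The remainder of the associated function\<close>

definition saw :: "real \<Rightarrow> real" where "saw t = real_of_int \<lfloor>t + 1/2\<rfloor> - t"

lemma saw_bound: "\<bar>saw t\<bar> \<le> 1/2"
  unfolding saw_def by linarith

text \<open>Mean zero of the sawtooth shows here as a bounded antiderivative, valid away from the
  jumps.\<close>

lemma saw_deriv:
  assumes "t + 1/2 \<notin> \<int>"
  shows "((\<lambda>t. - (saw t)\<^sup>2 / 2) has_real_derivative saw t) (at t)"
proof -
  define k where "k = \<lfloor>t + 1/2\<rfloor>"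
  have k: "real_of_int k < t + 1/2" "t + 1/2 < real_of_int k + 1"
    using assms unfolding k_def by (metis Ints_of_int floor_correct less_eq_real_def, linarith)
  have "((\<lambda>t. - (real_of_int k - t)\<^sup>2 / 2) has_real_derivative (real_of_int k - t)) (at t)"
    by (auto intro!: derivative_eq_intros simp: field_simps)
  moreover have ev: "\<forall>\<^sub>F s in nhds t. - (saw s)\<^sup>2 / 2 = - (real_of_int k - s)\<^sup>2 / 2"
  proof (unfold eventually_nhds, intro exI conjI ballI)
    show "open {real_of_int k - 1/2<..<real_of_int k + 1/2}" by simp
    show "t \<in> {real_of_int k - 1/2<..<real_of_int k + 1/2}" using k by auto
    fix s assume "s \<in> {real_of_int k - 1/2<..<real_of_int k + 1/2}"
    then have "\<lfloor>s + 1/2\<rfloor> = k" by (intro floor_unique) auto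
    then show "- (saw s)\<^sup>2 / 2 = - (real_of_int k - s)\<^sup>2 / 2" by (simp add: saw_def)
  qed
  ultimately have "((\<lambda>t. - (saw t)\<^sup>2 / 2) has_real_derivative (real_of_int k - t)) (at t)"
    using DERIV_cong_ev[OF refl ev refl] by blast
  then show ?thesis by (simp add: saw_def k_def)
qed

text \<open>At a jump \<open>saw\<close> switches from -1/2 to 1/2, so its square is continuous: it
  is the squared distance to the nearest integer.\<close>

lemma saw_sq_continuous: "isCont (\<lambda>t. (saw t)\<^sup>2) t"
proof -
  \<comment> \<open>Within distance 1 of an integer k only k - 1, k and k + 1 can be nearest, so
    locally the distance is a minimum of three continuous functions.\<close>
  have eq: "(saw s)\<^sup>2 = (min \<bar>s - real_of_int k\<bar> (min \<bar>s - real_of_int (k - 1)\<bar> \<bar>s - real_of_int (k+1)\<bar>))\<^sup>2"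
    if "\<bar>s - real_of_int k\<bar> < 1" for s k
  proof -
    have "\<lfloor>s + 1/2\<rfloor> = k - 1 \<or> \<lfloor>s + 1/2\<rfloor> = k \<or> \<lfloor>s + 1/2\<rfloor> = k + 1"
      using that by linarith
    moreover have "\<bar>saw s\<bar> \<le> 1/2" by (rule saw_bound)
    ultimately have "\<bar>saw s\<bar> = min \<bar>s - real_of_int k\<bar> (min \<bar>s - real_of_int (k - 1)\<bar> \<bar>s - real_of_int (k+1)\<bar>)"
      using that unfolding saw_def by (elim disjE) (simp_all, linarith+)
    then show ?thesis by (metis power2_abs)
  qed
  define k where "k = \<lfloor>t\<rfloor>"
  have k: "\<bar>t - real_of_int k\<bar> < 1" unfolding k_def by linarith
  let ?g = "\<lambda>s. (min \<bar>s - real_of_int k\<bar> (min \<bar>s - real_of_int (k - 1)\<bar> \<bar>s - real_of_int (k+1)\<bar>))\<^sup>2"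
  have "isCont ?g t" by (intro continuous_intros)
  moreover have ev: "\<forall>\<^sub>F s in nhds t. (saw s)\<^sup>2 = ?g s"
  proof (unfold eventually_nhds, intro exI conjI ballI)
    show "open {s. \<bar>s - real_of_int k\<bar> < 1}" by (intro open_Collect_less continuous_intros)
  qed (use k eq in auto)
  ultimately show ?thesis using isCont_cong[OF ev] by blast
qed

context angle
begin

lemma kern_deriv_y:
  assumes w: "w \<in> sec"
  shows "((\<lambda>y. kern w y) has_vector_derivative - kern w y * (1 / (of_real y - w * cis th) + 1 / (of_real y - w * cis (-th)))) (at y)"
proof -
  note nz = kern_nz[OF w, of y]
  have "((\<lambda>u. 1 / (u - w * cis th) - 1 / (u - w * cis (- th))) has_field_derivative
     - (1 / (of_real y - w * cis th))\<^sup>2 + (1 / (of_real y - w * cis (-th)))\<^sup>2) (at (of_real y))"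
    using nz by (auto intro!: derivative_eq_intros simp: power2_eq_square)
  from DERIV_cmult[OF this, of "1 / (2 * pi * \<i>)"]
  have "((\<lambda>u. 1 / (2 * pi * \<i>) * (1 / (u - w * cis th) - 1 / (u - w * cis (- th)))) has_field_derivative
     1 / (2 * pi * \<i>) * (- (1 / (of_real y - w * cis th))\<^sup>2 + (1 / (of_real y - w * cis (-th)))\<^sup>2)) (at (of_real y))" .
  moreover have "1 / (2 * pi * \<i>) * (- (1 / (of_real y - w * cis th))\<^sup>2 + (1 / (of_real y - w * cis (-th)))\<^sup>2)
     = - kern w y * (1 / (of_real y - w * cis th) + 1 / (of_real y - w * cis (-th)))"
  proof -
    have gen: "c * (- A\<^sup>2 + B\<^sup>2) = - (c * (A - B)) * (A + B)" for c A B :: complex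
      by (simp add: power2_eq_square algebra_simps)
    show ?thesis unfolding kern_def by (rule gen)
  qed
  ultimately have "((\<lambda>u. 1 / (2 * pi * \<i>) * (1 / (u - w * cis th) - 1 / (u - w * cis (- th)))) has_field_derivative
     - kern w y * (1 / (of_real y - w * cis th) + 1 / (of_real y - w * cis (-th)))) (at (of_real y))" by simp
  then show ?thesis unfolding kern_def[abs_def] by (rule has_vector_derivative_real_field)
qed

lemma kern_continuous_y: "w \<in> sec \<Longrightarrow> continuous_on A (kern w)"
  using has_vector_derivative_continuous[OF kern_deriv_y] by (simp add: continuous_at_imp_continuous_on)

end

section \<open>The convolution equation for the remainder\<close>

context bae
begin

lemma th_e: "th * e = pi / \<alpha>" "th / pi = 2 / (1 + \<alpha>)"
proof -
  have "1 + \<alpha> \<noteq> 0" "\<alpha> \<noteq> 0" using \<alpha> by auto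
  then show "th * e = pi / \<alpha>" "th / pi = 2 / (1 + \<alpha>)" by (simp_all add: bae_theta_def bae_exp_def)
qed

text \<open>From th e = pi / \<alpha> and 2 pi e = pi + pi / \<alpha> follows (pi - th) e = pi - pi
  e. So the multiplier at e is 1, and x^e can be the leading term of both N and z.\<close>

lemma khat_e: "sin ((pi - th) * e) = sin (pi * e)" "sin (pi * e) > 0"
proof -
  have "(pi - th) * e = pi - pi * e"
  proof -
    have "2 * pi * e = pi + th * e" unfolding th_e using \<alpha> by (simp add: bae_exp_def field_simps)
    then show ?thesis by (simp add: algebra_simps)
  qed
  then show "sin ((pi - th) * e) = sin (pi * e)" by simp
  show "sin (pi * e) > 0" using e_bounds by (intro sin_gt_zero) auto
qed

text \<open>The multiplier is even, so t = -s is used. The sum-to-product formula gives sin (pi t) -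
  sin ((pi - th) t) = 2 sin (th t / 2) cos ((pi - th/2) t), and the cosine stays positive while (pi
  - th/2) t < pi / 2, that is for t < e.\<close>

lemma khat_less: assumes s: "- e < s" "s < 0" shows "sin ((pi - th) * s) / sin (pi * s) < 1"
proof -
  define t where "t = - s"
  have t: "0 < t" "t < e" using s by (auto simp: t_def)
  have st: "sin (pi * t) > 0" using t e_bounds by (intro sin_gt_zero) auto
  have "sin (pi * t) - sin ((pi - th) * t) = 2 * sin ((pi * t - (pi - th) * t) / 2) * cos ((pi * t + (pi - th) * t) / 2)"
    by (rule sin_diff_sin)
  also have "(pi * t - (pi - th) * t) / 2 = th * t / 2" by (simp add: algebra_simps)
  also have "(pi * t + (pi - th) * t) / 2 = (pi - th / 2) * t" by (simp add: field_simps)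
  also have "2 * sin (th * t / 2) * cos ((pi - th / 2) * t) > 0"
  proof -
    have p1: "0 < th * t / 2" "0 < (pi - th/2) * t" using t th by simp_all
    have "th * t < pi * 1" using t th e_bounds by (intro mult_strict_mono) auto
    then have p2: "th * t / 2 < pi" using pi_gt_zero by linarith
    have "(pi - th/2) * t < (pi - th/2) * e" using t th by (intro mult_strict_left_mono) auto
    also have "\<dots> = pi / 2"
    proof -
      have "(pi - th/2) * e = pi * e - (th * e) / 2" by (simp add: algebra_simps)
      then show ?thesis unfolding th_e using \<alpha> by (simp add: bae_exp_def field_simps)
    qed
    finally have p3: "(pi - th/2) * t < pi / 2" .
    show ?thesis using sin_gt_zero[OF p1(1) p2] cos_gt_zero[OF p1(2) p3] by simp
  qed
  finally have "sin ((pi - th) * t) < sin (pi * t)" by simp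
  then have "sin ((pi - th) * t) / sin (pi * t) < 1" using st by simp
  then show ?thesis by (simp add: t_def)
qed

text \<open>The expected constant term of \<open>N\<close> with the oscillation left out. The
  transform multiplies it by 1 - th / pi, and z is N + S up to the sawtooth; so it must solve Cc + S
  = -2p + Cc (1 - th / pi).\<close>

definition Cc :: real where "Cc = - (1 + \<alpha>) * (2 * p + S) / 2"
definition r :: "real \<Rightarrow> real" where "r x = z x - x powr e + p * (1 + \<alpha>) + S / 2 * (\<alpha> - 1)"
definition R :: "complex \<Rightarrow> complex" where "R w = ZI w - w powr of_real e - of_real (Cc * (1 - th / pi))"
definition \<psi> :: "real \<Rightarrow> real" where "\<psi> y = N y - z y + S"

lemma Cc_eq: "Cc * (1 - th / pi) = - (\<alpha> - 1) * (2 * p + S) / 2" "Cc + S = - 2 * p + Cc * (1 - th/pi)"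
  unfolding Cc_def th_e using \<alpha> by (auto simp: field_simps)

lemma R_of_real: "x > 0 \<Longrightarrow> R (of_real x) = of_real (r x)"
  unfolding R_def r_def Cc_eq ZI_real z_pos[OF less_imp_le]
  by (simp add: powr_of_real field_simps complex_eq_iff)

lemma R_holomorphic: "R holomorphic_on sec"
proof -
  have "w \<notin> \<real>\<^sub>\<le>\<^sub>0" if "w \<in> sec" for w using sec_Re(1)[OF that] by (auto simp: complex_nonpos_Reals_iff)
  then show ?thesis unfolding R_def using ZI_holomorphic by (intro holomorphic_intros) auto
qed

lemma z_measurable: "(\<lambda>y. indicator {0<..} y * z y) \<in> borel_measurable borel"
  unfolding real_scaleR_def[symmetric]
proof (rule borel_measurable_continuous_on_indicator)
  show "continuous_on {0<..} z" by (rule continuous_on_subset[OF z_continuous]) auto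
qed simp

lemma phi_eq: "y > 0 \<Longrightarrow> N y - y powr e - Cc = r y + \<psi> y"
  by (simp add: r_def \<psi>_def Cc_def field_simps)

lemma one_bound: "\<And>y. y > 0 \<Longrightarrow> norm (complex_of_real c) \<le> \<bar>c\<bar> * y powr 0" by simp

text \<open>The subtracted terms are compatible with the transform: y^e goes to w^e, and the
  constant \<open>Cc\<close> to the constant in \<open>R\<close>. Since the data equal r + \<psi>
  for positive y, this is the convolution equation for r on the real axis and a representation of
  \<open>R\<close> off it.\<close>

lemma R_integral:
  assumes w: "w \<in> sec"
  shows "set_integrable lborel {0<..} (\<lambda>y. of_real (N y - y powr e - Cc) * kern w y)"
    "R w = (LINT y:{0<..}|lborel. of_real (N y - y powr e - Cc) * kern w y)"
proof -
  have i1: "set_integrable lborel {0<..} (\<lambda>y. of_real (y powr e) * kern w y)"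
    by (rule kern_bound_integrable(1)[OF w e_abs, of _ 1]) auto
  have i2: "set_integrable lborel {0<..} (\<lambda>y. of_real Cc * kern w y)"
    by (rule kern_bound_integrable(1)[OF w _ _ one_bound]) auto
  have eq: "of_real (N y - y powr e - Cc) * kern w y = of_real (N y) * kern w y - of_real (y powr e) * kern w y - of_real Cc * kern w y" for y
    by (simp add: algebra_simps)
  show "set_integrable lborel {0<..} (\<lambda>y. of_real (N y - y powr e - Cc) * kern w y)"
    unfolding eq by (intro set_integral_diff i1 i2 N_kern_integrable w)
  have "(LINT y:{0<..}|lborel. of_real (N y - y powr e - Cc) * kern w y) = ZI w - (LINT y:{0<..}|lborel. of_real (y powr e) * kern w y) - (LINT y:{0<..}|lborel. of_real Cc * kern w y)"
    unfolding eq ZI_def using i1 i2 N_kern_integrable[OF w] by (simp add: set_integral_diff)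
  also have "\<dots> = R w"
    unfolding R_def kern_power_pos[OF w e_bounds(3,2)] set_integral_mult_right kern_integral[OF w]
    using khat_e by simp
  finally show "R w = (LINT y:{0<..}|lborel. of_real (N y - y powr e - Cc) * kern w y)" by simp
qed

lemma psi_bounded_ex: "\<exists>B y0. y0 > 0 \<and> (\<forall>y>0. \<bar>\<psi> y\<bar> \<le> B) \<and> (\<forall>y\<ge>y0. \<psi> y = saw (z y))"
proof -
  obtain y0 where y0: "y0 > 0" "\<And>y. y \<ge> y0 \<Longrightarrow> N y = real_of_int \<lfloor>z y + 1/2\<rfloor> - S" using N_count by blast
  have s: "\<psi> y = saw (z y)" if "y \<ge> y0" for y using y0(2)[OF that] by (simp add: \<psi>_def saw_def)
  define B where "B = N y0 + \<bar>z 0\<bar> + \<bar>z y0\<bar> + \<bar>S\<bar> + 1"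
  have "\<bar>\<psi> y\<bar> \<le> B" if y: "y > 0" for y
  proof (cases "y \<ge> y0")
    case True
    then show ?thesis using s[OF True] saw_bound[of "z y"] N_nonneg[of y0] by (simp add: B_def)
  next
    case False
    have "z 0 \<le> z y" "z y \<le> z y0" using z_le_iff[of 0 y] z_le_iff[of y y0] y False by auto
    moreover have "0 \<le> N y" "N y \<le> N y0" using N_nonneg N_mono False by auto
    ultimately show ?thesis unfolding \<psi>_def B_def by linarith
  qed
  then show ?thesis using y0 s by blast
qed

text \<open>The second derivative is read off from Euler operators: w^2 f'' = D^2 f - D f, and both
  iterates are of order e in a sector.\<close>

lemma ZI_derivative_bounds: "\<exists>C M. M > 0 \<and> (\<forall>x\<ge>M. norm (deriv (deriv ZI) (of_real x)) \<le> C * x powr (e - 2))"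
proof -
  obtain C where C: "\<And>w. w \<in> sec \<Longrightarrow> norm (ZI w) \<le> C * norm w powr e" using ZI_bound_ex by blast
  have C0: "C \<ge> 0" using C[of 1] of_real_sec[of 1] order_trans[OF norm_ge_zero C[of 1]] by simp
  have bd: "norm (ZI w) \<le> (C * 2 powr e) * Re w powr e" if w: "w \<in> wedge m0 0" for w
  proof -
    have "norm w powr e \<le> (2 * Re w) powr e" using sec_Re[OF w] e_bounds by (intro powr_mono2) auto
    also have "\<dots> = 2 powr e * Re w powr e" using sec_Re[OF w] by (simp add: powr_mult)
    finally have "C * norm w powr e \<le> C * (2 powr e * Re w powr e)" using C0 by (rule mult_left_mono)
    then show ?thesis using C[OF w] by simp
  qed
  obtain C1 m1 M1 where 1: "m1 > 0" "M1 \<ge> 0" "\<And>w. w \<in> wedge m1 M1 \<Longrightarrow> norm ((cDop ^^ 1) ZI w) \<le> C1 * Re w powr e"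
    using cDop_wedge_bound[OF m0 order_refl ZI_holomorphic bd, of 1] by auto
  obtain C2 m2 M2 where 2: "m2 > 0" "M2 \<ge> 0" "\<And>w. w \<in> wedge m2 M2 \<Longrightarrow> norm ((cDop ^^ 2) ZI w) \<le> C2 * Re w powr e"
    using cDop_wedge_bound[OF m0 order_refl ZI_holomorphic bd, of 2] by auto
  have "norm (deriv (deriv ZI) (of_real x)) \<le> (C1 + C2) * x powr (e - 2)" if x: "x \<ge> max M1 M2 + 1" for x
  proof -
    have x0: "x > 0" "x > M1" "x > M2" using x 1 2 by auto
    have sx: "complex_of_real x \<in> sec" using x0 by simp
    have dh: "deriv ZI holomorphic_on sec" using ZI_holomorphic open_wedge by (rule holomorphic_deriv)
    have "((\<lambda>w. w * deriv ZI w) has_field_derivative deriv ZI (of_real x) + of_real x * deriv (deriv ZI) (of_real x)) (at (of_real x))"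
      using holomorphic_derivI[OF dh open_wedge sx] by (auto intro!: derivative_eq_intros)
    then have "deriv (cDop ZI) (of_real x) = deriv ZI (of_real x) + of_real x * deriv (deriv ZI) (of_real x)"
      unfolding cDop_def by (rule DERIV_imp_deriv)
    then have "(cDop ^^ 2) ZI (of_real x) = (cDop ^^ 1) ZI (of_real x) + of_real x ^ 2 * deriv (deriv ZI) (of_real x)"
      by (simp add: numeral_2_eq_2 cDop_def[of "cDop ZI"]) (simp add: cDop_def algebra_simps)
    then have "of_real x ^ 2 * deriv (deriv ZI) (of_real x) = (cDop ^^ 2) ZI (of_real x) - (cDop ^^ 1) ZI (of_real x)" by simp
    then have "norm (of_real x ^ 2 * deriv (deriv ZI) (of_real x)) \<le> norm ((cDop ^^ 2) ZI (of_real x)) + norm ((cDop ^^ 1) ZI (of_real x))"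
      by (metis norm_triangle_ineq4)
    also have "\<dots> \<le> C2 * x powr e + C1 * x powr e"
      using 1(3)[of "of_real x"] 2(3)[of "of_real x"] of_real_wedge[OF 1(1,2)] of_real_wedge[OF 2(1,2)] x0 by (intro add_mono) auto
    finally have "x ^ 2 * norm (deriv (deriv ZI) (of_real x)) \<le> (C1 + C2) * x powr e"
      using x0 by (simp add: norm_mult norm_power algebra_simps)
    then have "norm (deriv (deriv ZI) (of_real x)) \<le> (C1 + C2) * x powr e / x ^ 2"
      using x0 by (simp add: pos_le_divide_eq mult.commute)
    also have "\<dots> = (C1 + C2) * x powr (e - 2)" using x0 by (simp add: powr_diff)
    finally show ?thesis .
  qed
  then show ?thesis using 1 2 by (intro exI[of _ "C1 + C2"] exI[of _ "max M1 M2 + 1"]) auto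
qed

lemma zd_deriv: "x > 0 \<Longrightarrow> (zd has_real_derivative Re (deriv (deriv ZI) (of_real x))) (at x)"
proof -
  assume x: "x > 0"
  have dh: "deriv ZI holomorphic_on sec" using ZI_holomorphic open_wedge by (rule holomorphic_deriv)
  have "(deriv ZI has_field_derivative deriv (deriv ZI) (of_real x)) (at (of_real x))"
    using holomorphic_derivI[OF dh open_wedge] x by simp
  then have "((\<lambda>x. deriv ZI (of_real x)) has_vector_derivative deriv (deriv ZI) (of_real x)) (at x)"
    by (rule has_vector_derivative_real_field)
  then show ?thesis unfolding zd_def
    by (simp add: has_real_derivative_iff_has_vector_derivative bounded_linear.has_vector_derivative[OF bounded_linear_Re])
qed

text \<open>The sawtooth has mean zero, so integrating by parts against it gains a factor
  of order |w| to the power -e.\<close>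

lemma psi_kern_bound_ex: "\<exists>C. \<forall>w\<in>sec. norm w \<ge> 1 \<longrightarrow> norm (LINT y:{0<..}|lborel. of_real (\<psi> y) * kern w y) \<le> C * norm w powr (- e)"
proof -
  obtain B y1 where B: "y1 > 0" "\<And>y. y > 0 \<Longrightarrow> \<bar>\<psi> y\<bar> \<le> B" "\<And>y. y \<ge> y1 \<Longrightarrow> \<psi> y = saw (z y)" using psi_bounded_ex by blast
  obtain c x0 where c: "c > 0" "x0 > 0" "\<And>x. x \<ge> x0 \<Longrightarrow> zd x \<ge> c * x powr (e - 1)" using zd_growth by blast
  obtain C2 M where C2: "M > 0" "\<And>x. x \<ge> M \<Longrightarrow> norm (deriv (deriv ZI) (of_real x)) \<le> C2 * x powr (e - 2)" using ZI_derivative_bounds by blast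
  define y0 where "y0 = max (max y1 x0) M"
  have y0: "y0 > 0" "y0 \<ge> y1" "y0 \<ge> x0" "y0 \<ge> M" using B(1) by (auto simp: y0_def)
  have B0: "B \<ge> 0" using B(2)[of 1] by simp
  have C20: "C2 \<ge> 0" using order_trans[OF norm_ge_zero C2(2)[of M]] C2(1) by (simp add: zero_le_mult_iff)
  \<comment> \<open>\<open>D\<close> collects the two terms in the derivative of kern / zd.
    \<open>K\<close> adds two boundary terms and the remaining integral; the factor 1/8 is the bound
    for half the squared sawtooth.\<close>
  define D where "D = 2 / c1 / c + C2 / c\<^sup>2"
  have D0: "D \<ge> 0" using c C20 c1 by (simp add: D_def)
  define K where "K = 2 * (1 / 8 * (1 / (c1\<^sup>2 * c))) + 1/8 * D / c1\<^sup>2 * Beta (1 + - e) (1 - - e)"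
  have ae: "\<bar>- e\<bar> < 1" using e_abs by simp
  have m\<psi>: "set_borel_measurable lborel A (\<lambda>y. of_real (\<psi> y) * kern w y)" if "A \<in> sets borel" "A \<subseteq> {0<..}" for A w
  proof -
    define zz where "zz = (\<lambda>y. indicator {0<..} y * z y)"
    have [measurable]: "zz \<in> borel_measurable borel" unfolding zz_def by (rule z_measurable)
    have [measurable]: "A \<in> sets borel" by (rule that(1))
    have "(\<lambda>y. indicator A y *\<^sub>R (of_real (\<psi> y) * kern w y)) = (\<lambda>y. indicator A y *\<^sub>R (of_real (N y - zz y + S) * kern w y))"
      using that(2) by (auto simp: fun_eq_iff indicator_def \<psi>_def zz_def)
    moreover have "(\<lambda>y. indicator A y *\<^sub>R (of_real (N y - zz y + S) * kern w y)) \<in> borel_measurable lborel" by measurable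
    ultimately show ?thesis unfolding set_borel_measurable_def by simp
  qed
  have tail: "norm (LINT y:{y0..Y}|lborel. of_real (\<psi> y) * kern w y) \<le> K * norm w powr (- e)" if w: "w \<in> sec" and Y: "Y \<ge> y0" for w Y
  proof -
    have nw: "norm w > 0" using sec_Re(3)[OF w] by simp
    \<comment> \<open>The integrand is split as saw (z y) zd y times kern w y / zd y. Away from the
      jumps the first factor is the derivative of the bounded function \<open>\<beta>\<close>; the
      second factor \<open>k\<close> is the one to be differentiated.\<close>
    define k where "k = (\<lambda>y. kern w y / of_real (zd y))"
    define k' where "k' = (\<lambda>y. - kern w y * (1 / (of_real y - w * cis th) + 1 / (of_real y - w * cis (-th))) / of_real (zd y)
        - kern w y * of_real (Re (deriv (deriv ZI) (of_real y))) / of_real ((zd y)\<^sup>2))"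
    define \<beta> where "\<beta> = (\<lambda>y. - (saw (z y))\<^sup>2 / 2)"
    have zdp: "zd y > 0" if "y > 0" for y using zd_pos that .
    have dk: "(k has_vector_derivative k' y) (at y)" if y: "y > 0" for y
    proof -
      have a: "(zd has_vector_derivative Re (deriv (deriv ZI) (of_real y))) (at y)"
        using zd_deriv[OF y] by (simp add: has_real_derivative_iff_has_vector_derivative)
      have "((\<lambda>y. inverse (zd y)) has_real_derivative - (Re (deriv (deriv ZI) (of_real y)) * inverse ((zd y)\<^sup>2))) (at y)"
        using DERIV_inverse_fun[OF zd_deriv[OF y]] zdp[OF y] by (simp add: power2_eq_square mult_ac)
      then have "((\<lambda>y. complex_of_real (inverse (zd y))) has_vector_derivative of_real (- (Re (deriv (deriv ZI) (of_real y)) * inverse ((zd y)\<^sup>2)))) (at y)"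
        by (intro has_vector_derivative_of_real)
      from has_vector_derivative_mult[OF kern_deriv_y[OF w, of y] this]
      show ?thesis unfolding k_def k'_def by (simp add: divide_inverse algebra_simps)
    qed
    \<comment> \<open>As e < 1, the lower bound for \<open>zd\<close> may be weakened to the power e
      - 1 of norm w + y, which combines with the kernel bound 1 / (norm w + y) into the power
      -e.\<close>
    have bk: "norm (k y) \<le> 1 / (c1\<^sup>2 * c) * norm w powr (- e)" if y: "y \<ge> y0" for y
    proof -
      have yp: "y > 0" using y y0 by simp
      let ?s = "norm w + y"
      have "zd y \<ge> c * y powr (e - 1)" using c(3) y y0 by simp
      moreover have "y powr (e - 1) \<ge> ?s powr (e - 1)" using yp e_bounds by (intro powr_mono2') auto
      ultimately have z1: "zd y \<ge> c * ?s powr (e - 1)" using c(1) by (meson mult_left_mono less_imp_le order_trans)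
      have sp: "?s > 0" by (rule add_pos_pos[OF nw yp])
      have "norm (kern w y) \<le> 1 / c1\<^sup>2 * (norm w / ?s\<^sup>2)" using norm_kern_le[OF w] yp by simp
      also have "\<dots> \<le> 1 / c1\<^sup>2 * (1 / ?s)" using yp nw by (intro mult_left_mono) (auto simp: power2_eq_square divide_simps)
      finally have k1: "norm (kern w y) \<le> 1 / c1\<^sup>2 * (1 / ?s)" .
      have alg: "(1 / c1\<^sup>2 * (1 / v)) / (c * v powr (e - 1)) = 1 / (c1\<^sup>2 * c) * v powr (- e)" if "v > 0" for v
        using that by (simp add: powr_diff powr_minus field_simps)
      have "norm (k y) = norm (kern w y) / zd y" using zdp[OF yp] by (simp add: k_def norm_divide)
      also have "\<dots> \<le> (1 / c1\<^sup>2 * (1 / ?s)) / (c * ?s powr (e - 1))"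
        using k1 z1 c(1) sp by (intro frac_le) auto
      also have "\<dots> = 1 / (c1\<^sup>2 * c) * ?s powr (- e)" by (rule alg[OF sp])
      also have "\<dots> \<le> 1 / (c1\<^sup>2 * c) * norm w powr (- e)" using nw yp c(1) e_bounds by (intro mult_left_mono powr_mono2') auto
      finally show ?thesis .
    qed
    \<comment> \<open>Relative to the kernel both terms have the same size y^(-e): (1 / y) / y^(e-1)
      from differentiating the kernel, and y^(e-2) / y^(2e-2) from differentiating 1 / zd.\<close>
    have bk': "norm (k' y) \<le> D * y powr (- e) * norm (kern w y)" if y: "y \<ge> y0" for y
    proof -
      have yp: "y > 0" using y y0 by simp
      have z1: "zd y \<ge> c * y powr (e - 1)" using c(3) y y0 by simp
      have cy: "c * y powr (e - 1) > 0" using c yp by simp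
      have lo: "norm (of_real y - w * cis th) \<ge> c1 * y" "norm (of_real y - w * cis (-th)) \<ge> c1 * y"
        using kern_den_lower[OF w, of y] yp nw c1 by (auto intro: order_trans[rotated])
      have c1y: "c1 * y > 0" using c1 yp by simp
      have "norm (1 / (of_real y - w * cis th) + 1 / (of_real y - w * cis (-th))) \<le> 1 / (c1 * y) + 1 / (c1 * y)"
        using lo c1y by (intro order_trans[OF norm_triangle_ineq] add_mono) (auto simp: norm_divide intro!: frac_le)
      then have a1: "norm (1 / (of_real y - w * cis th) + 1 / (of_real y - w * cis (-th))) \<le> 2 / c1 / y" by (simp add: mult.commute)
      have "norm (- kern w y * (1 / (of_real y - w * cis th) + 1 / (of_real y - w * cis (-th))) / of_real (zd y))
          = norm (kern w y) * norm (1 / (of_real y - w * cis th) + 1 / (of_real y - w * cis (-th))) / zd y"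
        using zdp[OF yp] by (simp add: norm_mult norm_divide)
      also have "\<dots> \<le> norm (kern w y) * (2 / c1 / y) / (c * y powr (e - 1))"
        using a1 z1 cy c1 yp by (intro frac_le mult_left_mono) auto
      also have "\<dots> = 2 / c1 / c * y powr (- e) * norm (kern w y)" using yp by (simp add: powr_diff powr_minus field_simps)
      finally have t1: "norm (- kern w y * (1 / (of_real y - w * cis th) + 1 / (of_real y - w * cis (-th))) / of_real (zd y)) \<le> 2 / c1 / c * y powr (- e) * norm (kern w y)" .
      have "norm (kern w y * of_real (Re (deriv (deriv ZI) (of_real y))) / of_real ((zd y)\<^sup>2))
         = norm (kern w y) * \<bar>Re (deriv (deriv ZI) (of_real y))\<bar> / (zd y)\<^sup>2" by (simp add: norm_mult norm_divide norm_power)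
      also have "\<dots> \<le> norm (kern w y) * (C2 * y powr (e - 2)) / (c * y powr (e - 1))\<^sup>2"
      proof (intro frac_le mult_left_mono power_mono)
        show "\<bar>Re (deriv (deriv ZI) (of_real y))\<bar> \<le> C2 * y powr (e - 2)"
          using C2(2)[of y] y y0 abs_Re_le_cmod order_trans by fastforce
      qed (use z1 cy C20 in auto)
      also have "(c * y powr (e - 1))\<^sup>2 = c\<^sup>2 * (y powr (e - 2) * y powr e)"
        by (simp add: power_mult_distrib power2_eq_square powr_add[symmetric])
      also have "norm (kern w y) * (C2 * y powr (e - 2)) / (c\<^sup>2 * (y powr (e - 2) * y powr e)) = C2 / c\<^sup>2 * y powr (- e) * norm (kern w y)"
        using yp by (simp add: powr_minus field_simps)
      finally have t2: "norm (kern w y * of_real (Re (deriv (deriv ZI) (of_real y))) / of_real ((zd y)\<^sup>2)) \<le> C2 / c\<^sup>2 * y powr (- e) * norm (kern w y)" .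
      have "norm (k' y) \<le> 2 / c1 / c * y powr (- e) * norm (kern w y) + C2 / c\<^sup>2 * y powr (- e) * norm (kern w y)"
        unfolding k'_def by (intro order_trans[OF norm_triangle_ineq4] add_mono t1 t2)
      then show ?thesis by (simp add: D_def algebra_simps)
    qed
    have b\<beta>: "\<bar>\<beta> y\<bar> \<le> 1/8" for y
    proof -
      have "(saw (z y))\<^sup>2 \<le> (1/2)\<^sup>2" using saw_bound[of "z y"] by (metis abs_ge_zero power2_abs power_mono)
      then show ?thesis by (simp add: \<beta>_def power2_eq_square)
    qed
    have c\<beta>: "continuous_on {y0..Y} \<beta>"
    proof -
      have "continuous_on UNIV (\<lambda>t. (saw t)\<^sup>2)" using saw_sq_continuous by (simp add: continuous_at_imp_continuous_on)
      moreover have "continuous_on {y0..Y} z" by (rule continuous_on_subset[OF z_continuous]) (use y0 in auto)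
      ultimately have "continuous_on {y0..Y} ((\<lambda>t. (saw t)\<^sup>2) \<circ> z)" by (intro continuous_on_compose) (auto intro: continuous_on_subset)
      then show ?thesis unfolding \<beta>_def comp_def by (intro continuous_on_divide continuous_on_minus continuous_on_const) auto
    qed
    have cz: "continuous_on {y0..Y} zd" 
    proof (rule DERIV_continuous_on)
      fix y assume "y \<in> {y0..Y}"
      then have "y > 0" using y0 by auto
      then show "(zd has_real_derivative Re (deriv (deriv ZI) (of_real y))) (at y within {y0..Y})"
        by (rule has_field_derivative_at_within[OF zd_deriv])
    qed
    have c2: "continuous_on {y0..Y} (\<lambda>y. deriv (deriv ZI) (of_real y))"
    proof -
      have "deriv (deriv ZI) holomorphic_on sec" using ZI_holomorphic open_wedge by (intro holomorphic_deriv)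
      then have "continuous_on sec (deriv (deriv ZI))" by (rule holomorphic_on_imp_continuous_on)
      moreover have "of_real ` {y0..Y} \<subseteq> sec" using y0 by auto
      ultimately show ?thesis using continuous_on_compose2[of sec "deriv (deriv ZI)" "{y0..Y}" of_real] by (auto intro!: continuous_intros)
    qed
    have ck: "continuous_on {y0..Y} k" 
    proof (intro continuous_at_imp_continuous_on ballI)
      fix y assume "y \<in> {y0..Y}"
      then have "y > 0" using y0 by auto
      then show "isCont k y" by (rule has_vector_derivative_continuous[OF dk])
    qed
    have ck': "continuous_on {y0..Y} k'"
      unfolding k'_def using kern_nz[OF w] zdp y0 by (intro continuous_intros kern_continuous_y[OF w] cz c2) (auto simp: less_le)
    let ?G = "\<lambda>y. of_real (\<beta> y) * k y"
    \<comment> \<open>At these points the sawtooth jumps and \<open>\<beta>\<close> is merely known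
      to be continuous. A compact interval contains finitely many of them because z is strictly
      increasing.\<close>
    let ?bad = "{y \<in> {y0..Y}. z y + 1/2 \<in> \<int>}"
    have cb: "finite ?bad"
    proof (rule finite_imageD[of z])
      have "z ` ?bad \<subseteq> (\<lambda>n. real_of_int n - 1/2) ` {\<lfloor>z y0\<rfloor>..\<lceil>z Y\<rceil> + 1}"
      proof safe
        fix y assume y: "y \<in> {y0..Y}" "z y + 1/2 \<in> \<int>"
        then obtain n :: int where n: "z y + 1/2 = of_int n" by (auto elim: Ints_cases)
        have "z y0 \<le> z y" "z y \<le> z Y" using y y0 z_le_iff by auto
        then have "n \<in> {\<lfloor>z y0\<rfloor>..\<lceil>z Y\<rceil> + 1}" using n by (auto; linarith)
        then show "z y \<in> (\<lambda>n. real_of_int n - 1/2) ` {\<lfloor>z y0\<rfloor>..\<lceil>z Y\<rceil> + 1}" using n by (intro image_eqI[of _ _ n]) auto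
      qed
      then show "finite (z ` ?bad)" by (rule finite_subset) auto
      show "inj_on z ?bad" using y0 by (auto simp: inj_on_def intro: z_inj)
    qed
    have FT: "((\<lambda>y. of_real (\<psi> y) * kern w y + of_real (\<beta> y) * k' y) has_integral ?G Y - ?G y0) {y0..Y}"
    proof (rule fundamental_theorem_of_calculus_strong[OF cb Y])
      show "continuous_on {y0..Y} ?G" by (intro continuous_intros c\<beta> ck)
      fix y assume y: "y \<in> {y0..Y} - ?bad"
      then have yp: "y > 0" "y \<ge> y0" "z y + 1/2 \<notin> \<int>" using y0 by auto
      have "(\<beta> has_real_derivative saw (z y) * zd y) (at y)" unfolding \<beta>_def
        using DERIV_chain2[OF saw_deriv[OF yp(3)] z_deriv[OF yp(1)]] .
      then have "((\<lambda>y. complex_of_real (\<beta> y)) has_vector_derivative of_real (saw (z y) * zd y)) (at y)"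
        by (rule has_vector_derivative_of_real)
      from has_vector_derivative_mult[OF this dk[OF yp(1)]]
      have "(?G has_vector_derivative of_real (\<beta> y) * k' y + of_real (saw (z y) * zd y) * k y) (at y)" .
      moreover have "of_real (saw (z y) * zd y) * k y = of_real (\<psi> y) * kern w y"
        using zdp[OF yp(1)] B(3)[of y] yp y0 by (simp add: k_def)
      ultimately show "(?G has_vector_derivative of_real (\<psi> y) * kern w y + of_real (\<beta> y) * k' y) (at y)"
        by (simp add: add.commute)
    qed
    have si2: "set_integrable lborel {y0..Y} (\<lambda>y. of_real (\<beta> y) * k' y)"
      by (intro borel_integrable_atLeastAtMost' continuous_intros c\<beta> ck')
    have si1: "set_integrable lborel {y0..Y} (\<lambda>y. of_real (\<psi> y) * kern w y)"
    proof (rule set_integrable_dominated)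
      show "set_integrable lborel {y0..Y} (\<lambda>y. B * norm (kern w y))"
        by (intro borel_integrable_atLeastAtMost' continuous_intros kern_continuous_y[OF w])
      show "set_borel_measurable lborel {y0..Y} (\<lambda>y. of_real (\<psi> y) * kern w y)" using y0 by (intro m\<psi>) auto
      show "norm (of_real (\<psi> y) * kern w y) \<le> B * norm (kern w y)" if "y \<in> {y0..Y}" for y
        using B(2)[of y] y0 that by (simp add: norm_mult mult_right_mono)
    qed
    have "(LINT y:{y0..Y}|lborel. of_real (\<psi> y) * kern w y) + (LINT y:{y0..Y}|lborel. of_real (\<beta> y) * k' y) = ?G Y - ?G y0"
    proof -
      have "(LINT y:{y0..Y}|lborel. of_real (\<psi> y) * kern w y) + (LINT y:{y0..Y}|lborel. of_real (\<beta> y) * k' y)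
         = (LINT y:{y0..Y}|lborel. of_real (\<psi> y) * kern w y + of_real (\<beta> y) * k' y)"
        by (rule set_integral_add(2)[symmetric, OF si1 si2])
      also have "\<dots> = integral {y0..Y} (\<lambda>y. of_real (\<psi> y) * kern w y + of_real (\<beta> y) * k' y)"
        by (rule set_borel_integral_eq_integral(2)[OF set_integral_add(1)[OF si1 si2]])
      also have "\<dots> = ?G Y - ?G y0" using FT by (rule integral_unique)
      finally show ?thesis .
    qed
    then have eq: "(LINT y:{y0..Y}|lborel. of_real (\<psi> y) * kern w y) = ?G Y - ?G y0 - (LINT y:{y0..Y}|lborel. of_real (\<beta> y) * k' y)"
      by (simp add: algebra_simps)
    have bG: "norm (?G y) \<le> 1/8 * (1 / (c1\<^sup>2 * c) * norm w powr (- e))" if "y \<ge> y0" for y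
      unfolding norm_mult using b\<beta>[of y] bk[OF that] by (intro mult_mono) auto
    have "norm (LINT y:{y0..Y}|lborel. of_real (\<beta> y) * k' y) \<le> 1/8 * D / c1\<^sup>2 * Beta (1 + - e) (1 - - e) * norm w powr (- e)"
    proof -
      let ?h = "\<lambda>y. 1/8 * D / c1\<^sup>2 * (y powr (- e) * (norm w / (norm w + y)\<^sup>2))"
      have hi: "set_integrable lborel {0<..} ?h"
        by (rule set_integrable_mult_right[OF power_kernel_halfline(1)[OF nw ae]])
      have hp: "norm (of_real (\<beta> y) * k' y) \<le> ?h y" if y: "y \<ge> y0" for y
      proof -
        have "norm (of_real (\<beta> y) * k' y) \<le> 1/8 * (D * y powr (- e) * norm (kern w y))"
          unfolding norm_mult using b\<beta>[of y] bk'[OF y] by (intro mult_mono) auto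
        also have "\<dots> \<le> 1/8 * (D * y powr (- e) * (1 / c1\<^sup>2 * (norm w / (norm w + y)\<^sup>2)))"
          using norm_kern_le[OF w, of y] y y0 D0 by (intro mult_left_mono mult_nonneg_nonneg) auto
        also have "\<dots> = ?h y" by simp
        finally show ?thesis .
      qed
      have "norm (LINT y:{y0..Y}|lborel. of_real (\<beta> y) * k' y) \<le> (LINT y:{y0..Y}|lborel. norm (of_real (\<beta> y) * k' y))"
        by (rule set_integral_norm_bound[OF si2])
      also have "\<dots> \<le> (LINT y:{y0..Y}|lborel. ?h y)"
        using hp y0 by (intro set_integral_mono set_integrable_norm si2 set_integrable_subset[OF hi]) auto
      also have "\<dots> \<le> (LINT y:{0<..}|lborel. ?h y)" unfolding set_lebesgue_integral_def
      proof (rule integral_mono)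
        show "integrable lborel (\<lambda>y. indicator {y0..Y} y *\<^sub>R ?h y)"
        proof -
          have "{y0..Y} \<subseteq> {0<..}" using y0 by auto
          then have "set_integrable lborel {y0..Y} ?h" by (intro set_integrable_subset[OF hi]) auto
          then show ?thesis unfolding set_integrable_def .
        qed
        show "integrable lborel (\<lambda>y. indicator {0<..} y *\<^sub>R ?h y)" using hi unfolding set_integrable_def .
        show "indicator {y0..Y} y *\<^sub>R ?h y \<le> indicator {0<..} y *\<^sub>R ?h y" for y
          using y0 D0 nw by (auto simp: indicator_def intro!: mult_nonneg_nonneg divide_nonneg_nonneg)
      qed
      also have "\<dots> = 1/8 * D / c1\<^sup>2 * (Beta (1 + - e) (1 - - e) * norm w powr (- e))"
        unfolding set_integral_mult_right power_kernel_halfline(2)[OF nw ae] ..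
      finally show ?thesis by simp
    qed
    then have "norm (LINT y:{y0..Y}|lborel. of_real (\<psi> y) * kern w y) \<le>
        1/8 * (1 / (c1\<^sup>2 * c) * norm w powr (- e)) + 1/8 * (1 / (c1\<^sup>2 * c) * norm w powr (- e)) + 1/8 * D / c1\<^sup>2 * Beta (1 + - e) (1 - - e) * norm w powr (- e)"
      unfolding eq using Y by (intro order_trans[OF norm_triangle_ineq4] add_mono bG) auto
    also have "\<dots> = K * norm w powr (- e)" by (simp add: K_def algebra_simps)
    finally show ?thesis .
  qed
  have main: "norm (LINT y:{0<..}|lborel. of_real (\<psi> y) * kern w y) \<le> (B * y0 / c1\<^sup>2 + K) * norm w powr (- e)"
    if w: "w \<in> sec" and w1: "norm w \<ge> 1" for w
  proof -
    have si: "set_integrable lborel {0<..} (\<lambda>y. of_real (\<psi> y) * kern w y)"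
    proof (rule set_integrable_dominated)
      have "set_integrable lborel {0<..} (\<lambda>y. complex_of_real B * kern w y)"
        by (rule kern_bound_integrable(1)[OF w _ _ one_bound]) auto
      from set_integrable_norm[OF this] show "set_integrable lborel {0<..} (\<lambda>y. norm (complex_of_real B * kern w y))" .
      show "set_borel_measurable lborel {0<..} (\<lambda>y. of_real (\<psi> y) * kern w y)" by (intro m\<psi>) auto
      show "norm (of_real (\<psi> y) * kern w y) \<le> norm (complex_of_real B * kern w y)" if "y \<in> {0<..}" for y
        using B(2)[of y] B0 that by (simp add: norm_mult mult_right_mono)
    qed
    have s1: "set_integrable lborel {0<..<y0} (\<lambda>y. of_real (\<psi> y) * kern w y)" by (rule set_integrable_subset[OF si]) auto
    have s2: "set_integrable lborel {y0..} (\<lambda>y. of_real (\<psi> y) * kern w y)" by (rule set_integrable_subset[OF si]) (use y0 in auto)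
    have un: "{0<..} = {0<..<y0} \<union> {y0..}" using y0 by auto
    have eq: "(LINT y:{0<..}|lborel. of_real (\<psi> y) * kern w y) = (LINT y:{0<..<y0}|lborel. of_real (\<psi> y) * kern w y) + (LINT y:{y0..}|lborel. of_real (\<psi> y) * kern w y)"
      unfolding un by (rule set_integral_Un[OF _ s1 s2]) auto
    have "((\<lambda>Y. LINT y:{y0..Y}|lborel. of_real (\<psi> y) * kern w y) \<longlongrightarrow> (LINT y:{y0..}|lborel. of_real (\<psi> y) * kern w y)) at_top"
      by (rule tendsto_set_lebesgue_integral_at_top[OF _ s2]) auto
    then have n2: "norm (LINT y:{y0..}|lborel. of_real (\<psi> y) * kern w y) \<le> K * norm w powr (- e)"
    proof (rule tendsto_upperbound[OF tendsto_norm])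
      show "\<forall>\<^sub>F Y in at_top. norm (LINT y:{y0..Y}|lborel. of_real (\<psi> y) * kern w y) \<le> K * norm w powr (- e)"
        using eventually_ge_at_top[of y0] by eventually_elim (rule tail[OF w])
    qed simp
    \<comment> \<open>Below \<open>y0\<close> only boundedness of \<open>\<psi>\<close> is known.
      There the kernel is of order 1 / norm w, which for norm w >= 1 is at most the power
      -e.\<close>
    have kb: "norm (of_real (\<psi> y) * kern w y) \<le> B / c1\<^sup>2 * norm w powr (- e)" if y: "y \<in> {0<..<y0}" for y
    proof -
      have "norm (kern w y) \<le> 1 / c1\<^sup>2 * (norm w / (norm w + y)\<^sup>2)" using norm_kern_le[OF w] y by simp
      also have "\<dots> \<le> 1 / c1\<^sup>2 * (norm w / (norm w)\<^sup>2)" 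
      proof (intro mult_left_mono frac_le power_mono)
        show "0 < (norm w)\<^sup>2" using sec_Re(3)[OF w] by simp
      qed (use y in auto)
      also have "norm w / (norm w)\<^sup>2 = norm w powr (- 1)" using w1 by (simp add: power2_eq_square powr_minus field_simps)
      also have "1 / c1\<^sup>2 * norm w powr (- 1) \<le> 1 / c1\<^sup>2 * norm w powr (- e)" using w1 e_bounds by (intro mult_left_mono powr_mono) auto
      finally have "norm (kern w y) \<le> 1 / c1\<^sup>2 * norm w powr (- e)" .
      then have "norm (of_real (\<psi> y) * kern w y) \<le> B * (1 / c1\<^sup>2 * norm w powr (- e))"
        unfolding norm_mult using B(2)[of y] y B0 by (intro mult_mono) auto
      then show ?thesis by simp
    qed
    have "norm (LINT y:{0<..<y0}|lborel. of_real (\<psi> y) * kern w y) \<le> (LINT y:{0<..<y0}|lborel. norm (of_real (\<psi> y) * kern w y))"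
      by (rule set_integral_norm_bound[OF s1])
    also have "\<dots> \<le> (LINT y:{0<..<y0}|lborel. B / c1\<^sup>2 * norm w powr (- e))"
    proof (intro set_integral_mono set_integrable_norm s1 kb)
      have "set_integrable lborel {0..y0} (\<lambda>y. B / c1\<^sup>2 * norm w powr (- e))"
        by (intro borel_integrable_atLeastAtMost' continuous_intros)
      then show "set_integrable lborel {0<..<y0} (\<lambda>y. B / c1\<^sup>2 * norm w powr (- e))"
        by (rule set_integrable_subset) auto
    qed
    also have "\<dots> = B * y0 / c1\<^sup>2 * norm w powr (- e)" using y0 by (simp add: set_lebesgue_integral_def)
    finally have n1: "norm (LINT y:{0<..<y0}|lborel. of_real (\<psi> y) * kern w y) \<le> B * y0 / c1\<^sup>2 * norm w powr (- e)" .
    show ?thesis unfolding eq using norm_triangle_ineq n1 n2 by (simp add: algebra_simps order_trans[OF norm_triangle_ineq])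
  qed
  then show ?thesis by blast
qed

end

section \<open>Bounding the remainder by comparison\<close>

context bae
begin

text \<open>Giving up \<delta> makes the estimate hold on the whole sector: for norm w < 1
  boundedness suffices, as the exponent is negative. It also moves the exponent into the open
  interval where the multiplier is below 1.\<close>

lemma psi_transform:
  assumes \<delta>: "0 < \<delta>" "\<delta> < e"
  shows "\<exists>C. \<forall>w\<in>sec. set_integrable lborel {0<..} (\<lambda>y. of_real (\<psi> y) * kern w y)
    \<and> norm (LINT y:{0<..}|lborel. of_real (\<psi> y) * kern w y) \<le> C * norm w powr (- e + \<delta>)"
proof -
  obtain B where B: "\<And>y. y > 0 \<Longrightarrow> \<bar>\<psi> y\<bar> \<le> B" using psi_bounded_ex by blast
  obtain C1 where C1: "\<And>w. w \<in> sec \<Longrightarrow> norm w \<ge> 1 \<Longrightarrow> norm (LINT y:{0<..}|lborel. of_real (\<psi> y) * kern w y) \<le> C1 * norm w powr (- e)"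
    using psi_kern_bound_ex by blast
  define zz where "zz = (\<lambda>y. indicator {0<..} y * z y)"
  have zzm [measurable]: "zz \<in> borel_measurable borel" unfolding zz_def by (rule z_measurable)
  let ?f = "\<lambda>y. complex_of_real (N y - zz y + S)"
  have f\<psi>: "?f y = of_real (\<psi> y)" if "y > 0" for y using that by (simp add: \<psi>_def zz_def)
  have fm: "?f \<in> borel_measurable borel" by measurable
  have fb: "norm (?f y) \<le> B * y powr 0" if "y > 0" for y using B[OF that] f\<psi>[OF that] that by simp
  define C2 where "C2 = B / c1\<^sup>2 * Beta (1+0) (1-0)"
  show ?thesis
  proof (intro exI[of _ "max \<bar>C1\<bar> \<bar>C2\<bar>"] ballI conjI)
    fix w assume w: "w \<in> sec"
    have z0: "\<bar>0::real\<bar> < 1" by simp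
    note K = kern_bound_integrable[OF w z0 fm fb]
    have cong: "(LINT y:{0<..}|lborel. of_real (\<psi> y) * kern w y) = (LINT y:{0<..}|lborel. ?f y * kern w y)"
      by (rule set_lebesgue_integral_cong) (use f\<psi> in auto)
    show "set_integrable lborel {0<..} (\<lambda>y. of_real (\<psi> y) * kern w y)"
      by (rule iffD1[OF set_integrable_cong[OF refl refl] K(1)]) (use f\<psi> in auto)
    have nw: "norm w > 0" using sec_Re(3)[OF w] by simp
    show "norm (LINT y:{0<..}|lborel. of_real (\<psi> y) * kern w y) \<le> max \<bar>C1\<bar> \<bar>C2\<bar> * norm w powr (- e + \<delta>)"
    proof (cases "norm w \<ge> 1")
      case True
      have "norm (LINT y:{0<..}|lborel. of_real (\<psi> y) * kern w y) \<le> C1 * norm w powr (- e)" using C1[OF w True] .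
      also have "\<dots> \<le> max \<bar>C1\<bar> \<bar>C2\<bar> * norm w powr (- e + \<delta>)"
        using True \<delta> by (intro mult_mono powr_mono) auto
      finally show ?thesis .
    next
      case False
      have "norm (LINT y:{0<..}|lborel. of_real (\<psi> y) * kern w y) \<le> C2 * norm w powr 0"
        unfolding cong C2_def using K(2) by simp
      also have "\<dots> \<le> max \<bar>C1\<bar> \<bar>C2\<bar> * norm w powr (- e + \<delta>)"
        using False nw \<delta> by (intro mult_mono powr_mono') auto
      finally show ?thesis .
    qed
  qed
qed

lemma r_continuous: "continuous_on {0<..} r"
  unfolding r_def by (intro continuous_intros continuous_on_subset[OF z_continuous]) auto

lemma r_bounded_near_0: "\<exists>B. \<forall>x. 0 < x \<and> x \<le> 1 \<longrightarrow> \<bar>r x\<bar> \<le> B"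
proof -
  have "\<bar>r x\<bar> \<le> \<bar>z 0\<bar> + \<bar>z 1\<bar> + 1 + \<bar>p * (1 + \<alpha>) + S / 2 * (\<alpha> - 1)\<bar>" if x: "0 < x" "x \<le> 1" for x
  proof -
    have "z 0 \<le> z x" "z x \<le> z 1" using z_le_iff[of 0 x] z_le_iff[of x 1] x by auto
    moreover have "x powr e \<le> 1" "0 \<le> x powr e" using x e_bounds by (auto simp: powr_le1)
    ultimately show ?thesis unfolding r_def by linarith
  qed
  then show ?thesis by blast
qed

text \<open>Here the normalisation of the zero count enters the comparison: it excludes at infinity
  the homogeneous solution x^e.\<close>

lemma r_small_o: "((\<lambda>x. r x / x powr e) \<longlongrightarrow> 0) at_top"
proof -
  obtain B where B: "\<And>y. y > 0 \<Longrightarrow> \<bar>\<psi> y\<bar> \<le> B" using psi_bounded_ex by blast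
  have "((\<lambda>x. x powr (-e) * N x - 1 - Cc * x powr (-e)) \<longlongrightarrow> 1 - 1 - Cc * 0) at_top"
    using e_bounds by (intro tendsto_intros N_lim) real_asymp
  then have l1: "((\<lambda>x. x powr (-e) * N x - 1 - Cc * x powr (-e)) \<longlongrightarrow> 0) at_top" by simp
  have l2: "((\<lambda>x. \<psi> x / x powr e) \<longlongrightarrow> 0) at_top"
  proof (rule Lim_null_comparison)
    show "\<forall>\<^sub>F x in at_top. norm (\<psi> x / x powr e) \<le> B * x powr (-e)"
      using eventually_gt_at_top[of 0]
    proof eventually_elim
      case (elim x)
      then show ?case using B[OF elim] by (simp add: powr_minus divide_inverse abs_mult mult_right_mono)
    qed
    have "((\<lambda>x. B * x powr (-e)) \<longlongrightarrow> B * 0) at_top" using e_bounds by (intro tendsto_intros) real_asymp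
    then show "((\<lambda>x. B * x powr (-e)) \<longlongrightarrow> 0) at_top" by simp
  qed
  from tendsto_diff[OF l1 l2]
  have l: "((\<lambda>x. (x powr (-e) * N x - 1 - Cc * x powr (-e)) - \<psi> x / x powr e) \<longlongrightarrow> 0) at_top" by simp
  show ?thesis
  proof (rule Lim_transform_eventually[OF l])
    show "\<forall>\<^sub>F x in at_top. (x powr (-e) * N x - 1 - Cc * x powr (-e)) - \<psi> x / x powr e = r x / x powr e"
      using eventually_gt_at_top[of 0]
    proof eventually_elim
      case (elim x)
      have "r x = N x - x powr e - Cc - \<psi> x" using phi_eq[OF elim] by simp
      then show ?case using elim by (simp add: diff_divide_distrib powr_minus_divide)
    qed
  qed
qed

text \<open>The sum of the powers with exponents e and s is a strict super-solution of the convolution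
  equation, so f divided by it cannot attain a positive maximum.\<close>

lemma max_principle:
  fixes f :: "real \<Rightarrow> real"
  assumes s: "- e < s" "s < 0" and cont: "continuous_on {0<..} f"
    and int: "\<And>x. x > 0 \<Longrightarrow> set_integrable lborel {0<..} (\<lambda>y. f y * kr x y)"
    and sub: "\<And>x. x > 0 \<Longrightarrow> f x \<le> (LINT y:{0<..}|lborel. f y * kr x y)"
    and l0: "\<And>\<eta>. \<eta> > 0 \<Longrightarrow> \<forall>\<^sub>F x in at_right 0. f x < \<eta> * (x powr e + x powr s)"
    and l1: "\<And>\<eta>. \<eta> > 0 \<Longrightarrow> \<forall>\<^sub>F x in at_top. f x < \<eta> * (x powr e + x powr s)"
    and x: "x > 0"
  shows "f x \<le> 0"
proof (rule ccontr)
  assume neg: "\<not> f x \<le> 0"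
  define w0 where "w0 = (\<lambda>x::real. x powr e + x powr s)"
  have w0: "w0 y > 0" if "y > 0" for y using that by (simp add: w0_def add_pos_pos)
  define \<eta> where "\<eta> = f x / w0 x"
  have \<eta>: "\<eta> > 0" using neg w0[OF x] by (simp add: \<eta>_def)
  obtain a0 where a0: "a0 > 0" "\<And>y. 0 < y \<Longrightarrow> y < a0 \<Longrightarrow> f y < \<eta> * w0 y"
    using l0[OF \<eta>] unfolding eventually_at_right_field w0_def by auto
  obtain b0 where b0: "\<And>y. y \<ge> b0 \<Longrightarrow> f y < \<eta> * w0 y"
    using l1[OF \<eta>] unfolding eventually_at_top_linorder w0_def by auto
  define a where "a = min (a0/2) x"
  define b where "b = max b0 x"
  have ab: "0 < a" "a \<le> x" "x \<le> b" using a0 x by (auto simp: a_def b_def)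
  have "continuous_on {a..b} (\<lambda>y. f y / w0 y)"
    unfolding w0_def using ab w0[unfolded w0_def]
    by (intro continuous_intros continuous_on_subset[OF cont]) (auto simp: less_imp_neq[symmetric])
  then obtain y where y: "y \<in> {a..b}" "\<And>u. u \<in> {a..b} \<Longrightarrow> f u / w0 u \<le> f y / w0 y"
    using continuous_attains_sup[of "{a..b}" "\<lambda>y. f y / w0 y"] ab by auto
  \<comment> \<open>\<open>M\<close> is the maximum of f / w0 on a compact interval outside which
    this quotient is below \<open>\<eta>\<close>. The interval contains x, so \<open>M\<close> is at
    least \<eta> > 0 and bounds the quotient globally.\<close>
  define M where "M = f y / w0 y"
  have y0: "y > 0" using y ab by auto
  have M: "M \<ge> \<eta>" using y(2)[of x] ab by (simp add: M_def \<eta>_def)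
  have le: "f u \<le> M * w0 u" if u: "u > 0" for u
  proof (cases "u \<in> {a..b}")
    case True
    then show ?thesis using y(2)[OF True] w0[OF u] by (simp add: M_def pos_divide_le_eq)
  next
    case False
    then have "f u < \<eta> * w0 u" using a0(2)[of u] b0[of u] u by (auto simp: a_def b_def not_le)
    also have "\<dots> \<le> M * w0 u" using M w0[OF u] by (intro mult_right_mono) auto
    finally show ?thesis by simp
  qed
  have sec: "of_real y \<in> sec" using y0 by simp
  have s1: "-1 < s" "\<bar>s\<bar> < 1" using s e_bounds by auto
  have ie: "set_integrable lborel {0<..} (\<lambda>u. u powr e * kr y u)" by (rule kr_bound_integrable[OF y0 e_abs, of _ 1]) auto
  have iss: "set_integrable lborel {0<..} (\<lambda>u. u powr s * kr y u)" by (rule kr_bound_integrable[OF y0 s1(2), of _ 1]) auto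
  have ve: "(LINT u:{0<..}|lborel. u powr e * kr y u) = y powr e"
  proof -
    have "complex_of_real (LINT u:{0<..}|lborel. u powr e * kr y u) = of_real y powr of_real e"
      using kern_power_pos[OF sec e_bounds(3,2)] kern_kr_integral[OF y0, of "\<lambda>u. u powr e"] khat_e by simp
    also have "\<dots> = of_real (y powr e)" using y0 by (simp add: powr_of_real)
    finally show ?thesis using of_real_eq_iff by blast
  qed
  define k where "k = sin ((pi - th) * s) / sin (pi * s)"
  have vs: "(LINT u:{0<..}|lborel. u powr s * kr y u) = y powr s * k"
  proof -
    have "complex_of_real (LINT u:{0<..}|lborel. u powr s * kr y u) = of_real y powr of_real s * of_real k"
      using kern_power_neg[OF sec s1(1) s(2)] kern_kr_integral[OF y0, of "\<lambda>u. u powr s"] unfolding k_def by simp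
    also have "\<dots> = of_real (y powr s * k)" using y0 by (simp add: powr_of_real)
    finally show ?thesis using of_real_eq_iff by blast
  qed
  have "f y \<le> (LINT u:{0<..}|lborel. f u * kr y u)" by (rule sub[OF y0])
  also have "\<dots> \<le> (LINT u:{0<..}|lborel. M * (u powr e * kr y u) + M * (u powr s * kr y u))"
  proof (rule set_integral_mono[OF int[OF y0]])
    show "set_integrable lborel {0<..} (\<lambda>u. M * (u powr e * kr y u) + M * (u powr s * kr y u))"
      by (intro set_integral_add set_integrable_mult_right ie iss)
    fix u :: real assume "u \<in> {0<..}"
    then have "f u * kr y u \<le> (M * w0 u) * kr y u" using le[of u] kr_pos[OF y0, of u] by (intro mult_right_mono) auto
    then show "f u * kr y u \<le> M * (u powr e * kr y u) + M * (u powr s * kr y u)" by (simp add: w0_def algebra_simps)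
  qed
  also have "\<dots> = M * y powr e + M * (y powr s * k)"
    using ie iss by (simp add: set_integral_add set_integrable_mult_right ve vs)
  \<comment> \<open>At the maximum point the power e is reproduced while the power s is strictly
    diminished, so the chain ends in f y < f y.\<close>
  also have "\<dots> < M * y powr e + M * (y powr s * 1)"
    using M \<eta> y0 khat_less[OF s] unfolding k_def by (intro add_strict_left_mono mult_strict_left_mono) auto
  also have "\<dots> = M * w0 y" by (simp add: w0_def distrib_left)
  also have "\<dots> = f y" using w0[OF y0] by (simp add: M_def)
  finally show False by simp
qed

text \<open>The constant solves A (1 - k) = |C|, so A x^s exceeds its own transform by a bound for
  the inhomogeneity. Hence r - A x^s and -r - A x^s both satisfy the hypotheses of the maximum
  principle.\<close>

lemma r_bound:
  assumes \<delta>: "0 < \<delta>" "\<delta> < e"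
  shows "\<exists>A. \<forall>x>0. \<bar>r x\<bar> \<le> A * x powr (- e + \<delta>)"
proof -
  define s where "s = - e + \<delta>"
  have s: "- e < s" "s < 0" using \<delta> by (auto simp: s_def)
  have s1: "-1 < s" "\<bar>s\<bar> < 1" using s e_bounds by auto
  obtain C where C: "\<And>w. w \<in> sec \<Longrightarrow> set_integrable lborel {0<..} (\<lambda>y. of_real (\<psi> y) * kern w y)"
    "\<And>w. w \<in> sec \<Longrightarrow> norm (LINT y:{0<..}|lborel. of_real (\<psi> y) * kern w y) \<le> C * norm w powr s"
    using psi_transform[OF \<delta>] unfolding s_def by blast
  define k where "k = sin ((pi - th) * s) / sin (pi * s)"
  have k: "k < 1" unfolding k_def by (rule khat_less[OF s])
  define A where "A = \<bar>C\<bar> / (1 - k)"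
  have A: "A \<ge> 0" "A * (1 - k) = \<bar>C\<bar>" using k by (auto simp: A_def)
  have real_int: "set_integrable lborel {0<..} (\<lambda>y. g y * kr x y)" if x: "x > 0" and g: "set_integrable lborel {0<..} (\<lambda>y. complex_of_real (g y) * kern (of_real x) y)" for g x
  proof -
    have "integrable lborel (\<lambda>y. complex_of_real (indicator {0<..} y *\<^sub>R (g y * kr x y)))"
      using g unfolding set_integrable_def kern_of_real[OF x] by (simp add: scaleR_conv_of_real)
    then show ?thesis unfolding set_integrable_def complex_of_real_integrable_eq .
  qed
  have i\<psi>: "set_integrable lborel {0<..} (\<lambda>y. \<psi> y * kr x y)" if "x > 0" for x
    by (rule real_int[OF that C(1)]) (use that in simp)
  have i\<phi>: "set_integrable lborel {0<..} (\<lambda>y. (N y - y powr e - Cc) * kr x y)" if "x > 0" for x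
    by (rule real_int[OF that R_integral(1)]) (use that in simp)
  have ir: "set_integrable lborel {0<..} (\<lambda>y. r y * kr x y)" if x: "x > 0" for x
  proof -
    have A: "set_integrable lborel {0<..} (\<lambda>y. (N y - y powr e - Cc) * kr x y - \<psi> y * kr x y)"
      by (intro set_integral_diff i\<phi> i\<psi> x)
    have B: "(N y - y powr e - Cc) * kr x y - \<psi> y * kr x y = r y * kr x y" if "y \<in> {0<..}" for y
    proof -
      have "N y - y powr e - Cc = r y + \<psi> y" using phi_eq that by simp
      then show ?thesis by (simp only: distrib_right)
    qed
    show ?thesis by (rule iffD1[OF set_integrable_cong[OF refl refl B] A])
  qed
  have iss: "set_integrable lborel {0<..} (\<lambda>y. y powr s * kr x y)" if "x > 0" for x
    by (rule kr_bound_integrable[OF that s1(2), of _ 1]) auto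
  have vs: "(LINT u:{0<..}|lborel. u powr s * kr y u) = y powr s * k" if y0: "y > 0" for y
  proof -
    have "complex_of_real (LINT u:{0<..}|lborel. u powr s * kr y u) = of_real y powr of_real s * of_real k"
      using kern_power_neg[OF _ s1(1) s(2), of "of_real y"] kern_kr_integral[OF y0, of "\<lambda>u. u powr s"] y0 unfolding k_def by simp
    also have "\<dots> = of_real (y powr s * k)" using y0 by (simp add: powr_of_real)
    finally show ?thesis using of_real_eq_iff by blast
  qed
  have req: "r x = (LINT y:{0<..}|lborel. r y * kr x y) + (LINT y:{0<..}|lborel. \<psi> y * kr x y)" if x: "x > 0" for x
  proof -
    have "complex_of_real (r x) = (LINT y:{0<..}|lborel. of_real (N y - y powr e - Cc) * kern (of_real x) y)"
      using R_integral(2)[of "of_real x"] R_of_real[OF x] x by simp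
    also have "\<dots> = of_real (LINT y:{0<..}|lborel. (N y - y powr e - Cc) * kr x y)" by (rule kern_kr_integral[OF x])
    finally have "r x = (LINT y:{0<..}|lborel. (N y - y powr e - Cc) * kr x y)" using of_real_eq_iff by blast
    also have "\<dots> = (LINT y:{0<..}|lborel. r y * kr x y + \<psi> y * kr x y)"
    proof (rule set_lebesgue_integral_cong, simp, intro allI impI)
      fix y :: real assume "y \<in> {0<..}"
      then have "N y - y powr e - Cc = r y + \<psi> y" using phi_eq by simp
      then show "(N y - y powr e - Cc) * kr x y = r y * kr x y + \<psi> y * kr x y" by (simp only: distrib_right)
    qed
    also have "\<dots> = (LINT y:{0<..}|lborel. r y * kr x y) + (LINT y:{0<..}|lborel. \<psi> y * kr x y)"
      by (rule set_integral_add(2)[OF ir[OF x] i\<psi>[OF x]])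
    finally show ?thesis .
  qed
  have gb: "\<bar>LINT y:{0<..}|lborel. \<psi> y * kr x y\<bar> \<le> C * x powr s" if x: "x > 0" for x
    using C(2)[of "of_real x"] x kern_kr_integral[OF x, of \<psi>] by simp
  have key: "\<sigma> * r x - A * x powr s \<le> 0" if x: "x > 0" and \<sigma>: "\<sigma> = 1 \<or> \<sigma> = -1" for x \<sigma>
  proof (rule max_principle[OF s _ _ _ _ _ x, where f="\<lambda>x. \<sigma> * r x - A * x powr s"])
    show "continuous_on {0<..} (\<lambda>x. \<sigma> * r x - A * x powr s)"
      by (intro continuous_intros r_continuous) auto
    have eq: "(\<sigma> * r y - A * y powr s) * kr x y = \<sigma> * (r y * kr x y) - A * (y powr s * kr x y)" for x y by (simp add: algebra_simps)
    fix x :: real assume x: "x > 0"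
    show "set_integrable lborel {0<..} (\<lambda>y. (\<sigma> * r y - A * y powr s) * kr x y)"
      unfolding eq by (intro set_integral_diff set_integrable_mult_right ir iss x)
    have "(LINT y:{0<..}|lborel. (\<sigma> * r y - A * y powr s) * kr x y) = \<sigma> * (LINT y:{0<..}|lborel. r y * kr x y) - A * (x powr s * k)"
      unfolding eq using ir[OF x] iss[OF x] by (simp add: set_integral_diff set_integrable_mult_right vs[OF x])
    moreover have "\<sigma> * r x = \<sigma> * (LINT y:{0<..}|lborel. r y * kr x y) + \<sigma> * (LINT y:{0<..}|lborel. \<psi> y * kr x y)"
      using req[OF x] by (metis distrib_left)
    moreover have "\<sigma> * (LINT y:{0<..}|lborel. \<psi> y * kr x y) \<le> \<bar>C\<bar> * x powr s"
    proof -
      have "\<sigma> * (LINT y:{0<..}|lborel. \<psi> y * kr x y) \<le> \<bar>LINT y:{0<..}|lborel. \<psi> y * kr x y\<bar>" using \<sigma> by auto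
      also have "\<dots> \<le> C * x powr s" by (rule gb[OF x])
      also have "\<dots> \<le> \<bar>C\<bar> * x powr s" by (intro mult_right_mono) auto
      finally show ?thesis .
    qed
    moreover have "\<bar>C\<bar> * x powr s = A * x powr s - A * (x powr s * k)" using A(2) by (simp add: algebra_simps flip: A(2))
    ultimately show "\<sigma> * r x - A * x powr s \<le> (LINT y:{0<..}|lborel. (\<sigma> * r y - A * y powr s) * kr x y)" by linarith
  next
    fix \<eta> :: real assume \<eta>: "\<eta> > 0"
    obtain B where B: "\<And>x. 0 < x \<Longrightarrow> x \<le> 1 \<Longrightarrow> \<bar>r x\<bar> \<le> B" using r_bounded_near_0 by blast
    have sr: "\<sigma> * v \<le> \<bar>v\<bar>" for v using \<sigma> by auto
    have "filterlim (\<lambda>x. \<eta> * x powr s) at_top (at_right 0)" using \<eta> s(2) by real_asymp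
    then have "\<forall>\<^sub>F x in at_right 0. \<eta> * x powr s \<ge> B + 1" by (simp add: filterlim_at_top)
    moreover have "\<forall>\<^sub>F x in at_right (0::real). 0 < x \<and> x < 1" by (auto simp: eventually_at_right_field intro!: exI[of _ 1])
    ultimately show "\<forall>\<^sub>F x in at_right 0. \<sigma> * r x - A * x powr s < \<eta> * (x powr e + x powr s)"
    proof eventually_elim
      case (elim x)
      have "\<sigma> * r x \<le> B" using sr[of "r x"] B[of x] elim by simp
      moreover have "A * x powr s \<ge> 0" "\<eta> * x powr e \<ge> 0" using A \<eta> by auto
      ultimately show ?case using elim by (simp add: distrib_left)
    qed
    have "\<forall>\<^sub>F x in at_top. \<bar>r x / x powr e\<bar> < \<eta>"
      using tendstoD[OF r_small_o \<eta>] by (simp add: dist_real_def)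
    then show "\<forall>\<^sub>F x in at_top. \<sigma> * r x - A * x powr s < \<eta> * (x powr e + x powr s)"
      using eventually_gt_at_top[of 0]
    proof eventually_elim
      case (elim x)
      have "\<bar>r x\<bar> < \<eta> * x powr e" using elim by (simp add: abs_divide pos_divide_less_eq)
      moreover have "A * x powr s \<ge> 0" "\<eta> * x powr s \<ge> 0" using A \<eta> by auto
      ultimately show ?case using sr[of "r x"] by (simp add: distrib_left)
    qed
  qed
  show ?thesis
  proof (intro exI allI impI)
    fix x :: real assume x: "x > 0"
    show "\<bar>r x\<bar> \<le> A * x powr (- e + \<delta>)" using key[OF x, of 1] key[OF x, of "-1"] by (simp add: s_def abs_le_iff)
  qed
qed

text \<open>With r under control on the real axis, \<open>R\<close> is the transform of r + \<psi>,
  so the mapping property suffices and no comparison argument is needed off the axis.\<close>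

lemma R_bound:
  assumes \<delta>: "0 < \<delta>" "\<delta> < e"
  shows "\<exists>C. \<forall>w\<in>sec. norm (R w) \<le> C * norm w powr (- e + \<delta>)"
proof -
  obtain A where A: "\<And>x. x > 0 \<Longrightarrow> \<bar>r x\<bar> \<le> A * x powr (- e + \<delta>)" using r_bound[OF \<delta>] by blast
  obtain C where C: "\<And>w. w \<in> sec \<Longrightarrow> set_integrable lborel {0<..} (\<lambda>y. of_real (\<psi> y) * kern w y)"
    "\<And>w. w \<in> sec \<Longrightarrow> norm (LINT y:{0<..}|lborel. of_real (\<psi> y) * kern w y) \<le> C * norm w powr (- e + \<delta>)"
    using psi_transform[OF \<delta>] by blast
  have s1: "\<bar>- e + \<delta>\<bar> < 1" using \<delta> e_bounds by auto
  define rr where "rr = (\<lambda>y. indicator {0<..} y * r y)"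
  have [measurable]: "rr \<in> borel_measurable borel" unfolding rr_def real_scaleR_def[symmetric]
    by (rule borel_measurable_continuous_on_indicator[OF _ r_continuous]) simp
  have rrb: "norm (complex_of_real (rr y)) \<le> A * y powr (- e + \<delta>)" if "y > 0" for y using A[OF that] that by (simp add: rr_def)
  show ?thesis
  proof (intro exI ballI)
    fix w assume w: "w \<in> sec"
    have rm: "(\<lambda>y. complex_of_real (rr y)) \<in> borel_measurable borel" by measurable
    note K = kern_bound_integrable[OF w s1 rm rrb]
    have "R w = (LINT y:{0<..}|lborel. of_real (N y - y powr e - Cc) * kern w y)" by (rule R_integral(2)[OF w])
    also have "\<dots> = (LINT y:{0<..}|lborel. of_real (rr y) * kern w y + of_real (\<psi> y) * kern w y)"
    proof (rule set_lebesgue_integral_cong, simp, intro allI impI)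
      fix y :: real assume "y \<in> {0<..}"
      then have "N y - y powr e - Cc = rr y + \<psi> y" using phi_eq by (simp add: rr_def)
      then show "of_real (N y - y powr e - Cc) * kern w y = of_real (rr y) * kern w y + of_real (\<psi> y) * kern w y" by (simp only: of_real_add distrib_right)
    qed
    also have "\<dots> = (LINT y:{0<..}|lborel. of_real (rr y) * kern w y) + (LINT y:{0<..}|lborel. of_real (\<psi> y) * kern w y)"
      by (rule set_integral_add(2)[OF K(1) C(1)[OF w]])
    finally have "norm (R w) \<le> norm (LINT y:{0<..}|lborel. of_real (rr y) * kern w y) + norm (LINT y:{0<..}|lborel. of_real (\<psi> y) * kern w y)"
      by (simp add: norm_triangle_ineq)
    also have "\<dots> \<le> A / c1\<^sup>2 * Beta (1 + (- e + \<delta>)) (1 - (- e + \<delta>)) * norm w powr (- e + \<delta>) + C * norm w powr (- e + \<delta>)"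
      by (intro add_mono K(2) C(2) w)
    also have "\<dots> = (A / c1\<^sup>2 * Beta (1 + (- e + \<delta>)) (1 - (- e + \<delta>)) + C) * norm w powr (- e + \<delta>)" by (simp add: distrib_right)
    finally show "norm (R w) \<le> (A / c1\<^sup>2 * Beta (1 + (- e + \<delta>)) (1 - (- e + \<delta>)) + C) * norm w powr (- e + \<delta>)" .
  qed
qed

end

section \<open>The action integral\<close>

locale well =
  fixes \<alpha> :: real
  assumes \<alpha>: "\<alpha> > 1"
begin

abbreviation "e \<equiv> bae_exp \<alpha>"

definition q :: "real \<Rightarrow> real" where "q t = exp t - exp ((1 + \<alpha>) * t)"
definition qc :: "complex \<Rightarrow> complex" where "qc t = exp t - exp (of_real (1 + \<alpha>) * t)"
text \<open>The maximum point of \<open>q\<close>, where (1 + \<alpha>) exp (\<alpha> t) = 1. The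
  value \<open>ss\<close> there is the level at which the two turning points merge.\<close>

definition ts :: real where "ts = - ln (1 + \<alpha>) / \<alpha>"
definition ss :: real where "ss = q ts"
definition sg1 :: "real \<Rightarrow> real" where "sg1 s = (THE t. t \<le> ts \<and> q t = s)"
definition sg2 :: "real \<Rightarrow> real" where "sg2 s = (THE t. t \<ge> ts \<and> q t = s)"
definition \<Delta> :: "real \<Rightarrow> real" where "\<Delta> s = sg2 s - sg1 s"
definition G :: "real \<Rightarrow> real" where "G \<epsilon> = integral {sg1 \<epsilon>..sg2 \<epsilon>} (\<lambda>t. sqrt (q t - \<epsilon>))"

lemma e_bounds: "1/2 < e" "e < 1" "0 < e"
  using \<alpha> by (auto simp: bae_exp_def field_simps)

lemma qc_of_real: "qc (of_real t) = of_real (q t)"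
  by (simp only: qc_def q_def of_real_diff exp_of_real[symmetric] of_real_mult)

lemma qc_holomorphic: "qc holomorphic_on A"
  unfolding qc_def by (intro holomorphic_intros)

lemma qc_cnj: "qc (cnj t) = cnj (qc t)"
  by (simp add: qc_def exp_cnj)

lemma q_deriv: "(q has_real_derivative exp t * (1 - (1 + \<alpha>) * exp (\<alpha> * t))) (at t)"
proof -
  have "(q has_real_derivative exp t - (1 + \<alpha>) * exp ((1 + \<alpha>) * t)) (at t)"
    unfolding q_def by (auto intro!: derivative_eq_intros)
  moreover have "exp ((1 + \<alpha>) * t) = exp t * exp (\<alpha> * t)" by (simp add: exp_add[symmetric] algebra_simps)
  ultimately show ?thesis by (simp add: algebra_simps)
qed

lemma qc_deriv: "(qc has_field_derivative exp t - of_real (1 + \<alpha>) * exp (of_real (1 + \<alpha>) * t)) (at t)"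
  unfolding qc_def by (auto intro!: derivative_eq_intros)

lemma q_continuous: "continuous_on A q" unfolding q_def by (intro continuous_intros)

lemma exp_ts: "exp (\<alpha> * ts) = 1 / (1 + \<alpha>)"
proof -
  have "\<alpha> * ts = - ln (1 + \<alpha>)" using \<alpha> by (simp add: ts_def)
  then show ?thesis using \<alpha> by (simp add: exp_minus inverse_eq_divide)
qed

lemma slope_sign: "t < ts \<Longrightarrow> 1 - (1 + \<alpha>) * exp (\<alpha> * t) > 0" "t > ts \<Longrightarrow> 1 - (1 + \<alpha>) * exp (\<alpha> * t) < 0"
proof -
  have eq: "1 - (1 + \<alpha>) * exp (\<alpha> * t) = (1 + \<alpha>) * (exp (\<alpha> * ts) - exp (\<alpha> * t))"
    unfolding exp_ts using \<alpha> by (simp add: field_simps)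
  show "t < ts \<Longrightarrow> 1 - (1 + \<alpha>) * exp (\<alpha> * t) > 0" "t > ts \<Longrightarrow> 1 - (1 + \<alpha>) * exp (\<alpha> * t) < 0"
    unfolding eq using \<alpha> by (auto simp: zero_less_mult_iff mult_less_0_iff)
qed

lemma q_inc: assumes ab: "a < b" "b \<le> ts" shows "q a < q b"
proof (rule DERIV_pos_imp_increasing_open[OF ab(1)])
  fix t assume "a < t" "t < b"
  then have "exp t * (1 - (1 + \<alpha>) * exp (\<alpha> * t)) > 0" using slope_sign(1)[of t] ab by simp
  then show "\<exists>D. (q has_real_derivative D) (at t) \<and> 0 < D" using q_deriv[of t] by blast
qed (auto intro: q_continuous)

lemma q_dec: assumes ab: "a < b" "ts \<le> a" shows "q b < q a"
proof (rule DERIV_neg_imp_decreasing_open[OF ab(1)])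
  fix t assume "a < t" "t < b"
  then have "exp t * (1 - (1 + \<alpha>) * exp (\<alpha> * t)) < 0" using slope_sign(2)[of t] ab by (simp add: mult_pos_neg)
  then show "\<exists>D. (q has_real_derivative D) (at t) \<and> D < 0" using q_deriv[of t] by blast
qed (auto intro: q_continuous)

lemma q_0: "q 0 = 0" by (simp add: q_def)
lemma ts_neg: "ts < 0" using \<alpha> by (simp add: ts_def divide_neg_pos)
lemma ss_pos: "ss > 0" using q_dec[OF ts_neg] by (simp add: ss_def q_0)
lemma q_le_ss: "q t \<le> ss"
  using q_inc[of t ts] q_dec[of ts t] unfolding ss_def by (cases t ts rule: linorder_cases) auto

lemma q_pos_neg: "t < 0 \<longleftrightarrow> q t > 0"
proof -
  have "(1 + \<alpha>) * t < t \<longleftrightarrow> t < 0" using \<alpha> by (simp add: distrib_right mult_less_0_iff)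
  then show ?thesis by (simp add: q_def)
qed

lemma sg1: assumes "0 < s" "s \<le> ss" shows "sg1 s \<le> ts" "q (sg1 s) = s"
proof -
  have "ss < exp ts" by (simp add: ss_def q_def)
  then have "s < exp ts" using assms by linarith
  then have l: "ln s < ts" using assms ln_less_cancel_iff[of s "exp ts"] by simp
  \<comment> \<open>Since q t < exp t, the point ln s lies below the level s and serves as left end
    for the intermediate value theorem.\<close>
  have "q (ln s) \<le> s" using assms by (simp add: q_def)
  then obtain t where t: "t \<le> ts" "q t = s"
    using IVT'[of q "ln s" s ts] assms l q_continuous by (auto simp: ss_def)
  have "sg1 s = t" unfolding sg1_def
  proof (rule the_equality)
    fix t' assume "t' \<le> ts \<and> q t' = s"
    then show "t' = t" using t q_inc[of t t'] q_inc[of t' t] by (cases t t' rule: linorder_cases) auto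
  qed (use t in auto)
  then show "sg1 s \<le> ts" "q (sg1 s) = s" using t by auto
qed

lemma sg1_unique: "0 < s \<Longrightarrow> s \<le> ss \<Longrightarrow> t \<le> ts \<Longrightarrow> q t = s \<Longrightarrow> sg1 s = t"
  using sg1[of s] q_inc[of t "sg1 s"] q_inc[of "sg1 s" t] by (cases t "sg1 s" rule: linorder_cases) auto

lemma sg2: assumes "0 < s" "s \<le> ss" shows "sg2 s \<ge> ts" "q (sg2 s) = s" "sg2 s < 0"
proof -
  obtain t where t: "t \<ge> ts" "q t = s"
    using IVT2'[of q 0 s ts] assms ts_neg q_continuous by (auto simp: ss_def q_0)
  have "sg2 s = t" unfolding sg2_def
  proof (rule the_equality)
    fix t' assume "t' \<ge> ts \<and> q t' = s"
    then show "t' = t" using t q_dec[of t t'] q_dec[of t' t] by (cases t t' rule: linorder_cases) auto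
  qed (use t in auto)
  then show "sg2 s \<ge> ts" "q (sg2 s) = s" "sg2 s < 0" using t assms q_pos_neg by auto
qed

lemma sg2_unique: "0 < s \<Longrightarrow> s \<le> ss \<Longrightarrow> t \<ge> ts \<Longrightarrow> q t = s \<Longrightarrow> sg2 s = t"
  using sg2[of s] q_dec[of t "sg2 s"] q_dec[of "sg2 s" t] by (cases t "sg2 s" rule: linorder_cases) auto

lemma q_gt_iff: assumes "0 < s" "s \<le> ss" shows "q t > s \<longleftrightarrow> sg1 s < t \<and> t < sg2 s"
proof -
  note a = sg1[OF assms] sg2[OF assms]
  show ?thesis
  proof (cases "t \<le> ts")
    case True
    have "q t > s \<longleftrightarrow> sg1 s < t" using a q_inc[of "sg1 s" t] q_inc[of t "sg1 s"] True
      by (cases t "sg1 s" rule: linorder_cases) auto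
    moreover have "t < sg2 s" if "q t > s"
    proof (rule ccontr)
      assume "\<not> t < sg2 s"
      then have "t = ts" "sg2 s = ts" using a True by auto
      then show False using that a by simp
    qed
    ultimately show ?thesis by auto
  next
    case False
    have "q t > s \<longleftrightarrow> t < sg2 s" using a q_dec[of "sg2 s" t] q_dec[of t "sg2 s"] False
      by (cases t "sg2 s" rule: linorder_cases) auto
    then show ?thesis using a False by auto
  qed
qed

lemma q_ge_iff: assumes "0 < s" "s \<le> ss" shows "q t \<ge> s \<longleftrightarrow> sg1 s \<le> t \<and> t \<le> sg2 s"
proof -
  note a = sg1[OF assms] sg2[OF assms]
  have "q t = s \<longleftrightarrow> t = sg1 s \<or> t = sg2 s"
    using a sg1_unique[OF assms, of t] sg2_unique[OF assms, of t] by (cases "t \<le> ts") auto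
  then show ?thesis using q_gt_iff[OF assms, of t] a by auto
qed

lemma sg_le: "0 < s \<Longrightarrow> s \<le> ss \<Longrightarrow> sg1 s \<le> sg2 s" using sg1[of s] sg2[of s] by linarith

text \<open>Cutting off at 0 removes the level-dependent limits of integration; this form suits
  Tonelli and dominated convergence.\<close>

lemma G_eq: assumes "0 < \<epsilon>" "\<epsilon> \<le> ss"
  shows "G \<epsilon> = (LINT t:{sg1 \<epsilon>..sg2 \<epsilon>}|lborel. sqrt (q t - \<epsilon>))"
    "G \<epsilon> = (LINT t|lborel. sqrt (max 0 (q t - \<epsilon>)))"
    "integrable lborel (\<lambda>t. sqrt (max 0 (q t - \<epsilon>)))"
proof -
  have "set_integrable lborel {sg1 \<epsilon>..sg2 \<epsilon>} (\<lambda>t. sqrt (q t - \<epsilon>))"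
    by (intro borel_integrable_atLeastAtMost' continuous_intros q_continuous)
  then show 1: "G \<epsilon> = (LINT t:{sg1 \<epsilon>..sg2 \<epsilon>}|lborel. sqrt (q t - \<epsilon>))"
    unfolding G_def by (simp add: set_borel_integral_eq_integral)
  have eq: "(\<lambda>t. indicator {sg1 \<epsilon>..sg2 \<epsilon>} t *\<^sub>R sqrt (q t - \<epsilon>)) = (\<lambda>t. sqrt (max 0 (q t - \<epsilon>)))"
    using q_ge_iff[OF assms] by (auto simp: fun_eq_iff indicator_def max_def)
  show "G \<epsilon> = (LINT t|lborel. sqrt (max 0 (q t - \<epsilon>)))" unfolding 1 set_lebesgue_integral_def eq ..
  show "integrable lborel (\<lambda>t. sqrt (max 0 (q t - \<epsilon>)))"
    using \<open>set_integrable _ _ _\<close> unfolding set_integrable_def eq .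
qed

text \<open>The part of the area under the graph of the integrand below height sqrt(s0 - eps) is computed by horizontal slices;
  the part above it only involves the fixed interval between the two turning points of level s0.\<close>

lemma layer_cake:
  assumes \<epsilon>: "0 < \<epsilon>" "\<epsilon> < s0" "s0 \<le> ss"
  defines "T \<equiv> sqrt (s0 - \<epsilon>)"
  shows "G \<epsilon> = (LINT t:{sg1 s0..sg2 s0}|lborel. sqrt (q t - \<epsilon>) - T) + (LINT \<tau>:{0<..<T}|lborel. \<Delta> (\<epsilon> + \<tau>\<^sup>2))"
proof -
  have e1: "0 < \<epsilon>" "\<epsilon> \<le> ss" and s0: "0 < s0" "s0 \<le> ss" using \<epsilon> by auto
  have T: "T > 0" "T\<^sup>2 = s0 - \<epsilon>" using \<epsilon> by (auto simp: T_def)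
  let ?f = "\<lambda>t. sqrt (max 0 (q t - \<epsilon>))"
  have fT: "?f t > T \<longleftrightarrow> q t > s0" "?f t \<ge> T \<longleftrightarrow> q t \<ge> s0" for t using \<epsilon> by (auto simp: T_def max_def)
  have [measurable]: "q \<in> borel_measurable borel" using q_continuous by (rule borel_measurable_continuous_onI)
  \<comment> \<open>The region under the graph and below height T is measured in both orders:
    vertical sections give min (f t) T, horizontal ones the distance of the turning points.\<close>
  let ?R = "\<lambda>t \<tau>. indicator {0<..<T} \<tau> * indicator {(t, \<tau>). \<epsilon> + \<tau>\<^sup>2 < q t} (t, \<tau>) :: ennreal"
  have mR: "(\<lambda>(t, \<tau>). ?R t \<tau>) \<in> borel_measurable (lborel \<Otimes>\<^sub>M lborel)" by measurable
  have in1: "(\<integral>\<^sup>+\<tau>. ?R t \<tau> \<partial>lborel) = ennreal (min (?f t) T)" for t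
  proof -
    have "(\<integral>\<^sup>+\<tau>. ?R t \<tau> \<partial>lborel) = (\<integral>\<^sup>+\<tau>. indicator {0<..<min (?f t) T} \<tau> \<partial>lborel)"
    proof (intro nn_integral_cong)
      fix \<tau> :: real
      have "\<epsilon> + \<tau>\<^sup>2 < q t \<longleftrightarrow> \<tau> < ?f t" if "0 < \<tau>"
      proof (cases "q t - \<epsilon> > 0")
        case True
        have "\<tau> < sqrt (q t - \<epsilon>) \<longleftrightarrow> \<tau>\<^sup>2 < q t - \<epsilon>" using real_sqrt_less_iff[of "\<tau>\<^sup>2" "q t - \<epsilon>"] that by simp
        then show ?thesis using True by (simp add: max_def algebra_simps)
      next
        case False
        have "\<not> \<epsilon> + \<tau>\<^sup>2 < q t" using False zero_le_power2[of \<tau>] by linarith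
        then show ?thesis using False that by (simp add: max_def)
      qed
      then show "?R t \<tau> = indicator {0<..<min (?f t) T} \<tau>" by (auto simp: indicator_def)
    qed
    also have "\<dots> = ennreal (min (?f t) T)" using T by (simp add: emeasure_lborel_Ioo min_def)
    finally show ?thesis .
  qed
  have in2: "(\<integral>\<^sup>+t. ?R t \<tau> \<partial>lborel) = ennreal (indicator {0<..<T} \<tau> * \<Delta> (\<epsilon> + \<tau>\<^sup>2))" for \<tau>
  proof (cases "\<tau> \<in> {0<..<T}")
    case True
    then have "\<tau>\<^sup>2 < T\<^sup>2" by (intro power_strict_mono) auto
    then have s: "0 < \<epsilon> + \<tau>\<^sup>2" "\<epsilon> + \<tau>\<^sup>2 \<le> ss" using T \<epsilon> by (auto simp: add_pos_nonneg)
    have "(\<integral>\<^sup>+t. ?R t \<tau> \<partial>lborel) = (\<integral>\<^sup>+t. indicator {sg1 (\<epsilon> + \<tau>\<^sup>2)<..<sg2 (\<epsilon> + \<tau>\<^sup>2)} t \<partial>lborel)"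
      using True q_gt_iff[OF s] by (intro nn_integral_cong) (auto simp: indicator_def)
    also have "\<dots> = ennreal (\<Delta> (\<epsilon> + \<tau>\<^sup>2))" using sg_le[OF s] by (simp add: \<Delta>_def)
    finally show ?thesis using True by simp
  qed auto
  have D0: "0 \<le> indicator {0<..<T} \<tau> * \<Delta> (\<epsilon> + \<tau>\<^sup>2)" for \<tau>
  proof (cases "\<tau> \<in> {0<..<T}")
    case True
    then have "\<tau>\<^sup>2 < T\<^sup>2" by (intro power_strict_mono) auto
    then have s: "0 < \<epsilon> + \<tau>\<^sup>2" "\<epsilon> + \<tau>\<^sup>2 \<le> ss" using T \<epsilon> by (auto simp: add_pos_nonneg)
    then show ?thesis using sg_le[OF s] by (simp add: \<Delta>_def)
  qed simp
  have mD: "(\<lambda>\<tau>. indicator {0<..<T} \<tau> * \<Delta> (\<epsilon> + \<tau>\<^sup>2)) \<in> borel_measurable lborel"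
  proof -
    have "(\<lambda>\<tau>. \<integral>\<^sup>+t. ?R t \<tau> \<partial>lborel) \<in> borel_measurable lborel" by measurable
    then have "(\<lambda>\<tau>. enn2real (\<integral>\<^sup>+t. ?R t \<tau> \<partial>lborel)) \<in> borel_measurable lborel" by measurable
    then show ?thesis unfolding in2 using D0 by simp
  qed
  have "(\<integral>\<^sup>+t. (\<integral>\<^sup>+\<tau>. ?R t \<tau> \<partial>lborel) \<partial>lborel) = (\<integral>\<^sup>+\<tau>. (\<integral>\<^sup>+t. ?R t \<tau> \<partial>lborel) \<partial>lborel)"
    using lborel_pair.Fubini'[OF mR] by simp
  then have "(\<integral>\<^sup>+t. ennreal (min (?f t) T) \<partial>lborel) = (\<integral>\<^sup>+\<tau>. ennreal (indicator {0<..<T} \<tau> * \<Delta> (\<epsilon> + \<tau>\<^sup>2)) \<partial>lborel)"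
    unfolding in1 in2 .
  then have m1: "(LINT t|lborel. min (?f t) T) = (LINT \<tau>:{0<..<T}|lborel. \<Delta> (\<epsilon> + \<tau>\<^sup>2))"
    unfolding set_lebesgue_integral_def real_scaleR_def using T D0 mD
    by (subst (1 2) integral_eq_nn_integral) auto
  have i0: "integrable lborel ?f" using G_eq(3)[OF e1] .
  have i1: "integrable lborel (\<lambda>t. min (?f t) T)"
    by (rule Bochner_Integration.integrable_bound[OF i0]) (use T in \<open>auto simp: min_def\<close>)
  have "G \<epsilon> = (LINT t|lborel. (?f t - min (?f t) T) + min (?f t) T)" unfolding G_eq(2)[OF e1] by simp
  also have "\<dots> = (LINT t|lborel. ?f t - min (?f t) T) + (LINT t|lborel. min (?f t) T)"
    using i0 i1 by (intro Bochner_Integration.integral_add) auto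
  also have "(\<lambda>t. ?f t - min (?f t) T) = (\<lambda>t. indicator {sg1 s0..sg2 s0} t *\<^sub>R (sqrt (q t - \<epsilon>) - T))"
  proof
    fix t
    show "?f t - min (?f t) T = indicator {sg1 s0..sg2 s0} t *\<^sub>R (sqrt (q t - \<epsilon>) - T)"
    proof (cases "q t \<ge> s0")
      case True
      then show ?thesis using q_ge_iff[OF s0, of t] fT(2)[of t] \<epsilon> by (auto simp: indicator_def min_def max_def)
    next
      case False
      then show ?thesis using q_ge_iff[OF s0, of t] fT(2)[of t] by (auto simp: indicator_def min_def)
    qed
  qed
  finally show ?thesis unfolding m1 set_lebesgue_integral_def by simp
qed

text \<open>Rescaling heights by sqrt (s0 - eps) makes the slices run over a fixed interval, so that
  eps enters only through the integrand and can be made complex.\<close>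

lemma layer_cake_scaled:
  assumes \<epsilon>: "0 < \<epsilon>" "\<epsilon> < s0" "s0 \<le> ss"
  shows "G \<epsilon> = (LINT t:{sg1 s0..sg2 s0}|lborel. sqrt (q t - \<epsilon>) - sqrt (s0 - \<epsilon>))
     + sqrt (s0 - \<epsilon>) * (LINT u:{0<..<1}|lborel. \<Delta> (\<epsilon> + (s0 - \<epsilon>) * u\<^sup>2))"
proof -
  let ?T = "sqrt (s0 - \<epsilon>)"
  have T: "?T > 0" using \<epsilon> by simp
  have "(LINT \<tau>:{0<..<?T}|lborel. \<Delta> (\<epsilon> + \<tau>\<^sup>2)) = ?T * (LINT u:{0<..<1}|lborel. \<Delta> (\<epsilon> + (s0 - \<epsilon>) * u\<^sup>2))"
  proof -
    have "(LINT \<tau>|lborel. indicator {0<..<?T} \<tau> *\<^sub>R \<Delta> (\<epsilon> + \<tau>\<^sup>2)) = ?T *\<^sub>R (LINT u|lborel. indicator {0<..<?T} (0 + ?T * u) *\<^sub>R \<Delta> (\<epsilon> + (0 + ?T * u)\<^sup>2))"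
      using lborel_integral_real_affine[of ?T "\<lambda>\<tau>. indicator {0<..<?T} \<tau> *\<^sub>R \<Delta> (\<epsilon> + \<tau>\<^sup>2)" 0] T by simp
    also have "(\<lambda>u. indicator {0<..<?T} (0 + ?T * u) *\<^sub>R \<Delta> (\<epsilon> + (0 + ?T * u)\<^sup>2)) = (\<lambda>u. indicator {0<..<1} u *\<^sub>R \<Delta> (\<epsilon> + (s0 - \<epsilon>) * u\<^sup>2))"
      using T \<epsilon> by (auto simp: fun_eq_iff indicator_def zero_less_mult_iff power_mult_distrib)
    finally show ?thesis unfolding set_lebesgue_integral_def by simp
  qed
  then show ?thesis using layer_cake[OF \<epsilon>] by simp
qed

end

text \<open>The argument of \<open>D\<close> runs through the segment from eps to s0, which
  convexity keeps inside \<open>V\<close>; the bound on \<open>D\<close> supplies the dominating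
  function.\<close>

lemma holomorphic_segment_integral:
  fixes D :: "complex \<Rightarrow> complex"
  assumes V: "open V" "convex V" and hol: "D holomorphic_on V" and B: "\<And>v. v \<in> V \<Longrightarrow> norm (D v) \<le> B" and s0: "s0 \<in> V"
  shows "(\<lambda>\<epsilon>. LINT u:{0<..<1}|lborel. D (\<epsilon> + (s0 - \<epsilon>) * of_real (u\<^sup>2))) holomorphic_on V"
proof -
  have inV: "\<epsilon> + (s0 - \<epsilon>) * of_real (u\<^sup>2) \<in> V" if "\<epsilon> \<in> V" "u \<in> {0<..<1}" for \<epsilon> and u :: real
  proof -
    have "u\<^sup>2 < 1" "0 \<le> u\<^sup>2" using that by (auto simp: abs_square_less_1)
    then have "(1 - u\<^sup>2) *\<^sub>R \<epsilon> + u\<^sup>2 *\<^sub>R s0 \<in> V" using V(2) that s0 by (intro convexD) auto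
    moreover have "(1 - u\<^sup>2) *\<^sub>R \<epsilon> + u\<^sup>2 *\<^sub>R s0 = \<epsilon> + (s0 - \<epsilon>) * of_real (u\<^sup>2)"
      by (simp add: scaleR_conv_of_real algebra_simps)
    ultimately show ?thesis by simp
  qed
  have cont: "continuous_on V D" using hol by (rule holomorphic_on_imp_continuous_on)
  have B0: "B \<ge> 0" using order_trans[OF norm_ge_zero B[OF s0]] .
  show ?thesis unfolding set_lebesgue_integral_def
  proof (rule holomorphic_on_lebesgue_integral[OF V(1)])
    fix \<epsilon> assume \<epsilon>: "\<epsilon> \<in> V"
    have "continuous_on {0<..<1} (\<lambda>u::real. D (\<epsilon> + (s0 - \<epsilon>) * of_real (u\<^sup>2)))"
      by (rule continuous_on_compose2[OF cont]) (use inV[OF \<epsilon>] in \<open>auto intro!: continuous_intros\<close>)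
    then show "(\<lambda>u. indicator {0<..<1} u *\<^sub>R D (\<epsilon> + (s0 - \<epsilon>) * of_real (u\<^sup>2))) \<in> borel_measurable lborel"
      by (simp add: borel_measurable_continuous_on_indicator)
    show "\<exists>r>0. \<exists>g. integrable lborel g \<and> (\<forall>w'\<in>ball \<epsilon> r \<inter> V. \<forall>u. norm (indicator {0<..<1} u *\<^sub>R D (w' + (s0 - w') * of_real (u\<^sup>2))) \<le> g u)"
    proof (intro exI[of _ 1] conjI exI[of _ "\<lambda>u. indicator {0<..<1} u * B"] ballI allI)
      show "integrable lborel (\<lambda>u. indicator {0<..<1::real} u * B)" by (intro integrable_mult_left) simp
      fix w' and u :: real assume w': "w' \<in> ball \<epsilon> 1 \<inter> V"
      show "norm (indicator {0<..<1} u *\<^sub>R D (w' + (s0 - w') * of_real (u\<^sup>2))) \<le> indicator {0<..<1} u * B"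
      proof (cases "u \<in> {0<..<1}")
        case True
        then show ?thesis using B[OF inV[of w' u]] w' by simp
      qed simp
    qed simp
  next
    fix u :: real
    show "(\<lambda>\<epsilon>. indicator {0<..<1} u *\<^sub>R D (\<epsilon> + (s0 - \<epsilon>) * of_real (u\<^sup>2))) holomorphic_on V"
    proof (cases "u \<in> {0<..<1}")
      case True
      have "(D \<circ> (\<lambda>\<epsilon>. \<epsilon> + (s0 - \<epsilon>) * of_real (u\<^sup>2))) holomorphic_on V"
        by (rule holomorphic_on_compose_gen[OF _ hol]) (use inV True in \<open>auto intro!: holomorphic_intros\<close>)
      then show ?thesis using True by (simp add: comp_def)
    qed simp
  qed
qed

lemma holomorphic_shrink_bounded:
  assumes "r > 0" "f holomorphic_on ball z r"
  shows "\<exists>B. \<forall>w\<in>ball z (r/2). norm (f w) \<le> (B::real)"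
proof -
  have "continuous_on (cball z (r/2)) f"
    by (rule continuous_on_subset[OF holomorphic_on_imp_continuous_on[OF assms(2)]]) (use assms in auto)
  then have "compact (f ` cball z (r/2))" by (rule compact_continuous_image) simp
  then obtain B where "\<forall>y\<in>f ` cball z (r/2). norm y \<le> B" using compact_imp_bounded bounded_iff by blast
  then show ?thesis by (intro exI[of _ B]) auto
qed

section \<open>Analyticity of the action integral at interior levels\<close>

context well
begin

text \<open>Away from \<open>ts\<close> the derivative of \<open>q\<close> does not vanish, so there
  is an analytic inverse. Confining it to distance less than |ts - t0| from t0 keeps it on one side
  of \<open>ts\<close>, which later identifies it with \<open>sg1\<close> or
  \<open>sg2\<close>.\<close>

lemma branch_analytic:
  assumes t0: "t0 \<noteq> ts"
  shows "\<exists>r>0. \<exists>g. g holomorphic_on ball (of_real (q t0)) r \<and> (\<forall>s. \<bar>s - q t0\<bar> < r \<longrightarrow> (\<exists>t. g (of_real s) = of_real t \<and> q t = s \<and> \<bar>t - t0\<bar> < \<bar>ts - t0\<bar>))"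
proof -
  have "deriv qc (of_real t0) = of_real (exp t0 - (1 + \<alpha>) * exp ((1 + \<alpha>) * t0))"
    using DERIV_imp_deriv[OF qc_deriv[of "of_real t0"]] by (simp only: of_real_diff exp_of_real[symmetric] of_real_mult)
  also have "exp t0 - (1 + \<alpha>) * exp ((1 + \<alpha>) * t0) = exp t0 * (1 - (1 + \<alpha>) * exp (\<alpha> * t0))"
    by (simp add: algebra_simps exp_add)
  finally have dq: "deriv qc (of_real t0) = of_real (exp t0 * (1 - (1 + \<alpha>) * exp (\<alpha> * t0)))" .
  have "exp t0 * (1 - (1 + \<alpha>) * exp (\<alpha> * t0)) \<noteq> 0" using slope_sign[of t0] t0 by (cases "t0 < ts") auto
  then have d: "deriv qc (of_real t0) \<noteq> 0" unfolding dq of_real_eq_0_iff .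
  have \<delta>: "\<bar>ts - t0\<bar> > 0" using t0 by simp
  obtain r g where rg: "r > 0" "g holomorphic_on ball (qc (of_real t0)) r"
    "\<And>w. w \<in> ball (qc (of_real t0)) r \<Longrightarrow> qc (g w) = w"
    "\<And>w. w \<in> ball (qc (of_real t0)) r \<Longrightarrow> g w \<in> ball (of_real t0) \<bar>ts - t0\<bar>"
    "\<And>w. w \<in> ball (qc (of_real t0)) r \<Longrightarrow> w \<in> \<real> \<Longrightarrow> g w \<in> \<real>"
    using real_local_inverse[OF open_UNIV qc_holomorphic _ d \<delta> qc_cnj] by auto
  have "\<exists>t. g (of_real s) = of_real t \<and> q t = s \<and> \<bar>t - t0\<bar> < \<bar>ts - t0\<bar>" if s: "\<bar>s - q t0\<bar> < r" for s
  proof -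
    have w: "of_real s \<in> ball (qc (of_real t0)) r"
      using s by (simp add: qc_of_real dist_norm norm_minus_commute flip: of_real_diff)
    obtain t where t: "g (of_real s) = of_real t" using rg(5)[OF w] by (auto elim: Reals_cases)
    have "of_real (q t) = complex_of_real s" using rg(3)[OF w] t by (simp add: qc_of_real)
    then have "q t = s" by simp
    moreover have "\<bar>t - t0\<bar> < \<bar>ts - t0\<bar>" using rg(4)[OF w] t by (simp add: dist_norm abs_minus_commute flip: of_real_diff)
    ultimately show ?thesis using t by blast
  qed
  moreover have "g holomorphic_on ball (of_real (q t0)) r" using rg(2) by (simp add: qc_of_real)
  ultimately show ?thesis using rg(1) by blast
qed

lemma Delta_analytic:
  assumes s0: "0 < s0" "s0 < ss"
  shows "\<exists>r>0. \<exists>D. D holomorphic_on ball (of_real s0) r \<and> (\<forall>s. \<bar>s - s0\<bar> < r \<longrightarrow> 0 < s \<and> s < ss \<and> D (of_real s) = of_real (\<Delta> s))"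
proof -
  note a = sg1[OF s0(1) less_imp_le[OF s0(2)]] and b = sg2[OF s0(1) less_imp_le[OF s0(2)]]
  have n1: "sg1 s0 \<noteq> ts" "sg1 s0 < ts" and n2: "sg2 s0 \<noteq> ts" "sg2 s0 > ts" using a b s0 by (auto simp: ss_def less_le)
  obtain r1 g1 where 1: "r1 > 0" "g1 holomorphic_on ball (of_real s0) r1"
     "\<And>s. \<bar>s - s0\<bar> < r1 \<Longrightarrow> \<exists>t. g1 (of_real s) = of_real t \<and> q t = s \<and> \<bar>t - sg1 s0\<bar> < \<bar>ts - sg1 s0\<bar>"
    using branch_analytic[OF n1(1)] unfolding a by blast
  obtain r2 g2 where 2: "r2 > 0" "g2 holomorphic_on ball (of_real s0) r2"
     "\<And>s. \<bar>s - s0\<bar> < r2 \<Longrightarrow> \<exists>t. g2 (of_real s) = of_real t \<and> q t = s \<and> \<bar>t - sg2 s0\<bar> < \<bar>ts - sg2 s0\<bar>"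
    using branch_analytic[OF n2(1)] unfolding b by blast
  define r where "r = Min {r1, r2, s0, ss - s0}"
  have r: "r > 0" "r \<le> r1" "r \<le> r2" "r \<le> s0" "r \<le> ss - s0" using 1 2 s0 by (auto simp: r_def)
  show ?thesis
  proof (intro exI[of _ r] conjI exI[of _ "\<lambda>w. g2 w - g1 w"] allI impI)
    show "(\<lambda>w. g2 w - g1 w) holomorphic_on ball (of_real s0) r"
      using r by (intro holomorphic_on_diff holomorphic_on_subset[OF 1(2)] holomorphic_on_subset[OF 2(2)]) auto
    fix s assume s: "\<bar>s - s0\<bar> < r"
    show ps: "0 < s" "s < ss" using s r by linarith+
    obtain t where t: "g1 (of_real s) = of_real t" "q t = s" "\<bar>t - sg1 s0\<bar> < \<bar>ts - sg1 s0\<bar>" using 1(3)[of s] s r by auto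
    have "sg1 s = t" using t n1 ps by (intro sg1_unique) auto
    obtain t' where t': "g2 (of_real s) = of_real t'" "q t' = s" "\<bar>t' - sg2 s0\<bar> < \<bar>ts - sg2 s0\<bar>" using 2(3)[of s] s r by auto
    have "sg2 s = t'" using t' n2 ps by (intro sg2_unique) auto
    show "g2 (of_real s) - g1 (of_real s) = of_real (\<Delta> s)" using t t' \<open>sg1 s = t\<close> \<open>sg2 s = t'\<close> by (simp add: \<Delta>_def)
  qed (use r in auto)
qed

text \<open>The part of the area above height sqrt (s0 - eps), for complex eps. As q >= s0 on this
  interval, Re eps < s0 keeps every square root away from its cut.\<close>

definition inner :: "real \<Rightarrow> complex \<Rightarrow> complex" where
  "inner s0 \<epsilon> = (LINT t:{sg1 s0..sg2 s0}|lborel. csqrt (of_real (q t) - \<epsilon>) - csqrt (of_real s0 - \<epsilon>))"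

lemma inner_holomorphic:
  assumes s0: "0 < s0" "s0 \<le> ss"
  shows "inner s0 holomorphic_on {\<epsilon>. Re \<epsilon> < s0}"
  unfolding inner_def set_lebesgue_integral_def
proof (rule holomorphic_on_lebesgue_integral)
  show "open {\<epsilon>. Re \<epsilon> < s0}" by (intro open_Collect_less continuous_intros)
  have nn: "of_real v - \<epsilon> \<notin> \<real>\<^sub>\<le>\<^sub>0" if "v \<ge> s0" "Re \<epsilon> < s0" for v \<epsilon>
    using that by (auto simp: complex_nonpos_Reals_iff)
  have qs: "q t \<ge> s0" if "t \<in> {sg1 s0..sg2 s0}" for t using q_ge_iff[OF s0] that by auto
  fix \<epsilon> assume \<epsilon>: "\<epsilon> \<in> {\<epsilon>. Re \<epsilon> < s0}"
  have "continuous_on {sg1 s0..sg2 s0} (\<lambda>t. csqrt (of_real (q t) - \<epsilon>))"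
  proof (rule continuous_on_compose2[of "- \<real>\<^sub>\<le>\<^sub>0" csqrt])
    show "continuous_on (- \<real>\<^sub>\<le>\<^sub>0) csqrt" by (rule continuous_on_csqrt)
    show "continuous_on {sg1 s0..sg2 s0} (\<lambda>t. complex_of_real (q t) - \<epsilon>)" by (intro continuous_intros q_continuous)
  qed (use nn qs \<epsilon> in auto)
  then have "continuous_on {sg1 s0..sg2 s0} (\<lambda>t. csqrt (of_real (q t) - \<epsilon>) - csqrt (of_real s0 - \<epsilon>))"
    by (rule continuous_on_diff[OF _ continuous_on_const])
  then show "(\<lambda>t. indicator {sg1 s0..sg2 s0} t *\<^sub>R (csqrt (of_real (q t) - \<epsilon>) - csqrt (of_real s0 - \<epsilon>))) \<in> borel_measurable lborel"
    by (simp add: borel_measurable_continuous_on_indicator)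
  define B where "B = 2 * sqrt (ss + norm \<epsilon> + 1)"
  have "norm (csqrt (of_real (q t) - w') - csqrt (of_real s0 - w')) \<le> B" if w': "w' \<in> ball \<epsilon> 1" and t: "t \<in> {sg1 s0..sg2 s0}" for w' t
  proof -
    have nw: "norm w' \<le> norm \<epsilon> + 1" using w' norm_triangle_sub[of w' \<epsilon>] by (simp add: dist_norm norm_minus_commute)
    have gen: "norm (csqrt (of_real v - w')) \<le> sqrt (ss + norm \<epsilon> + 1)" if "0 \<le> v" "v \<le> ss" for v
    proof (rule real_le_rsqrt)
      have "(norm (csqrt (of_real v - w')))\<^sup>2 = norm (of_real v - w')" by (metis norm_power power2_csqrt)
      also have "\<dots> \<le> v + norm w'" using norm_triangle_ineq4[of "of_real v" w'] that by simp
      finally show "(norm (csqrt (of_real v - w')))\<^sup>2 \<le> ss + norm \<epsilon> + 1" using nw that by simp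
    qed
    have "0 \<le> q t" using s0 qs[OF t] by linarith
    then have "norm (csqrt (of_real (q t) - w')) \<le> sqrt (ss + norm \<epsilon> + 1)" by (rule gen[OF _ q_le_ss])
    moreover have "norm (csqrt (of_real s0 - w')) \<le> sqrt (ss + norm \<epsilon> + 1)" using s0 by (intro gen) auto
    ultimately show ?thesis unfolding B_def
      using norm_triangle_ineq4[of "csqrt (of_real (q t) - w')" "csqrt (of_real s0 - w')"] by linarith
  qed
  then show "\<exists>r>0. \<exists>g. integrable lborel g \<and> (\<forall>w'\<in>ball \<epsilon> r \<inter> {\<epsilon>. Re \<epsilon> < s0}. \<forall>t. norm (indicator {sg1 s0..sg2 s0} t *\<^sub>R (csqrt (of_real (q t) - w') - csqrt (of_real s0 - w'))) \<le> g t)"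
  proof (intro exI[of _ 1] conjI exI[of _ "\<lambda>t. indicator {sg1 s0..sg2 s0} t * B"] ballI allI)
    show "integrable lborel (\<lambda>t. indicator {sg1 s0..sg2 s0} t * B)"
      by (intro integrable_mult_left integrable_real_indicator) (auto simp: emeasure_lborel_Icc_eq)
  qed (auto simp: indicator_def)
next
  fix t
  have nn: "of_real v - \<epsilon> \<notin> \<real>\<^sub>\<le>\<^sub>0" if "v \<ge> s0" "Re \<epsilon> < s0" for v \<epsilon>
    using that by (auto simp: complex_nonpos_Reals_iff)
  show "(\<lambda>\<epsilon>. indicator {sg1 s0..sg2 s0} t *\<^sub>R (csqrt (of_real (q t) - \<epsilon>) - csqrt (of_real s0 - \<epsilon>))) holomorphic_on {\<epsilon>. Re \<epsilon> < s0}"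
  proof (cases "t \<in> {sg1 s0..sg2 s0}")
    case True
    then have "q t \<ge> s0" using q_ge_iff[OF s0] by auto
    then show ?thesis using nn True by (auto intro!: holomorphic_intros)
  qed simp
qed

lemma csqrt_of_real: "x \<ge> 0 \<Longrightarrow> csqrt (of_real x) = of_real (sqrt x)"
  by (simp add: complex_eq_iff)

text \<open>\<open>D\<close> is any function agreeing with \<open>\<Delta>\<close> at the levels
  between eps and s0; a holomorphic choice of it therefore makes the right-hand side holomorphic in
  eps.\<close>

lemma G_decompose:
  assumes \<epsilon>: "0 < \<epsilon>" "\<epsilon> < s0" "s0 \<le> ss"
    and D: "\<And>s. \<epsilon> < s \<Longrightarrow> s < s0 \<Longrightarrow> D (of_real s) = of_real (\<Delta> s)"
  shows "of_real (G \<epsilon>) = inner s0 (of_real \<epsilon>) + csqrt (of_real s0 - of_real \<epsilon>) * (LINT u:{0<..<1}|lborel. D (of_real \<epsilon> + (of_real s0 - of_real \<epsilon>) * of_real (u\<^sup>2)))"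
proof -
  have "inner s0 (of_real \<epsilon>) = (LINT t:{sg1 s0..sg2 s0}|lborel. of_real (sqrt (q t - \<epsilon>) - sqrt (s0 - \<epsilon>)))"
    unfolding inner_def
  proof (rule set_lebesgue_integral_cong)
    have "q t \<ge> s0" if "t \<in> {sg1 s0..sg2 s0}" for t using q_ge_iff[of s0] \<epsilon> that by auto
    then show "\<forall>t. t \<in> {sg1 s0..sg2 s0} \<longrightarrow> csqrt (of_real (q t) - of_real \<epsilon>) - csqrt (of_real s0 - of_real \<epsilon>) = of_real (sqrt (q t - \<epsilon>) - sqrt (s0 - \<epsilon>))"
      using \<epsilon> by (auto simp flip: of_real_diff simp: csqrt_of_real order_trans[of \<epsilon> s0])
  qed simp
  then have 1: "inner s0 (of_real \<epsilon>) = of_real (LINT t:{sg1 s0..sg2 s0}|lborel. sqrt (q t - \<epsilon>) - sqrt (s0 - \<epsilon>))"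
    by (simp only: set_integral_complex_of_real)
  have "(LINT u:{0<..<1}|lborel. D (of_real \<epsilon> + (of_real s0 - of_real \<epsilon>) * of_real (u\<^sup>2))) = (LINT u:{0<..<1}|lborel. of_real (\<Delta> (\<epsilon> + (s0 - \<epsilon>) * u\<^sup>2)))"
  proof (rule set_lebesgue_integral_cong, simp, intro allI impI)
    fix u :: real assume u: "u \<in> {0<..<1}"
    have u2: "0 < u\<^sup>2" "u\<^sup>2 < 1" using u by (auto simp: abs_square_less_1)
    have "\<epsilon> < \<epsilon> + (s0 - \<epsilon>) * u\<^sup>2" using u2 \<epsilon> by simp
    moreover have "(s0 - \<epsilon>) * u\<^sup>2 < (s0 - \<epsilon>) * 1" using u2 \<epsilon> by (intro mult_strict_left_mono) auto
    ultimately have "D (of_real (\<epsilon> + (s0 - \<epsilon>) * u\<^sup>2)) = of_real (\<Delta> (\<epsilon> + (s0 - \<epsilon>) * u\<^sup>2))" by (intro D) auto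
    then show "D (of_real \<epsilon> + (of_real s0 - of_real \<epsilon>) * of_real (u\<^sup>2)) = of_real (\<Delta> (\<epsilon> + (s0 - \<epsilon>) * u\<^sup>2))" by simp
  qed
  then have 2: "(LINT u:{0<..<1}|lborel. D (of_real \<epsilon> + (of_real s0 - of_real \<epsilon>) * of_real (u\<^sup>2))) = of_real (LINT u:{0<..<1}|lborel. \<Delta> (\<epsilon> + (s0 - \<epsilon>) * u\<^sup>2))"
    by (simp only: set_integral_complex_of_real)
  have 3: "csqrt (of_real s0 - of_real \<epsilon>) = of_real (sqrt (s0 - \<epsilon>))" using \<epsilon> by (simp add: csqrt_of_real flip: of_real_diff)
  show ?thesis unfolding 1 2 3 layer_cake_scaled[OF \<epsilon>] by simp
qed

lemma G_analytic_interior: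
  assumes \<epsilon>0: "0 < \<epsilon>0" "\<epsilon>0 < ss"
  shows "\<exists>r>0. \<exists>g. g holomorphic_on ball (of_real \<epsilon>0) r \<and> (\<forall>\<epsilon>. \<bar>\<epsilon> - \<epsilon>0\<bar> < r \<longrightarrow> g (of_real \<epsilon>) = of_real (G \<epsilon>))"
proof -
  obtain r1 D where D: "r1 > 0" "D holomorphic_on ball (of_real \<epsilon>0) r1"
    "\<And>s. \<bar>s - \<epsilon>0\<bar> < r1 \<Longrightarrow> 0 < s \<and> s < ss \<and> D (of_real s) = of_real (\<Delta> s)" using Delta_analytic[OF \<epsilon>0] by blast
  obtain B where B: "\<And>w. w \<in> ball (of_real \<epsilon>0) (r1/2) \<Longrightarrow> norm (D w) \<le> B" using holomorphic_shrink_bounded[OF D(1,2)] by blast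
  \<comment> \<open>The cut level lies just above \<epsilon>0, so that all slices stay in the disc
    where \<open>\<Delta>\<close> is analytic; the radius r1/4 for eps guarantees Re eps <
    s0.\<close>
  define s0 where "s0 = \<epsilon>0 + r1/4"
  let ?V = "ball (complex_of_real \<epsilon>0) (r1/2)"
  let ?W = "ball (complex_of_real \<epsilon>0) (r1/4)"
  have s0: "of_real s0 \<in> ?V" "0 < s0" "s0 \<le> ss" "\<epsilon>0 < s0"
    using D(1) D(3)[of s0] by (auto simp: s0_def dist_norm norm_divide)
  have h1: "(\<lambda>\<epsilon>. LINT u:{0<..<1}|lborel. D (\<epsilon> + (of_real s0 - \<epsilon>) * of_real (u\<^sup>2))) holomorphic_on ?V"
    by (rule holomorphic_segment_integral[OF _ _ _ B s0(1)]) (use D in \<open>auto intro: holomorphic_on_subset\<close>)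
  have re: "Re w < s0" if "w \<in> ?W" for w
  proof -
    have "\<bar>Re (w - of_real \<epsilon>0)\<bar> \<le> norm (w - of_real \<epsilon>0)" by (rule abs_Re_le_cmod)
    then show ?thesis using that by (simp add: s0_def dist_norm norm_minus_commute)
  qed
  let ?g = "\<lambda>\<epsilon>. inner s0 \<epsilon> + csqrt (of_real s0 - \<epsilon>) * (LINT u:{0<..<1}|lborel. D (\<epsilon> + (of_real s0 - \<epsilon>) * of_real (u\<^sup>2)))"
  have "?g holomorphic_on ?W"
  proof (intro holomorphic_on_add holomorphic_on_mult)
    show "inner s0 holomorphic_on ?W" using inner_holomorphic[OF s0(2,3)] by (rule holomorphic_on_subset) (use re in auto)
    show "(\<lambda>\<epsilon>. csqrt (of_real s0 - \<epsilon>)) holomorphic_on ?W"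
    proof (intro holomorphic_intros)
      fix w assume "w \<in> ?W"
      then show "of_real s0 - w \<notin> \<real>\<^sub>\<le>\<^sub>0" using re[of w] by (auto simp: complex_nonpos_Reals_iff)
    qed
    show "(\<lambda>\<epsilon>. LINT u:{0<..<1}|lborel. D (\<epsilon> + (of_real s0 - \<epsilon>) * of_real (u\<^sup>2))) holomorphic_on ?W"
      using h1 by (rule holomorphic_on_subset) (use D(1) in auto)
  qed
  moreover have "?g (of_real \<epsilon>) = of_real (G \<epsilon>)" if \<epsilon>: "\<bar>\<epsilon> - \<epsilon>0\<bar> < r1/4" for \<epsilon>
  proof (rule G_decompose[symmetric])
    show "0 < \<epsilon>" using D(3)[of \<epsilon>] \<epsilon> D(1) by auto
    show "\<epsilon> < s0" unfolding s0_def using \<epsilon> by linarith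
    show "s0 \<le> ss" by fact
    show "D (of_real s) = of_real (\<Delta> s)" if "\<epsilon> < s" "s < s0" for s
    proof -
      have "\<bar>s - \<epsilon>0\<bar> < r1" using that \<epsilon> D(1) unfolding s0_def by linarith
      then show ?thesis using D(3)[of s] by blast
    qed
  qed
  ultimately show ?thesis using D(1) by (intro exI[of _ "r1/4"] conjI exI[of _ ?g]) auto
qed

end

lemma holomorphic_Lipschitz_at_center:
  assumes r: "r > 0" and hol: "f holomorphic_on ball z r"
  shows "\<exists>C. \<forall>w\<in>ball z (r/2). norm (f w - f z) \<le> C * norm (w - z)"
proof -
  have "deriv f holomorphic_on ball z r" using hol by (rule holomorphic_deriv) simp
  from holomorphic_shrink_bounded[OF r this] obtain B where B: "\<And>w. w \<in> ball z (r/2) \<Longrightarrow> norm (deriv f w) \<le> B" by blast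
  have "norm (f w - f z) \<le> B * norm (w - z)" if "w \<in> ball z (r/2)" for w
  proof (rule field_differentiable_bound[where S="ball z (r/2)" and f'="deriv f"])
    show "(f has_field_derivative deriv f v) (at v within ball z (r/2))" if "v \<in> ball z (r/2)" for v
      by (rule has_field_derivative_at_within, rule holomorphic_derivI[OF hol]) (use that r in auto)
  qed (use B that r in auto)
  then show ?thesis by blast
qed

section \<open>The level ss, where the turning points merge\<close>

context well
begin

text \<open>(ss - q) / exp ts as a function of the displacement x from \<open>ts\<close>, extended
  to complex x.\<close>

definition kk :: "complex \<Rightarrow> complex" where
  "kk x = of_real (\<alpha> / (1 + \<alpha>)) - exp x + exp (of_real (1 + \<alpha>) * x) / of_real (1 + \<alpha>)"

lemma exp_ts2: "exp ((1 + \<alpha>) * ts) = exp ts / (1 + \<alpha>)"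
proof -
  have "exp ((1 + \<alpha>) * ts) = exp ts * exp (\<alpha> * ts)" by (simp add: exp_add[symmetric] algebra_simps)
  then show ?thesis by (simp add: exp_ts)
qed

lemma ss_eq: "ss = exp ts * (\<alpha> / (1 + \<alpha>))"
  unfolding ss_def q_def exp_ts2 using \<alpha> by (simp add: field_simps)

lemma kk_eq: "of_real ss - qc (of_real ts + x) = of_real (exp ts) * kk x"
proof -
  have "exp (of_real (1 + \<alpha>) * (of_real ts + x)) = complex_of_real (exp ((1 + \<alpha>) * ts)) * exp (of_real (1 + \<alpha>) * x)"
    by (simp only: distrib_left exp_add of_real_mult[symmetric] exp_of_real)
  then have "qc (of_real ts + x) = of_real (exp ts) * exp x - of_real (exp ts / (1 + \<alpha>)) * exp (of_real (1 + \<alpha>) * x)"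
    unfolding qc_def exp_ts2 by (simp only: exp_add exp_of_real)
  then show ?thesis unfolding kk_def ss_eq by (simp add: algebra_simps)
qed

lemma kk_deriv: "(kk has_field_derivative - exp x + exp (of_real (1 + \<alpha>) * x)) (at x)"
proof -
  have "1 + \<alpha> \<noteq> 0" using \<alpha> by simp
  then have "of_real (1 + \<alpha>) \<noteq> (0::complex)" unfolding of_real_eq_0_iff .
  then show ?thesis unfolding kk_def by (auto intro!: derivative_eq_intros)
qed

text \<open>Dividing twice by x gives h, and h 0 is half of the second derivative \<alpha> of
  \<open>kk\<close> at 0. Positivity of this value means that the maximum of \<open>q\<close> is
  non-degenerate, so ss - q has a holomorphic square root near \<open>ts\<close>.\<close>

lemma kk_square: "\<exists>h. h holomorphic_on UNIV \<and> (\<forall>x. kk x = x\<^sup>2 * h x) \<and> h 0 = of_real (\<alpha> / 2)"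
proof -
  have hk: "kk holomorphic_on UNIV" using kk_deriv by (auto simp: holomorphic_on_def field_differentiable_def intro: has_field_derivative_at_within)
  have k0: "kk 0 = 0"
  proof -
    have "kk 0 = of_real (\<alpha> / (1 + \<alpha>) - 1 + 1 / (1 + \<alpha>))" unfolding kk_def by simp
    also have "\<alpha> / (1 + \<alpha>) - 1 + 1 / (1 + \<alpha>) = 0" using \<alpha> by (simp add: field_simps)
    finally show ?thesis by simp
  qed
  have dk0: "deriv kk 0 = 0" using DERIV_imp_deriv[OF kk_deriv[of 0]] by simp
  define k1 where "k1 = (\<lambda>x. if x = 0 then deriv kk 0 else (kk x - kk 0) / (x - 0))"
  have hk1: "k1 holomorphic_on UNIV" unfolding k1_def by (rule pole_lemma_open[OF hk open_UNIV])
  have e1: "kk x = x * k1 x" for x by (simp add: k1_def k0)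
  define h where "h = (\<lambda>x. if x = 0 then deriv k1 0 else (k1 x - k1 0) / (x - 0))"
  have hh: "h holomorphic_on UNIV" unfolding h_def by (rule pole_lemma_open[OF hk1 open_UNIV])
  have e2: "k1 x = x * h x" for x by (simp add: h_def k1_def dk0)
  have e: "kk x = x\<^sup>2 * h x" for x using e1[of x] e2[of x] by (simp add: power2_eq_square)
  have dh: "(h has_field_derivative deriv h x) (at x)" for x using holomorphic_derivI[OF hh open_UNIV] by simp
  have dh2: "(deriv h has_field_derivative deriv (deriv h) x) (at x)" for x
    using holomorphic_derivI[OF holomorphic_deriv[OF hh open_UNIV] open_UNIV] by simp
  have "(kk has_field_derivative 2 * x * h x + x\<^sup>2 * deriv h x) (at x)" for x
  proof -
    have "((\<lambda>x. x\<^sup>2 * h x) has_field_derivative 2 * x * h x + x\<^sup>2 * deriv h x) (at x)"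
      using dh[of x] by (auto intro!: derivative_eq_intros simp: algebra_simps)
    moreover have "kk = (\<lambda>x. x\<^sup>2 * h x)" using e by auto
    ultimately show ?thesis by simp
  qed
  then have eq: "- exp x + exp (of_real (1 + \<alpha>) * x) = 2 * x * h x + x\<^sup>2 * deriv h x" for x
    using DERIV_unique[OF kk_deriv[of x]] by blast
  have "((\<lambda>x::complex. - exp x + exp (of_real (1 + \<alpha>) * x)) has_field_derivative of_real \<alpha>) (at 0)"
    by (auto intro!: derivative_eq_intros)
  then have "((\<lambda>x. 2 * x * h x + x\<^sup>2 * deriv h x) has_field_derivative of_real \<alpha>) (at 0)" unfolding eq .
  moreover have "((\<lambda>x. 2 * x * h x + x\<^sup>2 * deriv h x) has_field_derivative 2 * h 0) (at 0)"
    using dh[of 0] dh2[of 0] by (auto intro!: derivative_eq_intros)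
  ultimately have "of_real \<alpha> = 2 * h 0" by (rule DERIV_unique)
  then have "h 0 = of_real (\<alpha> / 2)" by simp
  then show ?thesis using hh e by blast
qed

text \<open>Near \<open>ts\<close> one has ss - q (ts + x) = T(x)^2 with T(x) = x csqrt (exp ts
  h(x)), and T has a holomorphic inverse Z that is real on the real axis. The turning points at
  level ss - t^2 are then ts + Z(t) and ts + Z(-t).\<close>

lemma Delta_top:
  "\<exists>r>0. \<exists>Z. Z holomorphic_on ball 0 r \<and> (\<forall>w\<in>ball 0 r. norm (Z w) \<le> 1) \<and>
     (\<forall>t. 0 < t \<and> t < r \<longrightarrow> 0 < ss - t\<^sup>2 \<and> of_real (\<Delta> (ss - t\<^sup>2)) = Z (of_real t) - Z (- of_real t))"
proof -
  obtain h where h: "h holomorphic_on UNIV" "\<And>x. kk x = x\<^sup>2 * h x" "h 0 = of_real (\<alpha> / 2)" using kk_square by blast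
  have kk_cnj: "kk (cnj x) = cnj (kk x)" for x by (simp add: kk_def exp_cnj)
  have h_cnj: "h (cnj x) = cnj (h x)" for x
  proof (cases "x = 0")
    case False
    have "(cnj x)\<^sup>2 * h (cnj x) = (cnj x)\<^sup>2 * cnj (h x)" using kk_cnj[of x] h(2)[of x] h(2)[of "cnj x"] by simp
    then show ?thesis using False by simp
  qed (simp add: h(3))
  define S0 where "S0 = {x. Re (h x) > 0}"
  have S0: "open S0" "0 \<in> S0"
  proof -
    have "continuous_on UNIV h" using h(1) by (rule holomorphic_on_imp_continuous_on)
    then show "open S0" unfolding S0_def by (intro open_Collect_less continuous_intros) auto
    show "0 \<in> S0" unfolding S0_def mem_Collect_eq h(3) Re_complex_of_real using \<alpha> by simp
  qed
  define T where "T = (\<lambda>x. x * csqrt (of_real (exp ts) * h x))"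
  have nn: "of_real (exp ts) * h x \<notin> \<real>\<^sub>\<le>\<^sub>0" if "x \<in> S0" for x
    using that by (auto simp: S0_def complex_nonpos_Reals_iff mult_le_0_iff not_le)
  have hT: "T holomorphic_on S0" unfolding T_def
    using nn by (intro holomorphic_intros holomorphic_on_subset[OF h(1)]) auto
  have T_cnj: "T (cnj x) = cnj (T x)" if "x \<in> S0" for x
    unfolding T_def using cnj_csqrt[OF nn[OF that]] by (simp add: h_cnj)
  have dT: "deriv T (of_real 0) \<noteq> 0"
  proof -
    have "(\<lambda>x. csqrt (of_real (exp ts) * h x)) holomorphic_on S0"
      using nn by (intro holomorphic_intros holomorphic_on_subset[OF h(1)]) auto
    then obtain D where "((\<lambda>x. csqrt (of_real (exp ts) * h x)) has_field_derivative D) (at 0)"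
      using S0 holomorphic_derivI by blast
    from DERIV_mult[OF DERIV_ident this]
    have "(T has_field_derivative csqrt (of_real (exp ts) * h 0)) (at 0)" unfolding T_def by simp
    then have "deriv T 0 = csqrt (of_real (exp ts) * h 0)" by (rule DERIV_imp_deriv)
    then show ?thesis using h(3) \<alpha> by simp
  qed
  obtain d0 where d0: "d0 > 0" "ball 0 d0 \<subseteq> S0" using S0 openE by blast
  define d where "d = min d0 1"
  have d: "d > 0" "d \<le> 1" "ball 0 d \<subseteq> S0" using d0 by (auto simp: d_def)
  have z0: "complex_of_real 0 \<in> S0" using S0 by simp
  have T0: "T 0 = 0" by (simp add: T_def)
  obtain r0 Z where Z: "r0 > 0" "Z holomorphic_on ball 0 r0"
    "\<And>w. w \<in> ball 0 r0 \<Longrightarrow> T (Z w) = w" "\<And>w. w \<in> ball 0 r0 \<Longrightarrow> Z w \<in> ball 0 d"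
    "\<And>w. w \<in> ball 0 r0 \<Longrightarrow> w \<in> \<real> \<Longrightarrow> Z w \<in> \<real>"
    by (rule real_local_inverse[OF S0(1) hT z0 dT d(1) T_cnj, unfolded of_real_0 T0], assumption, rule that, assumption+)
  \<comment> \<open>The sign of x agrees with that of t, which tells the right turning point from
    the left one.\<close>
  have real: "\<exists>x. Z (of_real t) = of_real x \<and> q (ts + x) = ss - t\<^sup>2 \<and> sgn x = sgn t" if t: "\<bar>t\<bar> < r0" for t
  proof -
    have w: "complex_of_real t \<in> ball 0 r0" using t by simp
    obtain x where x: "Z (of_real t) = of_real x" using Z(5)[OF w] by (auto elim: Reals_cases)
    have xS: "complex_of_real x \<in> S0" using Z(4)[OF w] d(3) x by auto
    have "h (of_real x) \<in> \<real>" using h_cnj[of "of_real x"] by (simp add: Reals_cnj_iff)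
    then obtain y where y: "h (of_real x) = of_real y" by (auto elim: Reals_cases)
    have y0: "y > 0" using xS y by (simp add: S0_def)
    have "csqrt (of_real (exp ts) * h (of_real x)) = of_real (sqrt (exp ts * y))"
      unfolding y using y0 csqrt_of_real[of "exp ts * y"] by simp
    then have "complex_of_real (x * sqrt (exp ts * y)) = of_real t" using Z(3)[OF w] unfolding T_def x by simp
    then have xt: "x * sqrt (exp ts * y) = t" using of_real_eq_iff by blast
    then have t2: "t\<^sup>2 = x\<^sup>2 * (exp ts * y)" using y0 by (auto simp: power_mult_distrib)
    have "of_real ss - qc (of_real ts + of_real x) = complex_of_real (exp ts) * (of_real x ^ 2 * of_real y)"
      unfolding kk_eq h(2) y ..
    then have "complex_of_real (ss - q (ts + x)) = of_real (t\<^sup>2)"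
      unfolding t2 using qc_of_real[of "ts + x"] by (simp add: mult_ac)
    then have "ss - q (ts + x) = t\<^sup>2" using of_real_eq_iff by blast
    moreover have "sgn x = sgn t" unfolding xt[symmetric] using y0 by (simp add: sgn_mult)
    ultimately show ?thesis using x by force
  qed
  define r where "r = min r0 (sqrt ss)"
  have r: "r > 0" "r \<le> r0" "r \<le> sqrt ss" using Z(1) ss_pos by (auto simp: r_def)
  show ?thesis
  proof (intro exI[of _ r] exI[of _ Z] conjI ballI allI impI)
    show "Z holomorphic_on ball 0 r" using Z(2) by (rule holomorphic_on_subset) (use r in auto)
    show "norm (Z w) \<le> 1" if "w \<in> ball 0 r" for w using Z(4)[of w] that r d by auto
    fix t assume t: "0 < t \<and> t < r"
    have "t\<^sup>2 < (sqrt ss)\<^sup>2" using t r by (intro power_strict_mono) auto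
    then have s: "0 < ss - t\<^sup>2" "ss - t\<^sup>2 \<le> ss" using ss_pos by auto
    show "0 < ss - t\<^sup>2" by fact
    obtain x where x: "Z (of_real t) = of_real x" "q (ts + x) = ss - t\<^sup>2" "sgn x = sgn t" using real[of t] t r by auto
    obtain y where y: "Z (of_real (-t)) = of_real y" "q (ts + y) = ss - t\<^sup>2" "sgn y = sgn (-t)" using real[of "-t"] t r by auto
    have "x > 0" using x(3) t by (simp add: sgn_if split: if_splits)
    moreover have "y < 0" using y(3) t by (simp add: sgn_if split: if_splits)
    ultimately have "sg2 (ss - t\<^sup>2) = ts + x" "sg1 (ss - t\<^sup>2) = ts + y" using x y s by (auto intro!: sg1_unique sg2_unique)
    then show "of_real (\<Delta> (ss - t\<^sup>2)) = Z (of_real t) - Z (- of_real t)" using x(1) y(1) by (simp add: \<Delta>_def)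
  qed (use r in auto)
qed

text \<open>With s0 = ss the part above the cut vanishes and, for T = sqrt (ss - eps), the slice
  levels are ss - (T c(u))^2. The difference Z(v) - Z(-v) is odd in T and its product with T is
  even, so G is holomorphic in T^2 = ss - eps although the turning points themselves branch
  there.\<close>

lemma G_analytic_top:
  "\<exists>r>0. \<exists>g. g holomorphic_on ball (of_real ss) r \<and> (\<forall>\<epsilon>. ss - r < \<epsilon> \<and> \<epsilon> < ss \<longrightarrow> g (of_real \<epsilon>) = of_real (G \<epsilon>))"
proof -
  obtain r Z where Z: "r > 0" "Z holomorphic_on ball 0 r" "\<And>w. w \<in> ball 0 r \<Longrightarrow> norm (Z w) \<le> 1"
     "\<And>t. 0 < t \<Longrightarrow> t < r \<Longrightarrow> 0 < ss - t\<^sup>2 \<and> of_real (\<Delta> (ss - t\<^sup>2)) = Z (of_real t) - Z (- of_real t)"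
    using Delta_top by blast
  define c where "c = (\<lambda>u::real. sqrt (1 - u\<^sup>2))"
  have c: "0 < c u" "c u \<le> 1" if "u \<in> {0<..<1}" for u using that by (auto simp: c_def abs_square_less_1)
  define K where "K = (\<lambda>T u. Z (T * of_real (c u)) - Z (- (T * of_real (c u))))"
  have inb: "T * of_real (c u) \<in> ball 0 r" "- (T * of_real (c u)) \<in> ball 0 r" if "T \<in> ball 0 r" "u \<in> {0<..<1}" for T :: complex and u
  proof -
    have "norm T * c u \<le> norm T * 1" using c[OF that(2)] by (intro mult_left_mono) auto
    then show "T * of_real (c u) \<in> ball 0 r" "- (T * of_real (c u)) \<in> ball 0 r" using that(1) c[OF that(2)] by (auto simp: norm_mult)
  qed
  define E where "E = (\<lambda>T. T * (LINT u:{0<..<1}|lborel. K T u))"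
  have "(\<lambda>T. LINT u:{0<..<1}|lborel. K T u) holomorphic_on ball 0 r" unfolding set_lebesgue_integral_def
  proof (rule holomorphic_on_lebesgue_integral)
    fix T assume T: "T \<in> ball (0::complex) r"
    have "continuous_on {0<..<1} (K T)" unfolding K_def c_def
      using inb[OF T, unfolded c_def]
      by (intro continuous_intros continuous_on_compose2[OF holomorphic_on_imp_continuous_on[OF Z(2)]]) auto
    then show "(\<lambda>u. indicator {0<..<1} u *\<^sub>R K T u) \<in> borel_measurable lborel"
      by (simp add: borel_measurable_continuous_on_indicator)
    have "norm (K w u) \<le> 2" if "w \<in> ball 0 r" "u \<in> {0<..<1}" for w u
      unfolding K_def using Z(3)[OF inb(1)[OF that]] Z(3)[OF inb(2)[OF that]] norm_triangle_ineq4[of "Z (w * of_real (c u))" "Z (- (w * of_real (c u)))"] by linarith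
    then show "\<exists>r'>0. \<exists>g. integrable lborel g \<and> (\<forall>w'\<in>ball T r' \<inter> ball 0 r. \<forall>u. norm (indicator {0<..<1} u *\<^sub>R K w' u) \<le> g u)"
    proof (intro exI[of _ 1] conjI exI[of _ "\<lambda>u. indicator {0<..<1} u * 2"] ballI allI)
      show "integrable lborel (\<lambda>u. indicator {0<..<1::real} u * (2::real))" by (intro integrable_mult_left) simp
    qed (auto simp: indicator_def)
  next
    fix u :: real
    show "(\<lambda>T. indicator {0<..<1} u *\<^sub>R K T u) holomorphic_on ball 0 r"
    proof (cases "u \<in> {0<..<1}")
      case True
      have "(Z \<circ> (\<lambda>T. T * of_real (c u))) holomorphic_on ball 0 r" "(Z \<circ> (\<lambda>T. - (T * of_real (c u)))) holomorphic_on ball 0 r"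
        using inb True by (auto intro!: holomorphic_on_compose_gen[OF _ Z(2)] holomorphic_intros)
      then show ?thesis using True unfolding K_def by (auto simp: comp_def intro!: holomorphic_intros)
    qed simp
  qed simp
  then have hE: "E holomorphic_on ball 0 r" unfolding E_def by (intro holomorphic_intros)
  have ev: "E (- T) = E T" for T
  proof -
    have "K (- T) u = - K T u" for u by (simp add: K_def)
    then show ?thesis unfolding E_def by (simp add: set_lebesgue_integral_def)
  qed
  obtain w where w: "w holomorphic_on ball 0 (r\<^sup>2)" "\<And>t. t \<in> ball 0 r \<Longrightarrow> w (t\<^sup>2) = E t"
    using even_holomorphic_sqrt[OF Z(1) hE ev] by blast
  show ?thesis
  proof (intro exI[of _ "r\<^sup>2"] exI[of _ "\<lambda>\<epsilon>. w (of_real ss - \<epsilon>)"] conjI allI impI)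
    show "0 < r\<^sup>2" using Z(1) by simp
    have "(w \<circ> (\<lambda>\<epsilon>. of_real ss - \<epsilon>)) holomorphic_on ball (of_real ss) (r\<^sup>2)"
      by (rule holomorphic_on_compose_gen[OF _ w(1)]) (auto intro!: holomorphic_intros simp: dist_norm norm_minus_commute)
    then show "(\<lambda>\<epsilon>. w (of_real ss - \<epsilon>)) holomorphic_on ball (of_real ss) (r\<^sup>2)" by (simp add: comp_def)
    fix \<epsilon> assume \<epsilon>: "ss - r\<^sup>2 < \<epsilon> \<and> \<epsilon> < ss"
    define T where "T = sqrt (ss - \<epsilon>)"
    have T2: "T\<^sup>2 = ss - \<epsilon>" "T > 0" using \<epsilon> by (auto simp: T_def)
    have Tr: "T < r" using T2 \<epsilon> Z(1) by (intro power2_less_imp_less[of T r]) auto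
    have ep: "0 < \<epsilon>" using Z(4)[OF T2(2) Tr] T2 by simp
    have "ss \<le> ss" "0 < ss" using ss_pos by auto
    then have sgs: "sg1 ss = ts" "sg2 ss = ts" by (auto intro!: sg1_unique sg2_unique simp: ss_def)
    have "G \<epsilon> = T * (LINT u:{0<..<1}|lborel. \<Delta> (\<epsilon> + (ss - \<epsilon>) * u\<^sup>2))"
    proof -
      have "(\<lambda>t. indicator {ts..ts} t *\<^sub>R (sqrt (q t - \<epsilon>) - sqrt (ss - \<epsilon>))) = (\<lambda>t. 0)"
        by (auto simp: fun_eq_iff indicator_def ss_def)
      then have "(LINT t:{ts..ts}|lborel. sqrt (q t - \<epsilon>) - sqrt (ss - \<epsilon>)) = 0" unfolding set_lebesgue_integral_def by simp
      then show ?thesis using layer_cake_scaled[of \<epsilon> ss] ep \<epsilon> sgs unfolding T_def by simp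
    qed
    then have "of_real (G \<epsilon>) = of_real T * (LINT u:{0<..<1}|lborel. complex_of_real (\<Delta> (\<epsilon> + (ss - \<epsilon>) * u\<^sup>2)))"
      by (simp add: set_integral_complex_of_real)
    also have "(LINT u:{0<..<1}|lborel. complex_of_real (\<Delta> (\<epsilon> + (ss - \<epsilon>) * u\<^sup>2))) = (LINT u:{0<..<1}|lborel. K (of_real T) u)"
    proof (rule set_lebesgue_integral_cong, simp, intro allI impI)
      fix u :: real assume u: "u \<in> {0<..<1}"
      have "\<epsilon> + (ss - \<epsilon>) * u\<^sup>2 = ss - (T * c u)\<^sup>2"
      proof -
        have "(c u)\<^sup>2 = 1 - u\<^sup>2" using u by (auto simp: c_def abs_square_le_1)
        then show ?thesis by (simp only: power_mult_distrib T2(1)) (simp add: algebra_simps)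
      qed
      moreover have "0 < T * c u" "T * c u < r"
      proof -
        have "T * c u \<le> T * 1" using c[OF u] T2 by (intro mult_left_mono) auto
        then show "T * c u < r" using Tr by simp
        show "0 < T * c u" using c[OF u] T2 by simp
      qed
      ultimately show "complex_of_real (\<Delta> (\<epsilon> + (ss - \<epsilon>) * u\<^sup>2)) = K (of_real T) u"
        using Z(4)[of "T * c u"] by (simp add: K_def)
    qed
    also have "of_real T * (LINT u:{0<..<1}|lborel. K (of_real T) u) = E (of_real T)" by (simp add: E_def)
    also have "\<dots> = w ((of_real T)\<^sup>2)" using Tr T2 by (intro w(2)[symmetric]) auto
    also have "(of_real T)\<^sup>2 = complex_of_real (ss - \<epsilon>)" unfolding T2(1)[symmetric] by simp
    finally show "w (of_real ss - of_real \<epsilon>) = of_real (G \<epsilon>)" by simp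
  qed
qed

end

section \<open>The action integral as the level tends to 0\<close>

context well
begin

definition G0 :: real where "G0 = Beta (1 / (2 * \<alpha>)) (3 / 2) / \<alpha>"

text \<open>The substitution y = exp (\<alpha> t) produces a Beta integral. Its value is, up to the
  factor \<open>c0\<close> below, the leading coefficient of \<open>tau\<close>.\<close>

lemma sqrt_q_integral:
  "set_integrable lborel {..<0} (\<lambda>t. sqrt (q t))" "(LINT t:{..<0}|lborel. sqrt (q t)) = G0"
proof -
  let ?f = "\<lambda>y::real. y powr (1 / (2 * \<alpha>) - 1) * (1 - y) powr (3/2 - 1)"
  let ?g = "\<lambda>t. exp (\<alpha> * t)"
  have ap: "\<alpha> > 0" using \<alpha> by simp
  have im: "?g ` {..<0} = {0<..<1}"
  proof safe
    fix y :: real assume "y \<in> {0<..<1}"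
    then show "y \<in> ?g ` {..<0}" using ap by (intro image_eqI[of _ _ "ln y / \<alpha>"]) (auto simp: divide_neg_pos)
  qed (use ap in \<open>auto simp: mult_pos_neg\<close>)
  have inj: "inj_on ?g {..<0}" using ap by (auto simp: inj_on_def)
  have hi: "(?f has_integral Beta (1 / (2 * \<alpha>)) (3/2)) {0<..<1}"
    using has_integral_Beta_real[of "1 / (2 * \<alpha>)" "3/2"] ap by (simp add: has_integral_Icc_iff_Ioo)
  have "?f absolutely_integrable_on {0<..<1}"
    using hi by (intro nonnegative_absolutely_integrable_1) auto
  then have "?f absolutely_integrable_on (?g ` {..<0}) \<and> integral (?g ` {..<0}) ?f = Beta (1 / (2 * \<alpha>)) (3/2)"
    unfolding im using hi by (simp add: integral_unique)
  moreover have "(?g has_field_derivative \<alpha> * exp (\<alpha> * t)) (at t within {..<0})" for t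
    by (auto intro!: derivative_eq_intros)
  ultimately have *: "(\<lambda>t. \<bar>\<alpha> * exp (\<alpha> * t)\<bar> * ?f (?g t)) absolutely_integrable_on {..<0} \<and>
     integral {..<0} (\<lambda>t. \<bar>\<alpha> * exp (\<alpha> * t)\<bar> * ?f (?g t)) = Beta (1 / (2 * \<alpha>)) (3/2)"
    using has_absolute_integral_change_of_variables_1'[of "{..<0}" ?g "\<lambda>t. \<alpha> * exp (\<alpha> * t)" ?f] inj by simp
  have eq: "\<bar>\<alpha> * exp (\<alpha> * t)\<bar> * ?f (?g t) = \<alpha> * sqrt (q t)" if "t \<in> {..<0}" for t
  proof -
    have "exp (\<alpha> * t) < 1" using that ap by (simp add: mult_pos_neg)
    then have 1: "(1 - exp (\<alpha> * t)) powr (3/2 - 1) = sqrt (1 - exp (\<alpha> * t))" by (simp add: powr_half_sqrt)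
    have "exp (\<alpha> * t) powr (1 / (2 * \<alpha>) - 1) = exp ((1 / (2 * \<alpha>) - 1) * (\<alpha> * t))" by (simp add: exp_powr_real mult.commute)
    also have "(1 / (2 * \<alpha>) - 1) * (\<alpha> * t) = t / 2 - \<alpha> * t" using ap by (simp add: algebra_simps)
    finally have 2: "exp (\<alpha> * t) * exp (\<alpha> * t) powr (1 / (2 * \<alpha>) - 1) = exp (t / 2)" by (simp add: exp_diff)
    have "q t = exp t * (1 - exp (\<alpha> * t))" by (simp add: q_def algebra_simps exp_add)
    moreover have "sqrt (exp t) = exp (t/2)" by (intro real_sqrt_unique) (simp_all add: exp_double[symmetric])
    ultimately have 3: "sqrt (q t) = exp (t/2) * sqrt (1 - exp (\<alpha> * t))" by (simp add: real_sqrt_mult)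
    have "\<bar>\<alpha> * exp (\<alpha> * t)\<bar> * ?f (?g t) = \<alpha> * (exp (\<alpha> * t) * exp (\<alpha> * t) powr (1 / (2 * \<alpha>) - 1)) * (1 - exp (\<alpha> * t)) powr (3/2 - 1)"
      using ap by (simp add: abs_mult)
    then show ?thesis unfolding 1 2 3 by simp
  qed
  have "(\<lambda>t. \<alpha> * sqrt (q t)) absolutely_integrable_on {..<0} \<longleftrightarrow> (\<lambda>t. \<bar>\<alpha> * exp (\<alpha> * t)\<bar> * ?f (?g t)) absolutely_integrable_on {..<0}"
    using eq by (intro set_integrable_cong) auto
  moreover have "integral {..<0} (\<lambda>t. \<alpha> * sqrt (q t)) = integral {..<0} (\<lambda>t. \<bar>\<alpha> * exp (\<alpha> * t)\<bar> * ?f (?g t))"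
    using eq by (intro integral_cong) auto
  ultimately have **: "(\<lambda>t. \<alpha> * sqrt (q t)) absolutely_integrable_on {..<0}" "integral {..<0} (\<lambda>t. \<alpha> * sqrt (q t)) = Beta (1 / (2 * \<alpha>)) (3/2)" using * by auto
  have [measurable]: "q \<in> borel_measurable borel" using q_continuous by (rule borel_measurable_continuous_onI)
  have si: "set_integrable lborel {..<0} (\<lambda>t. \<alpha> * sqrt (q t))"
    using **(1) unfolding set_integrable_def
    by (subst (asm) integrable_completion) measurable
  have v: "(LINT t:{..<0}|lborel. \<alpha> * sqrt (q t)) = Beta (1 / (2 * \<alpha>)) (3/2)"
    by (rule trans[OF set_borel_integral_eq_integral(2)[OF si] **(2)])
  show "(LINT t:{..<0}|lborel. sqrt (q t)) = G0" using v ap unfolding G0_def by (simp add: field_simps)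
  have "set_integrable lborel {..<0} (\<lambda>t. (1/\<alpha>) * (\<alpha> * sqrt (q t)))" using si by (rule set_integrable_mult_right)
  then show "set_integrable lborel {..<0} (\<lambda>t. sqrt (q t))" using ap by simp
qed

text \<open>Identifies the constant term of the expansion at 0, which the slicing delivers in a form
  that involves the cut level.\<close>

lemma G_limit: "(G \<longlongrightarrow> G0) (at_right 0)"
proof -
  have [measurable]: "q \<in> borel_measurable borel" using q_continuous by (rule borel_measurable_continuous_onI)
  have eq: "indicator {..<0} t *\<^sub>R sqrt (q t) = sqrt (max 0 (q t))" for t
    using q_pos_neg[of t] by (auto simp: indicator_def max_def)
  have i: "integrable lborel (\<lambda>t. sqrt (max 0 (q t)))" and v: "(LINT t|lborel. sqrt (max 0 (q t))) = G0"
    using sqrt_q_integral unfolding set_integrable_def set_lebesgue_integral_def eq by auto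
  have "(G \<longlongrightarrow> G0) (at 0 within {0<..<ss})"
    unfolding tendsto_at_iff_sequentially
  proof (intro allI impI)
    fix E assume E: "\<forall>i. E i \<in> {0<..<ss} - {0}" "E \<longlonglongrightarrow> 0"
    have "(\<lambda>i. LINT t|lborel. sqrt (max 0 (q t - E i))) \<longlonglongrightarrow> (LINT t|lborel. sqrt (max 0 (q t)))"
    proof (rule integral_dominated_convergence[OF _ _ i])
      show "AE t in lborel. (\<lambda>i. sqrt (max 0 (q t - E i))) \<longlonglongrightarrow> sqrt (max 0 (q t))"
      proof (rule AE_I2)
        fix t
        have "(\<lambda>i. sqrt (max 0 (q t - E i))) \<longlonglongrightarrow> sqrt (max 0 (q t - 0))" by (intro tendsto_intros E(2))
        then show "(\<lambda>i. sqrt (max 0 (q t - E i))) \<longlonglongrightarrow> sqrt (max 0 (q t))" by simp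
      qed
      show "AE t in lborel. norm (sqrt (max 0 (q t - E i))) \<le> sqrt (max 0 (q t))" for i
      proof (rule AE_I2)
        fix t
        have "0 < E i" using E(1) by auto
        then show "norm (sqrt (max 0 (q t - E i))) \<le> sqrt (max 0 (q t))" by (simp add: max_def)
      qed
    qed measurable
    moreover have "G (E i) = (LINT t|lborel. sqrt (max 0 (q t - E i)))" for i
      by (rule G_eq(2)) (use E(1) in \<open>auto simp: less_imp_le\<close>)
    ultimately show "(G \<circ> E) \<longlonglongrightarrow> G0" by (simp add: comp_def v)
  qed
  moreover have "at 0 within {0<..<ss} = at_right 0"
    by (rule at_within_nhd[of _ "{..<ss}"]) (use ss_pos in auto)
  ultimately show ?thesis by simp
qed

text \<open>The right turning point tends to 0, where \<open>q\<close> has non-zero slope, and is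
  analytic in s. The left one runs to minus infinity: writing it as ln s + x turns q = s into (exp x
  - 1) exp (-(1 + \<alpha>) x) = s^\<alpha>, so x is an analytic function \<eta> of
  s^\<alpha>.\<close>

lemma Delta_small:
  "\<exists>r>0. \<exists>g \<eta>. r \<le> 1 \<and> r \<le> ss \<and> g holomorphic_on ball 0 r \<and> \<eta> holomorphic_on ball 0 r \<and>
     (\<forall>s. 0 < s \<and> s < r \<longrightarrow> of_real (\<Delta> s) = - of_real (ln s) + g (of_real s) - \<eta> (of_real (s powr \<alpha>)))"
proof -
  have n0: "(0::real) \<noteq> ts" using ts_neg by simp
  obtain r1 g where g: "r1 > 0" "g holomorphic_on ball 0 r1"
     "\<And>s. \<bar>s\<bar> < r1 \<Longrightarrow> \<exists>t. g (of_real s) = of_real t \<and> q t = s \<and> \<bar>t\<bar> < \<bar>ts\<bar>"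
    using branch_analytic[OF n0] by (auto simp: q_0)
  define f where "f = (\<lambda>x::complex. (exp x - 1) * exp (- of_real (1 + \<alpha>) * x))"
  have hf: "f holomorphic_on UNIV" unfolding f_def by (intro holomorphic_intros)
  have df: "(f has_field_derivative 1) (at 0)" unfolding f_def by (auto intro!: derivative_eq_intros)
  have f0: "f 0 = 0" by (simp add: f_def)
  have fc: "f (cnj x) = cnj (f x)" for x by (simp add: f_def exp_cnj)
  have d0: "deriv f (of_real 0) \<noteq> 0" using DERIV_imp_deriv[OF df] by simp
  obtain r2 \<eta> where \<eta>: "r2 > 0" "\<eta> holomorphic_on ball 0 r2" "\<And>w. w \<in> ball 0 r2 \<Longrightarrow> f (\<eta> w) = w"
    "\<And>w. w \<in> ball 0 r2 \<Longrightarrow> \<eta> w \<in> ball 0 1" "\<And>w. w \<in> ball 0 r2 \<Longrightarrow> w \<in> \<real> \<Longrightarrow> \<eta> w \<in> \<real>"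
    by (rule real_local_inverse[OF open_UNIV hf UNIV_I d0 zero_less_one fc, unfolded of_real_0 f0], rule that, assumption+)
  \<comment> \<open>s < 1 gives s^\<alpha> <= s < r2, and s < exp (ts - 1) together with |x| < 1
    puts ln s + x to the left of \<open>ts\<close>, as \<open>sg1\<close> requires.\<close>
  define r where "r = Min {r1, r2, 1, ss, exp (ts - 1)}"
  have r: "r > 0" "r \<le> r1" "r \<le> r2" "r \<le> 1" "r \<le> ss" "r \<le> exp (ts - 1)" using g \<eta> ss_pos by (auto simp: r_def)
  have main: "of_real (\<Delta> s) = - of_real (ln s) + g (of_real s) - \<eta> (of_real (s powr \<alpha>))" if s: "0 < s" "s < r" for s
  proof -
    have ps: "0 < s" "s \<le> ss" using s r by auto
    obtain t where t: "g (of_real s) = of_real t" "q t = s" "\<bar>t\<bar> < \<bar>ts\<bar>" using g(3)[of s] s r by auto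
    have "sg2 s = t" using t ts_neg ps by (intro sg2_unique) auto
    have "s powr \<alpha> \<le> s powr 1" using s r \<alpha> by (intro powr_mono') auto
    then have sa: "0 < s powr \<alpha>" "s powr \<alpha> < r2" using s r by auto
    have w: "complex_of_real (s powr \<alpha>) \<in> ball 0 r2" using sa by simp
    obtain x where x: "\<eta> (of_real (s powr \<alpha>)) = of_real x" using \<eta>(5)[OF w] by (auto elim: Reals_cases)
    have x1: "\<bar>x\<bar> < 1" using \<eta>(4)[OF w] x by simp
    have "f (of_real x) = of_real (s powr \<alpha>)" using \<eta>(3)[OF w] x by simp
    moreover have "f (of_real x) = of_real ((exp x - 1) * exp (- (1 + \<alpha>) * x))"
      unfolding f_def by (simp only: of_real_mult of_real_diff exp_of_real[symmetric] of_real_1 of_real_minus)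
    ultimately have "(exp x - 1) * exp (- (1 + \<alpha>) * x) = s powr \<alpha>" using of_real_eq_iff by metis
    then have "(exp x - 1) * (exp (- (1 + \<alpha>) * x) * exp ((1 + \<alpha>) * x)) = s powr \<alpha> * exp ((1 + \<alpha>) * x)" by (simp only: mult.assoc[symmetric])
    then have x2: "exp x - 1 = s powr \<alpha> * exp ((1 + \<alpha>) * x)" by (simp add: exp_add[symmetric] algebra_simps)
    have "exp ((1 + \<alpha>) * (ln s + x)) = s * (s powr \<alpha> * exp ((1 + \<alpha>) * x))"
    proof -
      have "exp ((1 + \<alpha>) * (ln s + x)) = exp (ln s) * (exp (\<alpha> * ln s) * exp ((1 + \<alpha>) * x))" by (simp add: exp_add[symmetric] algebra_simps)
      then show ?thesis using s by (simp add: powr_def)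
    qed
    then have "q (ln s + x) = s" unfolding q_def x2[symmetric] using s by (simp add: exp_add algebra_simps)
    moreover have "ln s + x \<le> ts"
    proof -
      have "ln s < ln (exp (ts - 1))" using s r by (intro ln_less_cancel_iff[THEN iffD2]) auto
      then show ?thesis using x1 by simp
    qed
    ultimately have "sg1 s = ln s + x" using ps by (intro sg1_unique) auto
    then show ?thesis using \<open>sg2 s = t\<close> t x by (simp add: \<Delta>_def)
  qed
  have hg: "g holomorphic_on ball 0 r" using g(2) by (rule holomorphic_on_subset) (use r in auto)
  have h\<eta>: "\<eta> holomorphic_on ball 0 r" using \<eta>(2) by (rule holomorphic_on_subset) (use r in auto)
  show ?thesis
    by (rule exI[of _ r], rule conjI[OF r(1)], rule exI[of _ g], rule exI[of _ \<eta>]) (use r main hg h\<eta> in auto)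
qed

text \<open>The logarithm from the left turning point integrates in closed form. Its arctangent of T
  / sqrt eps tends to pi / 2 as eps tends to 0, which is the origin of the term pi sqrt eps.\<close>

lemma log_integral:
  fixes \<epsilon> T :: real
  assumes \<epsilon>: "\<epsilon> > 0" and T: "T > 0"
  shows "set_integrable lborel {0<..<1} (\<lambda>u. ln (\<epsilon> + T\<^sup>2 * u\<^sup>2))"
    "T * (LINT u:{0<..<1}|lborel. ln (\<epsilon> + T\<^sup>2 * u\<^sup>2)) = T * ln (\<epsilon> + T\<^sup>2) - 2 * T + pi * sqrt \<epsilon> - 2 * sqrt \<epsilon> * arctan (sqrt \<epsilon> / T)"
proof -
  define se where "se = sqrt \<epsilon>"
  have se: "se > 0" "se\<^sup>2 = \<epsilon>" using \<epsilon> by (auto simp: se_def)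
  let ?F = "\<lambda>u. u * ln (\<epsilon> + T\<^sup>2 * u\<^sup>2) - 2 * u + 2 * (se / T) * arctan (T * u / se)"
  have pos: "\<epsilon> + T\<^sup>2 * u\<^sup>2 > 0" for u using \<epsilon> by (simp add: add_pos_nonneg)
  have cont: "continuous_on {0..1} (\<lambda>u. ln (\<epsilon> + T\<^sup>2 * u\<^sup>2))"
    using pos by (intro continuous_intros) (auto simp: less_imp_neq[symmetric])
  have d: "(?F has_real_derivative ln (\<epsilon> + T\<^sup>2 * u\<^sup>2)) (at u)" for u
  proof -
    have a: "((\<lambda>u. arctan (T * u / se)) has_real_derivative inverse (1 + (T * u / se)\<^sup>2) * (T / se)) (at u)"
      by (rule DERIV_chain2[OF DERIV_arctan]) (use se in \<open>auto intro!: derivative_eq_intros\<close>)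
    have b: "((\<lambda>u. ln (\<epsilon> + T\<^sup>2 * u\<^sup>2)) has_real_derivative inverse (\<epsilon> + T\<^sup>2 * u\<^sup>2) * (T\<^sup>2 * (2 * u))) (at u)"
      by (rule DERIV_chain2[where f=ln and g="\<lambda>u. \<epsilon> + T\<^sup>2 * u\<^sup>2", OF DERIV_ln[OF pos]]) (auto intro!: derivative_eq_intros)
    have c: "((\<lambda>u. u * ln (\<epsilon> + T\<^sup>2 * u\<^sup>2)) has_real_derivative 1 * ln (\<epsilon> + T\<^sup>2 * u\<^sup>2) + inverse (\<epsilon> + T\<^sup>2 * u\<^sup>2) * (T\<^sup>2 * (2 * u)) * u) (at u)"
      by (rule DERIV_mult[OF DERIV_ident b])
    have f: "((\<lambda>u. 2 * u) has_real_derivative 2) (at u)" by (auto intro!: derivative_eq_intros)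
    have "(?F has_real_derivative (1 * ln (\<epsilon> + T\<^sup>2 * u\<^sup>2) + inverse (\<epsilon> + T\<^sup>2 * u\<^sup>2) * (T\<^sup>2 * (2 * u)) * u) - 2
        + 2 * (se / T) * (inverse (1 + (T * u / se)\<^sup>2) * (T / se))) (at u)"
      by (intro DERIV_add DERIV_diff c f DERIV_cmult a)
    moreover have "2 * (se / T) * (inverse (1 + (T * u / se)\<^sup>2) * (T / se)) = 2 * \<epsilon> * inverse (\<epsilon> + T\<^sup>2 * u\<^sup>2)"
    proof -
      have "1 + (T * u / se)\<^sup>2 = (\<epsilon> + T\<^sup>2 * u\<^sup>2) / \<epsilon>" using se \<epsilon> by (simp add: power_divide power_mult_distrib add_divide_distrib)
      then show ?thesis using se T \<epsilon> by (simp add: inverse_eq_divide)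
    qed
    moreover have "inverse (\<epsilon> + T\<^sup>2 * u\<^sup>2) * (T\<^sup>2 * (2 * u)) * u + 2 * \<epsilon> * inverse (\<epsilon> + T\<^sup>2 * u\<^sup>2) = 2"
    proof -
      have "inverse (\<epsilon> + T\<^sup>2 * u\<^sup>2) * (T\<^sup>2 * (2 * u)) * u + 2 * \<epsilon> * inverse (\<epsilon> + T\<^sup>2 * u\<^sup>2) = inverse (\<epsilon> + T\<^sup>2 * u\<^sup>2) * (\<epsilon> + T\<^sup>2 * u\<^sup>2) * 2"
        by (simp add: power2_eq_square algebra_simps)
      then show ?thesis using pos[of u] by simp
    qed
    ultimately show ?thesis by (simp add: algebra_simps)
  qed
  have si0: "set_integrable lborel {0..1} (\<lambda>u. ln (\<epsilon> + T\<^sup>2 * u\<^sup>2))" using cont by (rule borel_integrable_atLeastAtMost')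
  then show "set_integrable lborel {0<..<1} (\<lambda>u. ln (\<epsilon> + T\<^sup>2 * u\<^sup>2))" by (rule set_integrable_subset) auto
  have "(LINT u:{0<..<1}|lborel. ln (\<epsilon> + T\<^sup>2 * u\<^sup>2)) = (LINT u:{0..1}|lborel. ln (\<epsilon> + T\<^sup>2 * u\<^sup>2))"
    by (rule set_integral_discrete_difference[where X="{0,1}"]) auto
  also have "\<dots> = ?F 1 - ?F 0" unfolding set_lebesgue_integral_def
  proof (rule integral_FTC_atLeastAtMost[OF _ _ cont])
    show "(?F has_vector_derivative ln (\<epsilon> + T\<^sup>2 * u\<^sup>2)) (at u within {0..1})" for u
      by (rule has_vector_derivative_at_within[OF d[unfolded has_real_derivative_iff_has_vector_derivative]])
  qed simp
  finally have v: "(LINT u:{0<..<1}|lborel. ln (\<epsilon> + T\<^sup>2 * u\<^sup>2)) = ln (\<epsilon> + T\<^sup>2) - 2 + 2 * (se / T) * arctan (T / se)" by simp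
  have at: "arctan (T / se) = pi / 2 - arctan (se / T)" using arctan_inverse[of "se / T"] se T by simp
  show "T * (LINT u:{0<..<1}|lborel. ln (\<epsilon> + T\<^sup>2 * u\<^sup>2)) = T * ln (\<epsilon> + T\<^sup>2) - 2 * T + pi * sqrt \<epsilon> - 2 * sqrt \<epsilon> * arctan (sqrt \<epsilon> / T)"
    unfolding v at se_def[symmetric] using T by (simp add: field_simps)
qed

end

lemma norm_powr_of_real: "(w::complex) \<noteq> 0 \<Longrightarrow> norm (w powr of_real a) = norm w powr a"
  by (simp add: powr_def)

lemma norm_csqrt: "norm (csqrt w) = sqrt (norm w)"
proof -
  have "(norm (csqrt w))\<^sup>2 = norm w" by (metis norm_power power2_csqrt)
  then show ?thesis by (metis norm_ge_zero real_sqrt_unique)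
qed

context well
begin

text \<open>In the sliced formula the logarithm gives pi sqrt eps and an arctangent term,
  \<open>Reg\<close> is analytic at 0, and the part in s^\<alpha> is Lipschitz up to 0. Apart from
  pi sqrt eps, each of these minus its value at 0 is of order eps and holomorphic in the right half
  of a disc.\<close>

lemma G_small:
  "\<exists>\<delta>>0. \<exists>H C. H holomorphic_on {w. Re w > 0 \<and> norm w < \<delta>} \<and>
     (\<forall>w. Re w > 0 \<and> norm w < \<delta> \<longrightarrow> norm (H w) \<le> C * norm w) \<and>
     (\<forall>\<epsilon>. 0 < \<epsilon> \<and> \<epsilon> < \<delta> \<longrightarrow> of_real (G \<epsilon>) = of_real (G0 - pi * sqrt \<epsilon>) + H (of_real \<epsilon>))"
proof -
  obtain r g \<eta> where r: "r > 0" "r \<le> 1" "r \<le> ss" and hg: "g holomorphic_on ball 0 r" and h\<eta>: "\<eta> holomorphic_on ball 0 r"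
    and \<Delta>: "\<And>s. 0 < s \<Longrightarrow> s < r \<Longrightarrow> of_real (\<Delta> s) = - of_real (ln s) + g (of_real s) - \<eta> (of_real (s powr \<alpha>))"
    using Delta_small by blast
  obtain Bg where Bg: "\<And>w. w \<in> ball 0 (r/2) \<Longrightarrow> norm (g w) \<le> Bg" using holomorphic_shrink_bounded[OF r(1) hg] by blast
  obtain B\<eta> where B\<eta>: "\<And>w. w \<in> ball 0 (r/2) \<Longrightarrow> norm (\<eta> w) \<le> B\<eta>" using holomorphic_shrink_bounded[OF r(1) h\<eta>] by blast
  have hd: "deriv \<eta> holomorphic_on ball 0 r" using h\<eta> by (rule holomorphic_deriv) simp
  obtain Bd where Bd: "\<And>w. w \<in> ball 0 (r/2) \<Longrightarrow> norm (deriv \<eta> w) \<le> Bd" using holomorphic_shrink_bounded[OF r(1) hd] by blast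
  have Bd0: "Bd \<ge> 0" using order_trans[OF norm_ge_zero Bd[of 0]] r(1) by simp
  \<comment> \<open>Convexity keeps the segments to s0 inside, and the half-disc avoids the cut of
    the power \<alpha>.\<close>
  define Hd where "Hd = {w::complex. Re w > 0 \<and> norm w < r/2}"
  have Hd_eq: "Hd = {w. 0 < Re w} \<inter> ball 0 (r/2)" by (auto simp: Hd_def)
  have oH: "open Hd" unfolding Hd_eq by (intro open_Int open_ball open_Collect_less continuous_intros)
  have cH: "convex Hd" unfolding Hd_eq by (intro convex_Int convex_ball convex_halfspace_Re_gt)
  have nn: "w \<notin> \<real>\<^sub>\<le>\<^sub>0" "w \<noteq> 0" if "w \<in> Hd" for w using that by (auto simp: Hd_def complex_nonpos_Reals_iff)
  have pw: "w powr of_real \<alpha> \<in> ball 0 (r/2)" if "w \<in> Hd" for w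
  proof -
    have "norm w powr \<alpha> \<le> norm w powr 1" using that r \<alpha> nn[OF that] by (intro powr_mono') (auto simp: Hd_def)
    then show ?thesis using that nn[OF that] by (simp add: norm_powr_of_real Hd_def)
  qed
  define f where "f = (\<lambda>w. \<eta> (w powr of_real \<alpha>))"
  have df: "(f has_field_derivative deriv \<eta> (w powr of_real \<alpha>) * (of_real \<alpha> * w powr (of_real \<alpha> - 1))) (at w)" if w: "w \<in> Hd" for w
  proof -
    have "w powr of_real \<alpha> \<in> ball 0 r" using pw[OF w] r(1) by auto
    then have "(\<eta> has_field_derivative deriv \<eta> (w powr of_real \<alpha>)) (at (w powr of_real \<alpha>))"
      by (rule holomorphic_derivI[OF h\<eta> open_ball])
    then show ?thesis unfolding f_def by (rule DERIV_chain2) (rule has_field_derivative_powr[OF nn(1)[OF w]])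
  qed
  have hf: "f holomorphic_on Hd" using df oH by (auto simp: holomorphic_on_open)
  have Bf: "norm (f w) \<le> B\<eta>" if "w \<in> Hd" for w unfolding f_def by (rule B\<eta>[OF pw[OF that]])
  define L where "L = Bd * \<alpha>"
  have L0: "L \<ge> 0" using Bd0 \<alpha> by (simp add: L_def)
  \<comment> \<open>As \<alpha> > 1, the derivative of w^\<alpha> is bounded near 0; this gives a
    Lipschitz bound for f up to the boundary point 0.\<close>
  have Lf: "norm (f a - f b) \<le> L * norm (a - b)" if "a \<in> Hd" "b \<in> Hd" for a b
  proof (rule field_differentiable_bound[OF cH _ _ that])
    fix w assume w: "w \<in> Hd"
    show "(f has_field_derivative deriv \<eta> (w powr of_real \<alpha>) * (of_real \<alpha> * w powr (of_real \<alpha> - 1))) (at w within Hd)"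
      by (rule has_field_derivative_at_within[OF df[OF w]])
    have "norm (w powr (of_real \<alpha> - 1)) = norm w powr (\<alpha> - 1)"
      using norm_powr_of_real[OF nn(2)[OF w], of "\<alpha> - 1"] by simp
    also have "\<dots> \<le> 1" using w r \<alpha> by (intro powr_le1) (auto simp: Hd_def)
    finally have "norm (of_real \<alpha> * w powr (of_real \<alpha> - 1)) \<le> \<alpha> * 1" unfolding norm_mult using \<alpha> by (intro mult_mono) auto
    then show "norm (deriv \<eta> (w powr of_real \<alpha>) * (of_real \<alpha> * w powr (of_real \<alpha> - 1))) \<le> L"
      unfolding norm_mult[of "deriv \<eta> _"] L_def using Bd[OF pw[OF w]] Bd0 by (intro mult_mono) auto
  qed
  define s0 where "s0 = r / 4"
  have s0: "s0 > 0" "s0 < r" "s0 \<le> ss" "complex_of_real s0 \<in> Hd" "complex_of_real s0 \<in> ball 0 (r/2)"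
    using r by (auto simp: s0_def Hd_def)
  define I2 where "I2 = (\<lambda>w. LINT u:{0<..<1}|lborel. g (w + (of_real s0 - w) * of_real (u\<^sup>2)))"
  define I3 where "I3 = (\<lambda>w. LINT u:{0<..<1}|lborel. f (w + (of_real s0 - w) * of_real (u\<^sup>2)))"
  \<comment> \<open>The value of \<open>I3\<close> at the boundary point 0, which is not in
    \<open>Hd\<close>; the open segment from 0 to s0 still runs inside \<open>Hd\<close>.\<close>
  define I30 where "I30 = (LINT u:{0<..<1}|lborel. f (0 + (of_real s0 - 0) * of_real (u\<^sup>2)))"
  have hI2: "I2 holomorphic_on ball 0 (r/2)" unfolding I2_def
    by (rule holomorphic_segment_integral[OF _ _ _ Bg s0(5)]) (use hg r in \<open>auto intro: holomorphic_on_subset\<close>)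
  have hI3: "I3 holomorphic_on Hd" unfolding I3_def
    by (rule holomorphic_segment_integral[OF oH cH hf Bf s0(4)])
  have seg: "w + (of_real s0 - w) * of_real (u\<^sup>2) \<in> Hd" if w: "w = 0 \<or> w \<in> Hd" and u: "u \<in> {0<..<1}" for w :: complex and u :: real
  proof -
    have u2: "0 < u\<^sup>2" "u\<^sup>2 < 1" using u by (auto simp: abs_square_less_1)
    have eq: "w + (of_real s0 - w) * of_real (u\<^sup>2) = (1 - u\<^sup>2) *\<^sub>R w + u\<^sup>2 *\<^sub>R of_real s0"
      by (simp add: scaleR_conv_of_real algebra_simps)
    show ?thesis
    proof (cases "w = 0")
      case True
      have "s0 * u\<^sup>2 < s0 * 1" using u2 s0(1) by (intro mult_strict_left_mono) auto
      then show ?thesis using True u2 s0(1) r(1) by (auto simp: Hd_def s0_def norm_mult simp del: of_real_power)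
    next
      case False
      then have "w \<in> Hd" using w by simp
      then have "(1 - u\<^sup>2) *\<^sub>R w + u\<^sup>2 *\<^sub>R of_real s0 \<in> Hd" using u2 s0(4) by (intro convexD[OF cH]) auto
      then show ?thesis unfolding eq .
    qed
  qed
  have sif: "set_integrable lborel {0<..<1} (\<lambda>u. f (w + (of_real s0 - w) * of_real (u\<^sup>2)))" if w: "w = 0 \<or> w \<in> Hd" for w
  proof (rule set_integrable_dominated[where g="\<lambda>_. B\<eta>"])
    show "set_integrable lborel {0<..<1::real} (\<lambda>_. B\<eta>)" unfolding set_integrable_def real_scaleR_def by (intro integrable_mult_left) simp
    have "continuous_on {0<..<1} (\<lambda>u::real. f (w + (of_real s0 - w) * of_real (u\<^sup>2)))"
      by (rule continuous_on_compose2[OF holomorphic_on_imp_continuous_on[OF hf]]) (use seg[OF w] in \<open>auto intro!: continuous_intros simp del: of_real_power\<close>)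
    then show "set_borel_measurable lborel {0<..<1} (\<lambda>u. f (w + (of_real s0 - w) * of_real (u\<^sup>2)))"
      unfolding set_borel_measurable_def by (simp add: borel_measurable_continuous_on_indicator del: of_real_power)
    show "norm (f (w + (of_real s0 - w) * of_real (u\<^sup>2))) \<le> B\<eta>" if "u \<in> {0<..<1}" for u by (rule Bf[OF seg[OF w that]])
  qed
  have dI3: "norm (I3 w - I30) \<le> L * norm w" if w: "w \<in> Hd" for w
  proof -
    note i1 = sif[OF disjI2[OF w]] and i2 = sif[OF disjI1[OF refl]]
    have "I3 w - I30 = (LINT u:{0<..<1}|lborel. f (w + (of_real s0 - w) * of_real (u\<^sup>2)) - f (0 + (of_real s0 - 0) * of_real (u\<^sup>2)))"
      unfolding I3_def I30_def by (rule set_integral_diff(2)[OF i1 i2, symmetric])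
    also have "norm \<dots> \<le> (LINT u:{0<..<1}|lborel. norm (f (w + (of_real s0 - w) * of_real (u\<^sup>2)) - f (0 + (of_real s0 - 0) * of_real (u\<^sup>2))))"
      by (rule set_integral_norm_bound[OF set_integral_diff(1)[OF i1 i2]])
    also have "\<dots> \<le> (LINT u:{0<..<1::real}|lborel. L * norm w)"
    proof (rule set_integral_mono)
      show "set_integrable lborel {0<..<1} (\<lambda>u. norm (f (w + (of_real s0 - w) * of_real (u\<^sup>2)) - f (0 + (of_real s0 - 0) * of_real (u\<^sup>2))))"
        by (rule set_integrable_norm[OF set_integral_diff(1)[OF i1 i2]])
      show "set_integrable lborel {0<..<1::real} (\<lambda>_. L * norm w)" unfolding set_integrable_def real_scaleR_def by (intro integrable_mult_left) simp
      fix u :: real assume u: "u \<in> {0<..<1}"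
      have "norm (f (w + (of_real s0 - w) * of_real (u\<^sup>2)) - f (0 + (of_real s0 - 0) * of_real (u\<^sup>2)))
         \<le> L * norm (w + (of_real s0 - w) * of_real (u\<^sup>2) - (0 + (of_real s0 - 0) * of_real (u\<^sup>2)))"
        using w u by (intro Lf seg) auto
      also have "w + (of_real s0 - w) * of_real (u\<^sup>2) - (0 + (of_real s0 - 0) * of_real (u\<^sup>2)) = of_real (1 - u\<^sup>2) * w"
        by (simp add: algebra_simps)
      also have "norm (of_real (1 - u\<^sup>2) * w) \<le> 1 * norm w" unfolding norm_mult
      proof (rule mult_right_mono)
        have "0 \<le> u\<^sup>2" "u\<^sup>2 < 1" using u by (auto simp: abs_square_less_1)
        then show "norm (complex_of_real (1 - u\<^sup>2)) \<le> 1" unfolding norm_of_real by linarith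
      qed simp
      finally show "norm (f (w + (of_real s0 - w) * of_real (u\<^sup>2)) - f (0 + (of_real s0 - 0) * of_real (u\<^sup>2))) \<le> L * norm w"
        using L0 by (simp add: mult_left_mono)
    qed
    also have "\<dots> = L * norm w" by (simp add: set_lebesgue_integral_def)
    finally show ?thesis .
  qed
  have nnc: "of_real s0 - w \<notin> \<real>\<^sub>\<le>\<^sub>0" if "w \<in> ball 0 s0" for w :: complex
    using that abs_Re_le_cmod[of w] by (auto simp: complex_nonpos_Reals_iff)
  have hc: "(\<lambda>w. csqrt (of_real s0 - w)) holomorphic_on ball 0 s0" using nnc by (intro holomorphic_intros) auto
  \<comment> \<open>The terms T ln s0 and -2 T of the closed-form logarithmic integral are analytic
    at eps = 0 and are collected here as well.\<close>
  define Reg where "Reg = (\<lambda>w. inner s0 w - csqrt (of_real s0 - w) * of_real (ln s0 - 2) + csqrt (of_real s0 - w) * I2 w)"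
  have hR: "Reg holomorphic_on ball 0 s0" unfolding Reg_def
  proof (intro holomorphic_on_add holomorphic_on_diff holomorphic_on_mult hc holomorphic_on_const)
    show "inner s0 holomorphic_on ball 0 s0"
      by (rule holomorphic_on_subset[OF inner_holomorphic[OF s0(1,3)]]) (auto intro: le_less_trans[OF complex_Re_le_cmod])
    show "I2 holomorphic_on ball 0 s0" using hI2 by (rule holomorphic_on_subset) (use r in \<open>auto simp: s0_def\<close>)
  qed
  obtain C1 where C1: "\<And>w. w \<in> ball 0 (s0/2) \<Longrightarrow> norm (Reg w - Reg 0) \<le> C1 * norm w"
    using holomorphic_Lipschitz_at_center[OF s0(1) hR] unfolding diff_zero by blast
  obtain C2 where C2: "\<And>w. w \<in> ball 0 (s0/2) \<Longrightarrow> norm (csqrt (of_real s0 - w) - csqrt (of_real s0)) \<le> C2 * norm w"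
    using holomorphic_Lipschitz_at_center[OF s0(1) hc] unfolding diff_zero by blast
  have hA: "Arctan holomorphic_on ball 0 1"
  proof (rule holomorphic_on_Arctan)
    fix z assume "z \<in> ball (0::complex) 1" "Re z = 0"
    then show "\<bar>Im z\<bar> < 1" using abs_Im_le_cmod[of z] by auto
  qed
  obtain C3 where C3: "\<And>w. w \<in> ball 0 (1/2) \<Longrightarrow> norm (Arctan w) \<le> C3 * norm w"
    using holomorphic_Lipschitz_at_center[OF zero_less_one hA] unfolding diff_zero Arctan_0 by blast
  \<comment> \<open>Then |w| / |s0 - w| is at most 1/7 < 1/4, so \<open>x w\<close> stays in the
    disc of radius 1/2 where the Lipschitz bound for Arctan holds.\<close>
  define \<delta> where "\<delta> = s0 / 8"
  have \<delta>: "\<delta> > 0" "\<delta> < s0/2" "\<delta> < s0" using s0 by (auto simp: \<delta>_def)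
  define x where "x = (\<lambda>w. csqrt w / csqrt (of_real s0 - w))"
  define H where "H = (\<lambda>w. (Reg w - Reg 0) + 2 * csqrt w * Arctan (x w) - (csqrt (of_real s0 - w) * I3 w - csqrt (of_real s0) * I30))"
  let ?V = "{w. Re w > 0 \<and> norm w < \<delta>}"
  have VHd: "w \<in> Hd" "w \<in> ball 0 s0" "w \<in> ball 0 (s0/2)" if "w \<in> ?V" for w
    using that \<delta> r by (auto simp: Hd_def s0_def)
  have lo: "7 * s0 / 8 \<le> norm (of_real s0 - w)" if "w \<in> ?V" for w
    using norm_triangle_ineq2[of "of_real s0" w] that s0(1) by (simp add: \<delta>_def)
  have nx: "norm (x w) = sqrt (norm w) / sqrt (norm (of_real s0 - w))" for w by (simp add: x_def norm_divide norm_csqrt)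
  have xb: "x w \<in> ball 0 (1/2)" if w: "w \<in> ?V" for w
  proof -
    have p: "norm (of_real s0 - w) > 0" using lo[OF w] s0(1) by linarith
    have "norm w / norm (of_real s0 - w) \<le> (s0 / 8) / (7 * s0 / 8)" using lo[OF w] w s0(1) by (intro frac_le) (auto simp: \<delta>_def)
    also have "\<dots> < (1/2)\<^sup>2" using s0(1) by (simp add: power2_eq_square)
    finally have "sqrt (norm w / norm (of_real s0 - w)) < sqrt ((1/2)\<^sup>2)" by (rule real_sqrt_less_mono)
    then have "sqrt (norm w / norm (of_real s0 - w)) < 1/2" by (simp only: real_sqrt_abs)
    then show ?thesis by (simp add: nx real_sqrt_divide)
  qed
  have hH: "H holomorphic_on ?V"
  proof -
    have nn': "w \<notin> \<real>\<^sub>\<le>\<^sub>0" if "w \<in> ?V" for w using nn VHd that by blast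
    have hcs: "csqrt holomorphic_on ?V" by (rule holomorphic_on_subset[OF holomorphic_on_csqrt]) (use nn' in auto)
    have hcd: "(\<lambda>w. csqrt (of_real s0 - w)) holomorphic_on ?V" by (rule holomorphic_on_subset[OF hc]) (use VHd in auto)
    have hx: "x holomorphic_on ?V" unfolding x_def
    proof (intro holomorphic_on_divide hcs hcd)
      fix w assume "w \<in> ?V" then show "csqrt (of_real s0 - w) \<noteq> 0" using lo[of w] s0(1) by auto
    qed
    have "(Arctan \<circ> x) holomorphic_on ?V" by (rule holomorphic_on_compose_gen[OF hx hA]) (use xb in force)
    then have hAx: "(\<lambda>w. Arctan (x w)) holomorphic_on ?V" by (simp add: comp_def)
    show ?thesis unfolding H_def
      by (intro holomorphic_on_add holomorphic_on_diff holomorphic_on_mult holomorphic_on_const hcs hcd hAx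
          holomorphic_on_subset[OF hR] holomorphic_on_subset[OF hI3]) (use VHd in auto)
  qed
  define C where "C = C1 + 2 * (\<bar>C3\<bar> / sqrt (7 * s0 / 8)) + (sqrt (2 * s0) * L + \<bar>C2\<bar> * norm I30)"
  have bH: "norm (H w) \<le> C * norm w" if w: "w \<in> ?V" for w
  proof -
    have t1: "norm (Reg w - Reg 0) \<le> C1 * norm w" by (rule C1[OF VHd(3)[OF w]])
    have sw: "sqrt (norm w) * sqrt (norm w) = norm w" by simp
    have t2: "norm (2 * csqrt w * Arctan (x w)) \<le> 2 * (\<bar>C3\<bar> / sqrt (7 * s0 / 8)) * norm w"
    proof -
      have "norm (Arctan (x w)) \<le> C3 * norm (x w)" by (rule C3[OF xb[OF w]])
      also have "\<dots> \<le> \<bar>C3\<bar> * norm (x w)" by (intro mult_right_mono) auto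
      also have "\<dots> \<le> \<bar>C3\<bar> * (sqrt (norm w) / sqrt (7 * s0 / 8))"
        unfolding nx using lo[OF w] s0(1) by (intro mult_left_mono frac_le) auto
      finally have "norm (2 * csqrt w * Arctan (x w)) \<le> 2 * sqrt (norm w) * (\<bar>C3\<bar> * (sqrt (norm w) / sqrt (7 * s0 / 8)))"
        unfolding norm_mult norm_csqrt by (intro mult_mono) auto
      also have "\<dots> = 2 * (\<bar>C3\<bar> / sqrt (7 * s0 / 8)) * (sqrt (norm w) * sqrt (norm w))" by simp
      finally show ?thesis unfolding sw .
    qed
    have t3: "norm (csqrt (of_real s0 - w) * I3 w - csqrt (of_real s0) * I30) \<le> (sqrt (2 * s0) * L + \<bar>C2\<bar> * norm I30) * norm w"
    proof -
      have "csqrt (of_real s0 - w) * I3 w - csqrt (of_real s0) * I30 = csqrt (of_real s0 - w) * (I3 w - I30) + (csqrt (of_real s0 - w) - csqrt (of_real s0)) * I30"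
        by (simp add: algebra_simps)
      also have "norm \<dots> \<le> norm (csqrt (of_real s0 - w)) * norm (I3 w - I30) + norm (csqrt (of_real s0 - w) - csqrt (of_real s0)) * norm I30"
        by (metis norm_mult norm_triangle_ineq)
      also have "\<dots> \<le> sqrt (2 * s0) * (L * norm w) + (\<bar>C2\<bar> * norm w) * norm I30"
      proof (intro add_mono mult_mono)
        have "norm (of_real s0 - w) \<le> s0 + norm w" using norm_triangle_ineq4[of "of_real s0" w] s0(1) by simp
        then show "norm (csqrt (of_real s0 - w)) \<le> sqrt (2 * s0)" unfolding norm_csqrt using w \<delta> by simp
        show "norm (I3 w - I30) \<le> L * norm w" by (rule dI3[OF VHd(1)[OF w]])
        have "C2 * norm w \<le> \<bar>C2\<bar> * norm w" by (intro mult_right_mono) auto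
        then show "norm (csqrt (of_real s0 - w) - csqrt (of_real s0)) \<le> \<bar>C2\<bar> * norm w" using C2[OF VHd(3)[OF w]] by linarith
      qed (use s0(1) in auto)
      finally show ?thesis by (simp add: algebra_simps)
    qed
    have "norm (H w) \<le> norm (Reg w - Reg 0) + norm (2 * csqrt w * Arctan (x w)) + norm (csqrt (of_real s0 - w) * I3 w - csqrt (of_real s0) * I30)"
      unfolding H_def by (intro order_trans[OF norm_triangle_ineq4] add_mono norm_triangle_ineq order_refl)
    also have "\<dots> \<le> C1 * norm w + 2 * (\<bar>C3\<bar> / sqrt (7 * s0 / 8)) * norm w + (sqrt (2 * s0) * L + \<bar>C2\<bar> * norm I30) * norm w"
      by (intro add_mono t1 t2 t3)
    also have "\<dots> = C * norm w" unfolding C_def by (simp add: distrib_right)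
    finally show ?thesis .
  qed
  define K0 where "K0 = Reg 0 - csqrt (of_real s0) * I30"
  have eq: "of_real (G \<epsilon>) = K0 - of_real (pi * sqrt \<epsilon>) + H (of_real \<epsilon>)" if \<epsilon>: "0 < \<epsilon>" "\<epsilon> < \<delta>" for \<epsilon>
  proof -
    have es: "\<epsilon> < s0" using \<epsilon> \<delta> by linarith
    define T where "T = sqrt (s0 - \<epsilon>)"
    have T: "T > 0" "T\<^sup>2 = s0 - \<epsilon>" using es by (auto simp: T_def)
    have cT: "csqrt (of_real s0 - of_real \<epsilon>) = of_real T" using es by (simp add: T_def csqrt_of_real flip: of_real_diff)
    have eH: "complex_of_real \<epsilon> \<in> Hd" using VHd(1)[of "of_real \<epsilon>"] \<epsilon> by simp
    define D where "D = (\<lambda>s::complex. - Ln s + g s - f s)"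
    have D: "D (of_real s) = of_real (\<Delta> s)" if "\<epsilon> < s" "s < s0" for s
    proof -
      have s: "0 < s" "s < r" using that \<epsilon> s0 by auto
      have "f (of_real s) = \<eta> (of_real (s powr \<alpha>))" unfolding f_def using s powr_of_real[of s \<alpha>] by simp
      then show ?thesis unfolding D_def using \<Delta>[OF s] s by (simp add: Ln_of_real)
    qed
    let ?p = "\<lambda>u::real. of_real \<epsilon> + (of_real s0 - of_real \<epsilon>) * of_real (u\<^sup>2) :: complex"
    have pr: "?p u = of_real (\<epsilon> + T\<^sup>2 * u\<^sup>2)" for u unfolding T by simp
    have pp: "\<epsilon> + T\<^sup>2 * u\<^sup>2 > 0" for u using \<epsilon> by (simp add: add_pos_nonneg)
    have iL: "set_integrable lborel {0<..<1} (\<lambda>u. Ln (?p u))" and vL: "(LINT u:{0<..<1}|lborel. Ln (?p u)) = of_real (LINT u:{0<..<1}|lborel. ln (\<epsilon> + T\<^sup>2 * u\<^sup>2))"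
    proof -
      have e: "Ln (?p u) = of_real (ln (\<epsilon> + T\<^sup>2 * u\<^sup>2))" for u unfolding pr by (rule Ln_of_real[OF pp])
      show "set_integrable lborel {0<..<1} (\<lambda>u. Ln (?p u))" unfolding e
        using log_integral(1)[OF \<epsilon>(1) T(1)] unfolding set_integrable_def by (simp add: scaleR_conv_of_real flip: of_real_mult)
      show "(LINT u:{0<..<1}|lborel. Ln (?p u)) = of_real (LINT u:{0<..<1}|lborel. ln (\<epsilon> + T\<^sup>2 * u\<^sup>2))"
        unfolding e by (rule set_integral_complex_of_real)
    qed
    have ig: "set_integrable lborel {0<..<1} (\<lambda>u. g (?p u))"
    proof (rule set_integrable_dominated[where g="\<lambda>_. Bg"])
      have inb: "?p u \<in> ball 0 (r/2)" if "u \<in> {0<..<1}" for u using seg[of "of_real \<epsilon>" u] eH that by (auto simp: Hd_eq)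
      show "set_integrable lborel {0<..<1::real} (\<lambda>_. Bg)" unfolding set_integrable_def real_scaleR_def by (intro integrable_mult_left) simp
      have "continuous_on (ball 0 (r/2)) g" by (rule continuous_on_subset[OF holomorphic_on_imp_continuous_on[OF hg]]) (use r in auto)
      then have "continuous_on {0<..<1} (\<lambda>u. g (?p u))"
        by (rule continuous_on_compose2) (use inb in \<open>auto intro!: continuous_intros simp del: of_real_power\<close>)
      then show "set_borel_measurable lborel {0<..<1} (\<lambda>u. g (?p u))"
        unfolding set_borel_measurable_def by (simp add: borel_measurable_continuous_on_indicator del: of_real_power)
      show "norm (g (?p u)) \<le> Bg" if "u \<in> {0<..<1}" for u by (rule Bg[OF inb[OF that]])
    qed
    have if3: "set_integrable lborel {0<..<1} (\<lambda>u. f (?p u))" by (rule sif) (use eH in auto)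
    have iD: "(LINT u:{0<..<1}|lborel. D (?p u)) = - of_real (LINT u:{0<..<1}|lborel. ln (\<epsilon> + T\<^sup>2 * u\<^sup>2)) + I2 (of_real \<epsilon>) - I3 (of_real \<epsilon>)"
    proof -
      have "(LINT u:{0<..<1}|lborel. D (?p u)) = (LINT u:{0<..<1}|lborel. (g (?p u) - Ln (?p u)) - f (?p u))"
        unfolding D_def by (simp add: algebra_simps)
      also have "\<dots> = (LINT u:{0<..<1}|lborel. g (?p u)) - (LINT u:{0<..<1}|lborel. Ln (?p u)) - (LINT u:{0<..<1}|lborel. f (?p u))"
        using set_integral_diff(2)[OF set_integral_diff(1)[OF ig iL] if3] set_integral_diff(2)[OF ig iL] by simp
      finally show ?thesis unfolding vL I2_def I3_def by simp
    qed
    have "complex_of_real (G \<epsilon>) = inner s0 (of_real \<epsilon>) + of_real T * (LINT u:{0<..<1}|lborel. D (?p u))"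
      using G_decompose[OF \<epsilon>(1) es s0(3) D] unfolding cT by simp
    also have "\<dots> = inner s0 (of_real \<epsilon>) - of_real (T * (LINT u:{0<..<1}|lborel. ln (\<epsilon> + T\<^sup>2 * u\<^sup>2))) + of_real T * I2 (of_real \<epsilon>) - of_real T * I3 (of_real \<epsilon>)"
      unfolding iD by (simp add: algebra_simps)
    also have "T * (LINT u:{0<..<1}|lborel. ln (\<epsilon> + T\<^sup>2 * u\<^sup>2)) = T * ln s0 - 2 * T + pi * sqrt \<epsilon> - 2 * sqrt \<epsilon> * arctan (sqrt \<epsilon> / T)"
      unfolding log_integral(2)[OF \<epsilon>(1) T(1)] unfolding T(2) by simp
    finally have "complex_of_real (G \<epsilon>) = inner s0 (of_real \<epsilon>) - of_real (T * ln s0 - 2 * T + pi * sqrt \<epsilon> - 2 * sqrt \<epsilon> * arctan (sqrt \<epsilon> / T)) + of_real T * I2 (of_real \<epsilon>) - of_real T * I3 (of_real \<epsilon>)" .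
    moreover have "Arctan (x (of_real \<epsilon>)) = of_real (arctan (sqrt \<epsilon> / T))"
      unfolding x_def cT using csqrt_of_real[of \<epsilon>] \<epsilon> by (simp add: Arctan_of_real flip: of_real_divide)
    moreover have "csqrt (of_real \<epsilon>) = of_real (sqrt \<epsilon>)" using csqrt_of_real[of \<epsilon>] \<epsilon> by simp
    ultimately show ?thesis unfolding K0_def H_def Reg_def cT by (simp add: algebra_simps)
  qed
  \<comment> \<open>\<open>K0\<close> is assembled from pieces that depend on the cut level s0;
    comparing limits at 0 shows that it is \<open>G0\<close>.\<close>
  have K0: "K0 = of_real G0"
  proof -
    have "((\<lambda>\<epsilon>. K0 - of_real (pi * sqrt \<epsilon>) + H (of_real \<epsilon>)) \<longlongrightarrow> K0 - of_real (pi * sqrt 0) + 0) (at_right 0)"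
    proof (intro tendsto_intros)
      show "((\<lambda>\<epsilon>. H (of_real \<epsilon>)) \<longlongrightarrow> 0) (at_right 0)"
      proof (rule Lim_null_comparison)
        show "\<forall>\<^sub>F \<epsilon> in at_right 0. norm (H (of_real \<epsilon>)) \<le> C * \<epsilon>"
          unfolding eventually_at_right_field using bH[of "of_real _"] \<delta> by (intro exI[of _ \<delta>]) auto
        have "((\<lambda>\<epsilon>. C * \<epsilon>) \<longlongrightarrow> C * 0) (at_right 0)" by (intro tendsto_intros)
        then show "((\<lambda>\<epsilon>. C * \<epsilon>) \<longlongrightarrow> 0) (at_right 0)" by simp
      qed
    qed
    then have "((\<lambda>\<epsilon>. K0 - of_real (pi * sqrt \<epsilon>) + H (of_real \<epsilon>)) \<longlongrightarrow> K0) (at_right 0)" by simp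
    moreover have "\<forall>\<^sub>F \<epsilon> in at_right 0. K0 - of_real (pi * sqrt \<epsilon>) + H (of_real \<epsilon>) = of_real (G \<epsilon>)"
      unfolding eventually_at_right_field using eq \<delta> by (intro exI[of _ \<delta>]) auto
    ultimately have "((\<lambda>\<epsilon>. complex_of_real (G \<epsilon>)) \<longlongrightarrow> K0) (at_right 0)" by (rule Lim_transform_eventually)
    moreover have "((\<lambda>\<epsilon>. complex_of_real (G \<epsilon>)) \<longlongrightarrow> of_real G0) (at_right 0)" by (intro tendsto_of_real G_limit)
    ultimately show ?thesis using tendsto_unique trivial_limit_at_right_real by blast
  qed
  have "\<forall>\<epsilon>. 0 < \<epsilon> \<and> \<epsilon> < \<delta> \<longrightarrow> of_real (G \<epsilon>) = of_real (G0 - pi * sqrt \<epsilon>) + H (of_real \<epsilon>)"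
    using eq K0 by simp
  then show ?thesis using \<delta>(1) hH bH by blast
qed

end

section \<open>Expansion at infinity and local analyticity of tau\<close>

context well
begin

abbreviation "\<rho> \<equiv> rho_c \<alpha>"

lemma e2: "2 * e = 1 + 1 / \<alpha>" "2 * \<alpha> * e = 1 + \<alpha>"
  using \<alpha> by (auto simp: bae_exp_def field_simps)

lemma rho_pos: "\<rho> > 0" using \<alpha> by (simp add: rho_c_def)

lemma exp_ts_eq: "exp ts = (1 + \<alpha>) powr (- 1 / \<alpha>)"
  using \<alpha> by (simp add: ts_def powr_def)

lemma rho_e: "\<rho> powr e = (1 + \<alpha>) powr e / sqrt \<alpha>"
proof -
  have ap: "\<alpha> > 0" "1 + \<alpha> > 0" using \<alpha> by auto
  have "\<rho> powr e = ((1 + \<alpha>) / \<alpha>) powr e * (\<alpha> powr (1 / (1 + \<alpha>))) powr e"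
  proof -
    have "\<rho> = (1 + \<alpha>) / \<alpha> * \<alpha> powr (1 / (1 + \<alpha>))" unfolding rho_c_def by (simp only: add.commute)
    then show ?thesis using ap by (simp only: powr_mult)
  qed
  also have "(\<alpha> powr (1 / (1 + \<alpha>))) powr e = \<alpha> powr (e - 1/2)"
  proof -
    have "1 / (1 + \<alpha>) * e = e - 1/2" using ap by (simp add: bae_exp_def field_simps)
    then show ?thesis by (simp add: powr_powr)
  qed
  also have "((1 + \<alpha>) / \<alpha>) powr e = (1 + \<alpha>) powr e / \<alpha> powr e" using ap by (simp add: powr_divide)
  also have "(1 + \<alpha>) powr e / \<alpha> powr e * \<alpha> powr (e - 1/2) = (1 + \<alpha>) powr e / \<alpha> powr (1/2)" using ap by (simp add: powr_diff)
  also have "\<alpha> powr (1/2) = sqrt \<alpha>" using ap by (simp add: powr_half_sqrt)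
  finally show ?thesis .
qed

lemma rho_2e: "\<rho> powr (2 * e) = (1 + \<alpha>) powr (2 * e) / \<alpha>"
proof -
  have "\<rho> powr (2 * e) = (\<rho> powr e)\<^sup>2" using rho_pos by (simp add: power2_eq_square powr_add[symmetric])
  also have "\<dots> = ((1 + \<alpha>) powr e)\<^sup>2 / (sqrt \<alpha>)\<^sup>2" unfolding rho_e by (simp add: power_divide)
  also have "((1 + \<alpha>) powr e)\<^sup>2 = (1 + \<alpha>) powr (2 * e)" using \<alpha> by (simp add: power2_eq_square powr_add[symmetric])
  finally show ?thesis using \<alpha> by simp
qed

text \<open>Under the correspondence eps = x^(-2e) the threshold rho is the x whose level is
  \<open>ss\<close>, where the turning points merge.\<close>

lemma ss_rho: "ss = \<rho> powr (- (2 * e))"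
proof -
  have ap: "\<alpha> > 0" "1 + \<alpha> > 0" using \<alpha> by auto
  have "ss = (1 + \<alpha>) powr (- 1 / \<alpha>) * (\<alpha> / (1 + \<alpha>))" unfolding ss_eq exp_ts_eq ..
  also have "\<dots> = \<alpha> * ((1 + \<alpha>) powr (- 1 / \<alpha>) * (1 + \<alpha>) powr (- 1))" using ap by (simp add: powr_minus_divide)
  also have "(1 + \<alpha>) powr (- 1 / \<alpha>) * (1 + \<alpha>) powr (- 1) = (1 + \<alpha>) powr (- (2 * e))" unfolding e2 powr_add[symmetric] by (simp add: add.commute)
  also have "\<alpha> * (1 + \<alpha>) powr (- (2 * e)) = \<rho> powr (- (2 * e))" unfolding powr_minus rho_2e using ap by (simp add: divide_inverse)
  finally show ?thesis .
qed

lemma Sfun_eq: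
  assumes x: "x > \<rho>"
  shows "Sfun \<alpha> x = x powr e / (2 * pi) * G (x powr (- (2 * e)))" "0 < x powr (- (2 * e))" "x powr (- (2 * e)) < ss"
proof -
  have ap: "\<alpha> > 0" "1 + \<alpha> > 0" using \<alpha> by auto
  have x0: "x > 0" using x rho_pos by simp
  define \<epsilon> where "\<epsilon> = x powr (- (2 * e))"
  show ep: "0 < x powr (- (2 * e))" using x0 by simp
  show es: "x powr (- (2 * e)) < ss" unfolding ss_rho using x rho_pos e_bounds by (intro powr_less_mono2_neg) auto
  have \<epsilon>: "0 < \<epsilon>" "\<epsilon> \<le> ss" using ep es by (auto simp: \<epsilon>_def)
  \<comment> \<open>This shift gives x u^2 and u^(2 \<alpha> + 2) the same factor x^(2e), because 1
    + 1 / \<alpha> = 2e; dividing by it turns the term -1 into -eps.\<close>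
  define b where "b = ln x / (2 * \<alpha>)"
  define gg where "gg = (\<lambda>t. exp (t / 2 + b))"
  have V: "Vpot \<alpha> (gg t) x = x powr (2 * e) * (q t - \<epsilon>)" for t
  proof -
    have "(gg t)\<^sup>2 = exp (2 * (t / 2 + b))" unfolding gg_def by (rule exp_double[symmetric])
    then have "x * (gg t)\<^sup>2 = exp (ln x) * exp (2 * (t / 2 + b))" using x0 by (simp only: exp_ln)
    also have "\<dots> = exp t * exp (2 * e * ln x)"
      unfolding e2 b_def using ap by (simp add: exp_add[symmetric] algebra_simps)
    finally have 1: "x * (gg t)\<^sup>2 = exp t * x powr (2 * e)" using x0 by (simp add: powr_def)
    have "gg t powr (2 * \<alpha> + 2) = exp ((2 * \<alpha> + 2) * (t / 2 + b))" by (simp add: gg_def exp_powr_real mult.commute)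
    also have "(2 * \<alpha> + 2) * (t / 2 + b) = (1 + \<alpha>) * t + 2 * e * ln x"
      unfolding e2 b_def using ap by (simp add: field_simps)
    finally have 2: "gg t powr (2 * \<alpha> + 2) = exp ((1 + \<alpha>) * t) * x powr (2 * e)" using x0 by (simp add: powr_def exp_add)
    have 3: "x powr (2 * e) * \<epsilon> = 1" unfolding \<epsilon>_def using x0 by (simp add: powr_add[symmetric])
    show ?thesis unfolding Vpot_def 1 2 q_def using 3 by (simp add: algebra_simps)
  qed
  have xe: "x powr (2 * e) > 0" using x0 by simp
  have surj: "\<exists>t. u = gg t" if "u > 0" for u
    using that by (intro exI[of _ "2 * (ln u - b)"]) (simp add: gg_def diff_divide_distrib)
  have zs: "{u. u > 0 \<and> Vpot \<alpha> u x = 0} = {gg (sg1 \<epsilon>), gg (sg2 \<epsilon>)}"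
  proof (rule set_eqI, rule iffI)
    fix u assume "u \<in> {u. u > 0 \<and> Vpot \<alpha> u x = 0}"
    then have u: "u > 0" "Vpot \<alpha> u x = 0" by auto
    obtain t where t: "u = gg t" using surj u(1) by blast
    have "q t = \<epsilon>" using u(2) xe unfolding t V by simp
    then have "t = sg1 \<epsilon> \<or> t = sg2 \<epsilon>" using sg1_unique[OF \<epsilon>, of t] sg2_unique[OF \<epsilon>, of t] by (cases "t \<le> ts") auto
    then show "u \<in> {gg (sg1 \<epsilon>), gg (sg2 \<epsilon>)}" using t by auto
  next
    have "gg t > 0" for t by (simp add: gg_def)
    then show "u \<in> {u. u > 0 \<and> Vpot \<alpha> u x = 0}" if "u \<in> {gg (sg1 \<epsilon>), gg (sg2 \<epsilon>)}" for u
      using that sg1[OF \<epsilon>] sg2[OF \<epsilon>] by (auto simp: V)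
  qed
  have le: "gg (sg1 \<epsilon>) \<le> gg (sg2 \<epsilon>)" using sg_le[OF \<epsilon>] by (simp add: gg_def)
  have u1: "u1 \<alpha> x = gg (sg1 \<epsilon>)" unfolding u1_def zs using le by (intro cInf_eq_minimum) auto
  have u2: "u2 \<alpha> x = gg (sg2 \<epsilon>)" unfolding u2_def zs using le by (intro cSup_eq_maximum) auto
  let ?f = "\<lambda>u. sqrt (Vpot \<alpha> u x) / u"
  have gpos: "gg t > 0" for t by (simp add: gg_def)
  have cf: "continuous_on {gg (sg1 \<epsilon>)..gg (sg2 \<epsilon>)} ?f"
    unfolding Vpot_def using gpos[of "sg1 \<epsilon>"] by (intro continuous_intros) auto
  have "((\<lambda>t. (gg t / 2) *\<^sub>R ?f (gg t)) has_integral integral {gg (sg1 \<epsilon>)..gg (sg2 \<epsilon>)} ?f) {sg1 \<epsilon>..sg2 \<epsilon>}"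
  proof (rule has_integral_substitution[OF sg_le[OF \<epsilon>] le _ cf])
    show "gg ` {sg1 \<epsilon>..sg2 \<epsilon>} \<subseteq> {gg (sg1 \<epsilon>)..gg (sg2 \<epsilon>)}" by (auto simp: gg_def)
    show "(gg has_real_derivative gg t / 2) (at t within {sg1 \<epsilon>..sg2 \<epsilon>})" for t
      unfolding gg_def by (auto intro!: derivative_eq_intros)
  qed
  note sub = this
  have eqf: "(gg t / 2) *\<^sub>R ?f (gg t) = x powr e / 2 * sqrt (q t - \<epsilon>)" for t
  proof -
    have "sqrt (x powr (2 * e)) = x powr e" using x0 by (intro real_sqrt_unique) (simp_all add: power2_eq_square powr_add[symmetric])
    then show ?thesis using gpos[of t] unfolding V by (simp add: real_sqrt_mult)
  qed
  have "integral {gg (sg1 \<epsilon>)..gg (sg2 \<epsilon>)} ?f = integral {sg1 \<epsilon>..sg2 \<epsilon>} (\<lambda>t. x powr e / 2 * sqrt (q t - \<epsilon>))"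
    using integral_unique[OF sub] unfolding eqf by (rule sym)
  also have "\<dots> = x powr e / 2 * G \<epsilon>" unfolding G_def by simp
  finally have "integral {gg (sg1 \<epsilon>)..gg (sg2 \<epsilon>)} ?f = x powr e / 2 * G \<epsilon>" .
  then show "Sfun \<alpha> x = x powr e / (2 * pi) * G (x powr (- (2 * e)))"
    unfolding Sfun_def u1 u2 \<epsilon>_def[symmetric] using x by (simp only: if_True) simp
qed

definition c0 :: real where "c0 = (1 + \<alpha>) / pi * \<rho> powr e"

lemma tau_eq:
  assumes \<xi>: "\<xi> > 1"
  shows "tau \<alpha> \<xi> = c0 * \<xi> powr e * G (ss * \<xi> powr (- (2 * e)))" "0 < ss * \<xi> powr (- (2 * e))" "ss * \<xi> powr (- (2 * e)) < ss"
proof -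
  have x: "\<rho> * \<xi> > \<rho>" using \<xi> rho_pos by simp
  have eq: "(\<rho> * \<xi>) powr (- (2 * e)) = ss * \<xi> powr (- (2 * e))" unfolding ss_rho using \<xi> rho_pos by (simp add: powr_mult)
  note Sx = Sfun_eq[OF x, unfolded eq]
  have "(\<rho> * \<xi>) powr e = \<rho> powr e * \<xi> powr e" using \<xi> rho_pos by (simp add: powr_mult)
  then show "tau \<alpha> \<xi> = c0 * \<xi> powr e * G (ss * \<xi> powr (- (2 * e)))"
    unfolding tau_def c0_def Sx(1) by (simp add: field_simps)
  show "0 < ss * \<xi> powr (- (2 * e))" "ss * \<xi> powr (- (2 * e)) < ss" by (rule Sx(2), rule Sx(3))
qed

text \<open>The Gamma quotient in \<open>Aconst\<close> is the Beta integral \<open>G0\<close> in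
  disguise: A is the constant for which A^e is the leading coefficient of \<open>tau\<close> at
  infinity.\<close>

lemma Aconst_powr: "Aconst \<alpha> > 0" "Aconst \<alpha> powr e = c0 * G0"
proof -
  have ap: "\<alpha> > 0" "1 + \<alpha> > 0" using \<alpha> by auto
  define B where "B = (1 / sqrt (pi * \<alpha>)) * Gamma (1 / (2 * \<alpha>)) / Gamma e"
  have gp: "Gamma (1 / (2 * \<alpha>)) > 0" "Gamma e > 0" using ap e_bounds by (auto intro!: Gamma_real_pos)
  have B: "B > 0" unfolding B_def using gp ap by simp
  have A: "Aconst \<alpha> = (1 + \<alpha>) * B powr (1 / e)" unfolding Aconst_def B_def bae_exp_def by (simp add: add.commute)
  show "Aconst \<alpha> > 0" unfolding A using B ap by simp
  have "Aconst \<alpha> powr e = (1 + \<alpha>) powr e * B" unfolding A using B ap e_bounds by (simp add: powr_mult powr_powr)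
  moreover have "c0 * G0 = (1 + \<alpha>) powr e * B"
  proof -
    have "Gamma (3/2 :: real) = Gamma (1/2 + 1)" by simp
    also have "\<dots> = 1/2 * Gamma (1/2)" using nonpos_Ints_nonpos[of "1/2::real"] by (intro Gamma_plus1) auto
    finally have g1: "Gamma (3/2 :: real) = sqrt pi / 2" by (simp add: Gamma_one_half_real)
    have "1 / (2 * \<alpha>) + 3/2 = e + 1" using ap by (simp add: bae_exp_def field_simps)
    moreover have "Gamma (e + 1) = e * Gamma e" using e_bounds by (intro Gamma_plus1) (auto elim!: nonpos_Ints_cases)
    ultimately have "G0 = Gamma (1 / (2 * \<alpha>)) * (sqrt pi / 2) / (e * Gamma e) / \<alpha>" unfolding G0_def Beta_def g1 by simp
    then have "c0 * G0 = (1 + \<alpha>) / pi * ((1 + \<alpha>) powr e / sqrt \<alpha>) * (Gamma (1 / (2 * \<alpha>)) * (sqrt pi / 2) / (e * Gamma e) / \<alpha>)"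
      unfolding c0_def rho_e by simp
    also have "\<dots> = (1 + \<alpha>) powr e * ((sqrt pi / pi) * (1 / sqrt \<alpha>) * Gamma (1 / (2 * \<alpha>)) / Gamma e) * ((1 + \<alpha>) / (2 * \<alpha> * e))"
      by (simp add: mult_ac)
    also have "(1 + \<alpha>) / (2 * \<alpha> * e) = 1" unfolding e2 using ap by simp
    also have "sqrt pi / pi = 1 / sqrt pi" by (simp add: field_simps)
    also have "(1 / sqrt pi) * (1 / sqrt \<alpha>) = 1 / sqrt (pi * \<alpha>)" by (simp add: real_sqrt_mult)
    finally show ?thesis unfolding B_def by simp
  qed
  ultimately show "Aconst \<alpha> powr e = c0 * G0" by simp
qed

text \<open>In this sector |arg w| < pi / 4, so a power with exponent of modulus below 2 stays in
  the right half-plane. The exponent needed later is -2e, and e < 1.\<close>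

lemma wedge_powr_Re:
  assumes w: "w \<in> wedge 1 0" and s: "\<bar>s\<bar> < 2"
  shows "Re (w powr of_real s) > 0"
proof -
  have rw: "Re w > 0" "\<bar>Im w\<bar> < Re w" using w by (auto simp: wedge_def)
  have w0: "w \<noteq> 0" using rw by auto
  have i1: "\<bar>Im (Ln w)\<bar> < pi/2" using Re_Ln_pos_lt_imp[OF rw(1)] .
  have "Ln (w\<^sup>2) = 2 * Ln w"
  proof (rule Ln_unique)
    show "exp (2 * Ln w) = w\<^sup>2" using w0 by (simp add: exp_double)
  qed (use i1 in auto)
  moreover have "Re (w\<^sup>2) > 0"
  proof -
    have "\<bar>Im w\<bar>\<^sup>2 < (Re w)\<^sup>2" using rw by (intro power_strict_mono) auto
    then show ?thesis by (simp add: power2_eq_square)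
  qed
  ultimately have i2: "\<bar>2 * Im (Ln w)\<bar> < pi/2" using Re_Ln_pos_lt_imp[of "w\<^sup>2"] by simp
  have "\<bar>s * Im (Ln w)\<bar> \<le> 2 * \<bar>Im (Ln w)\<bar>" unfolding abs_mult using s by (intro mult_right_mono) auto
  then have "\<bar>s * Im (Ln w)\<bar> < pi/2" using i2 by simp
  then have "cos (s * Im (Ln w)) > 0" by (intro cos_gt_zero_pi) auto
  moreover have "Re (w powr of_real s) = exp (s * Re (Ln w)) * cos (s * Im (Ln w))"
    using w0 by (simp add: powr_def Re_exp)
  ultimately show ?thesis by simp
qed

lemma wedge_nonpos: "w \<in> wedge m 0 \<Longrightarrow> w \<notin> \<real>\<^sub>\<le>\<^sub>0" "w \<in> wedge m 0 \<Longrightarrow> w \<noteq> 0"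
  by (auto simp: wedge_def complex_nonpos_Reals_iff)

text \<open>With eps = ss \<xi>^(-2e) the three terms of G contribute c0 G0 \<xi>^e, a constant, and
  a term of order \<xi>^(-e). As sqrt eps = rho^(-e) \<xi>^(-e), the constant is -c0 pi rho^(-e) =
  -(1 + \<alpha>).\<close>

lemma tau_asymptotic:
  "\<exists>M\<ge>1. \<exists>Hr C. Hr holomorphic_on wedge 1 M \<and> (\<forall>w\<in>wedge 1 M. norm (Hr w) \<le> C * Re w powr (- e)) \<and>
     (\<forall>\<xi>>M. of_real (tau \<alpha> \<xi>) = of_real (Aconst \<alpha> powr e) * of_real \<xi> powr of_real e - of_real (1 + \<alpha>) + Hr (of_real \<xi>))"
proof -
  obtain \<delta> H C where \<delta>: "\<delta> > 0" and H: "H holomorphic_on {w. Re w > 0 \<and> norm w < \<delta>}"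
    "\<And>w. Re w > 0 \<Longrightarrow> norm w < \<delta> \<Longrightarrow> norm (H w) \<le> C * norm w"
    "\<And>\<epsilon>. 0 < \<epsilon> \<Longrightarrow> \<epsilon> < \<delta> \<Longrightarrow> of_real (G \<epsilon>) = of_real (G0 - pi * sqrt \<epsilon>) + H (of_real \<epsilon>)"
    using G_small by blast
  \<comment> \<open>The second entry solves ss M^(-2e) = \<delta>, so that beyond \<open>M\<close>
    the level lies in the range of the small-level expansion.\<close>
  define M where "M = max 1 ((ss / \<delta>) powr (1 / (2 * e)))"
  have M: "M \<ge> 1" by (simp add: M_def)
  have small: "ss * y powr (- (2 * e)) < \<delta>" if y: "y > M" for y
  proof -
    have "(ss / \<delta>) powr (1 / (2 * e)) < y" using y by (simp add: M_def)
    then have "((ss / \<delta>) powr (1 / (2 * e))) powr (2 * e) < y powr (2 * e)" using e_bounds by (intro powr_less_mono2) auto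
    then have "ss / \<delta> < y powr (2 * e)" using e_bounds ss_pos \<delta> by (simp add: powr_powr)
    then show ?thesis using \<delta> y M by (simp add: powr_minus_divide field_simps)
  qed
  define v where "v = (\<lambda>w. of_real ss * w powr of_real (- (2 * e)) :: complex)"
  define Hr where "Hr = (\<lambda>w. of_real c0 * w powr of_real e * H (v w))"
  have W0: "w \<in> wedge 1 0" if "w \<in> wedge 1 M" for w using that M by (auto simp: wedge_def)
  have nv: "norm (v w) = ss * norm w powr (- (2 * e))" if "w \<in> wedge 1 M" for w
    unfolding v_def norm_mult norm_powr_of_real[OF wedge_nonpos(2)[OF W0[OF that]]] using ss_pos by simp
  have vin: "Re (v w) > 0" "norm (v w) < \<delta>" if w: "w \<in> wedge 1 M" for w
  proof -
    show "Re (v w) > 0" unfolding v_def using wedge_powr_Re[OF W0[OF w], of "- (2 * e)"] ss_pos e_bounds by simp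
    have "norm w > M" using w complex_Re_le_cmod[of w] by (auto simp: wedge_def)
    then show "norm (v w) < \<delta>" unfolding nv[OF w] by (rule small)
  qed
  have hv: "v holomorphic_on wedge 1 M" unfolding v_def using wedge_nonpos(1)[OF W0] by (intro holomorphic_intros) auto
  have "(H \<circ> v) holomorphic_on wedge 1 M" by (rule holomorphic_on_compose_gen[OF hv H(1)]) (use vin in auto)
  then have hH: "Hr holomorphic_on wedge 1 M"
    unfolding Hr_def using wedge_nonpos(1)[OF W0] by (intro holomorphic_intros) (auto simp: comp_def)
  have c0p: "c0 > 0" unfolding c0_def using \<alpha> rho_pos by simp
  have bH: "norm (Hr w) \<le> (c0 * \<bar>C\<bar> * ss) * Re w powr (- e)" if w: "w \<in> wedge 1 M" for w
  proof -
    have nz: "w \<noteq> 0" using wedge_nonpos(2)[OF W0[OF w]] .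
    have "norm (Hr w) = c0 * norm w powr e * norm (H (v w))" unfolding Hr_def norm_mult norm_powr_of_real[OF nz] using c0p by simp
    also have "\<dots> \<le> c0 * norm w powr e * (\<bar>C\<bar> * norm (v w))"
    proof (rule mult_left_mono)
      have "norm (H (v w)) \<le> C * norm (v w)" by (rule H(2)[OF vin[OF w]])
      also have "\<dots> \<le> \<bar>C\<bar> * norm (v w)" by (intro mult_right_mono) auto
      finally show "norm (H (v w)) \<le> \<bar>C\<bar> * norm (v w)" .
    qed (use c0p in auto)
    also have "\<dots> = c0 * \<bar>C\<bar> * ss * (norm w powr e * norm w powr (- (2 * e)))" unfolding nv[OF w] by simp
    also have "norm w powr e * norm w powr (- (2 * e)) = norm w powr (- e)" by (simp add: powr_add[symmetric])
    also have "c0 * \<bar>C\<bar> * ss * norm w powr (- e) \<le> c0 * \<bar>C\<bar> * ss * Re w powr (- e)"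
      using c0p ss_pos e_bounds complex_Re_le_cmod[of w] w M by (intro mult_left_mono powr_mono2') (auto simp: wedge_def)
    finally show ?thesis .
  qed
  have val: "of_real (tau \<alpha> \<xi>) = of_real (Aconst \<alpha> powr e) * of_real \<xi> powr of_real e - of_real (1 + \<alpha>) + Hr (of_real \<xi>)" if \<xi>: "\<xi> > M" for \<xi>
  proof -
    have x1: "\<xi> > 1" using \<xi> M by simp
    note t = tau_eq[OF x1]
    define \<epsilon> where "\<epsilon> = ss * \<xi> powr (- (2 * e))"
    have ve: "v (of_real \<xi>) = of_real \<epsilon>" unfolding v_def \<epsilon>_def using x1 powr_of_real[of \<xi> "- (2 * e)"] by simp
    have pe: "complex_of_real \<xi> powr of_real e = of_real (\<xi> powr e)" using x1 powr_of_real[of \<xi> e] by simp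
    have ge: "of_real (G \<epsilon>) = of_real (G0 - pi * sqrt \<epsilon>) + H (of_real \<epsilon>)" by (rule H(3)) (use t(2) small[OF \<xi>] in \<open>auto simp: \<epsilon>_def\<close>)
    have sq: "\<xi> powr e * sqrt \<epsilon> = \<rho> powr (- e)"
    proof -
      have "sqrt \<epsilon> = \<rho> powr (- e) * \<xi> powr (- e)" unfolding \<epsilon>_def ss_rho
        using x1 rho_pos by (intro real_sqrt_unique) (simp_all add: power2_eq_square powr_add[symmetric] algebra_simps powr_mult[symmetric])
      then show ?thesis using x1 by (simp add: powr_add[symmetric])
    qed
    have cc: "c0 * (pi * \<rho> powr (- e)) = 1 + \<alpha>" unfolding c0_def using rho_pos by (simp add: powr_add[symmetric])
    have "complex_of_real (tau \<alpha> \<xi>) = of_real (c0 * \<xi> powr e) * of_real (G \<epsilon>)" unfolding t(1) \<epsilon>_def by simp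
    also have "\<dots> = of_real (c0 * \<xi> powr e * (G0 - pi * sqrt \<epsilon>)) + of_real (c0 * \<xi> powr e) * H (of_real \<epsilon>)"
      unfolding ge by (simp add: algebra_simps)
    also have "c0 * \<xi> powr e * (G0 - pi * sqrt \<epsilon>) = c0 * G0 * \<xi> powr e - c0 * (pi * (\<xi> powr e * sqrt \<epsilon>))" by (simp add: algebra_simps)
    also have "\<dots> = Aconst \<alpha> powr e * \<xi> powr e - (1 + \<alpha>)" unfolding sq cc Aconst_powr(2) ..
    finally show ?thesis unfolding Hr_def ve pe by simp
  qed
  show ?thesis using M hH bH val by blast
qed

text \<open>The point \<xi>0 = 1 is included through analyticity of G at the level
  \<open>ss\<close>. Agreement is claimed only for \<xi> > 1, because \<open>tau\<close> is
  identically 0 on the other side.\<close>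

lemma tau_local:
  assumes \<xi>0: "\<xi>0 \<ge> 1"
  shows "\<exists>r>0. \<exists>T. T holomorphic_on ball (of_real \<xi>0) r \<and> (\<forall>\<xi>>1. \<bar>\<xi> - \<xi>0\<bar> < r \<longrightarrow> of_real (tau \<alpha> \<xi>) = T (of_real \<xi>))"
proof -
  define \<epsilon>0 where "\<epsilon>0 = ss * \<xi>0 powr (- (2 * e))"
  have "\<exists>r>0. \<exists>g. g holomorphic_on ball (of_real \<epsilon>0) r \<and> (\<forall>\<epsilon>. \<bar>\<epsilon> - \<epsilon>0\<bar> < r \<and> 0 < \<epsilon> \<and> \<epsilon> < ss \<longrightarrow> g (of_real \<epsilon>) = of_real (G \<epsilon>))"
  proof (cases "\<xi>0 = 1")
    case True
    then have "\<epsilon>0 = ss" by (simp add: \<epsilon>0_def)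
    moreover obtain r g where "r > 0" "g holomorphic_on ball (of_real ss) r" "\<And>\<epsilon>. ss - r < \<epsilon> \<Longrightarrow> \<epsilon> < ss \<Longrightarrow> g (of_real \<epsilon>) = of_real (G \<epsilon>)"
      using G_analytic_top by blast
    ultimately show ?thesis by (intro exI[of _ r] conjI exI[of _ g]) auto
  next
    case False
    then have "\<xi>0 > 1" using \<xi>0 by simp
    from tau_eq(2,3)[OF this] have "0 < \<epsilon>0" "\<epsilon>0 < ss" by (auto simp: \<epsilon>0_def)
    from G_analytic_interior[OF this] show ?thesis by blast
  qed
  then obtain r0 g where g: "r0 > 0" "g holomorphic_on ball (of_real \<epsilon>0) r0" "\<And>\<epsilon>. \<bar>\<epsilon> - \<epsilon>0\<bar> < r0 \<Longrightarrow> 0 < \<epsilon> \<Longrightarrow> \<epsilon> < ss \<Longrightarrow> g (of_real \<epsilon>) = of_real (G \<epsilon>)"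
    by blast
  define v where "v = (\<lambda>w. of_real ss * w powr of_real (- (2 * e)) :: complex)"
  have hv: "v holomorphic_on wedge 1 0" unfolding v_def using wedge_nonpos(1) by (intro holomorphic_intros) auto
  have vr: "v (of_real \<xi>) = of_real (ss * \<xi> powr (- (2 * e)))" if "\<xi> > 0" for \<xi>
    unfolding v_def using that powr_of_real[of \<xi> "- (2 * e)"] by simp
  have "open (v -` ball (of_real \<epsilon>0) r0 \<inter> wedge 1 0)"
    by (rule continuous_on_open_vimage[OF open_wedge, THEN iffD1, rule_format])
       (use hv holomorphic_on_imp_continuous_on in auto)
  moreover have "of_real \<xi>0 \<in> v -` ball (of_real \<epsilon>0) r0 \<inter> wedge 1 0"
    using vr[of \<xi>0] \<xi>0 g(1) by (auto simp: \<epsilon>0_def wedge_def)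
  ultimately obtain r where r: "r > 0" "ball (of_real \<xi>0) r \<subseteq> v -` ball (of_real \<epsilon>0) r0 \<inter> wedge 1 0" using openE by blast
  define T where "T = (\<lambda>w. of_real c0 * w powr of_real e * g (v w))"
  have "(g \<circ> v) holomorphic_on ball (of_real \<xi>0) r"
    by (rule holomorphic_on_compose_gen[OF holomorphic_on_subset[OF hv] g(2)]) (use r in auto)
  then have "T holomorphic_on ball (of_real \<xi>0) r"
    unfolding T_def using r(2) wedge_nonpos(1) by (intro holomorphic_intros) (auto simp: comp_def)
  moreover have "of_real (tau \<alpha> \<xi>) = T (of_real \<xi>)" if \<xi>: "\<xi> > 1" "\<bar>\<xi> - \<xi>0\<bar> < r" for \<xi>
  proof -
    have "of_real \<xi> \<in> ball (complex_of_real \<xi>0) r" using \<xi>(2) by (simp add: dist_norm abs_minus_commute flip: of_real_diff)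
    then have "of_real \<xi> \<in> v -` ball (of_real \<epsilon>0) r0 \<inter> wedge 1 0" by (rule subsetD[OF r(2)])
    then have "v (of_real \<xi>) \<in> ball (of_real \<epsilon>0) r0" by blast
    then have "\<bar>ss * \<xi> powr (- (2 * e)) - \<epsilon>0\<bar> < r0" using vr[of \<xi>] \<xi>(1) by (simp add: dist_norm abs_minus_commute flip: of_real_diff of_real_mult)
    then have "g (v (of_real \<xi>)) = of_real (G (ss * \<xi> powr (- (2 * e))))" using g(3)[OF _ tau_eq(2,3)[OF \<xi>(1)]] vr[of \<xi>] \<xi>(1) by (simp del: of_real_mult)
    then show ?thesis unfolding T_def using tau_eq(1)[OF \<xi>(1)] \<xi>(1) powr_of_real[of \<xi> e] by simp
  qed
  ultimately show ?thesis using r(1) by blast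
qed

end

section \<open>Comparison\<close>

context bae
begin

sublocale W: well \<alpha>
  by unfold_locales (rule \<alpha>)

lemma assoc_bigo:
  assumes \<delta>: "\<delta> > 0"
  shows "(\<lambda>x. z x - (x powr e - p * (1 + \<alpha>) - S / 2 * (\<alpha> - 1))) \<in> O[at_top](\<lambda>x. x powr (- e + \<delta>))"
proof -
  define d where "d = min \<delta> (e / 2)"
  have d: "0 < d" "d < e" "d \<le> \<delta>" using \<delta> e_bounds by (auto simp: d_def)
  obtain A where A: "\<And>x. x > 0 \<Longrightarrow> \<bar>r x\<bar> \<le> A * x powr (- e + d)" using r_bound[OF d(1,2)] by blast
  have "norm (z x - (x powr e - p * (1 + \<alpha>) - S / 2 * (\<alpha> - 1))) \<le> \<bar>A\<bar> * norm (x powr (- e + \<delta>))" if x: "x \<ge> 1" for x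
  proof -
    have "z x - (x powr e - p * (1 + \<alpha>) - S / 2 * (\<alpha> - 1)) = r x" by (simp add: r_def)
    moreover have "\<bar>r x\<bar> \<le> A * x powr (- e + d)" using A x by simp
    moreover have "A * x powr (- e + d) \<le> \<bar>A\<bar> * x powr (- e + \<delta>)" using x d by (intro mult_mono powr_mono) auto
    ultimately show ?thesis by simp
  qed
  then show ?thesis by (intro bigoI[where c="\<bar>A\<bar>"] eventually_mono[OF eventually_ge_at_top[of 1]])
qed

definition lam :: "real \<Rightarrow> real \<Rightarrow> real" where
  "lam om = (\<lambda>\<xi>. z (\<xi> * om) - lfun \<alpha> om p (\<xi> * om))"

text \<open>Minus the coefficient of D tau in l. As 2 \<alpha> / (1 + \<alpha>) = 1 / e, it
  satisfies kap e = p - (om / A)^e, which is what D acting on \<xi>^e needs for the cancellation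
  below.\<close>

definition kap :: "real \<Rightarrow> real" where
  "kap om = 2 * \<alpha> / (1 + \<alpha>) * (p - (om / Aconst \<alpha>) powr e)"

lemma lam_eq: "om > 0 \<Longrightarrow> lam om \<xi> = z (\<xi> * om) - p * tau \<alpha> \<xi> + kap om * Dop (tau \<alpha>) \<xi>"
  by (simp add: lam_def lfun_def kap_def)

lemma m0_pos: "m0 > 0" using sin_th by (simp add: m0_def)

lemma sec_scale: "om > 0 \<Longrightarrow> w \<in> sec \<Longrightarrow> of_real om * w \<in> sec"
  by (simp add: wedge_def abs_mult mult.left_commute[of _ om])

text \<open>At \<xi>0 = 1 the bound holds from the right only, but uniformly up to 1, because the
  extension of \<open>tau\<close> is holomorphic in a full disc around 1.\<close>

lemma lam_locally_bounded:
  assumes om: "om > 0" and \<xi>0: "\<xi>0 \<ge> 1"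
  shows "\<exists>d>0. \<exists>B. \<forall>\<xi>>1. \<bar>\<xi> - \<xi>0\<bar> < d \<longrightarrow> \<bar>(Dop ^^ n) (lam om) \<xi>\<bar> \<le> B"
proof -
  obtain d0 T where d0: "d0 > 0" and T: "T holomorphic_on ball (of_real \<xi>0) d0"
    "\<And>\<xi>. \<xi> > 1 \<Longrightarrow> \<bar>\<xi> - \<xi>0\<bar> < d0 \<Longrightarrow> of_real (tau \<alpha> \<xi>) = T (of_real \<xi>)"
    using W.tau_local[OF \<xi>0] by blast
  define V where "V = ball (complex_of_real \<xi>0) d0 \<inter> sec"
  define U where "U = {1<..} \<inter> ball \<xi>0 d0"
  have oV: "open V" unfolding V_def by (intro open_Int open_ball open_wedge)
  have oU: "open U" unfolding U_def by (intro open_Int open_ball open_greaterThan)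
  have UV: "complex_of_real x \<in> V" if "x \<in> U" for x
    using that m0_pos by (auto simp: U_def V_def wedge_def dist_norm simp flip: of_real_diff)
  have TU: "of_real (tau \<alpha> x) = T (of_real x)" if "x \<in> U" for x
    using T(2)[of x] that by (auto simp: U_def dist_norm abs_minus_commute)
  have hT: "T holomorphic_on V" using T(1) by (rule holomorphic_on_subset) (auto simp: V_def)
  have hcT: "cDop T holomorphic_on V" using cDop_holomorphic[OF oV hT, of 1] by simp
  define F where "F = (\<lambda>w. - of_real (2 * p) + ZI (of_real om * w) - of_real p * T w + of_real (kap om) * cDop T w)"
  have "(ZI \<circ> (\<lambda>w. of_real om * w)) holomorphic_on V"
    by (rule holomorphic_on_compose_gen[OF _ ZI_holomorphic]) (use sec_scale[OF om] in \<open>auto simp: V_def intro!: holomorphic_intros\<close>)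
  then have hZ: "(\<lambda>w. ZI (of_real om * w)) holomorphic_on V" by (simp add: comp_def)
  have hF: "F holomorphic_on V" unfolding F_def by (intro holomorphic_intros hZ hT hcT)
  have eq: "lam om x = Re (F (of_real x))" if x: "x \<in> U" for x
  proof -
    have x0: "x > 0" using x by (auto simp: U_def)
    have t: "tau \<alpha> y = Re (T (of_real y))" if "y \<in> U" for y using TU[OF that] by (metis Re_complex_of_real)
    have "(Dop ^^ 1) (tau \<alpha>) x = Re ((cDop ^^ 1) T (of_real x))" by (rule Dop_iter_eq_Re_cDop[OF oV hT oU UV t x])
    then have D: "Dop (tau \<alpha>) x = Re (cDop T (of_real x))" by simp
    have "ZI (of_real om * of_real x) = of_real (zi (x * om))" using ZI_real[of "x * om"] om x0 by (simp add: mult.commute)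
    then show ?thesis unfolding lam_eq[OF om] D t[OF x] F_def using z_pos[of "x * om"] om x0 by simp
  qed
  let ?g = "(cDop ^^ n) F"
  have hg: "?g holomorphic_on V" by (rule cDop_holomorphic[OF oV hF])
  have "complex_of_real \<xi>0 \<in> V" using d0 \<xi>0 m0_pos by (auto simp: V_def wedge_def)
  then obtain d where d: "d > 0" "cball (of_real \<xi>0) d \<subseteq> V" using open_contains_cball_eq[OF oV] by blast
  have "compact (?g ` cball (of_real \<xi>0) d)"
    by (intro compact_continuous_image compact_cball continuous_on_subset[OF holomorphic_on_imp_continuous_on[OF hg] d(2)])
  then obtain B where B: "\<And>w. w \<in> cball (of_real \<xi>0) d \<Longrightarrow> norm (?g w) \<le> B"
    using compact_imp_bounded[of "?g ` cball (of_real \<xi>0) d"] unfolding bounded_iff by (auto simp del: mem_cball)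
  have "\<bar>(Dop ^^ n) (lam om) \<xi>\<bar> \<le> B" if \<xi>: "\<xi> > 1" "\<bar>\<xi> - \<xi>0\<bar> < d" for \<xi>
  proof -
    have in1: "complex_of_real \<xi> \<in> cball (of_real \<xi>0) d" using \<xi> by (simp add: dist_norm abs_minus_commute flip: of_real_diff)
    then have "complex_of_real \<xi> \<in> V" by (rule subsetD[OF d(2)])
    then have "complex_of_real \<xi> \<in> ball (of_real \<xi>0) d0" unfolding V_def by blast
    then have inU: "\<xi> \<in> U" using \<xi> by (simp add: U_def dist_norm flip: of_real_diff)
    have "(Dop ^^ n) (lam om) \<xi> = Re (?g (of_real \<xi>))"
      by (rule Dop_iter_eq_Re_cDop[where f="lam om" and U=U and V=V, OF oV hF oU _ _ inU]) (use UV eq in auto)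
    then show ?thesis using abs_Re_le_cmod[of "?g (of_real \<xi>)"] B[OF in1] by simp
  qed
  then show ?thesis using d(1) by blast
qed

text \<open>The closed interval from 1 to \<open>M\<close>, end point 1 included, is covered by
  finitely many of the local neighbourhoods; the sum of their bounds dominates each.\<close>

lemma lam_bounded_compact:
  assumes om: "om > 0"
  shows "\<exists>B. \<forall>\<xi>. 1 < \<xi> \<and> \<xi> \<le> M \<longrightarrow> \<bar>(Dop ^^ n) (lam om) \<xi>\<bar> \<le> B"
proof -
  let ?D = "(Dop ^^ n) (lam om)"
  have "\<forall>\<xi>0\<in>{1..M}. \<exists>dB. fst dB > 0 \<and> (\<forall>\<xi>>1. \<bar>\<xi> - \<xi>0\<bar> < fst dB \<longrightarrow> \<bar>?D \<xi>\<bar> \<le> snd dB)"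
    using lam_locally_bounded[OF om] by fastforce
  then obtain dB where dB: "\<And>\<xi>0. \<xi>0 \<in> {1..M} \<Longrightarrow> fst (dB \<xi>0) > 0"
    "\<And>\<xi>0 \<xi>. \<xi>0 \<in> {1..M} \<Longrightarrow> \<xi> > 1 \<Longrightarrow> \<bar>\<xi> - \<xi>0\<bar> < fst (dB \<xi>0) \<Longrightarrow> \<bar>?D \<xi>\<bar> \<le> snd (dB \<xi>0)"
    by (metis bchoice)
  obtain C where C: "C \<subseteq> {1..M}" "finite C" "{1..M} \<subseteq> (\<Union>c\<in>C. ball c (fst (dB c)))"
    by (rule compactE_image[OF compact_Icc[of 1 M], of "{1..M}" "\<lambda>c. ball c (fst (dB c))"]) (use dB(1) in \<open>auto intro: bexI\<close>)
  have "\<bar>?D \<xi>\<bar> \<le> (\<Sum>c\<in>C. \<bar>snd (dB c)\<bar>)" if \<xi>: "1 < \<xi>" "\<xi> \<le> M" for \<xi>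
  proof -
    have "\<xi> \<in> {1..M}" using \<xi> by simp
    then obtain c where c: "c \<in> C" "\<xi> \<in> ball c (fst (dB c))" using C(3) by blast
    have "\<bar>?D \<xi>\<bar> \<le> snd (dB c)" using c C(1) \<xi>(1) by (intro dB(2)) (auto simp: dist_norm)
    also have "\<dots> \<le> \<bar>snd (dB c)\<bar>" by simp
    also have "\<dots> \<le> (\<Sum>c\<in>C. \<bar>snd (dB c)\<bar>)" using C(2) c(1) by (intro member_le_sum) auto
    finally show ?thesis .
  qed
  then show ?thesis by blast
qed

text \<open>The terms p A \<xi>^e from p tau and from kap D tau cancel, the remaining (om \<xi>)^e
  cancels the leading term of z, and for S = 0 the constant p (1 + \<alpha>) of p tau cancels that
  of z. What is left consists of \<open>R\<close>, \<open>Hr\<close> and \<open>cDop Hr\<close>, all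
  holomorphic in a sector and of order at most -e + \<delta>.\<close>

lemma lam_decay:
  assumes om: "om > 0" and S0: "S = 0" and \<delta>: "0 < \<delta>" "\<delta> < e"
  shows "\<exists>B M. M \<ge> 1 \<and> (\<forall>\<xi>>M. \<bar>(Dop ^^ n) (lam om) \<xi>\<bar> \<le> B * \<xi> powr (- e + \<delta>))"
proof -
  obtain M Hr C where M: "M \<ge> 1" and Hr: "Hr holomorphic_on wedge 1 M" "\<And>w. w \<in> wedge 1 M \<Longrightarrow> norm (Hr w) \<le> C * Re w powr (- e)"
    and tau: "\<And>\<xi>. \<xi> > M \<Longrightarrow> of_real (tau \<alpha> \<xi>) = of_real (Aconst \<alpha> powr e) * of_real \<xi> powr of_real e - of_real (1 + \<alpha>) + Hr (of_real \<xi>)"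
    using W.tau_asymptotic by blast
  define m where "m = min m0 1"
  have m: "m > 0" "m \<le> m0" "m \<le> 1" using m0_pos by (auto simp: m_def)
  have M0: "M \<ge> 0" using M by simp
  have sub1: "wedge m M \<subseteq> wedge 1 M" using m M0 by (intro wedge_mono) auto
  have hHm: "Hr holomorphic_on wedge m M" using Hr(1) sub1 by (rule holomorphic_on_subset)
  obtain C' where C': "\<And>w. w \<in> wedge (m/2) (2*M) \<Longrightarrow> norm (cDop Hr w) \<le> C' * Re w powr (- e)"
    using cDop_wedge_bound_step[OF m(1) M0 hHm Hr(2)] sub1 by blast
  define V where "V = wedge (m/2) (2*M)"
  have V1: "V \<subseteq> wedge 1 M" unfolding V_def using m M0 by (intro wedge_mono) auto
  have Vs: "V \<subseteq> sec" unfolding V_def using m M0 by (intro wedge_mono) auto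
  have VRe: "Re w \<ge> 1" if "w \<in> V" for w using that M by (auto simp: V_def wedge_def)
  define s where "s = - e + \<delta>"
  have s: "s < 0" "- e \<le> s" using \<delta> by (auto simp: s_def)
  obtain CR where CR: "\<And>w. w \<in> sec \<Longrightarrow> norm (R w) \<le> CR * norm w powr s" using R_bound[OF \<delta>] unfolding s_def by blast
  define F where "F = (\<lambda>w. R (of_real om * w) - of_real p * Hr w + of_real (kap om) * cDop Hr w)"
  have hcH: "cDop Hr holomorphic_on wedge 1 M" using cDop_holomorphic[OF open_wedge Hr(1), of 1] by simp
  have "(R \<circ> (\<lambda>w. of_real om * w)) holomorphic_on V"
    by (rule holomorphic_on_compose_gen[OF _ R_holomorphic]) (use sec_scale[OF om] Vs in \<open>auto intro!: holomorphic_intros\<close>)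
  then have hR: "(\<lambda>w. R (of_real om * w)) holomorphic_on V" by (simp add: comp_def)
  have hF: "F holomorphic_on V" unfolding F_def
    by (intro holomorphic_intros hR holomorphic_on_subset[OF Hr(1) V1] holomorphic_on_subset[OF hcH V1])
  define B where "B = \<bar>CR\<bar> * om powr s + \<bar>p\<bar> * \<bar>C\<bar> + \<bar>kap om\<bar> * \<bar>C'\<bar>"
  have bF: "norm (F w) \<le> B * Re w powr s" if w: "w \<in> V" for w
  proof -
    have re: "Re w \<ge> 1" by (rule VRe[OF w])
    have cmp: "c * Re w powr (- e) \<le> \<bar>c\<bar> * Re w powr s" for c using re s by (intro mult_mono powr_mono) auto
    have "norm (R (of_real om * w)) \<le> CR * norm (of_real om * w) powr s" using CR sec_scale[OF om] w Vs by blast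
    also have "\<dots> \<le> \<bar>CR\<bar> * (om * Re w) powr s"
    proof (intro mult_mono powr_mono2')
      show "om * Re w \<le> norm (of_real om * w)" using om complex_Re_le_cmod[of w] by (simp add: norm_mult)
    qed (use om re s in auto)
    also have "\<dots> = \<bar>CR\<bar> * om powr s * Re w powr s" using om re by (simp add: powr_mult)
    finally have 1: "norm (R (of_real om * w)) \<le> \<bar>CR\<bar> * om powr s * Re w powr s" .
    have "norm (Hr w) \<le> \<bar>C\<bar> * Re w powr s" using order_trans[OF Hr(2) cmp] w V1 by blast
    then have "\<bar>p\<bar> * norm (Hr w) \<le> \<bar>p\<bar> * (\<bar>C\<bar> * Re w powr s)" by (rule mult_left_mono) simp
    then have 2: "norm (of_real p * Hr w) \<le> \<bar>p\<bar> * \<bar>C\<bar> * Re w powr s" by (simp add: norm_mult)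
    have "norm (cDop Hr w) \<le> \<bar>C'\<bar> * Re w powr s" using order_trans[OF C' cmp] w by (auto simp: V_def)
    then have "\<bar>kap om\<bar> * norm (cDop Hr w) \<le> \<bar>kap om\<bar> * (\<bar>C'\<bar> * Re w powr s)" by (rule mult_left_mono) simp
    then have 3: "norm (of_real (kap om) * cDop Hr w) \<le> \<bar>kap om\<bar> * \<bar>C'\<bar> * Re w powr s" by (simp add: norm_mult)
    have "norm (F w) \<le> norm (R (of_real om * w) - of_real p * Hr w) + norm (of_real (kap om) * cDop Hr w)"
      unfolding F_def by (rule norm_triangle_ineq)
    moreover have "norm (R (of_real om * w) - of_real p * Hr w) \<le> norm (R (of_real om * w)) + norm (of_real p * Hr w)"
      by (rule norm_triangle_ineq4)
    ultimately have "norm (F w) \<le> norm (R (of_real om * w)) + norm (of_real p * Hr w) + norm (of_real (kap om) * cDop Hr w)"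
      by linarith
    also have "\<dots> \<le> \<bar>CR\<bar> * om powr s * Re w powr s + \<bar>p\<bar> * \<bar>C\<bar> * Re w powr s + \<bar>kap om\<bar> * \<bar>C'\<bar> * Re w powr s"
      by (intro add_mono 1 2 3)
    finally show ?thesis by (simp add: B_def distrib_right)
  qed
  define A where "A = Aconst \<alpha> powr e"
  have Ap: "A > 0" "Aconst \<alpha> > 0" using W.Aconst_powr(1) by (auto simp: A_def)
  define FT where "FT = (\<lambda>w. of_real A * w powr of_real e - of_real (1 + \<alpha>) + Hr w)"
  have nn: "w \<notin> \<real>\<^sub>\<le>\<^sub>0" if "w \<in> wedge 1 M" for w using that M by (auto simp: wedge_def complex_nonpos_Reals_iff)
  have hFT: "FT holomorphic_on wedge 1 M" unfolding FT_def using nn by (intro holomorphic_intros Hr(1)) auto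
  have eq: "lam om x = Re (F (of_real x))" if x: "x \<in> {2*M<..}" for x
  proof -
    have xM: "x > M" "x > 0" using x M by auto
    have xw: "complex_of_real x \<in> wedge 1 M" using xM M0 by (simp add: of_real_wedge)
    have tr: "tau \<alpha> y = Re (FT (of_real y))" if "y \<in> {M<..}" for y
      using tau[of y] that unfolding FT_def A_def by (metis Re_complex_of_real greaterThan_iff)
    have pe: "complex_of_real x powr of_real e = of_real (x powr e)" using xM by (simp add: powr_of_real)
    have t: "tau \<alpha> x = A * x powr e - (1 + \<alpha>) + Re (Hr (of_real x))"
      using tr[of x] xM unfolding FT_def pe by (simp add: mult.commute)
    have "(FT has_field_derivative of_real A * (of_real e * of_real x powr (of_real e - 1)) - 0 + deriv Hr (of_real x)) (at (of_real x))"
      unfolding FT_def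
      by (intro DERIV_add DERIV_diff DERIV_cmult DERIV_const has_field_derivative_powr nn[OF xw] holomorphic_derivI[OF Hr(1) open_wedge xw])
    then have dF: "deriv FT (of_real x) = of_real A * (of_real e * of_real x powr (of_real e - 1)) + deriv Hr (of_real x)"
      by (simp add: DERIV_imp_deriv)
    have xp: "of_real x * of_real x powr (of_real e - 1) = complex_of_real (x powr e)"
    proof -
      have "x * x powr (e - 1) = x powr e" using xM by (simp add: powr_mult_base)
      moreover have "complex_of_real x powr (of_real e - 1) = of_real (x powr (e - 1))" using xM powr_of_real[of x "e - 1"] by simp
      ultimately show ?thesis by (metis of_real_mult)
    qed
    have "cDop FT (of_real x) = of_real A * of_real e * (of_real x * of_real x powr (of_real e - 1)) + cDop Hr (of_real x)"
      unfolding cDop_def dF by (simp add: algebra_simps)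
    then have cF: "cDop FT (of_real x) = of_real (A * e * x powr e) + cDop Hr (of_real x)" unfolding xp by simp
    have "(Dop ^^ 1) (tau \<alpha>) x = Re ((cDop ^^ 1) FT (of_real x))"
      by (rule Dop_iter_eq_Re_cDop[OF open_wedge hFT open_greaterThan _ tr]) (use xM M0 in \<open>auto simp: of_real_wedge\<close>)
    then have D: "Dop (tau \<alpha>) x = A * e * x powr e + Re (cDop Hr (of_real x))" by (simp add: cF)
    have "R (of_real om * of_real x) = of_real (r (x * om))" using R_of_real[of "x * om"] om xM by (simp add: mult.commute)
    then have RF: "Re (F (of_real x)) = r (x * om) - p * Re (Hr (of_real x)) + kap om * Re (cDop Hr (of_real x))"
      by (simp add: F_def)
    have ke: "kap om * e = p - (om / Aconst \<alpha>) powr e" 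
    proof -
      have "2 * \<alpha> / (1 + \<alpha>) * e = 1" using \<alpha> by (simp add: bae_exp_def)
      moreover have "kap om * e = (2 * \<alpha> / (1 + \<alpha>) * e) * (p - (om / Aconst \<alpha>) powr e)" unfolding kap_def by (simp only: mult_ac)
      ultimately show ?thesis by (simp only: mult_1)
    qed
    have "kap om * (A * e * x powr e) = (kap om * e) * A * x powr e" by simp
    also have "\<dots> = p * A * x powr e - ((om / Aconst \<alpha>) powr e * A) * x powr e" unfolding ke by (simp add: algebra_simps)
    also have "(om / Aconst \<alpha>) powr e * A = om powr e" using Ap om by (simp add: A_def powr_divide)
    also have "om powr e * x powr e = (x * om) powr e" using om xM by (simp add: powr_mult)
    finally have k: "kap om * (A * e * x powr e) = p * A * x powr e - (x * om) powr e" .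
    have zz: "z (x * om) = r (x * om) + (x * om) powr e - p * (1 + \<alpha>)" using S0 by (simp add: r_def)
    show ?thesis unfolding lam_eq[OF om] t D RF zz distrib_left k by (simp add: algebra_simps)
  qed
  have oV: "open V" unfolding V_def by (rule open_wedge)
  obtain C'' m' M' where K: "m' > 0" "M' \<ge> 2 * M" "m' \<le> m/2" "\<And>w. w \<in> wedge m' M' \<Longrightarrow> norm ((cDop ^^ n) F w) \<le> C'' * Re w powr s"
    using cDop_wedge_bound[OF _ _ hF[unfolded V_def] bF[unfolded V_def], of n] m(1) M0 by auto
  have "\<bar>(Dop ^^ n) (lam om) \<xi>\<bar> \<le> C'' * \<xi> powr s" if \<xi>: "\<xi> > M'" for \<xi>
  proof -
    have "(Dop ^^ n) (lam om) \<xi> = Re ((cDop ^^ n) F (of_real \<xi>))"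
      by (rule Dop_iter_eq_Re_cDop[OF oV hF open_greaterThan _ eq]) (use \<xi> K(2) m M0 in \<open>auto simp: V_def of_real_wedge\<close>)
    moreover have "complex_of_real \<xi> \<in> wedge m' M'" using \<xi> K(1,2) M0 by (simp add: of_real_wedge)
    ultimately show ?thesis using K(4)[of "of_real \<xi>"] abs_Re_le_cmod[of "(cDop ^^ n) F (of_real \<xi>)"] by simp
  qed
  moreover have "M' \<ge> 1" using K(2) M by simp
  ultimately show ?thesis unfolding s_def by blast
qed

text \<open>Choosing \<delta> <= s + e makes the decay exponent -e + \<delta> at most s. The point
  \<xi> = 1 is treated by itself: \<open>deriv\<close> there also sees \<xi> < 1, where
  \<open>tau\<close> has another formula, but a single value cannot spoil the supremum.\<close>

lemma lam_weighted_bounded: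
  assumes om: "om > 0" and S0: "S = 0" and s: "- e < s" "s \<le> 0"
  shows "bdd_above ((\<lambda>\<xi>. \<bar>\<xi> powr (- s) * (Dop ^^ n) (lam om) \<xi>\<bar>) ` {1..})"
proof -
  define \<delta> where "\<delta> = min (s + e) (e / 2)"
  have \<delta>: "0 < \<delta>" "\<delta> < e" "\<delta> \<le> s + e" using s e_bounds by (auto simp: \<delta>_def)
  obtain B M where M: "M \<ge> 1" and B: "\<And>\<xi>. \<xi> > M \<Longrightarrow> \<bar>(Dop ^^ n) (lam om) \<xi>\<bar> \<le> B * \<xi> powr (- e + \<delta>)"
    using lam_decay[OF om S0 \<delta>(1,2)] by blast
  obtain B' where B': "\<And>\<xi>. 1 < \<xi> \<Longrightarrow> \<xi> \<le> M \<Longrightarrow> \<bar>(Dop ^^ n) (lam om) \<xi>\<bar> \<le> B'"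
    using lam_bounded_compact[OF om] by blast
  show ?thesis
  proof (rule bdd_aboveI2)
    fix \<xi> :: real assume "\<xi> \<in> {1..}"
    then have \<xi>: "\<xi> \<ge> 1" by simp
    let ?L = "\<bar>\<xi> powr (- s) * (Dop ^^ n) (lam om) \<xi>\<bar>"
    have L: "?L = \<xi> powr (- s) * \<bar>(Dop ^^ n) (lam om) \<xi>\<bar>" by (simp add: abs_mult)
    consider "\<xi> = 1" | "1 < \<xi>" "\<xi> \<le> M" | "\<xi> > M" using \<xi> by linarith
    then show "?L \<le> \<bar>(Dop ^^ n) (lam om) 1\<bar> + M powr (- s) * \<bar>B'\<bar> + \<bar>B\<bar>"
    proof cases
      case 1 then show ?thesis by simp
    next
      case 2
      have "?L \<le> M powr (- s) * \<bar>B'\<bar>" unfolding L using 2 s B'[OF 2] by (intro mult_mono powr_mono2) auto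
      then show ?thesis by simp
    next
      case 3
      have "?L \<le> \<xi> powr (- s) * (\<bar>B\<bar> * \<xi> powr (- e + \<delta>))" unfolding L
        using order_trans[OF B[OF 3] mult_right_mono[OF abs_ge_self]] by (intro mult_left_mono) auto
      also have "\<dots> = \<bar>B\<bar> * \<xi> powr (- s + (- e + \<delta>))" by (simp only: powr_add mult_ac)
      also have "\<dots> \<le> \<bar>B\<bar> * \<xi> powr 0" using \<xi> \<delta> by (intro mult_left_mono powr_mono) auto
      finally have "?L \<le> \<bar>B\<bar>" using \<xi> by simp
      then show ?thesis by (simp add: add_increasing)
    qed
  qed
qed

end

theorem theorem4p9:
  fixes \<alpha> p :: real and Q :: "complex \<Rightarrow> complex"
  assumes "\<alpha> > 1" and "p \<ge> 0"
    and "bae_solution \<alpha> p Q" and "purely_real Q" and "normalised \<alpha> Q"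
    and "finite (holes \<alpha> p Q)"
  shows "(\<forall>\<delta>>0. (\<lambda>x. assoc_fun \<alpha> p Q x -
              (x powr bae_exp \<alpha> - p * (1 + \<alpha>) - real_of_int (sector \<alpha> p Q) / 2 * (\<alpha> - 1)))
            \<in> O[at_top](\<lambda>x. x powr (- bae_exp \<alpha> + \<delta>)))
    \<and> (sector \<alpha> p Q = 0 \<longrightarrow>
         (\<forall>om>0. \<lceil>assoc_fun \<alpha> p Q om - 1 / 2\<rceil> = - int (card (holes_kappa \<alpha> p Q)) \<longrightarrow>
           (\<forall>(n::nat) (s::real). - bae_exp \<alpha> < s \<and> s \<le> 0 \<longrightarrow>
              bdd_above ((\<lambda>\<xi>. \<bar>\<xi> powr (- s) *
                 (Dop ^^ n) (\<lambda>\<xi>. assoc_fun \<alpha> p Q (\<xi> * om) - lfun \<alpha> om p (\<xi> * om)) \<xi>\<bar>) ` {1..}))))"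
proof -
  interpret bae \<alpha> p Q by unfold_locales (use assms in auto)
  show ?thesis
    unfolding assoc_fun_eq by (intro conjI allI impI assoc_bigo lam_weighted_bounded[unfolded lam_def]) auto
qed

end
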